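(* Let $n\ge 1$ and place $2n$ points on the unit circle, labeled clockwise $1,2,\dots,2n$ (labels taken modulo $2n$); the odd points $1_\circ,3_\circ,\dots,(2n-1)_\circ$ are the hollow vertices and the even points $2_\bullet,4_\bullet,\dots,(2n)_\bullet$ are the solid vertices. For any hollow dissection $D_\circ$, there is a bijection between the set of serpent nests of $D_\circ$ and the set of (inclusion-)maximal $D_\circ$-accordion dissections.
   Context: The hollow polygon $P_\circ$ is the convex hull of the hollow vertices, and the solid polygon $P_\bullet$ is the convex hull of the solid vertices. A diagonal of a convex polygon means either an internal diagonal or a boundary edge (external diagonal); a hollow (resp. solid) diagonal has two hollow (resp. solid) endpoints. A dissection of a polygon is a set of pairwise noncrossing internal diagonals; a hollow dissection uses only hollow diagonals. For a dissection $D$, $\bar D$ denotes $D$ together with all boundary edges of the polygon. The cells of $D$ are the bounded connected components of the plane minus the diagonals of $\bar D$. An accordion of $D$ is a subset of $\bar D$ which contains, in each cell of $D$, either no diagonal or exactly two diagonals that share an endpoint (are incident). A subaccordion of $D$ is a subset of $D$ consisting of the diagonals lying between two given internal diagonals within some accordion of $D$. A $D_\circ$-accordion diagonal is a solid diagonal $\delta_\bullet$ such that the hollow diagonals of $\bar D_\circ$ crossed by $\delta_\bullet$ form an accordion of $D_\circ$ (equivalently, $\delta_\bullet$ never enters and exits a cell of $D_\circ$ through two non-incident diagonals). A $D_\circ$-accordion dissection is a set of pairwise noncrossing internal solid $D_\circ$-accordion diagonals. The dual tree $D_\circ^\star$ has the cells of $D_\circ$ as nodes, with an edge between two cells sharing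 a diagonal of $D_\circ$; edges of $D_\circ^\star$ are identified with the internal diagonals of $D_\circ$. A serpent of $D_\circ$ is a nonempty undirected path in $D_\circ^\star$ whose edges (viewed as hollow diagonals) form a subaccordion of $D_\circ$; its final edges are its two end edges (the edges whose removal does not disconnect the path; they coincide if the path has one edge). Cyclic order: for vertices $u,v,w$ (residues mod $2n$), $u<v<w$ means they appear in this order clockwise. Two serpents $S_1,S_2$ are incompatible if they share at least one edge — so that $S_1\cap S_2$ is a serpent whose final edges are diagonals $(u^h_\circ,v^h_\circ)$ and $(u^t_\circ,v^t_\circ)$ of $D_\circ$ with $u^h_\circ<v^h_\circ\le u^t_\circ<v^t_\circ$ cyclically — and one of the following holds, where the roles of $S_1,S_2$ may be exchanged and the roles of $(u^h_\circ,v^h_\circ)$ and $(u^t_\circ,v^t_\circ)$ may be exchanged: (1) $S_1$ and $S_2$ have a common final edge; (2) $S_1$ contains two diagonals incident to $u^h_\circ$ and two diagonals incident to $u^t_\circ$, and $S_2$ contains two diagonals incident to $v^h_\circ$ and two diagonals incident to $v^t_\circ$; (3) $(u^h_\circ,v^h_\circ)$ is a final edge of $S_2$, and $S_1$ contains two diagonals incident to $u^h_\circ$ and two diagonals incident to $u^t_\circ$, or $S_1$ contains two diagonals incident to $v^h_\circ$ and two diagonals incident to $v^t_\circ$; (4) $(u^h_\circ,v^h_\circ)$ is a final edge of $S_1$, $(u^t_\circ,v^t_\circ)$ is a final edge of $S_2$, and either ($S_1$ contains two diagonals incident to $u^t_\circ$ and $S_2$ contains two diagonals incident to $v^h_\circ$)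 or ($S_1$ contains two diagonals incident to $v^t_\circ$ and $S_2$ contains two diagonals incident to $u^h_\circ$). Here "contains two diagonals incident to $w$" means two edges of the serpent share the endpoint $w$. Serpents are compatible if not incompatible, and a serpent nest of $D_\circ$ is a (possibly empty) set of pairwise compatible serpents of $D_\circ$.
   Formalization: Incompatibility is corrected: in (1) the serpents must stop at the common final edge on the same side, and "two diagonals incident to w" must not both lie in S1∩S2; taken literally, n=6 and D={3-11, 5-11, 5-9} give 13 nests but 14 maximal dissections. *)

theory Defs
  imports "HOL-Analysis.Analysis"
begin

text \<open>
  Points are represented by their labels in \<open>{1..2*n}\<close>; a placement \<open>p\<close> maps labels to the plane.
  Diagonals are two-element sets of labels.  All geometric notions take the label set \<open>V\<close> of the
  polygon as an argument, so that they apply to the hollow and to the solid polygon.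
\<close>

definition clockwise_on_circle :: "nat \<Rightarrow> (nat \<Rightarrow> complex) \<Rightarrow> bool" where
  "clockwise_on_circle n p \<longleftrightarrow>
     (\<exists>\<theta>. strict_mono_on {1..2*n} \<theta> \<and> \<theta> (2*n) < \<theta> 1 + 2 * pi \<and>
          (\<forall>i\<in>{1..2*n}. p i = cis (- \<theta> i)))"

definition hollow :: "nat \<Rightarrow> nat set" where
  "hollow n = {i \<in> {1..2*n}. odd i}"

definition solid :: "nat \<Rightarrow> nat set" where
  "solid n = {i \<in> {1..2*n}. even i}"

definition polygon :: "(nat \<Rightarrow> complex) \<Rightarrow> nat set \<Rightarrow> complex set" where
  "polygon p V = convex hull (p ` V)"

definition seg :: "(nat \<Rightarrow> complex) \<Rightarrow> nat set \<Rightarrow> complex set" where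
  "seg p d = convex hull (p ` d)"

definition diagonals :: "nat set \<Rightarrow> nat set set" where
  "diagonals V = {{u, v} | u v. u \<in> V \<and> v \<in> V \<and> u \<noteq> v}"

text \<open>If \<open>V\<close> has two elements, the polygon is a segment, which is its own frontier; its unique
  diagonal is then a boundary edge.\<close>

definition boundary_edges :: "(nat \<Rightarrow> complex) \<Rightarrow> nat set \<Rightarrow> nat set set" where
  "boundary_edges p V = {d \<in> diagonals V. seg p d \<subseteq> frontier (polygon p V)}"

definition internal_diagonals :: "(nat \<Rightarrow> complex) \<Rightarrow> nat set \<Rightarrow> nat set set" where
  "internal_diagonals p V = diagonals V - boundary_edges p V"

text \<open>Diagonals that only meet at endpoints do not cross.\<close>

definition crossing :: "(nat \<Rightarrow> complex) \<Rightarrow> nat set \<Rightarrow> nat set \<Rightarrow> bool" where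
  "crossing p d e \<longleftrightarrow> d \<noteq> e \<and> rel_interior (seg p d) \<inter> rel_interior (seg p e) \<noteq> {}"

definition dissection :: "(nat \<Rightarrow> complex) \<Rightarrow> nat set \<Rightarrow> nat set set \<Rightarrow> bool" where
  "dissection p V D \<longleftrightarrow>
     D \<subseteq> internal_diagonals p V \<and> pairwise (\<lambda>d e. \<not> crossing p d e) D"

definition closed_dissection :: "(nat \<Rightarrow> complex) \<Rightarrow> nat set \<Rightarrow> nat set set \<Rightarrow> nat set set" where
  "closed_dissection p V D = D \<union> boundary_edges p V"

definition cells :: "(nat \<Rightarrow> complex) \<Rightarrow> nat set \<Rightarrow> nat set set \<Rightarrow> complex set set" where
  "cells p V D = {C \<in> components (- (\<Union>d\<in>closed_dissection p V D. seg p d)). bounded C}"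

definition is_side :: "(nat \<Rightarrow> complex) \<Rightarrow> nat set \<Rightarrow> complex set \<Rightarrow> bool" where
  "is_side p d C \<longleftrightarrow> seg p d \<subseteq> frontier C"

definition accordion :: "(nat \<Rightarrow> complex) \<Rightarrow> nat set \<Rightarrow> nat set set \<Rightarrow> nat set set \<Rightarrow> bool" where
  "accordion p V D A \<longleftrightarrow>
     A \<subseteq> closed_dissection p V D \<and>
     (\<forall>C\<in>cells p V D.
        {d \<in> A. is_side p d C} = {} \<or>
        (\<exists>d e. {d \<in> A. is_side p d C} = {d, e} \<and> d \<noteq> e \<and> d \<inter> e \<noteq> {}))"

text \<open>\<open>d\<close> lies between \<open>d1\<close> and \<open>d2\<close> if it separates them in the polygon.  The condition is vacuous
  if \<open>d\<close> is \<open>d1\<close> or \<open>d2\<close>, so that \<open>d1\<close> and \<open>d2\<close> themselves are included.\<close>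

definition lies_between ::
    "(nat \<Rightarrow> complex) \<Rightarrow> nat set \<Rightarrow> nat set \<Rightarrow> nat set \<Rightarrow> nat set \<Rightarrow> bool" where
  "lies_between p V d1 d2 d \<longleftrightarrow>
     (\<forall>x \<in> seg p d1 - seg p d. \<forall>y \<in> seg p d2 - seg p d.
        \<not> connected_component (polygon p V - seg p d) x y)"

definition subaccordion :: "(nat \<Rightarrow> complex) \<Rightarrow> nat set \<Rightarrow> nat set set \<Rightarrow> nat set set \<Rightarrow> bool" where
  "subaccordion p V D X \<longleftrightarrow>
     (\<exists>A. accordion p V D A \<and>
        (\<exists>d1 \<in> A \<inter> D. \<exists>d2 \<in> A \<inter> D. X = {d \<in> A \<inter> D. lies_between p V d1 d2 d}))"

definition accordion_diagonal :: "nat \<Rightarrow> (nat \<Rightarrow> complex) \<Rightarrow> nat set set \<Rightarrow> nat set \<Rightarrow> bool" where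
  "accordion_diagonal n p D \<delta> \<longleftrightarrow>
     \<delta> \<in> diagonals (solid n) \<and>
     accordion p (hollow n) D {d \<in> closed_dissection p (hollow n) D. crossing p \<delta> d}"

definition accordion_dissection :: "nat \<Rightarrow> (nat \<Rightarrow> complex) \<Rightarrow> nat set set \<Rightarrow> nat set set \<Rightarrow> bool" where
  "accordion_dissection n p D E \<longleftrightarrow>
     dissection p (solid n) E \<and> (\<forall>\<delta>\<in>E. accordion_diagonal n p D \<delta>)"

definition maximal_accordion_dissection ::
    "nat \<Rightarrow> (nat \<Rightarrow> complex) \<Rightarrow> nat set set \<Rightarrow> nat set set \<Rightarrow> bool" where
  "maximal_accordion_dissection n p D E \<longleftrightarrow>
     accordion_dissection n p D E \<and>
     (\<forall>E'. accordion_dissection n p D E' \<and> E \<subseteq> E' \<longrightarrow> E' = E)"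

text \<open>A path with at least one edge in the dual tree: \<open>cs\<close> lists its nodes (cells) and \<open>ds\<close> its
  edges (diagonals of \<open>D\<close>).\<close>

definition dual_path ::
    "(nat \<Rightarrow> complex) \<Rightarrow> nat set \<Rightarrow> nat set set \<Rightarrow> complex set list \<Rightarrow> nat set list \<Rightarrow> bool" where
  "dual_path p V D cs ds \<longleftrightarrow>
     ds \<noteq> [] \<and> length cs = Suc (length ds) \<and> distinct cs \<and> set cs \<subseteq> cells p V D \<and>
     (\<forall>i<length ds. ds ! i \<in> D \<and> is_side p (ds ! i) (cs ! i) \<and> is_side p (ds ! i) (cs ! Suc i))"

text \<open>A nonempty undirected path in a tree is determined by its set of edges, so a serpent is
  represented by a set of diagonals.\<close>

definition serpent :: "(nat \<Rightarrow> complex) \<Rightarrow> nat set \<Rightarrow> nat set set \<Rightarrow> nat set set \<Rightarrow> bool" where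
  "serpent p V D S \<longleftrightarrow> (\<exists>cs ds. dual_path p V D cs ds \<and> S = set ds) \<and> subaccordion p V D S"

text \<open>The ends of a path: each final edge together with the end node of the path incident to it.
  The two final edges of a path with a single edge coincide, but its two ends are distinct.\<close>

definition path_ends ::
    "(nat \<Rightarrow> complex) \<Rightarrow> nat set \<Rightarrow> nat set set \<Rightarrow> nat set set \<Rightarrow> (nat set \<times> complex set) set" where
  "path_ends p V D S =
     {(d, C). \<exists>cs ds. dual_path p V D cs ds \<and> set ds = S \<and>
        (d = hd ds \<and> C = hd cs \<or> d = last ds \<and> C = last cs)}"

definition final_edges ::
    "(nat \<Rightarrow> complex) \<Rightarrow> nat set \<Rightarrow> nat set set \<Rightarrow> nat set set \<Rightarrow> nat set set" where
  "final_edges p V D S = fst ` path_ends p V D S"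

definition clockwise_dist :: "nat \<Rightarrow> nat \<Rightarrow> nat \<Rightarrow> int" where
  "clockwise_dist n u v = (int v - int u) mod (2 * int n)"

text \<open>The cyclic order \<open>u < v \<le> u' < v'\<close>, read clockwise from \<open>u\<close> and allowing \<open>v'\<close> to close up at \<open>u\<close>.
  In particular the single diagonal \<open>{x, y}\<close> is labelled \<open>(x, y)\<close>, \<open>(y, x)\<close> or \<open>(y, x)\<close>, \<open>(x, y)\<close>.\<close>

definition cyclic_chain :: "nat \<Rightarrow> nat \<Rightarrow> nat \<Rightarrow> nat \<Rightarrow> nat \<Rightarrow> bool" where
  "cyclic_chain n u v u' v' \<longleftrightarrow>
     0 < clockwise_dist n u v \<and>
     clockwise_dist n u v \<le> clockwise_dist n u u' \<and>
     (clockwise_dist n u u' < clockwise_dist n u v' \<or> v' = u)"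

text \<open>\<open>two_at I S w\<close>: the serpent \<open>S\<close> contains two diagonals incident to \<open>w\<close>, where \<open>I\<close> is the
  intersection of the two serpents under comparison.  The two diagonals must not both lie in \<open>I\<close>:
  the condition tells through which endpoint of a final edge of \<open>I\<close> the serpent \<open>S\<close> leaves \<open>I\<close>,
  whereas two diagonals of \<open>I\<close> belong to both serpents and do not distinguish them.\<close>

definition two_at :: "nat set set \<Rightarrow> nat set set \<Rightarrow> nat \<Rightarrow> bool" where
  "two_at I S w \<longleftrightarrow> (\<exists>d\<in>S. \<exists>e\<in>S. d \<noteq> e \<and> w \<in> d \<and> w \<in> e \<and> \<not> (d \<in> I \<and> e \<in> I))"

text \<open>The four conditions for serpents in the roles of \<open>S1\<close> and \<open>S2\<close>, the final edges of their
  intersection being \<open>{uh, vh}\<close> and \<open>{ut, vt}\<close>.  In the first one, a common final edge is a common end: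
  the serpents stop at this edge on the same side of it.  If the intersection is a single diagonal
  at which the serpents stop on opposite sides, they stop at opposite ends of the intersection,
  and this is the situation of the fourth condition.\<close>

definition serpent_conflict ::
    "(nat \<Rightarrow> complex) \<Rightarrow> nat set \<Rightarrow> nat set set \<Rightarrow> nat set set \<Rightarrow> nat set set \<Rightarrow>
      nat \<Rightarrow> nat \<Rightarrow> nat \<Rightarrow> nat \<Rightarrow> bool" where
  "serpent_conflict p V D S1 S2 uh vh ut vt \<longleftrightarrow>
     (let two = two_at (S1 \<inter> S2) in
        path_ends p V D S1 \<inter> path_ends p V D S2 \<noteq> {}
      \<or> (two S1 uh \<and> two S1 ut \<and> two S2 vh \<and> two S2 vt)
      \<or> ({uh, vh} \<in> final_edges p V D S2 \<and>
          (two S1 uh \<and> two S1 ut \<or> two S1 vh \<and> two S1 vt))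
      \<or> ({uh, vh} \<in> final_edges p V D S1 \<and> {ut, vt} \<in> final_edges p V D S2 \<and>
          (two S1 ut \<and> two S2 vh \<or> two S1 vt \<and> two S2 uh)))"

definition incompatible ::
    "nat \<Rightarrow> (nat \<Rightarrow> complex) \<Rightarrow> nat set set \<Rightarrow> nat set set \<Rightarrow> nat set set \<Rightarrow> bool" where
  "incompatible n p D S1 S2 \<longleftrightarrow>
     S1 \<inter> S2 \<noteq> {} \<and>
     (\<exists>uh vh ut vt.
        final_edges p (hollow n) D (S1 \<inter> S2) = {{uh, vh}, {ut, vt}} \<and>
        cyclic_chain n uh vh ut vt \<and>
        (serpent_conflict p (hollow n) D S1 S2 uh vh ut vt \<or>
         serpent_conflict p (hollow n) D S2 S1 uh vh ut vt \<or>
         serpent_conflict p (hollow n) D S1 S2 ut vt uh vh \<or>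
         serpent_conflict p (hollow n) D S2 S1 ut vt uh vh))"

text \<open>A serpent is not compared with itself.\<close>

definition serpent_nest :: "nat \<Rightarrow> (nat \<Rightarrow> complex) \<Rightarrow> nat set set \<Rightarrow> nat set set set \<Rightarrow> bool" where
  "serpent_nest n p D N \<longleftrightarrow>
     (\<forall>S\<in>N. serpent p (hollow n) D S) \<and> pairwise (\<lambda>S1 S2. \<not> incompatible n p D S1 S2) N"

end

theory Submission
  imports Defs
begin

text \<open>
  Both sets satisfy the same recursion.  The arcs of the closed dissection, read as intervals of hollow
  indices, are nested and form a plane tree; cutting each cell into triangles by virtual arcs makes it
  binary.  A solid diagonal is an accordion diagonal iff its two ends reach each other through the tree,
  so maximal accordion dissections are the facets of a complex of noncrossing pairs of ends.  A serpent
  is a pair of descending words in the tree, and two serpents are incompatible iff at both ends of their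
  intersection the same one leaves weakly to the left of the other.  Gluing two subtrees then multiplies
  both counts by the same binomial coefficient: the number of maximal staircases in a product of two
  chains on the diagonal side, of antitone partial matchings between two chains on the serpent side.
\<close>

section \<open>Antitone matchings and ladders\<close>

text \<open>The two recursions are matched numerically, so the resulting bijection is not explicit.
  Plain cardinalities do not recurse: what can be built above a subtree depends on how many walks
  may still enter it from above without a conflict. Both sides are therefore summed with an
  arbitrary weight \<open>g\<close> of two statistics, one for each child: the admissible
  continuations to the left and to the right on the serpent side, and the chords to the outside,
  less one, on the diagonal side. A virtual node needs the two numbers separately, a real node only
  their total. The cutting of a cell fans out from the right end of its top arc, so every left child
  is real and only right children can be virtual; this is the source of the asymmetric conditions on
  words. Incompatibility becomes tractable once its four conditions are expressed by the turn (left,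
  stop, right) that each serpent takes at both ends of the intersection. Throughout, hollow index i
  is the label 2i+1 and solid index i the label 2i+2, so a solid vertex sits just after the hollow
  one of the same index.\<close>

definition antitone_matchings :: "'a::linorder set => 'b::linorder set => ('a \<times> 'b) set set" where
 "antitone_matchings X Y = {E. E \<subseteq> X \<times> Y &
   (\<forall>p\<in>E. \<forall>q\<in>E. p ~= q --> (fst p < fst q & snd q < snd p) \<or> (fst q < fst p & snd p < snd q))}"

text \<open>Maximal sets without two strictly comparable points of the product order. For finite
  nonempty \<open>X\<close> and \<open>Y\<close> these are the lattice staircases from (Min X, Max
  Y) to (Max X, Min Y).\<close>

definition ladders :: "'a::linorder set => 'b::linorder set => ('a \<times> 'b) set set" where
 "ladders X Y = {E. E \<subseteq> X \<times> Y &
   (\<forall>p\<in>E. \<forall>q\<in>E. ~ (fst p < fst q & snd p < snd q)) &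
   (\<forall>p\<in>X \<times> Y. p \<notin> E -->
    (\<exists>q\<in>E. (fst p < fst q & snd p < snd q) \<or> (fst q < fst p & snd q < snd p)))}"

lemma finite_antitone_matchings: "finite X ==> finite Y ==> finite (antitone_matchings X Y)" unfolding antitone_matchings_def
 by (rule finite_subset[of _ "Pow (X \<times> Y)"]) auto

lemma finite_ladders: "finite X ==> finite Y ==> finite (ladders X Y)" unfolding ladders_def
 by (rule finite_subset[of _ "Pow (X \<times> Y)"]) auto

lemma binomial_add_rec:
 assumes "x > 0" "y > 0" shows "(x + y) choose x = ((x + (y - 1)) choose x) + (((x - 1) + y) choose (x - 1))"
proof -
 obtain x' where [simp]: "x = Suc x'" using assms(1) by (cases x) auto
 obtain y' where [simp]: "y = Suc y'" using assms(2) by (cases y) auto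
 show ?thesis by simp
qed

text \<open>Pascal's rule on the largest element \<open>b\<close> of \<open>Y\<close>, which is
  either unmatched or matched. In the second case the pair of \<open>b\<close> with the least
  element \<open>a\<close> of \<open>X\<close> is removed if it is there; this reaches every
  matching of \<open>X - {a}\<close> with \<open>Y\<close> exactly once.\<close>

lemma card_antitone_matchings:
 fixes X :: "'a::linorder set" and Y :: "'b::linorder set"
 assumes "finite X" "finite Y" shows "card (antitone_matchings X Y) = (card X + card Y) choose card X" using assms
proof (induction "card X + card Y" arbitrary: X Y rule: less_induct)
 case less
 show ?case
 proof (cases "X = {} \<or> Y = {}")
  case True
  then have "antitone_matchings X Y = {{}}" by (auto simp: antitone_matchings_def)
  then have "card (antitone_matchings X Y) = 1" by simp
  moreover have "(card X + card Y) choose card X = 1" using True by (elim disjE) simp_all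
  ultimately show ?thesis by simp
 next
  case False
  define a b where "a = Min X" and "b = Max Y"
  have a: "a \<in> X" "\<And>x. x \<in> X ==> a \<le> x" and b: "b \<in> Y" "\<And>y. y \<in> Y ==> y \<le> b"
   using False less.prems by (auto simp: a_def b_def)
  define U where "U = {E \<in> antitone_matchings X Y. b \<in> snd ` E}"
  have split: "antitone_matchings X Y = antitone_matchings X (Y - {b}) \<union> U" proof -
   have *: "E \<subseteq> X \<times> (Y - {b}) \<longleftrightarrow> b \<notin> snd ` E" if "E \<subseteq> X \<times> Y" for E
    using that by force
   have **: "E \<subseteq> X \<times> (Y - {b}) ==> E \<subseteq> X \<times> Y" for E by auto
   show ?thesis
   proof (rule set_eqI)
    fix E show "E \<in> antitone_matchings X Y \<longleftrightarrow> E \<in> antitone_matchings X (Y - {b}) \<union> U"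
     unfolding antitone_matchings_def U_def using *[of E] **[of E]
     by (cases "E \<subseteq> X \<times> Y"; cases "b \<in> snd ` E"; cases "E \<subseteq> X \<times> (Y - {b})") simp_all
   qed
  qed
  have disj: "antitone_matchings X (Y - {b}) \<inter> U = {}" unfolding antitone_matchings_def U_def by auto
  \<comment> \<open>After the removal \<open>b\<close> is unmatched exactly when (a, b) was present,
    which tells the inverse map when to put the pair back.\<close>
  have "bij_betw (\<lambda>E. E - {(a, b)}) U (antitone_matchings (X - {a}) Y)"
  proof (rule bij_betw_byWitness[where f' = "\<lambda>E. if b \<in> snd ` E then E else insert (a, b) E"])
   have unused: "b \<notin> snd ` (E - {(a, b)})" if "E \<in> U" "(a, b) \<in> E" for E
   proof
    assume "b \<in> snd ` (E - {(a, b)})"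
    then obtain x where x: "(x, b) \<in> E" "x ~= a" by fastforce
    have "\<forall>p\<in>E. \<forall>q\<in>E. p ~= q --> (fst p < fst q & snd q < snd p) \<or> (fst q < fst p & snd p < snd q)"
     using that(1) unfolding U_def antitone_matchings_def by blast
    then have "(x < a & b < b) \<or> (a < x & b < b)" using x that(2) by fastforce
    then show False by simp
   qed
   have used: "b \<in> snd ` (E - {(a, b)})" if "E \<in> U" "(a, b) \<notin> E" for E using that unfolding U_def by auto
   show "\<forall>E\<in>U. (if b \<in> snd ` (E - {(a, b)}) then E - {(a, b)} else insert (a, b) (E - {(a, b)})) = E"
    using unused used by fastforce
   show "\<forall>E\<in>antitone_matchings (X - {a}) Y.
       (if b \<in> snd ` E then E else insert (a, b) E) - {(a, b)} = E" unfolding antitone_matchings_def by auto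
   show "(\<lambda>E. E - {(a, b)}) ` U \<subseteq> antitone_matchings (X - {a}) Y"
   proof clarify
    fix E assume E: "E \<in> U"
    then have sub: "E \<subseteq> X \<times> Y" and
     sm: "\<And>p q. p \<in> E ==> q \<in> E ==> p ~= q ==> (fst p < fst q & snd q < snd p) \<or> (fst q < fst p & snd p < snd q)"
     unfolding U_def antitone_matchings_def by auto
    obtain a' where a': "(a', b) \<in> E" using E unfolding U_def by force
    \<comment> \<open>If \<open>a\<close> were matched below \<open>b\<close>, antitonicity would
      put the partner of \<open>b\<close> strictly before \<open>a\<close>, the least
      element.\<close>
    have "y = b" if "(a, y) \<in> E" for y
    proof (rule ccontr)
     assume "y ~= b"
     then have "a < a' & b < y \<or> a' < a & y < b" using sm[OF that a'] by auto
     then show False using a b sub that a' by (meson SigmaD1 SigmaD2 leD subsetD)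
    qed
    then have "E - {(a, b)} \<subseteq> (X - {a}) \<times> Y" using sub by auto
    then show "E - {(a, b)} \<in> antitone_matchings (X - {a}) Y" using sm unfolding antitone_matchings_def by auto
   qed
   show "(\<lambda>E. if b \<in> snd ` E then E else insert (a, b) E) ` antitone_matchings (X - {a}) Y \<subseteq> U"
   proof clarify
    fix E assume E: "E \<in> antitone_matchings (X - {a}) Y"
    show "(if b \<in> snd ` E then E else insert (a, b) E) \<in> U"
    proof (cases "b \<in> snd ` E")
     case True
     then show ?thesis using E unfolding U_def antitone_matchings_def by auto
    next
     case False
     have 1: "a < fst p & snd p < b" if "p \<in> E" for p proof -
      have "fst p \<in> X" "fst p ~= a" "snd p \<in> Y" "snd p ~= b"
       using E that False unfolding antitone_matchings_def by auto
      then show ?thesis using a(2)[of "fst p"] b(2)[of "snd p"] by auto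
     qed
     then show ?thesis using E a(1) b(1) False unfolding U_def antitone_matchings_def by auto
    qed
   qed
  qed
  then have cU: "card U = card (antitone_matchings (X - {a}) Y)" by (rule bij_betw_same_card)
  have cx: "card (X - {a}) = card X - 1" "card X > 0" and cy: "card (Y - {b}) = card Y - 1" "card Y > 0"
   using a(1) b(1) less.prems by (auto simp: card_gt_0_iff)
  have "card (antitone_matchings X Y) =
    card (antitone_matchings X (Y - {b})) + card (antitone_matchings (X - {a}) Y)" unfolding split
  proof (subst card_Un_disjoint)
   show "finite U" unfolding U_def using finite_antitone_matchings[OF less.prems] by simp
   show "finite (antitone_matchings X (Y - {b}))" using less.prems by (intro finite_antitone_matchings) simp_all
  qed (simp_all add: disj cU)
  also have "card (antitone_matchings X (Y - {b})) = (card X + (card Y - 1)) choose card X"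
   using less.hyps[of X "Y - {b}"] less.prems cy by simp
  also have "card (antitone_matchings (X - {a}) Y) = ((card X - 1) + card Y) choose (card X - 1)"
   using less.hyps[of "X - {a}" Y] less.prems cx by simp
  finally show ?thesis using binomial_add_rec[of "card X" "card Y"] cx cy by simp
 qed
qed

lemma ladders_corner:
 assumes "finite X" "finite Y" "X ~= {}" "Y ~= {}" "E \<in> ladders X Y" shows "(Min X, Max Y) \<in> E"
proof (rule ccontr)
 assume n: "(Min X, Max Y) \<notin> E"
 have "(Min X, Max Y) \<in> X \<times> Y" using assms by auto
 then obtain q where q: "q \<in> E" "Min X < fst q & Max Y < snd q \<or> fst q < Min X & snd q < Max Y"
  using n assms(5) unfolding ladders_def by force
 then have "fst q \<in> X" "snd q \<in> Y" using assms(5) unfolding ladders_def by auto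
 then show False using q assms by (meson Max_ge Min_le leD)
qed

text \<open>A staircase starts at the corner (a, b) and continues with (a, b1) or (a1, b), where
  \<open>a1\<close> and \<open>b1\<close> are the elements next to the extreme ones. It cannot
  contain both, since these two points are strictly comparable. Without the corner it is a staircase
  of the rectangle whose corner is that second point.\<close>

lemma ladders_step:
 fixes X :: "'a::linorder set" and Y :: "'b::linorder set"
 assumes fin: "finite X" "finite Y" and a: "a \<in> X" "\<And>x. x \<in> X ==> a \<le> x"
  and b: "b \<in> Y" "\<And>y. y \<in> Y ==> y \<le> b" and ne: "X - {a} ~= {}" "Y - {b} ~= {}"
 shows "ladders X Y = insert (a, b) ` ladders X (Y - {b}) \<union> insert (a, b) ` ladders (X - {a}) Y"
  and "insert (a, b) ` ladders X (Y - {b}) \<inter> insert (a, b) ` ladders (X - {a}) Y = {}"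
proof -
 define a1 b1 where "a1 = Min (X - {a})" and "b1 = Max (Y - {b})"
 have a1: "a1 \<in> X" "a < a1" "\<And>x. x \<in> X ==> x ~= a ==> a1 \<le> x" proof -
  have "a1 \<in> X - {a}" unfolding a1_def using fin ne by (intro Min_in) auto
  then show "a1 \<in> X" "a < a1" using a(2)[of a1] by auto
  show "\<And>x. x \<in> X ==> x ~= a ==> a1 \<le> x" unfolding a1_def using fin by (intro Min_le) auto
 qed
 have b1: "b1 \<in> Y" "b1 < b" "\<And>y. y \<in> Y ==> y ~= b ==> y \<le> b1" proof -
  have "b1 \<in> Y - {b}" unfolding b1_def using fin ne by (intro Max_in) auto
  then show "b1 \<in> Y" "b1 < b" using b(2)[of b1] by auto
  show "\<And>x. x \<in> Y ==> x ~= b ==> x \<le> b1" unfolding b1_def using fin by (intro Max_ge) auto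
 qed
 have mX: "Min X = a" "Min (X - {a}) = a1" and mY: "Max Y = b" "Max (Y - {b}) = b1"
  using a b fin by (auto intro!: Min_eqI Max_eqI simp: a1_def b1_def)
 have lx: "a < x" if "x \<in> X" "x ~= a" for x using a(2)[OF that(1)] that by auto
 have ly: "y < b" if "y \<in> Y" "y ~= b" for y using b(2)[OF that(1)] that by auto
 have left: "(a, b1) \<in> E" if "E \<in> ladders X (Y - {b})" for E
  using ladders_corner[of X "Y - {b}" E] that fin ne mX mY by auto
 have right: "(a1, b) \<in> E" if "E \<in> ladders (X - {a}) Y" for E
  using ladders_corner[of "X - {a}" Y E] that fin ne mX mY by auto
 have sub1: "insert (a, b) E \<in> ladders X Y" if E: "E \<in> ladders X (Y - {b})" for E proof -
  have e: "E \<subseteq> X \<times> (Y - {b})" using E unfolding ladders_def by auto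
  have nc: "\<forall>p\<in>E. \<forall>q\<in>E. ~ (fst p < fst q & snd p < snd q)" using E unfolding ladders_def by blast
  have mx: "\<forall>p\<in>X \<times> (Y - {b}). p \<notin> E -->
    (\<exists>q\<in>E. (fst p < fst q & snd p < snd q) \<or> (fst q < fst p & snd q < snd p))"
   using E unfolding ladders_def by blast
  have 1: "\<forall>p\<in>E. a \<le> fst p & snd p < b" using e a ly by fastforce
  have "\<exists>q\<in>insert (a, b) E. (fst p < fst q & snd p < snd q) \<or> (fst q < fst p & snd q < snd p)"
   if "p \<in> X \<times> Y" "p \<notin> insert (a, b) E" for p
  proof (cases "snd p = b")
   case True
   then have "a < fst p" using that lx by (cases p) auto
   then have "fst (a, b1) < fst p & snd (a, b1) < snd p" using True b1 by auto
   then show ?thesis using left[OF E] by blast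
  next
   case False
   then have "p \<in> X \<times> (Y - {b})" "p \<notin> E" using that by (auto simp: mem_Times_iff)
   then show ?thesis using mx by blast
  qed
  moreover have "\<forall>p\<in>insert (a, b) E. \<forall>q\<in>insert (a, b) E. ~ (fst p < fst q & snd p < snd q)"
   using nc 1 by (auto simp: leD less_le_not_le)
  moreover have "insert (a, b) E \<subseteq> X \<times> Y" using e a b by auto
  ultimately show ?thesis unfolding ladders_def by blast
 qed
 have sub2: "insert (a, b) E \<in> ladders X Y" if E: "E \<in> ladders (X - {a}) Y" for E proof -
  have e: "E \<subseteq> (X - {a}) \<times> Y" using E unfolding ladders_def by auto
  have nc: "\<forall>p\<in>E. \<forall>q\<in>E. ~ (fst p < fst q & snd p < snd q)" using E unfolding ladders_def by blast
  have mx: "\<forall>p\<in>(X - {a}) \<times> Y. p \<notin> E -->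
    (\<exists>q\<in>E. (fst p < fst q & snd p < snd q) \<or> (fst q < fst p & snd q < snd p))"
   using E unfolding ladders_def by blast
  have 1: "\<forall>p\<in>E. a < fst p & snd p \<le> b" using e b lx by fastforce
  have "\<exists>q\<in>insert (a, b) E. (fst p < fst q & snd p < snd q) \<or> (fst q < fst p & snd q < snd p)"
   if "p \<in> X \<times> Y" "p \<notin> insert (a, b) E" for p
  proof (cases "fst p = a")
   case True
   then have "snd p < b" using that ly by (cases p) auto
   then have "fst p < fst (a1, b) & snd p < snd (a1, b)" using True a1 by auto
   then show ?thesis using right[OF E] by blast
  next
   case False
   then have "p \<in> (X - {a}) \<times> Y" "p \<notin> E" using that by (auto simp: mem_Times_iff)
   then show ?thesis using mx by blast
  qed
  moreover have "\<forall>p\<in>insert (a, b) E. \<forall>q\<in>insert (a, b) E. ~ (fst p < fst q & snd p < snd q)"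
   using nc 1 by (auto simp: leD less_le_not_le)
  moreover have "insert (a, b) E \<subseteq> X \<times> Y" using e a b by auto
  ultimately show ?thesis unfolding ladders_def by blast
 qed
 have sup: "E \<in> insert (a, b) ` ladders X (Y - {b}) \<union> insert (a, b) ` ladders (X - {a}) Y"
  if E: "E \<in> ladders X Y" for E proof -
  have e: "E \<subseteq> X \<times> Y" using E unfolding ladders_def by auto
  have nc: "\<And>p q. p \<in> E ==> q \<in> E ==> ~ (fst p < fst q & snd p < snd q)" using E unfolding ladders_def by blast
  have mx: "\<And>p. p \<in> X \<times> Y ==> p \<notin> E ==>
    \<exists>q\<in>E. (fst p < fst q & snd p < snd q) \<or> (fst q < fst p & snd q < snd p)"
   using E unfolding ladders_def by blast
  have ab: "(a, b) \<in> E" using ladders_corner[of X Y E] E fin a b mX mY by auto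
  have abE: "insert (a, b) (E - {(a, b)}) = E" using ab by auto
  show ?thesis
  proof (cases "\<exists>x. x ~= a & (x, b) \<in> E")
   case True
   then obtain x where x: "x ~= a" "(x, b) \<in> E" by auto
   then have "x \<in> X" using e by auto
   have "y = b" if "(a, y) \<in> E" for y
   proof (rule ccontr)
    assume "y ~= b"
    then have "y < b" using ly that e by auto
    then show False using nc[OF that x(2)] lx[OF \<open>x \<in> X\<close> x(1)] by auto
   qed
   then have s: "E - {(a, b)} \<subseteq> (X - {a}) \<times> Y" using e by auto
   have "E - {(a, b)} \<in> ladders (X - {a}) Y" unfolding ladders_def
   proof (intro CollectI conjI ballI impI)
    fix p assume p: "p \<in> (X - {a}) \<times> Y" "p \<notin> E - {(a, b)}"
    then have "p \<notin> E" "p \<in> X \<times> Y" by auto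
    then obtain q where q: "q \<in> E" "(fst p < fst q & snd p < snd q) \<or> (fst q < fst p & snd q < snd p)"
     using mx by blast
    show "\<exists>q\<in>E - {(a, b)}. (fst p < fst q & snd p < snd q) \<or> (fst q < fst p & snd q < snd p)"
    proof (cases "q = (a, b)")
     case True
     then have "a < fst p & b < snd p \<or> fst p < a & snd p < b" using q by auto
     moreover have "fst p \<in> X" "snd p \<in> Y" using p by auto
     ultimately show ?thesis using a b by (meson leD)
    qed (use q in blast)
   qed (use s nc in auto)
   then show ?thesis using abE by (metis UnCI imageI)
  next
   case False
   then have s: "E - {(a, b)} \<subseteq> X \<times> (Y - {b})" using e by auto
   have "E - {(a, b)} \<in> ladders X (Y - {b})" unfolding ladders_def
   proof (intro CollectI conjI ballI impI)
    fix p assume p: "p \<in> X \<times> (Y - {b})" "p \<notin> E - {(a, b)}"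
    then have "p \<notin> E" "p \<in> X \<times> Y" by auto
    then obtain q where q: "q \<in> E" "(fst p < fst q & snd p < snd q) \<or> (fst q < fst p & snd q < snd p)"
     using mx by blast
    show "\<exists>q\<in>E - {(a, b)}. (fst p < fst q & snd p < snd q) \<or> (fst q < fst p & snd q < snd p)"
    proof (cases "q = (a, b)")
     case True
     then have pp: "snd p < b & fst p < a \<or> a < fst p & b < snd p" using q by auto
     moreover have "fst p \<in> X" "snd p \<in> Y" using p by auto
     ultimately show ?thesis using a b by (meson leD)
    qed (use q in blast)
   qed (use s nc in auto)
   then show ?thesis using abE by (metis UnCI imageI)
  qed
 qed
 show "ladders X Y = insert (a, b) ` ladders X (Y - {b}) \<union> insert (a, b) ` ladders (X - {a}) Y"
  using sub1 sub2 sup by blast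
 show "insert (a, b) ` ladders X (Y - {b}) \<inter> insert (a, b) ` ladders (X - {a}) Y = {}"
 proof (rule ccontr)
  assume "~ ?thesis"
  then obtain E1 E2 where E: "E1 \<in> ladders X (Y - {b})" "E2 \<in> ladders (X - {a}) Y"
   "insert (a, b) E1 = insert (a, b) E2" by auto
  define F where "F = insert (a, b) E1"
  have F2: "F = insert (a, b) E2" unfolding F_def using E(3) .
  have "(a, b1) \<in> F" unfolding F_def using left[OF E(1)] by simp
  moreover have "(a1, b) \<in> F" unfolding F2 using right[OF E(2)] by simp
  moreover have "F \<in> ladders X Y" unfolding F_def using sub1[OF E(1)] .
  ultimately have "~ (fst (a, b1) < fst (a1, b) & snd (a, b1) < snd (a1, b))" unfolding ladders_def by blast
  then show False using a1 b1 by simp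
 qed
qed

lemma ladders_full:
 assumes "E \<subseteq> X \<times> Y ==> \<forall>p\<in>X \<times> Y. \<forall>q\<in>X \<times> Y. ~ (fst p < fst q & snd p < snd q)"
  and "\<forall>p\<in>X \<times> Y. \<forall>q\<in>X \<times> Y. ~ (fst p < fst q & snd p < snd q)"
 shows "ladders X Y = {X \<times> Y}" using assms(2) unfolding ladders_def by blast

text \<open>Lattice paths with \<open>card X - 1\<close> steps in one direction and
  \<open>card Y - 1\<close> in the other, counted by their first step.\<close>

lemma card_ladders:
 fixes X :: "'a::linorder set" and Y :: "'b::linorder set"
 assumes "finite X" "finite Y" "X ~= {}" "Y ~= {}"
 shows "card (ladders X Y) = ((card X - 1) + (card Y - 1)) choose (card X - 1)" using assms
proof (induction "card X + card Y" arbitrary: X Y rule: less_induct)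
 case less
 define a b where "a = Min X" and "b = Max Y"
 have a: "a \<in> X" "\<And>x. x \<in> X ==> a \<le> x" and b: "b \<in> Y" "\<And>y. y \<in> Y ==> y \<le> b"
  using less.prems by (auto simp: a_def b_def)
 show ?case
 proof (cases "X - {a} = {} \<or> Y - {b} = {}")
  case True
  then have "X = {a} \<or> Y = {b}" using a b by auto
  then have "\<forall>p\<in>X \<times> Y. \<forall>q\<in>X \<times> Y. ~ (fst p < fst q & snd p < snd q)" by auto
  then have "ladders X Y = {X \<times> Y}" using ladders_full by blast
  then show ?thesis using \<open>X = {a} \<or> Y = {b}\<close> by auto
 next
  case False
  then have ne: "X - {a} ~= {}" "Y - {b} ~= {}" by auto
  have "(a, b) \<notin> E" if "E \<in> ladders X (Y - {b}) \<or> E \<in> ladders (X - {a}) Y" for E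
   using that by (auto simp: ladders_def)
  then have inj: "inj_on (insert (a, b)) (ladders X (Y - {b}))" "inj_on (insert (a, b)) (ladders (X - {a}) Y)"
   by (meson inj_onI insert_ident)+
  have cx: "card (X - {a}) = card X - 1" "card X - 1 > 0" and cy: "card (Y - {b}) = card Y - 1" "card Y - 1 > 0"
   using a(1) b(1) less.prems ne card_gt_0_iff[of "X - {a}"] card_gt_0_iff[of "Y - {b}"] by simp_all
  have "card (ladders X Y) = card (ladders X (Y - {b})) + card (ladders (X - {a}) Y)"
   using ladders_step[OF less.prems(1,2) a b ne] inj by (simp add: card_Un_disjoint card_image finite_ladders less.prems)
  also have "card (ladders X (Y - {b})) = ((card X - 1) + (card Y - 1 - 1)) choose (card X - 1)"
   using less.hyps[of X "Y - {b}"] less.prems cy ne by simp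
  also have "card (ladders (X - {a}) Y) = ((card X - 1 - 1) + (card Y - 1)) choose (card X - 1 - 1)"
   using less.hyps[of "X - {a}" Y] less.prems cx ne by simp
  finally show ?thesis using binomial_add_rec[of "card X - 1" "card Y - 1"] cx cy by simp
 qed
qed

section \<open>Serpents and nests in a binary tree\<close>

text \<open>A leaf is a polygon edge, a node an arc together with the two intervals into which it is
  cut. The flag is true for an arc of the closed dissection (real) and false for one that only
  subdivides a cell (virtual).\<close>

datatype tr = Lf | Nd bool tr tr

primrec real_top :: "tr => bool" where
 "real_top Lf = True"
| "real_top (Nd r a b) = r"

datatype word = End | Lft word | Rgt word

text \<open>In-order comparison: at the first difference \<open>Lft\<close> precedes
  \<open>End\<close> and \<open>End\<close> precedes \<open>Rgt\<close>. This is the left-to-right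
  order in which descending serpents separate; a serpent that stops counts as the middle
  one.\<close>

fun word_less :: "word => word => bool" where
 "word_less (Lft u) (Lft v) = word_less u v"
| "word_less (Rgt u) (Rgt v) = word_less u v"
| "word_less (Lft u) v = True"
| "word_less End (Rgt v) = True"
| "word_less u v = False"

lemma word_less_irrefl: "~ word_less u u" by (induction u) auto

lemma word_less_trans: "word_less u v ==> word_less v w ==> word_less u w"
proof (induction u v arbitrary: w rule: word_less.induct)
qed (case_tac w; simp)+

lemma word_less_linear: "word_less u v \<or> u = v \<or> word_less v u"
proof (induction u arbitrary: v)
qed (case_tac v; simp)+

instantiation word :: linorder
begin
definition less_word :: "word => word => bool" where "less_word = word_less"
definition less_eq_word :: "word => word => bool" where "u \<le> v \<longleftrightarrow> u = v \<or> word_less u v" for u v :: word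
instance
proof
 fix x y z :: word
 show "(x < y) = (x \<le> y & ~ y \<le> x)"
  using word_less_irrefl word_less_trans by (auto simp: less_word_def less_eq_word_def)
 show "x \<le> x" by (simp add: less_eq_word_def)
 show "x \<le> z" if "x \<le> y" "y \<le> z" using that word_less_trans by (auto simp: less_eq_word_def)
 show "x = y" if "x \<le> y" "y \<le> x" using that word_less_irrefl word_less_trans by (auto simp: less_eq_word_def)
 show "x \<le> y \<or> y \<le> x" using word_less_linear by (auto simp: less_eq_word_def)
qed
end

lemma word_order_simps [simp]:
 "Lft u < Lft v \<longleftrightarrow> u < v" "Rgt u < Rgt v \<longleftrightarrow> u < v" "Lft u < Rgt v" "~ Rgt u < Lft v"
 "Lft u < End" "End < Rgt u" "~ End < Lft u" "~ Rgt u < End"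
 "Lft u \<le> Lft v \<longleftrightarrow> u \<le> v" "Rgt u \<le> Rgt v \<longleftrightarrow> u \<le> v" "Lft u \<le> Rgt v" "~ Rgt u \<le> Lft v"
 "Lft u \<le> End" "End \<le> Rgt u" "~ End \<le> Lft u" "~ Rgt u \<le> End" by (auto simp: less_word_def less_eq_word_def)

text \<open>Ways for a serpent to go down from the top. From the top arc of a cell it may pass only
  to an incident side, the first or the last one. The first side is the left child; reaching the
  last side means turning right at every virtual node of the fan, so a \<open>Rgt\<close> step into
  a virtual child must be followed by another \<open>Rgt\<close>.\<close>

primrec half_walks :: "tr => word set" where
 "half_walks Lf = {}"
| "half_walks (Nd r a b) =
   insert End (Lft ` half_walks a \<union> Rgt ` {w \<in> half_walks b. real_top b \<or> (\<exists>v. w = Rgt v)})"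

text \<open>Half walks whose first real arc touches the left end of the interval of
  \<open>t\<close>. A real top arc does so itself; below a virtual top the walk must go left at
  once.\<close>

definition enter_left :: "tr => word set" where
 "enter_left t = {w \<in> half_walks t. real_top t \<or> (\<exists>v. w = Lft v)}"

definition enter_right :: "tr => word set" where
 "enter_right t = {w \<in> half_walks t. real_top t \<or> (\<exists>v. w = Rgt v)}"

text \<open>Serpents sorted by their highest place. \<open>Top\<close> descends from the top arc;
  \<open>Hook\<close> passes from the left to the right child around their common vertex and
  descends on both sides; \<open>In\<close> and \<open>Skip\<close> move the serpent into the left
  and the right child.\<close>

datatype serp = Top word | Hook word word | In serp | Skip serp

text \<open>Serpents that avoid the top arc of the tree. For the whole polygon these are all
  serpents, because the root arc is a boundary edge; in the children the serpents starting at a real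
  top arc are added.\<close>

primrec inner_serps :: "tr => serp set" where
 "inner_serps Lf = {}"
| "inner_serps (Nd r a b) =
   {Hook u v |u v. u \<in> half_walks a & v \<in> enter_left b} \<union>
   In ` (inner_serps a \<union> {Top w |w. real_top a & w \<in> half_walks a}) \<union>
   Skip ` (inner_serps b \<union> {Top w |w. real_top b & w \<in> half_walks b})"

text \<open>Conflict of a serpent with one that meets the tree in the half walk \<open>w\<close> and
  comes from above. The number is the turn of the latter when it leaves the top arc upwards: 0
  around the right end of the interval, 1 for stopping there, 2 around the left end. Hence it
  becomes 2 on descending to the left child and 0 on descending to the right one.\<close>

fun hits :: "nat => word => serp => bool" where
 "hits u w (Top v) = (w \<le> v & u \<le> 1 \<or> v \<le> w & 1 \<le> u)"
| "hits u (Lft w) (In s) = hits 2 w s"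
| "hits u (Lft w) (Hook v v') = (v \<le> w)"
| "hits u (Rgt w) (Skip s) = hits 0 w s"
| "hits u (Rgt w) (Hook v v') = (w \<le> v')"
| "hits u w s = False"

text \<open>Conflict means that the same serpent is weakly left at both ends of the common part. Two
  serpents that stop on the same top arc always conflict. Against a serpent of a child, a hook acts
  as a half walk that leaves the left child around its right end (turn 0) and the right child around
  its left end (turn 2).\<close>

fun conf :: "serp => serp => bool" where
 "conf (Top w) (Top v) = True"
| "conf (Top w) (Hook v v') = hits 1 w (Hook v v')"
| "conf (Top w) (In s) = hits 1 w (In s)"
| "conf (Top w) (Skip s) = hits 1 w (Skip s)"
| "conf (Hook v v') (Top w) = hits 1 w (Hook v v')"
| "conf (In s) (Top w) = hits 1 w (In s)"
| "conf (Skip s) (Top w) = hits 1 w (Skip s)"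
| "conf (Hook v v') (Hook u u') = (v \<le> u & v' \<le> u' \<or> u \<le> v & u' \<le> v')"
| "conf (Hook v v') (In s) = hits 0 v s"
| "conf (In s) (Hook v v') = hits 0 v s"
| "conf (Hook v v') (Skip s) = hits 2 v' s"
| "conf (Skip s) (Hook v v') = hits 2 v' s"
| "conf (In s) (In s') = conf s s'"
| "conf (Skip s) (Skip s') = conf s s'"
| "conf (In s) (Skip s') = False"
| "conf (Skip s) (In s') = False"

lemma conf_sym: "conf s s' = conf s' s" by (induction s s' rule: conf.induct) auto

definition indep :: "serp set => bool" where
 "indep N \<longleftrightarrow> (\<forall>s\<in>N. \<forall>s'\<in>N. s ~= s' --> ~ conf s s')"

definition inner_nests :: "tr => serp set set" where "inner_nests t = {N. N \<subseteq> inner_serps t & indep N}"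

text \<open>The half walks \<open>w\<close> for which \<open>Top w\<close> conflicts with no serpent
  of \<open>N\<close>. For inner serpents the conflict is the same for every turn at the top arc, by
  \<open>hits_inner\<close>, so these are also the walks through which serpents from above can
  enter.\<close>

definition avail :: "tr => serp set => word set" where "avail t N = {w \<in> half_walks t. \<forall>s\<in>N. ~ hits 1 w s}"

definition avail_left :: "tr => serp set => word set" where "avail_left t N = {w. Lft w \<in> avail t N}"

definition avail_right :: "tr => serp set => word set" where "avail_right t N = {w. Rgt w \<in> avail t N}"

lemma finite_half_walks: "finite (half_walks t)" by (induction t) auto

lemma finite_avail: "finite (avail t N)" unfolding avail_def using finite_half_walks by simp

lemma finite_inner_serps: "finite (inner_serps t)"
proof (induction t)
 case (Nd r a b)
 have "finite (enter_left b)" unfolding enter_left_def using finite_half_walks by simp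
 then have "finite ((\<lambda>(u, v). Hook u v) ` (half_walks a \<times> enter_left b))" using finite_half_walks by blast
 moreover have "{Hook u v |u v. u \<in> half_walks a & v \<in> enter_left b} =
   (\<lambda>(u, v). Hook u v) ` (half_walks a \<times> enter_left b)" by auto
 moreover have "finite {Top w |w. real_top c & w \<in> half_walks c}" for c
  by (rule finite_subset[of _ "Top ` half_walks c"]) (use finite_half_walks in auto)
 ultimately show ?case using Nd by simp
qed simp

lemma finite_inner_nests: "finite (inner_nests t)" unfolding inner_nests_def
 by (rule finite_subset[of _ "Pow (inner_serps t)"]) (use finite_inner_serps in auto)

lemma Top_not_inner: "Top w \<notin> inner_serps t" by (cases t) auto

lemma hits_inner: "s \<in> inner_serps t ==> hits u w s = hits u' w s" using Top_not_inner by (cases s; cases w) auto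

lemma not_hits_End: "s \<in> inner_serps t ==> ~ hits u End s" using Top_not_inner by (cases s) auto

lemma card_avail:
 assumes "N \<in> inner_nests (Nd r a b)" shows "card (avail (Nd r a b) N) =
  1 + card (avail_left (Nd r a b) N) + card (avail_right (Nd r a b) N)"
proof -
 let ?t = "Nd r a b"
 have "\<forall>s\<in>N. ~ hits 1 End s" using assms not_hits_End unfolding inner_nests_def by blast
 then have "End \<in> avail ?t N" by (simp add: avail_def)
 then have eq: "avail ?t N = insert End (Lft ` avail_left ?t N \<union> Rgt ` avail_right ?t N)"
  unfolding avail_left_def avail_right_def by (auto simp: image_iff) (metis word.exhaust)
 have "finite (Lft ` avail_left ?t N)" "finite (Rgt ` avail_right ?t N)"
  by (rule finite_subset[OF _ finite_avail[of ?t N]], auto simp: avail_left_def avail_right_def)+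
 then have "card (avail ?t N) = 1 + card (Lft ` avail_left ?t N) + card (Rgt ` avail_right ?t N)"
  unfolding eq by (subst card_insert_disjoint, simp, blast, subst card_Un_disjoint) auto
 then show ?thesis by (simp add: card_image inj_on_def)
qed

text \<open>\<open>T\<close> is an optional element of \<open>X\<close> placed strictly below
  \<open>Z e\<close>. It is recorded by the least rank occurring in \<open>T\<close> or
  \<open>Z e\<close>, which is \<open>m\<close> if both are empty and also equals the number of
  elements of \<open>X\<close> below all of them. Conversely \<open>T\<close> holds the element of
  rank \<open>i\<close>, unless that element already lies in \<open>Z e\<close>.\<close>

lemma rank_marker_bij:
 fixes f :: "'a => nat"
 assumes f: "bij_betw f X {..<m}" and Z: "\<And>e. e \<in> P ==> Z e \<subseteq> X"
 shows "bij_betw (\<lambda>(T, e). (card {x \<in> X. \<forall>z\<in>T \<union> Z e. f x < f z}, e))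
  {(T, e). e \<in> P & T \<subseteq> X & (\<forall>x\<in>T. \<forall>y\<in>T. x = y) & (\<forall>x\<in>T. \<forall>z\<in>Z e. f x < f z)}
  {(i, e). e \<in> P & i \<le> m & (\<forall>z\<in>Z e. i \<le> f z)}"
proof -
 have inj: "x = y" if "x \<in> X" "y \<in> X" "f x = f y" for x y using f that by (auto simp: bij_betw_def inj_on_def)
 have lt: "f x < m" if "x \<in> X" for x using f that by (auto simp: bij_betw_def)
 have cnt: "card {x \<in> X. f x < i} = i" if "i \<le> m" for i proof -
  have "f ` {x \<in> X. f x < i} = {..<i}"
  proof (intro equalityI subsetI)
   fix k assume "k \<in> {..<i}"
   then have "k \<in> f ` X" using f that by (auto simp: bij_betw_def)
   then show "k \<in> f ` {x \<in> X. f x < i}" using \<open>k \<in> {..<i}\<close> by auto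
  qed auto
  moreover have "inj_on f {x \<in> X. f x < i}" using inj by (auto simp: inj_on_def)
  ultimately show ?thesis by (metis card_image card_lessThan)
 qed
 have cntW: "card {x \<in> X. \<forall>z\<in>W. f x < f z} = i"
  if W: "W \<subseteq> X" and im: "i \<le> m" and low: "\<forall>z\<in>W. i \<le> f z" and att: "i < m ==> \<exists>z\<in>W. f z = i" for W i
 proof -
  have "{x \<in> X. \<forall>z\<in>W. f x < f z} = {x \<in> X. f x < i}"
  proof (cases "i < m")
   case True
   then obtain z where "z \<in> W" "f z = i" using att by auto
   then show ?thesis using low by force
  next
   case False
   then have "W = {}" using W low lt by force
   then show ?thesis using False im lt by auto
  qed
  then show ?thesis using cnt im by simp
 qed
 have ex: "\<exists>i\<le>m. (\<forall>z\<in>W. i \<le> f z) & (i < m --> (\<exists>z\<in>W. f z = i))" if "W \<subseteq> X" for W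
 proof (cases "W = {}")
  case False
  define i where "i = (LEAST k. k \<in> f ` W)"
  have "i \<in> f ` W" unfolding i_def using False by (metis LeastI ex_in_conv imageI)
  moreover have "\<forall>z\<in>W. i \<le> f z" unfolding i_def by (auto intro: Least_le)
  ultimately show ?thesis using lt that by (intro exI[of _ i]) (auto simp: less_imp_le subset_iff)
 qed auto
 have k1: "{x \<in> X. f x = card {x \<in> X. \<forall>z\<in>T \<union> Z e. f x < f z} & x \<notin> Z e} = T"
  if a: "e \<in> P" "T \<subseteq> X" "\<forall>x\<in>T. \<forall>y\<in>T. x = y" "\<forall>x\<in>T. \<forall>z\<in>Z e. f x < f z" for T e
 proof -
  have sub: "T \<union> Z e \<subseteq> X" using a(1,2) Z by blast
  obtain i where i: "i \<le> m" "\<forall>z\<in>T \<union> Z e. i \<le> f z" "i < m --> (\<exists>z\<in>T \<union> Z e. f z = i)"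
   using ex[OF sub] by blast
  have c: "card {x \<in> X. \<forall>z\<in>T \<union> Z e. f x < f z} = i" by (rule cntW[OF sub i(1,2)]) (use i(3) in blast)
  show "{x \<in> X. f x = card {x \<in> X. \<forall>z\<in>T \<union> Z e. f x < f z} & x \<notin> Z e} = T" unfolding c
  proof (intro equalityI subsetI)
   fix x assume x: "x \<in> {x \<in> X. f x = i & x \<notin> Z e}"
   then have "i < m" using lt by auto
   then obtain z where "z \<in> T \<union> Z e" "f z = i" using i by blast
   then show "x \<in> T" using x inj a Z by blast
  next
   fix x assume x: "x \<in> T"
   then have "x \<in> X" "x \<notin> Z e" using a(2,4) by (blast intro: less_irrefl)+
   moreover have "f x = i" proof -
    have "i \<le> f x" using i(2) x by blast
    then have "i < m" using lt[OF \<open>x \<in> X\<close>] by simp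
    then obtain z where z: "z \<in> T \<union> Z e" "f z = i" using i by blast
    show ?thesis
    proof (cases "z \<in> T")
     case True
     then have "x = z" using a(3) x by blast
     then show ?thesis using z by simp
    next
     case False
     then have "f x < f z" using z(1) a(4) x by blast
     moreover have "i \<le> f x" using i(2) x by blast
     ultimately show ?thesis using z(2) by simp
    qed
   qed
   ultimately show "x \<in> {x \<in> X. f x = i & x \<notin> Z e}" by simp
  qed
 qed
 have k2: "card {x \<in> X. \<forall>z\<in>{x \<in> X. f x = i & x \<notin> Z e} \<union> Z e. f x < f z} = i"
  if a: "e \<in> P" "i \<le> m" "\<forall>z\<in>Z e. i \<le> f z" for i e proof -
  show "card {x \<in> X. \<forall>z\<in>{x \<in> X. f x = i & x \<notin> Z e} \<union> Z e. f x < f z} = i"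
  proof (rule cntW)
   assume "i < m"
   then have "i \<in> f ` X" using f by (auto simp: bij_betw_def)
   then show "\<exists>z\<in>{x \<in> X. f x = i & x \<notin> Z e} \<union> Z e. f z = i" by auto
  qed (use a Z in auto)
 qed
 have k3: "e \<in> P & card {x \<in> X. \<forall>z\<in>T \<union> Z e. f x < f z} \<le> m &
   (\<forall>z\<in>Z e. card {x \<in> X. \<forall>z\<in>T \<union> Z e. f x < f z} \<le> f z)"
  if a: "e \<in> P" "T \<subseteq> X" "\<forall>x\<in>T. \<forall>y\<in>T. x = y" "\<forall>x\<in>T. \<forall>z\<in>Z e. f x < f z" for T e
 proof -
   have sub: "T \<union> Z e \<subseteq> X" using a(1,2) Z by blast
  obtain i where i: "i \<le> m" "\<forall>z\<in>T \<union> Z e. i \<le> f z" "i < m --> (\<exists>z\<in>T \<union> Z e. f z = i)"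
    using ex[OF sub] by blast
   have c: "card {x \<in> X. \<forall>z\<in>T \<union> Z e. f x < f z} = i" by (rule cntW[OF sub i(1,2)]) (use i(3) in blast)
   show "e \<in> P & card {x \<in> X. \<forall>z\<in>T \<union> Z e. f x < f z} \<le> m &
     (\<forall>z\<in>Z e. card {x \<in> X. \<forall>z\<in>T \<union> Z e. f x < f z} \<le> f z)" unfolding c using i a by auto
 qed
 have k4: "e \<in> P & {x \<in> X. f x = i & x \<notin> Z e} \<subseteq> X &
   (\<forall>x\<in>{x \<in> X. f x = i & x \<notin> Z e}. \<forall>y\<in>{x \<in> X. f x = i & x \<notin> Z e}. x = y) &
   (\<forall>x\<in>{x \<in> X. f x = i & x \<notin> Z e}. \<forall>z\<in>Z e. f x < f z)"
  if a: "e \<in> P" "i \<le> m" "\<forall>z\<in>Z e. i \<le> f z" for i e proof -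
  have "f x < f z" if "x \<in> X" "f x = i" "x \<notin> Z e" "z \<in> Z e" for x z proof -
   have "z \<in> X" using a(1) Z that(4) by blast
   then have "f x ~= f z" using inj that by blast
   then show ?thesis using a(3) that by fastforce
  qed
  moreover have "x = y" if "x \<in> X" "f x = i" "y \<in> X" "f y = i" for x y using inj that by simp
  ultimately show ?thesis using a(1) by blast
 qed
 show ?thesis
 proof (rule bij_betw_byWitness[where f' = "\<lambda>(i, e). ({x \<in> X. f x = i & x \<notin> Z e}, e)"])
  show "\<forall>p\<in>{(T, e). e \<in> P & T \<subseteq> X & (\<forall>x\<in>T. \<forall>y\<in>T. x = y) & (\<forall>x\<in>T. \<forall>z\<in>Z e. f x < f z)}.
    (case case p of (T, e) => (card {x \<in> X. \<forall>z\<in>T \<union> Z e. f x < f z}, e) of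
     (i, e) => ({x \<in> X. f x = i & x \<notin> Z e}, e)) = p" using k1 by (clarify, simp only: prod.case)
  show "\<forall>p\<in>{(i, e). e \<in> P & i \<le> m & (\<forall>z\<in>Z e. i \<le> f z)}.
    (case case p of (i, e) => ({x \<in> X. f x = i & x \<notin> Z e}, e) of
     (T, e) => (card {x \<in> X. \<forall>z\<in>T \<union> Z e. f x < f z}, e)) = p"
   using k2 by (clarify, simp only: prod.case)
 next
 show "(\<lambda>(T, e). (card {x \<in> X. \<forall>z\<in>T \<union> Z e. f x < f z}, e)) `
   {(T, e). e \<in> P & T \<subseteq> X & (\<forall>x\<in>T. \<forall>y\<in>T. x = y) & (\<forall>x\<in>T. \<forall>z\<in>Z e. f x < f z)}
   \<subseteq> {(i, e). e \<in> P & i \<le> m & (\<forall>z\<in>Z e. i \<le> f z)}"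
 proof (rule image_subsetI)
  fix q assume q: "q \<in> {(T, e). e \<in> P & T \<subseteq> X & (\<forall>x\<in>T. \<forall>y\<in>T. x = y) & (\<forall>x\<in>T. \<forall>z\<in>Z e. f x < f z)}"
  obtain T e where Te: "q = (T, e)" by (cases q)
  note h = q[unfolded Te mem_Collect_eq prod.case]
  show "(\<lambda>(T, e). (card {x \<in> X. \<forall>z\<in>T \<union> Z e. f x < f z}, e)) q \<in>
    {(i, e). e \<in> P & i \<le> m & (\<forall>z\<in>Z e. i \<le> f z)}" unfolding Te prod.case mem_Collect_eq
   by (rule k3[OF conjunct1[OF h] h[THEN conjunct2, THEN conjunct1]
    h[THEN conjunct2, THEN conjunct2, THEN conjunct1] h[THEN conjunct2, THEN conjunct2, THEN conjunct2]])
 qed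
 show "(\<lambda>(i, e). ({x \<in> X. f x = i & x \<notin> Z e}, e)) ` {(i, e). e \<in> P & i \<le> m & (\<forall>z\<in>Z e. i \<le> f z)}
   \<subseteq> {(T, e). e \<in> P & T \<subseteq> X & (\<forall>x\<in>T. \<forall>y\<in>T. x = y) & (\<forall>x\<in>T. \<forall>z\<in>Z e. f x < f z)}"
 proof (rule image_subsetI)
  fix q assume q: "q \<in> {(i, e). e \<in> P & i \<le> m & (\<forall>z\<in>Z e. i \<le> f z)}"
  obtain i e where ie: "q = (i, e)" by (cases q)
  note h = q[unfolded ie mem_Collect_eq prod.case]
  show "(\<lambda>(i, e). ({x \<in> X. f x = i & x \<notin> Z e}, e)) q \<in>
    {(T, e). e \<in> P & T \<subseteq> X & (\<forall>x\<in>T. \<forall>y\<in>T. x = y) & (\<forall>x\<in>T. \<forall>z\<in>Z e. f x < f z)}"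
   unfolding ie prod.case mem_Collect_eq
   by (rule k4[OF conjunct1[OF h] h[THEN conjunct2, THEN conjunct1] h[THEN conjunct2, THEN conjunct2]])
 qed
 qed
qed

definition subsingleton :: "'a set => bool" where
 "subsingleton T \<longleftrightarrow> (\<forall>x\<in>T. \<forall>y\<in>T. x = y)"

text \<open>The preceding bijection as an identity of sums: the optional marker is traded for a
  threshold \<open>i\<close>, the number of elements that remain below everything.\<close>

lemma sum_markers:
 fixes f :: "'a => nat" and g :: "nat => 'b => nat"
 assumes f: "bij_betw f X {..<m}" and Z: "\<And>e. e \<in> P ==> Z e \<subseteq> X"
  and R: "\<And>x z. x \<in> X ==> z \<in> X ==> R x z \<longleftrightarrow> f x < f z" and fin: "finite P"
 shows "(\<Sum>(T, e)\<in>{(T, e). e \<in> P & T \<subseteq> X & subsingleton T & (\<forall>x\<in>T. \<forall>z\<in>Z e. R x z)}.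
      g (card {x \<in> X. \<forall>z\<in>T \<union> Z e. R x z}) e) =
     (\<Sum>i\<le>m. \<Sum>e\<in>{e \<in> P. \<forall>z\<in>Z e. i \<le> f z}. g i e)"
proof -
 let ?A = "{(T, e). e \<in> P & T \<subseteq> X & subsingleton T & (\<forall>x\<in>T. \<forall>z\<in>Z e. f x < f z)}"
 have A: "{(T, e). e \<in> P & T \<subseteq> X & subsingleton T & (\<forall>x\<in>T. \<forall>z\<in>Z e. R x z)} = ?A" proof -
  have "(\<forall>x\<in>T. \<forall>z\<in>Z e. R x z) \<longleftrightarrow> (\<forall>x\<in>T. \<forall>z\<in>Z e. f x < f z)" if "e \<in> P" "T \<subseteq> X" for T e
   using R Z[OF that(1)] that(2) by (meson subsetD)
  then show ?thesis by auto
 qed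
 have c: "{x \<in> X. \<forall>z\<in>T \<union> Z e. R x z} = {x \<in> X. \<forall>z\<in>T \<union> Z e. f x < f z}"
  if "(T, e) \<in> ?A" for T e proof -
  have "T \<union> Z e \<subseteq> X" using that Z by auto
  then show ?thesis using R by blast
 qed
 have "(\<Sum>(T, e)\<in>?A. g (card {x \<in> X. \<forall>z\<in>T \<union> Z e. R x z}) e) =
   (\<Sum>p\<in>?A. (\<lambda>(i, e). g i e) ((\<lambda>(T, e). (card {x \<in> X. \<forall>z\<in>T \<union> Z e. f x < f z}, e)) p))"
 proof (rule sum.cong[OF refl], goal_cases)
  case (1 p)
  then show ?case using c[of "fst p" "snd p"] by (simp add: case_prod_unfold)
 qed
 also have "\<dots> = (\<Sum>(i, e)\<in>{(i, e). e \<in> P & i \<le> m & (\<forall>z\<in>Z e. i \<le> f z)}. g i e)"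
  unfolding subsingleton_def by (rule sum.reindex_bij_betw[OF rank_marker_bij[OF f Z]])
 also have "{(i, e). e \<in> P & i \<le> m & (\<forall>z\<in>Z e. i \<le> f z)} = Sigma {..m} (\<lambda>i. {e \<in> P. \<forall>z\<in>Z e. i \<le> f z})"
  by auto
 also have "(\<Sum>(i, e)\<in>Sigma {..m} (\<lambda>i. {e \<in> P. \<forall>z\<in>Z e. i \<le> f z}). g i e) =
   (\<Sum>i\<le>m. \<Sum>e\<in>{e \<in> P. \<forall>z\<in>Z e. i \<le> f z}. g i e)"
  by (rule sum.Sigma[symmetric]) (use fin in auto)
 finally show ?thesis unfolding A .
qed

lemma rank_bij:
 fixes X :: "'a::linorder set"
 assumes "finite X" shows "bij_betw (\<lambda>x. card {y \<in> X. y < x}) X {..<card X}"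
  and "x \<in> X ==> z \<in> X ==> x < z \<longleftrightarrow> card {y \<in> X. y < x} < card {y \<in> X. y < z}"
proof -
 have mono: "card {y \<in> X. y < x} < card {y \<in> X. y < z}" if "x \<in> X" "x < z" for x z
  using that assms by (intro psubset_card_mono) auto
 show "x \<in> X ==> z \<in> X ==> x < z \<longleftrightarrow> card {y \<in> X. y < x} < card {y \<in> X. y < z}"
  using mono[of x z] mono[of z x] by (cases x z rule: linorder_cases) auto
 have "inj_on (\<lambda>x. card {y \<in> X. y < x}) X" by (rule linorder_inj_onI') (use mono in "simp add: less_imp_neq")
 moreover have "(\<lambda>x. card {y \<in> X. y < x}) ` X \<subseteq> {..<card X}"
  using assms by (auto intro!: psubset_card_mono)
 ultimately show "bij_betw (\<lambda>x. card {y \<in> X. y < x}) X {..<card X}"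
  by (simp add: bij_betw_def card_image card_subset_eq)
qed

lemma corank_bij:
 fixes X :: "'a::linorder set"
 assumes "finite X" shows "bij_betw (\<lambda>x. card {y \<in> X. x < y}) X {..<card X}"
  and "x \<in> X ==> z \<in> X ==> z < x \<longleftrightarrow> card {y \<in> X. x < y} < card {y \<in> X. z < y}"
proof -
 have mono: "card {y \<in> X. x < y} < card {y \<in> X. z < y}" if "x \<in> X" "z < x" for x z
  using that assms by (intro psubset_card_mono) auto
 show "x \<in> X ==> z \<in> X ==> z < x \<longleftrightarrow> card {y \<in> X. x < y} < card {y \<in> X. z < y}"
  using mono[of x z] mono[of z x] by (cases x z rule: linorder_cases) auto
 have "inj_on (\<lambda>x. card {y \<in> X. x < y}) X"
  by (rule linorder_inj_onI') (use mono in "simp add: less_imp_neq[symmetric]")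
 moreover have "(\<lambda>x. card {y \<in> X. x < y}) ` X \<subseteq> {..<card X}"
  using assms by (auto intro!: psubset_card_mono)
 ultimately show "bij_betw (\<lambda>x. card {y \<in> X. x < y}) X {..<card X}"
  by (simp add: bij_betw_def card_image card_subset_eq)
qed

lemma card_upper_part:
 assumes "bij_betw f X {..<m}" "i \<le> (m::nat)" shows "card {x \<in> X. i \<le> f x} = m - i"
proof -
 have "f ` {x \<in> X. i \<le> f x} = {k \<in> f ` X. i \<le> k}" by auto
 also have "\<dots> = {i..<m}" using assms by (auto simp: bij_betw_def)
 finally have "f ` {x \<in> X. i \<le> f x} = {i..<m}" .
 moreover have "inj_on f {x \<in> X. i \<le> f x}" using assms by (auto simp: bij_betw_def inj_on_def)
 ultimately show ?thesis by (metis card_image card_atLeastLessThan)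
qed

lemma restrict_antitone_matchings:
 "{E \<in> {E \<in> antitone_matchings X Y. \<forall>z\<in>fst ` E. P z}. \<forall>z\<in>snd ` E. Q z} =
   antitone_matchings {x \<in> X. P x} {y \<in> Y. Q y}" unfolding antitone_matchings_def by (auto simp: subset_iff)

text \<open>The ways of joining a nest of the left child and a nest of the right child:
  \<open>T\<close> and \<open>U\<close> hold the at most one serpent that starts at the top arc of
  either child, \<open>E\<close> the hooks. The inequalities express that such a serpent is
  compatible with a hook, whose turns at the two top arcs are 0 and 2.\<close>

definition strands :: "'a::linorder set => 'b::linorder set => ('a set \<times> 'b set \<times> ('a \<times> 'b) set) set" where
 "strands X Y = {(T, U, E). T \<subseteq> X & subsingleton T & U \<subseteq> Y & subsingleton U &
   E \<in> antitone_matchings X Y & (\<forall>x\<in>T. \<forall>z\<in>fst ` E. x < z) & (\<forall>y\<in>U. \<forall>z\<in>snd ` E. z < y)}"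

text \<open>Once the numbers \<open>i\<close> and \<open>j\<close> of elements that remain are
  fixed, the markers \<open>T\<close> and \<open>U\<close> are determined by \<open>E\<close>. What
  varies is a matching between the elements of \<open>X\<close> of rank at least \<open>i\<close>
  and those of \<open>Y\<close> of corank at least \<open>j\<close>, and such matchings are counted
  by a binomial coefficient.\<close>

lemma sum_strands:
 fixes X :: "'a::linorder set" and Y :: "'b::linorder set" and g :: "nat => nat => nat"
 assumes fin: "finite X" "finite Y" shows "(\<Sum>(T, U, E)\<in>strands X Y.
   g (card {x \<in> X. \<forall>z\<in>T \<union> fst ` E. x < z}) (card {y \<in> Y. \<forall>z\<in>U \<union> snd ` E. z < y})) =
  (\<Sum>i\<le>card X. \<Sum>j\<le>card Y. ((card X - i + (card Y - j)) choose (card X - i)) * g i j)"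
proof -
 let ?f = "\<lambda>x. card {y \<in> X. y < x}" and ?h = "\<lambda>x. card {y \<in> Y. x < y}"
 define Q where "Q = {(U, E). E \<in> antitone_matchings X Y & U \<subseteq> Y & subsingleton U &
   (\<forall>y\<in>U. \<forall>z\<in>snd ` E. z < y)}"
 have finQ: "finite Q" by (rule finite_subset[of _ "Pow Y \<times> antitone_matchings X Y"])
   (use fin finite_antitone_matchings in "auto simp: Q_def")
 have Q_sub: "\<And>q. q \<in> Q ==> fst ` snd q \<subseteq> X" unfolding Q_def antitone_matchings_def by auto
 have S: "strands X Y = {(T, q). q \<in> Q & T \<subseteq> X & subsingleton T & (\<forall>x\<in>T. \<forall>z\<in>fst ` snd q. x < z)}"
  unfolding strands_def Q_def by (simp add: case_prod_unfold conj_comms conj_left_commute)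
 have "(\<Sum>(T, U, E)\<in>strands X Y.
   g (card {x \<in> X. \<forall>z\<in>T \<union> fst ` E. x < z}) (card {y \<in> Y. \<forall>z\<in>U \<union> snd ` E. z < y})) =
   (\<Sum>(T, q)\<in>strands X Y.
   (\<lambda>i q. g i (card {y \<in> Y. \<forall>z\<in>fst q \<union> snd ` snd q. z < y})) (card {x \<in> X. \<forall>z\<in>T \<union> fst ` snd q. x < z}) q)"
  by (rule sum.cong) auto
 also have "\<dots> = (\<Sum>i\<le>card X. \<Sum>q\<in>{q \<in> Q. \<forall>z\<in>fst ` snd q. i \<le> ?f z}.
   g i (card {y \<in> Y. \<forall>z\<in>fst q \<union> snd ` snd q. z < y}))" unfolding S
  by (rule sum_markers[OF rank_bij(1)[OF fin(1)] Q_sub rank_bij(2)[OF fin(1)] finQ])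
 also have "\<dots> = (\<Sum>i\<le>card X. \<Sum>j\<le>card Y. ((card X - i + (card Y - j)) choose (card X - i)) * g i j)"
 proof (rule sum.cong[OF refl])
  fix i assume i: "i \<in> {..card X}"
  let ?P = "{E \<in> antitone_matchings X Y. \<forall>z\<in>fst ` E. i \<le> ?f z}"
  have finP: "finite ?P" using finite_antitone_matchings[OF fin] by simp
  have P_sub: "\<And>E. E \<in> ?P ==> snd ` E \<subseteq> Y" unfolding antitone_matchings_def by auto
  have "{q \<in> Q. \<forall>z\<in>fst ` snd q. i \<le> ?f z} =
    {(U, E). E \<in> ?P & U \<subseteq> Y & subsingleton U & (\<forall>y\<in>U. \<forall>z\<in>snd ` E. z < y)}"
   unfolding Q_def by auto
  then have "(\<Sum>q\<in>{q \<in> Q. \<forall>z\<in>fst ` snd q. i \<le> ?f z}.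
     g i (card {y \<in> Y. \<forall>z\<in>fst q \<union> snd ` snd q. z < y})) =
    (\<Sum>(U, E)\<in>{(U, E). E \<in> ?P & U \<subseteq> Y & subsingleton U & (\<forall>y\<in>U. \<forall>z\<in>snd ` E. z < y)}.
     (\<lambda>j E. g i j) (card {y \<in> Y. \<forall>z\<in>U \<union> snd ` E. z < y}) E)" by (intro sum.cong) auto
  also have "\<dots> = (\<Sum>j\<le>card Y. \<Sum>E\<in>{E \<in> ?P. \<forall>z\<in>snd ` E. j \<le> ?h z}. g i j)"
   by (rule sum_markers[OF corank_bij(1)[OF fin(2)] P_sub corank_bij(2)[OF fin(2)] finP])
  also have "\<dots> = (\<Sum>j\<le>card Y. ((card X - i + (card Y - j)) choose (card X - i)) * g i j)"
  proof (rule sum.cong[OF refl])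
   fix j assume j: "j \<in> {..card Y}"
   have "card {E \<in> ?P. \<forall>z\<in>snd ` E. j \<le> ?h z} = (card X - i + (card Y - j)) choose (card X - i)"
    unfolding restrict_antitone_matchings using fin i j
    by (subst card_antitone_matchings) (simp_all add: card_upper_part[OF rank_bij(1)] card_upper_part[OF corank_bij(1)])
   then show "(\<Sum>E\<in>{E \<in> ?P. \<forall>z\<in>snd ` E. j \<le> ?h z}. g i j) =
     ((card X - i + (card Y - j)) choose (card X - i)) * g i j" by simp
  qed
  finally show "(\<Sum>q\<in>{q \<in> Q. \<forall>z\<in>fst ` snd q. i \<le> ?f z}.
     g i (card {y \<in> Y. \<forall>z\<in>fst q \<union> snd ` snd q. z < y})) =
    (\<Sum>j\<le>card Y. ((card X - i + (card Y - j)) choose (card X - i)) * g i j)" .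
 qed
 finally show ?thesis .
qed

text \<open>The variant for a virtual right child: no serpent starts at its top, so only the left
  side carries a marker and no threshold is imposed on \<open>Y\<close>.\<close>

lemma sum_strands_left:
 fixes X :: "'a::linorder set" and Y :: "'b::linorder set" and g :: "nat => nat"
 assumes fin: "finite X" "finite Y"
 shows "(\<Sum>(T, U, E)\<in>{c \<in> strands X Y. fst (snd c) = {}}. g (card {x \<in> X. \<forall>z\<in>T \<union> fst ` E. x < z})) =
  (\<Sum>i\<le>card X. ((card X - i + card Y) choose (card X - i)) * g i)"
proof -
 let ?f = "\<lambda>x. card {y \<in> X. y < x}"
 define Q where "Q = {(U :: 'b set, E). U = {} & E \<in> antitone_matchings X Y}"
 have Q_image: "Q = (\<lambda>E. ({}, E)) ` antitone_matchings X Y" unfolding Q_def by auto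
 then have finQ: "finite Q" using finite_antitone_matchings[OF fin] by simp
 have Q_sub: "\<And>q. q \<in> Q ==> fst ` snd q \<subseteq> X" unfolding Q_def antitone_matchings_def by auto
 have S: "{c \<in> strands X Y. fst (snd c) = {}} =
   {(T, q). q \<in> Q & T \<subseteq> X & subsingleton T & (\<forall>x\<in>T. \<forall>z\<in>fst ` snd q. x < z)}"
  unfolding strands_def Q_def by (rule Collect_cong) (simp add: case_prod_unfold; auto simp: subsingleton_def[of "{}"])
 have "(\<Sum>(T, U, E)\<in>{c \<in> strands X Y. fst (snd c) = {}}. g (card {x \<in> X. \<forall>z\<in>T \<union> fst ` E. x < z})) =
   (\<Sum>(T, q)\<in>{c \<in> strands X Y. fst (snd c) = {}}. (\<lambda>i q. g i) (card {x \<in> X. \<forall>z\<in>T \<union> fst ` snd q. x < z}) q)"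
  by (rule sum.cong) auto
 also have "\<dots> = (\<Sum>i\<le>card X. \<Sum>q\<in>{q \<in> Q. \<forall>z\<in>fst ` snd q. i \<le> ?f z}. g i)"
  unfolding S by (rule sum_markers[OF rank_bij(1)[OF fin(1)] Q_sub rank_bij(2)[OF fin(1)] finQ])
 also have "\<dots> = (\<Sum>i\<le>card X. ((card X - i + card Y) choose (card X - i)) * g i)"
 proof (rule sum.cong[OF refl])
  fix i assume i: "i \<in> {..card X}"
  have "{q \<in> Q. \<forall>z\<in>fst ` snd q. i \<le> ?f z} =
    (\<lambda>E. ({}, E)) ` {E \<in> {E \<in> antitone_matchings X Y. \<forall>z\<in>fst ` E. i \<le> ?f z}. \<forall>z\<in>snd ` E. True}"
   unfolding Q_image by force
  then have "card {q \<in> Q. \<forall>z\<in>fst ` snd q. i \<le> ?f z} =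
    card {E \<in> {E \<in> antitone_matchings X Y. \<forall>z\<in>fst ` E. i \<le> ?f z}. \<forall>z\<in>snd ` E. True}"
   by (simp add: card_image inj_on_def)
  also have "\<dots> = (card X - i + card Y) choose (card X - i)" unfolding restrict_antitone_matchings using fin i
   by (subst card_antitone_matchings) (simp_all add: card_upper_part[OF rank_bij(1)])
  finally show "(\<Sum>q\<in>{q \<in> Q. \<forall>z\<in>fst ` snd q. i \<le> ?f z}. g i) =
    ((card X - i + card Y) choose (card X - i)) * g i" by simp
 qed
 finally show ?thesis .
qed

lemma Hook_image [simp]: "Hook u v \<in> (\<lambda>(u, v). Hook u v) ` E \<longleftrightarrow> (u, v) \<in> E" by force

definition assemble :: "serp set \<times> serp set \<times> word set \<times> word set \<times> (word \<times> word) set => serp set" where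
 "assemble = (\<lambda>(N, M, T, U, E).
   In ` (N \<union> Top ` T) \<union> Skip ` (M \<union> Top ` U) \<union> (\<lambda>(u, v). Hook u v) ` E)"

definition disassemble ::
  "tr => tr => serp set => serp set \<times> serp set \<times> word set \<times> word set \<times> (word \<times> word) set" where
 "disassemble a b N = ({s \<in> inner_serps a. In s \<in> N}, {s \<in> inner_serps b. Skip s \<in> N},
   {w. In (Top w) \<in> N}, {w. Skip (Top w) \<in> N}, {(u, v). Hook u v \<in> N})"

lemma indep_Un: "indep (A \<union> B) \<longleftrightarrow> indep A & indep B & (\<forall>s\<in>A. \<forall>s'\<in>B. s ~= s' --> ~ conf s s')"
proof
 assume l: "indep (A \<union> B)"
 show "indep A & indep B & (\<forall>s\<in>A. \<forall>s'\<in>B. s ~= s' --> ~ conf s s')" using l unfolding indep_def by simp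
next
 assume r: "indep A & indep B & (\<forall>s\<in>A. \<forall>s'\<in>B. s ~= s' --> ~ conf s s')"
 have A: "\<And>s s'. s \<in> A ==> s' \<in> A ==> s ~= s' ==> ~ conf s s'" using r by (simp add: indep_def)
 have B: "\<And>s s'. s \<in> B ==> s' \<in> B ==> s ~= s' ==> ~ conf s s'" using r by (simp add: indep_def)
 have AB: "\<And>s s'. s \<in> A ==> s' \<in> B ==> s ~= s' ==> ~ conf s s'" using r by simp
 have BA: "\<And>s s'. s \<in> B ==> s' \<in> A ==> s ~= s' ==> ~ conf s s'" using AB conf_sym by metis
 have "~ conf s s'" if "s \<in> A \<union> B" "s' \<in> A \<union> B" "s ~= s'" for s s'
  using that(1,2) by (elim UnE) (use that(3) A B AB BA in simp_all)
 then show "indep (A \<union> B)" by (simp add: indep_def)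
qed

lemma conf_Top: "s \<in> inner_serps t ==> conf s (Top w) = hits 1 w s" using Top_not_inner by (cases s) auto

lemma indep_with_tops:
 assumes "N \<subseteq> inner_serps t"
 shows "indep (N \<union> Top ` T) \<longleftrightarrow> indep N & subsingleton T & (\<forall>x\<in>T. \<forall>s\<in>N. ~ hits 1 x s)"
proof -
 have "indep (Top ` T) \<longleftrightarrow> subsingleton T" by (auto simp: indep_def subsingleton_def)
 moreover have "(\<forall>s\<in>N. \<forall>s'\<in>Top ` T. s ~= s' --> ~ conf s s') \<longleftrightarrow> (\<forall>x\<in>T. \<forall>s\<in>N. ~ hits 1 x s)"
 proof -
  have "conf s (Top w) = hits 1 w s" "s ~= Top w" if "s \<in> N" for s w using assms that conf_Top Top_not_inner by blast+
  then show ?thesis by auto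
 qed
 ultimately show ?thesis by (simp add: indep_Un)
qed

lemma indep_In: "indep (In ` A) \<longleftrightarrow> indep A" by (auto simp: indep_def)

lemma indep_Skip: "indep (Skip ` A) \<longleftrightarrow> indep A" by (auto simp: indep_def)

lemma indep_Hook:
 assumes "E \<subseteq> X \<times> Y"
 shows "indep ((\<lambda>(u, v). Hook u v) ` E) \<longleftrightarrow> E \<in> antitone_matchings X Y"
proof -
 have "conf (Hook (fst p) (snd p)) (Hook (fst q) (snd q)) \<longleftrightarrow>
   ~ ((fst p < fst q & snd q < snd p) \<or> (fst q < fst p & snd p < snd q))" if "p ~= q" for p q
  using that by (cases "fst p" "fst q" rule: linorder_cases; cases "snd p" "snd q" rule: linorder_cases)
   (auto simp: prod_eq_iff)
 then show ?thesis using assms by (simp add: indep_def antitone_matchings_def case_prod_unfold prod_eq_iff)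
qed

text \<open>Serpents in different children never conflict, so what has to be checked is each child
  by itself and the hooks against everything. Against inner serpents of a child the turns 0, 1 and 2
  give the same conflicts, which turns these checks into membership in \<open>avail\<close>.\<close>

lemma indep_assemble:
 assumes N: "N \<subseteq> inner_serps a" and M: "M \<subseteq> inner_serps b"
  and T: "T \<subseteq> half_walks a" and U: "U \<subseteq> half_walks b" "U ~= {} ==> real_top b"
  and E: "E \<subseteq> half_walks a \<times> enter_left b" shows "indep (assemble (N, M, T, U, E)) \<longleftrightarrow>
  indep N & indep M & (T, U, E) \<in> strands (avail a N) (avail b M \<inter> enter_left b)"
proof -
 have Us: "U \<subseteq> enter_left b" using U by (auto simp: enter_left_def)
 have IS: "indep (In ` A \<union> Skip ` B) \<longleftrightarrow> indep A & indep B" for A B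
  by (auto simp: indep_Un indep_In indep_Skip)
 have IH: "(\<forall>s\<in>In ` (N \<union> Top ` T). \<forall>s'\<in>(\<lambda>(u, v). Hook u v) ` E. s ~= s' --> ~ conf s s') \<longleftrightarrow>
   (\<forall>u\<in>fst ` E. \<forall>s\<in>N. ~ hits 1 u s) & (\<forall>x\<in>T. \<forall>z\<in>fst ` E. x < z)" proof -
  have "hits 0 u s = hits (Suc 0) u s" if "s \<in> N" for u s using N that hits_inner by blast
  then show ?thesis by (auto simp: case_prod_unfold not_le ball_Un)
 qed
 have SH: "(\<forall>s\<in>Skip ` (M \<union> Top ` U). \<forall>s'\<in>(\<lambda>(u, v). Hook u v) ` E. s ~= s' --> ~ conf s s') \<longleftrightarrow>
   (\<forall>u\<in>snd ` E. \<forall>s\<in>M. ~ hits 1 u s) & (\<forall>x\<in>U. \<forall>z\<in>snd ` E. z < x)" proof -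
  have "hits 2 u s = hits (Suc 0) u s" if "s \<in> M" for u s using M that hits_inner by blast
  then show ?thesis by (auto simp: case_prod_unfold not_le ball_Un)
 qed
 have "indep (assemble (N, M, T, U, E)) \<longleftrightarrow>
   indep (N \<union> Top ` T) & indep (M \<union> Top ` U) & E \<in> antitone_matchings (half_walks a) (enter_left b) &
   (\<forall>u\<in>fst ` E. \<forall>s\<in>N. ~ hits 1 u s) & (\<forall>x\<in>T. \<forall>z\<in>fst ` E. x < z) &
   (\<forall>u\<in>snd ` E. \<forall>s\<in>M. ~ hits 1 u s) & (\<forall>x\<in>U. \<forall>z\<in>snd ` E. z < x)"
  unfolding assemble_def prod.case indep_Un[of _ "(\<lambda>(u, v). Hook u v) ` E"] IS indep_Hook[OF E]
   ball_Un[of "In ` (N \<union> Top ` T)" "Skip ` (M \<union> Top ` U)"] IH SH by argo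
 also have "\<dots> \<longleftrightarrow> indep N & indep M & (T, U, E) \<in> strands (avail a N) (avail b M \<inter> enter_left b)"
 proof -
  have "E \<in> antitone_matchings (avail a N) (avail b M \<inter> enter_left b) \<longleftrightarrow>
    E \<in> antitone_matchings (half_walks a) (enter_left b) &
    (\<forall>u\<in>fst ` E. \<forall>s\<in>N. ~ hits 1 u s) & (\<forall>u\<in>snd ` E. \<forall>s\<in>M. ~ hits 1 u s)"
  proof -
   have "E \<subseteq> avail a N \<times> (avail b M \<inter> enter_left b) \<longleftrightarrow>
     (\<forall>u\<in>fst ` E. \<forall>s\<in>N. ~ hits 1 u s) & (\<forall>u\<in>snd ` E. \<forall>s\<in>M. ~ hits 1 u s)"
   proof -
    have "E \<subseteq> avail a N \<times> (avail b M \<inter> enter_left b) \<longleftrightarrow>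
      (\<forall>e\<in>E. fst e \<in> avail a N & snd e \<in> avail b M \<inter> enter_left b)"
     by (auto simp: subset_iff mem_Times_iff)
    also have "\<dots> \<longleftrightarrow> (\<forall>e\<in>E. (\<forall>s\<in>N. ~ hits 1 (fst e) s) & (\<forall>s\<in>M. ~ hits 1 (snd e) s))"
    proof (rule ball_cong[OF refl])
     fix e assume "e \<in> E"
     then have "fst e \<in> half_walks a" "snd e \<in> enter_left b" using E by auto
     then show "fst e \<in> avail a N & snd e \<in> avail b M \<inter> enter_left b \<longleftrightarrow>
       (\<forall>s\<in>N. ~ hits 1 (fst e) s) & (\<forall>s\<in>M. ~ hits 1 (snd e) s)"
      by (simp add: avail_def enter_left_def)
    qed
    finally show ?thesis by blast
   qed
   then show ?thesis using E unfolding antitone_matchings_def by auto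
  qed
  moreover have "T \<subseteq> avail a N \<longleftrightarrow> (\<forall>x\<in>T. \<forall>s\<in>N. ~ hits 1 x s)"
   using T unfolding avail_def by auto
  moreover have "U \<subseteq> avail b M \<inter> enter_left b \<longleftrightarrow> (\<forall>x\<in>U. \<forall>s\<in>M. ~ hits 1 x s)"
   using U Us unfolding avail_def by auto
  ultimately show ?thesis unfolding indep_with_tops[OF N] indep_with_tops[OF M] strands_def by auto
 qed
 finally show ?thesis .
qed

text \<open>A serpent of the node is a hook, or lies in one child and is inner there or starts at
  the top arc. The last kind is absent on the right when the right child is virtual.\<close>

lemma assemble_bij:
 assumes a: "real_top a" shows "bij_betw assemble
  (SIGMA N:inner_nests a. SIGMA M:inner_nests b.
    {c \<in> strands (avail a N) (avail b M \<inter> enter_left b). real_top b \<or> fst (snd c) = {}})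
  (inner_nests (Nd r a b))"
proof (rule bij_betw_byWitness[where f' = "disassemble a b"])
 let ?A = "SIGMA N:inner_nests a. SIGMA M:inner_nests b.
    {c \<in> strands (avail a N) (avail b M \<inter> enter_left b). real_top b \<or> fst (snd c) = {}}"
 have subs: "N \<subseteq> inner_serps a & M \<subseteq> inner_serps b & T \<subseteq> half_walks a & U \<subseteq> half_walks b &
   (U = {} \<or> real_top b) & E \<subseteq> half_walks a \<times> enter_left b" if "(N, M, T, U, E) \<in> ?A" for N M T U E
  using that by (auto simp: inner_nests_def strands_def avail_def antitone_matchings_def)
 have d: "disassemble a b (assemble (N, M, T, U, E)) = (N, M, T, U, E)"
  if "N \<subseteq> inner_serps a" "M \<subseteq> inner_serps b" for N M T U E using that Top_not_inner
  by (auto simp: disassemble_def assemble_def)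
 show "\<forall>x\<in>?A. disassemble a b (assemble x) = x"
 proof
  fix x assume x: "x \<in> ?A"
  obtain N M T U E where xe: "x = (N, M, T, U, E)" by (metis prod_cases5)
  have "N \<subseteq> inner_serps a & M \<subseteq> inner_serps b" using subs x unfolding xe by blast
  then show "disassemble a b (assemble x) = x" unfolding xe using d by blast
 qed
 have rec: "assemble (disassemble a b S) = S" if "S \<subseteq> inner_serps (Nd r a b)" for S
 proof
  show "assemble (disassemble a b S) \<subseteq> S" by (auto simp: disassemble_def assemble_def)
  show "S \<subseteq> assemble (disassemble a b S)"
  proof
   fix s assume s: "s \<in> S"
   then have "s \<in> inner_serps (Nd r a b)" using that by blast
   then show "s \<in> assemble (disassemble a b S)" using s by (auto simp: disassemble_def assemble_def image_iff)
  qed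
 qed
 show "\<forall>S\<in>inner_nests (Nd r a b). assemble (disassemble a b S) = S" using rec by (simp add: inner_nests_def)
 show "assemble ` ?A \<subseteq> inner_nests (Nd r a b)"
 proof (rule image_subsetI)
  fix x assume x: "x \<in> ?A"
  obtain N M T U E where xe: "x = (N, M, T, U, E)" by (metis prod_cases5)
  note s = subs[OF x[unfolded xe]]
  have "indep (assemble x)" unfolding xe using x xe s indep_assemble[of N a M b T U E] by (auto simp: inner_nests_def)
  moreover have "assemble x \<subseteq> inner_serps (Nd r a b)" unfolding xe using s a by (auto simp: assemble_def subset_iff)
  ultimately show "assemble x \<in> inner_nests (Nd r a b)" by (simp add: inner_nests_def)
 qed
 show "disassemble a b ` inner_nests (Nd r a b) \<subseteq> ?A"
 proof (rule image_subsetI)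
  fix S assume S: "S \<in> inner_nests (Nd r a b)"
  obtain N M T U E where xe: "disassemble a b S = (N, M, T, U, E)" by (metis prod_cases5)
  have SS: "S \<subseteq> inner_serps (Nd r a b)" using S by (simp add: inner_nests_def)
  have ind: "indep (assemble (N, M, T, U, E))" using S rec[OF SS] unfolding xe by (simp add: inner_nests_def)
  have sub: "N \<subseteq> inner_serps a" "M \<subseteq> inner_serps b" "T \<subseteq> half_walks a"
   "U \<subseteq> half_walks b" "U ~= {} ==> real_top b" "E \<subseteq> half_walks a \<times> enter_left b"
   using SS xe Top_not_inner by (auto simp: disassemble_def)
  then show "disassemble a b S \<in> ?A" using ind indep_assemble[OF sub] unfolding xe by (auto simp: inner_nests_def)
 qed
qed

text \<open>A walk from above enters the left child with turn 2, so it has to descend strictly to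
  the left of every hook and of the serpent that stops at the top arc.\<close>

lemma avail_left_assemble:
 assumes "N \<subseteq> inner_serps a" "M \<subseteq> inner_serps b" "E \<subseteq> half_walks a \<times> enter_left b"
 shows "avail_left (Nd r a b) (assemble (N, M, T, U, E)) = {x \<in> avail a N. \<forall>z\<in>T \<union> fst ` E. x < z}"
proof -
 have "hits 2 u s = hits (Suc 0) u s" if "s \<in> N" for u s using assms that hits_inner by blast
 then show ?thesis by (auto simp: avail_left_def avail_def assemble_def ball_Un case_prod_unfold not_le)
qed

text \<open>In a virtual right child the hooks go left and the walks from above go right, hence they
  never meet. The additional \<open>Rgt\<close> is the step through the virtual arc.\<close>

lemma avail_right_assemble:
 assumes "N \<subseteq> inner_serps a" "M \<subseteq> inner_serps b" "E \<subseteq> half_walks a \<times> enter_left b"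
  "U ~= {} ==> real_top b" shows "avail_right (Nd r a b) (assemble (N, M, T, U, E)) =
  (if real_top b then {y \<in> avail b M \<inter> enter_left b. \<forall>z\<in>U \<union> snd ` E. z < y}
   else Rgt ` avail_right b M)"
proof -
 have h: "hits 0 u s = hits (Suc 0) u s" if "s \<in> M" for u s using assms that hits_inner by blast
 show ?thesis
 proof (cases "real_top b")
  case True
  then show ?thesis using h
   by (auto simp: avail_right_def avail_def assemble_def ball_Un case_prod_unfold not_le enter_left_def)
 next
  case False
  have E: "snd e < Rgt v" if "e \<in> E" for e v
   using assms(3) that False by (cases e) (fastforce simp: enter_left_def subset_iff)
  have "U = {}" using False assms(4) by auto
  then show ?thesis using h False E
   by (auto simp: avail_right_def avail_def assemble_def ball_Un case_prod_unfold not_le image_iff)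
 qed
qed

text \<open>The weight is arbitrary because the node above needs the joint distribution of both
  numbers. A real right child enters through all its available walks; a virtual one lets hooks use
  its left walks only and passes its right walks on unchanged.\<close>

lemma sum_inner_nests_rec:
 fixes g :: "nat => nat => nat"
 assumes a: "real_top a" and t_def: "t = Nd r a b"
 shows "(\<Sum>S\<in>inner_nests t. g (card (avail_left t S)) (card (avail_right t S))) =
  (\<Sum>N\<in>inner_nests a. \<Sum>M\<in>inner_nests b. if real_top b then
     \<Sum>i\<le>card (avail a N). \<Sum>j\<le>card (avail b M).
      ((card (avail a N) - i + (card (avail b M) - j)) choose (card (avail a N) - i)) * g i j
    else
     \<Sum>i\<le>card (avail a N).
      ((card (avail a N) - i + card (avail_left b M)) choose (card (avail a N) - i)) *
      g i (card (avail_right b M)))"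
proof -
 let ?C = "\<lambda>N M. {c \<in> strands (avail a N) (avail b M \<inter> enter_left b). real_top b \<or> fst (snd c) = {}}"
 let ?G = "\<lambda>S. g (card (avail_left t S)) (card (avail_right t S))"
 have finC: "finite (?C N M)" for N M
 proof (rule finite_subset)
  show "?C N M \<subseteq> Pow (avail a N) \<times> Pow (avail b M \<inter> enter_left b) \<times>
    antitone_matchings (avail a N) (avail b M \<inter> enter_left b)" by (auto simp: strands_def)
  show "finite (Pow (avail a N) \<times> Pow (avail b M \<inter> enter_left b) \<times>
    antitone_matchings (avail a N) (avail b M \<inter> enter_left b))" by (simp add: finite_avail finite_antitone_matchings)
 qed
 have "(\<Sum>S\<in>inner_nests t. ?G S) =
   (\<Sum>x\<in>(SIGMA N:inner_nests a. SIGMA M:inner_nests b. ?C N M). ?G (assemble x))"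
  unfolding t_def by (rule sum.reindex_bij_betw[OF assemble_bij[OF a], symmetric])
 also have "\<dots> = (\<Sum>N\<in>inner_nests a. \<Sum>M\<in>inner_nests b. \<Sum>c\<in>?C N M. ?G (assemble (N, M, c)))"
 proof -
  have "(\<Sum>M\<in>inner_nests b. \<Sum>c\<in>?C N M. ?G (assemble (N, M, c))) =
    (\<Sum>y\<in>(SIGMA M:inner_nests b. ?C N M). ?G (assemble (N, y)))" for N
   by (subst sum.Sigma) (use finite_inner_nests finC in "auto simp: case_prod_unfold")
  moreover have "(\<Sum>N\<in>inner_nests a. \<Sum>y\<in>(SIGMA M:inner_nests b. ?C N M). ?G (assemble (N, y))) =
    (\<Sum>x\<in>(SIGMA N:inner_nests a. SIGMA M:inner_nests b. ?C N M). ?G (assemble x))"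
   by (subst sum.Sigma) (use finite_inner_nests finC in "auto simp: case_prod_unfold")
  ultimately show ?thesis by simp
 qed
 also have "\<dots> = (\<Sum>N\<in>inner_nests a. \<Sum>M\<in>inner_nests b. if real_top b then
     \<Sum>i\<le>card (avail a N). \<Sum>j\<le>card (avail b M).
      ((card (avail a N) - i + (card (avail b M) - j)) choose (card (avail a N) - i)) * g i j
    else
     \<Sum>i\<le>card (avail a N).
      ((card (avail a N) - i + card (avail_left b M)) choose (card (avail a N) - i)) *
      g i (card (avail_right b M)))"
 proof (intro sum.cong refl)
  fix N M assume NM: "N \<in> inner_nests a" "M \<in> inner_nests b"
  then have sub: "N \<subseteq> inner_serps a" "M \<subseteq> inner_serps b" by (auto simp: inner_nests_def)
  let ?X = "avail a N" and ?Y = "avail b M \<inter> enter_left b"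
  have fin: "finite ?X" "finite ?Y" by (simp_all add: finite_avail)
  have E: "E \<subseteq> half_walks a \<times> enter_left b" if "(T, U, E) \<in> ?C N M" for T U E
   using that by (auto simp: strands_def antitone_matchings_def avail_def)
  show "(\<Sum>c\<in>?C N M. ?G (assemble (N, M, c))) =
   (if real_top b then
     \<Sum>i\<le>card (avail a N). \<Sum>j\<le>card (avail b M).
      ((card (avail a N) - i + (card (avail b M) - j)) choose (card (avail a N) - i)) * g i j
    else
     \<Sum>i\<le>card (avail a N).
      ((card (avail a N) - i + card (avail_left b M)) choose (card (avail a N) - i)) *
      g i (card (avail_right b M)))"
  proof (cases "real_top b")
   case True
   have "avail b M \<inter> enter_left b = avail b M" using True by (auto simp: avail_def enter_left_def)
   then have cY: "card ?Y = card (avail b M)" by simp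
   have "(\<Sum>c\<in>?C N M. ?G (assemble (N, M, c))) = (\<Sum>(T, U, E)\<in>strands ?X ?Y.
     g (card {x \<in> ?X. \<forall>z\<in>T \<union> fst ` E. x < z}) (card {y \<in> ?Y. \<forall>z\<in>U \<union> snd ` E. z < y}))"
   proof (rule sum.cong)
    show "?C N M = strands ?X ?Y" using True by auto
    fix c assume c: "c \<in> strands ?X ?Y"
    obtain T U E where ce: "c = (T, U, E)" by (metis prod_cases3)
    have Es: "E \<subseteq> half_walks a \<times> enter_left b" using c ce True E[of T U E] by simp
    show "?G (assemble (N, M, c)) = (case c of (T, U, E) =>
     g (card {x \<in> ?X. \<forall>z\<in>T \<union> fst ` E. x < z}) (card {y \<in> ?Y. \<forall>z\<in>U \<union> snd ` E. z < y}))"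
     unfolding ce prod.case t_def avail_left_assemble[OF sub Es] using avail_right_assemble[OF sub Es, of U r T] True by simp
   qed
   then show ?thesis using sum_strands[OF fin, of g] True cY by simp
  next
   case False
   have "?Y = Lft ` avail_left b M" using False by (auto simp: avail_def enter_left_def avail_left_def)
   then have cY: "card ?Y = card (avail_left b M)" by (simp add: card_image inj_on_def)
   have "(\<Sum>c\<in>?C N M. ?G (assemble (N, M, c))) =
     (\<Sum>(T, U, E)\<in>{c \<in> strands ?X ?Y. fst (snd c) = {}}.
      (\<lambda>i. g i (card (avail_right b M))) (card {x \<in> ?X. \<forall>z\<in>T \<union> fst ` E. x < z}))"
   proof (rule sum.cong)
    show "?C N M = {c \<in> strands ?X ?Y. fst (snd c) = {}}" using False by auto
    fix c assume c: "c \<in> {c \<in> strands ?X ?Y. fst (snd c) = {}}"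
    obtain T U E where ce: "c = (T, U, E)" by (metis prod_cases3)
    have Es: "E \<subseteq> half_walks a \<times> enter_left b" using c ce E[of T U E] by blast
    have "U = {}" using c ce by simp
    then have "avail_right (Nd r a b) (assemble (N, M, T, U, E)) = Rgt ` avail_right b M"
     using avail_right_assemble[OF sub Es, of U r T] False by simp
    then have "card (avail_right (Nd r a b) (assemble (N, M, T, U, E))) = card (avail_right b M)"
     by (simp add: card_image inj_on_def)
    then show "?G (assemble (N, M, c)) = (case c of (T, U, E) =>
      (\<lambda>i. g i (card (avail_right b M))) (card {x \<in> ?X. \<forall>z\<in>T \<union> fst ` E. x < z}))"
     unfolding ce prod.case t_def avail_left_assemble[OF sub Es] by simp
   qed
   then show ?thesis using sum_strands_left[OF fin, of "\<lambda>i. g i (card (avail_right b M))"] False cY by simp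
  qed
 qed
 finally show ?thesis .
qed

section \<open>Facets of noncrossing chord sets\<close>

definition noncrossing :: "(nat \<times> nat) set => bool" where
 "noncrossing F \<longleftrightarrow> (\<forall>s t s' t'. (s, t) \<in> F --> (s', t') \<in> F --> ~ (s < s' & s' < t & t < t'))"

definition facets :: "(nat \<times> nat) set => (nat \<times> nat) set set" where
 "facets U = {F. F \<subseteq> U & noncrossing F &
   (\<forall>s t. (s, t) \<in> U --> (s, t) \<notin> F -->
    (\<exists>s' t'. (s', t') \<in> F & (s < s' & s' < t & t < t' \<or> s' < s & s < t' & t' < t)))}"

lemma facets_subset: "F \<in> facets U ==> F \<subseteq> U" by (simp add: facets_def)

lemma facets_nc: "F \<in> facets U ==> (s, t) \<in> F ==> (s', t') \<in> F ==> s < s' ==> s' < t ==> t < t' ==> P"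
 unfolding facets_def noncrossing_def by blast

lemma facets_max:
 assumes "F \<in> facets U" "(s, t) \<in> U" and "\<And>s' t'. (s', t') \<in> F ==> s < s' ==> s' < t ==> t < t' ==> False"
  and "\<And>s' t'. (s', t') \<in> F ==> s' < s ==> s < t' ==> t' < t ==> False" shows "(s, t) \<in> F"
 using assms unfolding facets_def by blast

lemma facets_crossed:
 assumes "F \<in> facets U" "(s, t) \<in> U" "(s, t) \<notin> F"
 obtains s' t' where "(s', t') \<in> F" "s < s'" "s' < t" "t < t'"
  | s' t' where "(s', t') \<in> F" "s' < s" "s < t'" "t' < t" using facets_max[OF assms(1,2)] assms(3) by blast

text \<open>Every row carries a point. Take \<open>y\<close> largest among the points in rows from
  \<open>x\<close> on: nothing in the ladder is strictly comparable to (x, y). If there are no such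
  points, the least element of \<open>Y\<close> serves as \<open>y\<close>.\<close>

lemma ladders_left:
 assumes fin: "finite X" "finite Y" "Y ~= {}" and E: "E \<in> ladders X Y" and x: "x \<in> X"
 shows "\<exists>y. (x, y) \<in> E"
proof -
 have sub: "E \<subseteq> X \<times> Y" and nc: "\<And>p q. p \<in> E ==> q \<in> E ==> ~ (fst p < fst q & snd p < snd q)"
  and mx: "\<And>p. p \<in> X \<times> Y ==> p \<notin> E ==>
    \<exists>q\<in>E. (fst p < fst q & snd p < snd q) \<or> (fst q < fst p & snd q < snd p)"
  using E unfolding ladders_def by blast+
 let ?S = "{y. \<exists>x'. x \<le> x' & (x', y) \<in> E}"
 show ?thesis
 proof (cases "?S = {}")
  case True
  obtain y0 where y0: "y0 \<in> Y" "\<And>y. y \<in> Y ==> y0 \<le> y" using fin(2,3) by (meson Min_in Min_le)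
  have "\<exists>q\<in>E. (x < fst q & y0 < snd q) \<or> (fst q < x & snd q < y0)" if "(x, y0) \<notin> E"
   using mx[of "(x, y0)"] that x y0 by auto
  moreover have "snd q \<in> Y" if "q \<in> E" for q using sub that by auto
  moreover have "fst q < x" if "q \<in> E" for q using True that by (cases q) (auto simp: not_le)
  ultimately show ?thesis using y0 by (meson leD less_asym)
 next
  case False
  have finS: "finite ?S" by (rule finite_subset[OF _ fin(2)]) (use sub in auto)
  define y where "y = Max ?S"
  have "y \<in> ?S" unfolding y_def using finS False by (rule Max_in)
  then obtain x0 where x0: "x \<le> x0" "(x0, y) \<in> E" by auto
  have ymax: "y' \<le> y" if "(x', y') \<in> E" "x \<le> x'" for x' y' unfolding y_def using finS that by (intro Max_ge) auto
  have "(x, y) \<in> E"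
  proof (rule ccontr)
   assume "(x, y) \<notin> E"
   then obtain q where q: "q \<in> E" "(x < fst q & y < snd q) \<or> (fst q < x & snd q < y)"
    using mx[of "(x, y)"] x subsetD[OF sub x0(2)] by auto
   have "x < fst q --> snd q \<le> y" using ymax[of "fst q" "snd q"] q(1) by auto
   then show False using q(2) nc[OF q(1) x0(2)] x0(1) by auto
  qed
  then show ?thesis by blast
 qed
qed

lemma ladders_right:
 assumes fin: "finite X" "X ~= {}" "finite Y" and E: "E \<in> ladders X Y" and y: "y \<in> Y"
 shows "\<exists>x. (x, y) \<in> E"
proof -
 have "prod.swap ` E \<in> ladders Y X" using E unfolding ladders_def
  by (simp add: ball_Un image_iff subset_iff) (fastforce simp: image_iff)
 then obtain x where "(y, x) \<in> prod.swap ` E" using ladders_left[OF fin(3) fin(1,2)] y by blast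
 then show ?thesis by auto
qed

text \<open>One tree node over the interval from \<open>l\<close> to \<open>j\<close>, split at
  \<open>k\<close>. \<open>PA\<close> and \<open>PB\<close> are the chords inside the two parts,
  \<open>RA\<close> the ends that can leave the left part, \<open>BL\<close> and \<open>BR\<close>
  the ends that can leave the right part at its left and at its right vertex. The vertex
  \<open>j\<close> stands for everything outside the interval.\<close>

locale glue =
 fixes l k j :: nat and PA PB :: "(nat \<times> nat) set" and RA BL BR :: "nat set" and real_b :: bool
 assumes PA: "(s, t) \<in> PA ==> l \<le> s & s < t & t < k" and PB: "(s, t) \<in> PB ==> k \<le> s & s < t & t < j"
  and RA: "s \<in> RA ==> l \<le> s & s < k" and RA0: "l \<in> RA" "k - 1 \<in> RA"
  and BL: "s \<in> BL ==> k \<le> s & s < j" and BL0: "k \<in> BL" and BR: "s \<in> BR ==> k \<le> s & s < j"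
  and real: "real_b ==> BL = BR" and virtual: "~ real_b ==> s \<in> BL ==> t \<in> BR ==> s < t"
begin

text \<open>The chord sets of the two children, whose outside vertices are \<open>k\<close> and
  \<open>j\<close>, and that of the node. Chords from \<open>RA\<close> to \<open>BL\<close> pass
  from one child to the other around the common vertex.\<close>

definition "U1 = PA \<union> RA \<times> {k}"
definition "U2 = PB \<union> (BL \<union> BR) \<times> {j}"
definition "U = PA \<union> PB \<union> RA \<times> BL \<union> (RA \<union> BR) \<times> {j}"

text \<open>Contractions of a facet to the children. The first collapses all vertices from
  \<open>k\<close> on to \<open>k\<close>. The second collapses all vertices before \<open>k\<close>
  to the outside vertex \<open>j\<close>, so a chord (s, y) between the parts becomes (y,
  j).\<close>

definition "con1 F = {(s, t) \<in> F. t < k} \<union> {s. s < k & (\<exists>t\<ge>k. (s, t) \<in> F)} \<times> {k}"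
definition "con2 F = {(s, t) \<in> F. k \<le> s & t < j} \<union>
 {y. k \<le> y & ((y, j) \<in> F \<or> y < j & (\<exists>s<k. (s, y) \<in> F))} \<times> {j}"

lemma lkj: "l < k" "k < j" using RA0 RA BL0 BL by fastforce+

lemma U_cases:
 assumes "(s, t) \<in> U"
 obtains "(s, t) \<in> PA" "t < k" "s < t" "l \<le> s" | "(s, t) \<in> PB" "k \<le> s" "s < t" "t < j"
  | "s \<in> RA" "t \<in> BL" "s < k" "k \<le> t" "t < j" | "s \<in> RA" "t = j" "s < k" | "s \<in> BR" "t = j" "k \<le> s" "s < j"
 using assms unfolding U_def using PA PB RA BL BR by blast

lemma U_low: "(s, t) \<in> U ==> t < k ==> (s, t) \<in> PA" using lkj by (elim U_cases) auto
lemma U_high: "(s, t) \<in> U ==> k \<le> s ==> t < j ==> (s, t) \<in> PB" using lkj by (elim U_cases) auto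
lemma U_mid: "(s, t) \<in> U ==> s < k ==> k \<le> t ==> t < j ==> s \<in> RA & t \<in> BL" using lkj by (elim U_cases) auto
lemma U_mid': "(s, t) \<in> U ==> s < k ==> k \<le> t ==> s \<in> RA" using lkj by (elim U_cases) auto
lemma U_end: "(s, j) \<in> U ==> k \<le> s ==> s \<in> BR" using lkj by (elim U_cases) auto
lemma U_bounds: "(s, t) \<in> U ==> l \<le> s & s < t & t \<le> j" using lkj RA BL by (elim U_cases) fastforce+

section \<open>Contracting a facet to the two parts\<close>

context
 fixes F assumes F: "F \<in> facets U"
begin

lemma FU: "(s, t) \<in> F ==> (s, t) \<in> U" using facets_subset[OF F] by blast

lemma nc: "(s, t) \<in> F ==> (s', t') \<in> F ==> s < s' ==> s' < t ==> t < t' ==> False" using facets_nc[OF F] by blast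

lemma fin_out: "finite {t. P t & (\<exists>s. Q s t & (s, t) \<in> F)}"
 by (rule finite_subset[of _ "{..j}"]) (use FU U_bounds in auto)

lemma fin_in: "finite {s. P s & (\<exists>t. Q s t & (s, t) \<in> F)}"
 by (rule finite_subset[of _ "{..j}"]) (use FU U_bounds in "force+")

lemma left_edge: "(l, j) \<in> F"
proof (rule facets_max[OF F])
 show "(l, j) \<in> U" using RA0 by (simp add: U_def)
next
 fix s' t' assume "(s', t') \<in> F" "j < t'"
 then show False using U_bounds[OF FU] by fastforce
next
 fix s' t' assume "(s', t') \<in> F" "s' < l"
 then show False using U_bounds[OF FU] by fastforce
qed

lemma middle_edge: "(k - 1, k) \<in> F"
proof (rule facets_max[OF F])
 show "(k - 1, k) \<in> U" using RA0 BL0 by (simp add: U_def)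
qed auto

text \<open>The chord from \<open>s\<close> to the farthest vertex reached from the stretch between
  \<open>s\<close> and \<open>k\<close> is uncrossed: a crossing chord would reach farther, cross
  the chord attaining that vertex, or separate \<open>s\<close> from \<open>k\<close> inside the
  left part.\<close>

lemma lift_left:
 assumes s: "s \<in> RA" and free: "\<And>s' t'. (s', t') \<in> F ==> s' < s ==> s < t' ==> t' < k ==> False"
 shows "\<exists>t\<ge>k. (s, t) \<in> F"
proof -
 define S where "S = {t. k \<le> t & (\<exists>s'. (s \<le> s' & s' < k) & (s', t) \<in> F)}"
 have fin: "finite S" unfolding S_def by (rule fin_out)
 have "k \<in> S" unfolding S_def using middle_edge lkj RA[OF s] by (auto intro!: exI[of _ "k - 1"])
 then have "Max S \<in> S" using fin by (intro Max_in) auto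
 then obtain s0 where t: "k \<le> Max S" "s \<le> s0" "s0 < k" "(s0, Max S) \<in> F" unfolding S_def by auto
 have tmax: "t' \<le> Max S" if "(s', t') \<in> F" "k \<le> t'" "s \<le> s'" "s' < k" for s' t'
  using fin that by (intro Max_ge) (auto simp: S_def)
 have "(s, Max S) \<in> U" using FU[OF t(4)] s t by (elim U_cases) (auto simp: U_def)
 then have "(s, Max S) \<in> F"
 proof (rule facets_max[OF F])
  fix s' t' assume q: "(s', t') \<in> F" "s < s'" "s' < Max S" "Max S < t'"
  show False
  proof (cases "s' < k")
   case True
   then show False using tmax[OF q(1)] q t by auto
  next
   case False
   then show False using nc[OF t(4) q(1)] q t by auto
  qed
 next
  fix s' t' assume q: "(s', t') \<in> F" "s' < s" "s < t'" "t' < Max S"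
  show False
  proof (cases "t' < k")
   case True
   then show False using free[OF q(1)] q by auto
  next
   case False
   then show False using nc[OF q(1) t(4)] q t by auto
  qed
 qed
 then show ?thesis using t by auto
qed

text \<open>The mirror argument: the chord joins \<open>y\<close> to the last left vertex that has a
  neighbour at \<open>y\<close> or beyond but before \<open>j\<close>.\<close>

lemma lift_right:
 assumes y: "y \<in> BL" and ex: "\<exists>s' y'. (s', y') \<in> F & s' < k & y \<le> y' & y' < j"
  and free: "\<And>s' t'. (s', t') \<in> F ==> k \<le> s' ==> s' < y ==> y < t' ==> t' < j ==> False"
 shows "\<exists>s<k. (s, y) \<in> F"
proof -
 define S where "S = {s. s < k & (\<exists>y'. (y \<le> y' & y' < j) & (s, y') \<in> F)}"
 have fin: "finite S" unfolding S_def by (rule fin_in)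
 have "S ~= {}" using ex unfolding S_def by auto
 then have "Max S \<in> S" using fin by (intro Max_in) auto
 then obtain y0 where s: "Max S < k" "y \<le> y0" "y0 < j" "(Max S, y0) \<in> F" unfolding S_def by auto
 have smax: "s' \<le> Max S" if "(s', y') \<in> F" "y \<le> y'" "y' < j" "s' < k" for s' y'
  using fin that by (intro Max_ge) (auto simp: S_def)
 have ky: "k \<le> y" using BL[OF y] by simp
 have "(Max S, y) \<in> U" using U_mid'[OF FU[OF s(4)]] s y ky by (auto simp: U_def)
 then have "(Max S, y) \<in> F"
 proof (rule facets_max[OF F])
  fix s' t' assume q: "(s', t') \<in> F" "Max S < s'" "s' < y" "y < t'"
  show False
  proof (cases "t' < j")
   case True
   then show False using smax[OF q(1)] free[OF q(1)] q by (cases "s' < k") auto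
  next
   case False
   then show False using nc[OF s(4) q(1)] q s by auto
  qed
 next
  fix s' t' assume q: "(s', t') \<in> F" "s' < Max S" "Max S < t'" "t' < y"
  then show False using nc[OF q(1) s(4)] s by auto
 qed
 then show ?thesis using s by auto
qed

text \<open>A chord that crosses a chord of the left part still crosses it after contraction, so
  maximality there is inherited. A missing chord to \<open>k\<close> is crossed inside the left part
  by \<open>lift_left\<close>.\<close>

lemma con1_facet: "con1 F \<in> facets U1" unfolding facets_def
proof (intro CollectI conjI allI impI)
 show "con1 F \<subseteq> U1" unfolding con1_def U1_def using U_low[OF FU] U_mid'[OF FU] by blast
 show "noncrossing (con1 F)" unfolding noncrossing_def con1_def using nc by (auto; force)
 fix s t assume st: "(s, t) \<in> U1" "(s, t) \<notin> con1 F"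
 show "\<exists>s' t'. (s', t') \<in> con1 F & (s < s' & s' < t & t < t' \<or> s' < s & s < t' & t' < t)"
 proof (cases "t = k")
  case True
  then have s: "s \<in> RA" using st PA unfolding U1_def by auto
  then have "~ (\<exists>t\<ge>k. (s, t) \<in> F)" using st True RA unfolding con1_def by auto
  then obtain s' t' where "(s', t') \<in> F" "s' < s" "s < t'" "t' < k" using lift_left[OF s] by blast
  then show ?thesis using True unfolding con1_def by blast
 next
  case False
  then have P: "(s, t) \<in> PA" "t < k" using st PA unfolding U1_def by auto
  then have nF: "(s, t) \<notin> F" using st unfolding con1_def by auto
  have "(s, t) \<in> U" using P unfolding U_def by auto
  then show ?thesis
  proof (rule facets_crossed[OF F _ nF])
   fix s' t' assume q: "(s', t') \<in> F" "s < s'" "s' < t" "t < t'"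
   show ?thesis
   proof (cases "t' < k")
    case True then show ?thesis using q unfolding con1_def by blast
   next
    case False
    then have "s' < k & (\<exists>t\<ge>k. (s', t) \<in> F)" using q P by (auto intro!: exI[of _ t'])
    then have "(s', k) \<in> con1 F" unfolding con1_def by simp
    then show ?thesis using q P by blast
   qed
  next
   fix s' t' assume q: "(s', t') \<in> F" "s' < s" "s < t'" "t' < t"
   then have "(s', t') \<in> con1 F" using P unfolding con1_def by auto
   then show ?thesis using q by blast
  qed
 qed
qed

text \<open>The last vertex of the right part joined to the left part. Beyond it the right part sees
  only itself and the outside, so it is where the neighbours on the right are cut in two.\<close>

definition "ystar = Max {y. (k \<le> y & y < j) & (\<exists>s. s < k & (s, y) \<in> F)}"

lemma ystar: "k \<le> ystar" "ystar < j" "\<exists>s<k. (s, ystar) \<in> F"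
 "\<And>s y. s < k ==> k \<le> y ==> y < j ==> (s, y) \<in> F ==> y \<le> ystar"
proof -
 let ?S = "{y. (k \<le> y & y < j) & (\<exists>s. s < k & (s, y) \<in> F)}"
 have fin: "finite ?S" by (rule fin_out)
 have "k \<in> ?S" using middle_edge lkj by (auto intro!: exI[of _ "k - 1"])
 then have "ystar \<in> ?S" unfolding ystar_def using fin by (intro Max_in) auto
 then show "k \<le> ystar" "ystar < j" "\<exists>s<k. (s, ystar) \<in> F" by auto
 show "\<And>s y. s < k ==> k \<le> y ==> y < j ==> (s, y) \<in> F ==> y \<le> ystar"
  unfolding ystar_def using fin by (intro Max_ge) auto
qed

lemma ystar_BL: "ystar \<in> BL" using ystar U_mid FU by blast

lemma ystar_edge: "ystar \<in> BR ==> (ystar, j) \<in> F"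
proof (rule facets_max[OF F])
 obtain s where s: "s < k" "(s, ystar) \<in> F" using ystar by auto
 show "ystar \<in> BR ==> (ystar, j) \<in> U" by (simp add: U_def)
 fix s' t' assume q: "(s', t') \<in> F"
 { assume "ystar < s'" "s' < j" "j < t'"
  then show False using U_bounds[OF FU[OF q]] by auto }
 assume a: "s' < ystar" "ystar < t'" "t' < j"
 show False
 proof (cases "s' < k")
  case True
  then show False using ystar(4)[of s' t'] q a ystar(1) by auto
 next
  case False
  then show False using nc[OF s(2) q] a s by auto
 qed
qed

text \<open>The delicate chords are those to \<open>j\<close>. If nothing inside the right part cuts
  off \<open>s\<close>, then \<open>s\<close> is joined to the left by \<open>lift_right\<close>
  when some left chord lands at or beyond it, and to \<open>j\<close> when it lies in
  \<open>BR\<close>; what is left is the case of a virtual right part.\<close>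

lemma con2_facet: "con2 F \<in> facets U2" unfolding facets_def
proof (intro CollectI conjI allI impI)
 show "con2 F \<subseteq> U2" unfolding con2_def U2_def using U_high[OF FU] U_mid[OF FU] U_end[OF FU] by blast
 show "noncrossing (con2 F)" unfolding noncrossing_def con2_def using nc by (auto; force)
 fix s t assume st: "(s, t) \<in> U2" "(s, t) \<notin> con2 F"
 show "\<exists>s' t'. (s', t') \<in> con2 F & (s < s' & s' < t & t < t' \<or> s' < s & s < t' & t' < t)"
 proof (cases "t = j")
  case True
  then have s: "s \<in> BL \<union> BR" using st PB unfolding U2_def by auto
  then have ks: "k \<le> s" "s < j" using BL BR by auto
  have no: "(s, j) \<notin> F" "\<And>s'. s' < k ==> (s', s) \<notin> F" using st True ks unfolding con2_def by auto
  show ?thesis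
  proof (rule ccontr)
   assume c: "~ ?thesis"
   have free: "False" if "(s', t') \<in> F" "k \<le> s'" "s' < s" "s < t'" "t' < j" for s' t' proof -
    have "(s', t') \<in> con2 F" using that unfolding con2_def by auto
    then show False using c True that by blast
   qed
   show False
   proof (cases "\<exists>s' y'. (s', y') \<in> F & s' < k & s \<le> y' & y' < j")
    case True
    then obtain s' y' where sy: "(s', y') \<in> F" "s' < k" "s \<le> y'" "y' < j" by blast
    then have "y' \<in> BL" using FU U_mid ks by (meson le_trans)
    then have "s \<in> BL" using s real virtual[of y' s] sy by (metis Un_iff leD)
    have "\<exists>s'<k. (s', s) \<in> F" by (rule lift_right[OF \<open>s \<in> BL\<close> True]) (rule free)
    then show False using no by blast
   next
    case no_right: False
    show False
    proof (cases "s \<in> BR")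
     case True
     have "(s, j) \<in> F"
     proof (rule facets_max[OF F])
      show "(s, j) \<in> U" using True by (simp add: U_def)
      fix s' t' assume q: "(s', t') \<in> F"
      { assume "s < s'" "s' < j" "j < t'"
       then show False using U_bounds[OF FU[OF q]] by auto }
      assume a: "s' < s" "s < t'" "t' < j"
      then show False using free[OF q] no_right q by (cases "s' < k") auto
     qed
     then show False using no by blast
    next
     case False
     then have sBL: "s \<in> BL" and nr: "~ real_b" using s real by auto
     \<comment> \<open>Here \<open>s\<close> lies in \<open>BL\<close> only and beyond all landing
       points. The chord from the first left neighbour of \<open>ystar\<close> to \<open>s\<close>
       is uncrossed: chords to \<open>j\<close> from the right part start in \<open>BR\<close>,
       which lies entirely after \<open>BL\<close>.\<close>
     have lt: "ystar < s" using no_right ystar(2,3) not_le by blast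
     define S where "S = {x. x < k & (\<exists>y. y = ystar & (x, y) \<in> F)}"
     have finS: "finite S" unfolding S_def by (rule fin_in)
     have "S ~= {}" using ystar(3) unfolding S_def by auto
     then have m: "Min S \<in> S" using finS by (intro Min_in) auto
     then have m1: "Min S < k" "(Min S, ystar) \<in> F" unfolding S_def by auto
     have mmin: "Min S \<le> x" if "x < k" "(x, ystar) \<in> F" for x using finS that by (intro Min_le) (auto simp: S_def)
     have "(Min S, s) \<in> F"
     proof (rule facets_max[OF F])
      show "(Min S, s) \<in> U" using U_mid[OF FU[OF m1(2)]] m1 ystar sBL by (auto simp: U_def)
      fix s' t' assume q: "(s', t') \<in> F"
      { assume a: "Min S < s'" "s' < s" "s < t'"
       show False
       proof (cases "t' < j")
        case True
        then show False using free[OF q] no_right q a by (cases "s' < k") auto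
       next
        case False
        then have tj: "t' = j" using U_bounds[OF FU[OF q]] by auto
        show False
        proof (cases "s' < ystar")
         case True then show False using nc[OF m1(2) q] a tj ystar by auto
        next
         case False
         then have "k \<le> s'" using ystar by simp
         then have "s' \<in> BR" using U_end FU q tj by blast
         then show False using virtual[OF nr sBL] a by fastforce
        qed
       qed }
      assume a: "s' < Min S" "Min S < t'" "t' < s"
      show False
      proof (cases "t' < ystar")
       case True then show False using nc[OF q m1(2)] a by auto
      next
       case False
       then have "t' \<le> ystar" using ystar(4)[of s' t'] q a m1 ystar(1) ks by auto
       then have "t' = ystar" using False by simp
       then show False using mmin[of s'] q a m1 by auto
      qed
     qed
     then show False using no m1 by blast
    qed
   qed
  qed
 next
  case False
  then have P: "(s, t) \<in> PB" "k \<le> s" "s < t" "t < j" using st PB unfolding U2_def by auto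
  then have nF: "(s, t) \<notin> F" using st unfolding con2_def by auto
  have "(s, t) \<in> U" using P unfolding U_def by auto
  then show ?thesis
  proof (rule facets_crossed[OF F _ nF])
   fix s' t' assume q: "(s', t') \<in> F" "s < s'" "s' < t" "t < t'"
   then have "t' < j \<or> t' = j" using U_bounds[OF FU[OF q(1)]] by auto
   then have "(s', t') \<in> con2 F" using q P unfolding con2_def by auto
   then show ?thesis using q by blast
  next
   fix s' t' assume q: "(s', t') \<in> F" "s' < s" "s < t'" "t' < t"
   show ?thesis
   proof (cases "s' < k")
    case False
    then have "(s', t') \<in> con2 F" using q P unfolding con2_def by auto
    then show ?thesis using q by blast
   next
    case True
    then have "(t', j) \<in> con2 F" using q P unfolding con2_def by auto
    then show ?thesis using q P by blast
   qed
  qed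
 qed
qed

text \<open>\<open>xs1\<close> and \<open>ys1\<close> are the neighbours of the outside in the left
  and the right part; \<open>xs2\<close> and \<open>ys2\<close> are the ends of the chords between
  the parts, and \<open>mid\<close> is the set of those chords.\<close>

definition "xs1 = {x. x < k & (x, j) \<in> F}"
definition "xs2 = {x. x < k & (\<exists>y. (k \<le> y & y < j) & (x, y) \<in> F)}"
definition "ys2 = {y. k \<le> y & y < j & (\<exists>s<k. (s, y) \<in> F)}"
definition "ys1 = {y. k \<le> y & (y, j) \<in> F}"
definition "mid = {(x, y) \<in> F. x < k & k \<le> y & y < j}"

lemma nb_con1: "{s. (s, k) \<in> con1 F} = xs1 \<union> xs2"
proof -
 have "t < j \<or> t = j" if "(s, t) \<in> F" for s t using U_bounds[OF FU[OF that]] by auto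
 then show ?thesis unfolding con1_def xs1_def xs2_def using less_imp_le[OF lkj(2)] by auto
qed

lemma nb_con2: "{s. (s, j) \<in> con2 F} = ys1 \<union> ys2" unfolding con2_def ys1_def ys2_def by auto

text \<open>The cut is at the last left neighbour \<open>p\<close> of \<open>j\<close>: the chord
  from \<open>p\<close> to \<open>ystar\<close> is uncrossed, so \<open>p\<close> belongs to both
  halves. Noncrossing puts every left neighbour of \<open>j\<close> weakly before every left end of
  a chord between the parts.\<close>

lemma split_left: "\<exists>p \<in> xs1 \<union> xs2. xs1 = {x \<in> xs1 \<union> xs2. x \<le> p} & xs2 = {x \<in> xs1 \<union> xs2. p \<le> x}"
proof -
 have fin: "finite xs1" unfolding xs1_def by (rule finite_subset[of _ "{..k}"]) auto
 have ne: "xs1 ~= {}" unfolding xs1_def using left_edge lkj by auto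
 define p where "p = Max xs1"
 have p: "p \<in> xs1" "\<And>x. x \<in> xs1 ==> x \<le> p" unfolding p_def using fin ne by auto
 have sep: "x \<le> x'" if "x \<in> xs1" "x' \<in> xs2" for x x'
 proof (rule ccontr)
  assume "~ x \<le> x'"
  then show False using that nc[of x' _ x j] unfolding xs1_def xs2_def by fastforce
 qed
 have pF: "p < k" "(p, j) \<in> F" using p(1) unfolding xs1_def by auto
 obtain s where s: "s < k" "(s, ystar) \<in> F" using ystar by auto
 have "(p, ystar) \<in> F"
 proof (rule facets_max[OF F])
  show "(p, ystar) \<in> U" using ystar_BL U_mid'[OF FU[OF pF(2)]] pF lkj by (auto simp: U_def)
  fix s' t' assume q: "(s', t') \<in> F"
  { assume a: "p < s'" "s' < ystar" "ystar < t'"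
   show False
   proof (cases "s' < k")
    case False
    then show False using nc[OF s(2) q] a s by auto
   next
    case True
    have "t' < j \<or> t' = j" using U_bounds[OF FU[OF q]] by auto
    then show False
    proof
     assume "t' < j" then show False using ystar(4)[of s' t'] q a True ystar(1) by auto
    next
     assume "t' = j" then show False using p(2)[of s'] True q a unfolding xs1_def by auto
    qed
   qed }
  assume a: "s' < p" "p < t'" "t' < ystar"
  show False
  proof (cases "t' < k")
   case True then show False using nc[OF q pF(2)] a lkj ystar by auto
  next
   case False
   then have "k \<le> t' & t' < j" "s' < k" using a pF ystar(2) by auto
   then have "s' \<in> xs2" unfolding xs2_def using q by blast
   then show False using sep[OF p(1)] a by fastforce
  qed
 qed
 then have "p \<in> xs2" unfolding xs2_def using pF ystar by auto
 then show ?thesis using p sep by (intro bexI[of _ p]) fastforce+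
qed

text \<open>For a real right part \<open>ystar\<close> lies in \<open>BR\<close> as well, so it is
  joined to \<open>j\<close> and is the common element of both halves.\<close>

lemma split_right_real:
 assumes real_b
 shows "\<exists>q \<in> ys1 \<union> ys2. ys2 = {y \<in> ys1 \<union> ys2. y \<le> q} & ys1 = {y \<in> ys1 \<union> ys2. q \<le> y}"
proof -
 have 1: "ystar \<in> ys2" unfolding ys2_def using ystar by auto
 have 2: "ystar \<in> ys1" unfolding ys1_def using ystar ystar_edge ystar_BL real assms by auto
 have 3: "y \<le> ystar" if "y \<in> ys2" for y using that ystar(4) unfolding ys2_def by auto
 have 4: "ystar \<le> y" if "y \<in> ys1" for y
 proof (rule ccontr)
  assume "~ ystar \<le> y"
  moreover obtain s where s: "s < k" "(s, ystar) \<in> F" using ystar by auto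
  ultimately show False using that nc[of s ystar y j] ystar unfolding ys1_def by auto
 qed
 show ?thesis using 1 2 3 4 by (intro bexI[of _ ystar]) fastforce+
qed

text \<open>For a virtual right part there is no choice of a cut: the two halves are dictated by the
  disjoint sets \<open>BL\<close> and \<open>BR\<close>.\<close>

lemma split_right_virtual:
 assumes "~ real_b" shows "ys2 = {y \<in> ys1 \<union> ys2. y \<in> BL} & ys1 = {y \<in> ys1 \<union> ys2. y \<in> BR}"
proof -
 have "y \<in> BL" if "y \<in> ys2" for y using that U_mid FU unfolding ys2_def by blast
 moreover have "y \<in> BR" if "y \<in> ys1" for y using that U_end FU unfolding ys1_def by blast
 moreover have "BL \<inter> BR = {}" using virtual[OF assms] by blast
 ultimately show ?thesis by blast
qed

lemma mid_ladder: "mid \<in> ladders xs2 ys2" unfolding ladders_def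
proof (intro CollectI conjI ballI impI)
 show "mid \<subseteq> xs2 \<times> ys2" unfolding mid_def xs2_def ys2_def by auto
 fix p q assume "p \<in> mid" "q \<in> mid"
 then show "~ (fst p < fst q & snd p < snd q)" using nc[of "fst p" "snd p" "fst q" "snd q"] unfolding mid_def by auto
next
 fix p assume p: "p \<in> xs2 \<times> ys2" "p \<notin> mid"
 obtain x y where pe: "p = (x, y)" by (cases p)
 have xy: "x < k" "k \<le> y" "y < j" "(x, y) \<notin> F" using p pe unfolding xs2_def ys2_def mid_def by auto
 obtain yx where yx: "k \<le> yx" "yx < j" "(x, yx) \<in> F" using p pe unfolding xs2_def by auto
 obtain xy' where xy': "xy' < k" "(xy', y) \<in> F" using p pe unfolding ys2_def by auto
 have "(x, y) \<in> U" using U_mid'[OF FU[OF yx(3)]] U_mid[OF FU[OF xy'(2)]] xy yx xy' by (auto simp: U_def)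
 then have "\<exists>x' y'. (x', y') \<in> mid & (x < x' & y < y' \<or> x' < x & y' < y)"
 proof (rule facets_crossed[OF F _ xy(4)])
  fix s' t' assume q: "(s', t') \<in> F" "x < s'" "s' < y" "y < t'"
  show ?thesis
  proof (cases "s' < k & t' < j")
   case True
   then have "(s', t') \<in> mid" using q xy unfolding mid_def by auto
   then show ?thesis using q by blast
  next
   case False
   have "t' \<le> j" using U_bounds[OF FU[OF q(1)]] by auto
   then show ?thesis using False nc[OF yx(3) q(1)] nc[OF xy'(2) q(1)] q xy yx xy' by (cases "s' < k") auto
  qed
 next
  fix s' t' assume q: "(s', t') \<in> F" "s' < x" "x < t'" "t' < y"
  show ?thesis
  proof (cases "t' < k")
   case False
   then have "(s', t') \<in> mid" using q xy unfolding mid_def by auto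
   then show ?thesis using q by blast
  next
   case True
   then show ?thesis using nc[OF q(1) yx(3)] q yx by auto
  qed
 qed
 then show "\<exists>q\<in>mid. fst p < fst q & snd p < snd q \<or> fst q < fst p & snd q < snd p" unfolding pe by force
qed

end

definition "reglue F1 F2 A1 B1 E =
 {(s, t) \<in> F1. t < k} \<union> {(s, t) \<in> F2. t < j} \<union> A1 \<times> {j} \<union> B1 \<times> {j} \<union> E"

text \<open>Weak cuts, with the pivot in both halves. On the left the initial half is joined to the
  outside; on the right the final half is, and only a real right part leaves a choice.\<close>

definition "splits_left A A1 A2 \<longleftrightarrow> (\<exists>p\<in>A. A1 = {x \<in> A. x \<le> p} & A2 = {x \<in> A. p \<le> x})"

definition "splits_right B B1 B2 \<longleftrightarrow>
 (if real_b then \<exists>q\<in>B. B2 = {y \<in> B. y \<le> q} & B1 = {y \<in> B. q \<le> y}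
  else B2 = {y \<in> B. y \<in> BL} & B1 = {y \<in> B. y \<in> BR})"

lemma unglue:
 assumes F: "F \<in> facets U" shows "F = reglue (con1 F) (con2 F) (xs1 F) (ys1 F) (mid F)"
  and "con1 F \<in> facets U1" "con2 F \<in> facets U2" and "splits_left {s. (s, k) \<in> con1 F} (xs1 F) (xs2 F)"
  and "splits_right {s. (s, j) \<in> con2 F} (ys1 F) (ys2 F)" and "mid F \<in> ladders (xs2 F) (ys2 F)"
proof -
 show "F = reglue (con1 F) (con2 F) (xs1 F) (ys1 F) (mid F)"
 proof (rule set_eqI)
  fix p :: "nat \<times> nat"
  obtain s t where p: "p = (s, t)" by (cases p)
  have b: "t \<le> j" if "(s, t) \<in> F" using U_bounds[OF FU[OF F that]] by simp
  have 1: "(s, t) \<in> con1 F & t < k \<longleftrightarrow> (s, t) \<in> F & t < k" unfolding con1_def by auto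
  have 2: "(s, t) \<in> con2 F & t < j \<longleftrightarrow> (s, t) \<in> F & k \<le> s & t < j" unfolding con2_def by auto
  have "p \<in> reglue (con1 F) (con2 F) (xs1 F) (ys1 F) (mid F) \<longleftrightarrow>
    (s, t) \<in> con1 F & t < k \<or> (s, t) \<in> con2 F & t < j \<or> s < k & (s, j) \<in> F & t = j \<or>
    k \<le> s & (s, j) \<in> F & t = j \<or> (s, t) \<in> F & s < k & k \<le> t & t < j"
   unfolding p reglue_def xs1_def[OF F] ys1_def[OF F] mid_def[OF F] by auto
  also have "\<dots> \<longleftrightarrow> (s, t) \<in> F" unfolding 1 2 using b lkj by (cases "s < k"; cases "t < k"; cases "t < j") auto
  finally show "p \<in> F \<longleftrightarrow> p \<in> reglue (con1 F) (con2 F) (xs1 F) (ys1 F) (mid F)" by (simp add: p)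
 qed
 show "con1 F \<in> facets U1" "con2 F \<in> facets U2" by (rule con1_facet[OF F], rule con2_facet[OF F])
 show "splits_left {s. (s, k) \<in> con1 F} (xs1 F) (xs2 F)"
  unfolding splits_left_def nb_con1[OF F] by (rule split_left[OF F])
 show "splits_right {s. (s, j) \<in> con2 F} (ys1 F) (ys2 F)" unfolding splits_right_def nb_con2[OF F]
  using split_right_real[OF F] split_right_virtual[OF F] by simp
 show "mid F \<in> ladders (xs2 F) (ys2 F)" by (rule mid_ladder[OF F])
qed

section \<open>Gluing two facets along a ladder\<close>

context
 fixes F1 F2 A1 A2 B1 B2 E
 assumes F1: "F1 \<in> facets U1" and F2: "F2 \<in> facets U2"
  and A: "splits_left {s. (s, k) \<in> F1} A1 A2" and B: "splits_right {s. (s, j) \<in> F2} B1 B2"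
  and E: "E \<in> ladders A2 B2"
begin

lemma F1U: "(s, t) \<in> F1 ==> (s, t) \<in> PA & t < k & s < t \<or> s \<in> RA & t = k & s < k"
 using facets_subset[OF F1] PA RA unfolding U1_def by blast
lemma F2U: "(s, t) \<in> F2 ==> (s, t) \<in> PB & t < j & k \<le> s & s < t \<or> s \<in> BL \<union> BR & t = j & k \<le> s & s < j"
 using facets_subset[OF F2] PB BL BR unfolding U2_def by blast

lemma A_un: "{s. (s, k) \<in> F1} = A1 \<union> A2" using A unfolding splits_left_def by auto
lemma B_un: "{s. (s, j) \<in> F2} = B1 \<union> B2"
proof (cases real_b)
 case True then show ?thesis using B unfolding splits_right_def by auto
next
 case False then show ?thesis using B F2U unfolding splits_right_def by auto
qed
lemma A_mem: "x \<in> A1 \<union> A2 ==> (x, k) \<in> F1 & x \<in> RA & x < k & l \<le> x" using A_un F1U RA by blast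
lemma B_mem: "y \<in> B1 \<union> B2 ==> (y, j) \<in> F2 & k \<le> y & y < j" using B_un F2U by blast
lemma B2_BL: "y \<in> B2 ==> y \<in> BL" using B F2U real unfolding splits_right_def by (auto split: if_splits)
lemma B1_BR: "y \<in> B1 ==> y \<in> BR" using B F2U real unfolding splits_right_def by (auto split: if_splits)
lemma A_order: "x \<in> A1 ==> x' \<in> A2 ==> x \<le> x'" using A unfolding splits_left_def by auto
lemma B_order: "y \<in> B2 ==> y' \<in> B1 ==> y \<le> y'"
proof (cases real_b)
 case True then show "y \<in> B2 ==> y' \<in> B1 ==> y \<le> y'" using B unfolding splits_right_def by auto
next
 case False then show "y \<in> B2 ==> y' \<in> B1 ==> y \<le> y'"
  using virtual B unfolding splits_right_def by (auto intro: less_imp_le)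
qed
lemma A_pivot: "\<exists>p. p \<in> A1 & p \<in> A2" using A unfolding splits_left_def by auto
lemma B_pivot: "real_b ==> \<exists>q. q \<in> B1 & q \<in> B2" using B unfolding splits_right_def by auto

lemma first_right: "(k, j) \<in> F2"
proof (rule facets_max[OF F2])
 show "(k, j) \<in> U2" using BL0 by (simp add: U2_def)
next
 fix s' t' assume "(s', t') \<in> F2" "j < t'"
 then show False using F2U by fastforce
next
 fix s' t' assume "(s', t') \<in> F2" "s' < k"
 then show False using F2U by fastforce
qed

lemma finAB: "finite A2" "A2 ~= {}" "finite B2" "B2 ~= {}"
proof -
 show "finite A2" by (rule finite_subset[of _ "{..k}"]) (use A_mem in force)+
 show "finite B2" by (rule finite_subset[of _ "{..j}"]) (use B_mem in force)+
 show "A2 ~= {}" using A_pivot by blast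
 show "B2 ~= {}"
 proof (cases real_b)
  case True then show ?thesis using B_pivot by blast
 next
  case False then show ?thesis using B first_right BL0 unfolding splits_right_def by auto
 qed
qed

lemma E_sub: "(x, y) \<in> E ==> x \<in> A2 & y \<in> B2" using E unfolding ladders_def by auto
lemma E_nc: "(x, y) \<in> E ==> (x', y') \<in> E ==> x < x' ==> y < y' ==> False" using E unfolding ladders_def by fastforce
lemma E_max: "x \<in> A2 ==> y \<in> B2 ==> (x, y) \<notin> E ==>
  \<exists>x' y'. (x', y') \<in> E & (x < x' & y < y' \<or> x' < x & y' < y)"
 using E unfolding ladders_def by (auto simp: Ball_def) (metis fst_conv snd_conv surj_pair)
lemma E_left: "x \<in> A2 ==> \<exists>y. (x, y) \<in> E" using ladders_left[OF finAB(1,3,4) E] .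
lemma E_right: "y \<in> B2 ==> \<exists>x. (x, y) \<in> E" using ladders_right[OF finAB(1,2,3) E] .

abbreviation "G \<equiv> reglue F1 F2 A1 B1 E"

lemma G_cases:
 assumes "(s, t) \<in> G" obtains "(s, t) \<in> F1" "(s, t) \<in> PA" "s < t" "t < k"
  | "(s, t) \<in> F2" "(s, t) \<in> PB" "k \<le> s" "s < t" "t < j"
  | "s \<in> A1" "t = j" "s < k" "(s, k) \<in> F1" | "s \<in> B1" "t = j" "k \<le> s" "s < j" "(s, j) \<in> F2"
  | "(s, t) \<in> E" "s \<in> A2" "t \<in> B2" "s < k" "k \<le> t" "t < j" "(s, k) \<in> F1" "(t, j) \<in> F2"
proof -
 have "(s, t) \<in> F1 & t < k \<or> (s, t) \<in> F2 & t < j \<or> s \<in> A1 & t = j \<or> s \<in> B1 & t = j \<or> (s, t) \<in> E"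
  using assms unfolding reglue_def by auto
 then show thesis
 proof (elim disjE)
  assume a: "(s, t) \<in> F1 & t < k" then show thesis using that(1) F1U[of s t] by auto
 next
  assume a: "(s, t) \<in> F2 & t < j" then show thesis using that(2) F2U[of s t] by auto
 next
  assume a: "s \<in> A1 & t = j" then show thesis using that(3) A_mem[of s] by auto
 next
  assume a: "s \<in> B1 & t = j" then show thesis using that(4) B_mem[of s] by auto
 next
  assume a: "(s, t) \<in> E" then show thesis using that(5) E_sub[of s t] A_mem[of s] B_mem[of t] by auto
 qed
qed

lemma G_U: "G \<subseteq> U"
proof (rule subrelI)
 fix s t assume "(s, t) \<in> G"
 then show "(s, t) \<in> U" by (cases rule: G_cases) (use A_mem B2_BL B1_BR in "auto simp: U_def")
qed

lemma G_noncrossing: "noncrossing G" unfolding noncrossing_def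
proof (intro allI impI notI, elim conjE)
 fix s t s' t' assume g: "(s, t) \<in> G" "(s', t') \<in> G" and c: "s < s'" "s' < t" "t < t'"
 note n1 = facets_nc[OF F1, where P = False] and n2 = facets_nc[OF F2, where P = False]
 from g(2) have tj: "t' \<le> j" by (cases rule: G_cases) (use lkj in auto)
 from g(1) show False
 proof (cases rule: G_cases)
  case 1
  note l = this
  from g(2) show False by (cases rule: G_cases) (use l c n1[of s t s' t'] n1[of s t s' k] in auto)
 next
  case 2
  note l = this
  from g(2) show False by (cases rule: G_cases) (use l c n2[of s t s' t'] in auto)
 next
  case 5
  note l = this
  from g(2) show False
  proof (cases rule: G_cases)
   case 2
   then show False using l c n2[of s' t' t j] n2[of t j s' t'] F2U lkj E_sub by auto
  next
   case 3
   then show False using A_order[of s' s] l c by auto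
  next
   case 4
   then show False using B_order[of t s'] l c by auto
  next
   case 5
   then show False using E_nc[of s t s' t'] l c by auto
  qed (use l c in auto)
 qed (use c tj in auto)
qed

text \<open>Consider a chord between the parts or to \<open>j\<close>. An end that is not joined to
  the outside in its own facet is cut off by a chord of that facet; an end in the wrong half is cut
  off by a chord at the pivot; for ends in the right halves the ladder is maximal. A chord inside
  one part keeps a crossing from its facet, because every neighbour of the outside still has a chord
  leaving the part.\<close>

lemma G_max:
 assumes u: "(s, t) \<in> U" "(s, t) \<notin> G"
 shows "\<exists>s' t'. (s', t') \<in> G & (s < s' & s' < t & t < t' \<or> s' < s & s < t' & t' < t)"
proof -
 have G1: "(x, y) \<in> G" if "(x, y) \<in> F1" "y < k" for x y using that by (simp add: reglue_def)
 have G2: "(x, y) \<in> G" if "(x, y) \<in> F2" "y < j" for x y using that by (simp add: reglue_def)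
 have GA: "(x, j) \<in> G" if "x \<in> A1" for x using that by (simp add: reglue_def)
 have GB: "(y, j) \<in> G" if "y \<in> B1" for y using that by (simp add: reglue_def)
 have GE: "(x, y) \<in> G" if "(x, y) \<in> E" for x y using that by (simp add: reglue_def)
 have far: "\<exists>t'\<ge>k. (x, t') \<in> G" if "x \<in> A1 \<union> A2" for x
  using that GA GE E_left E_sub B_mem lkj by (metis Un_iff less_imp_le)
 have notA: "\<exists>s' t'. (s', t') \<in> G & s' < x & x < t' & t' < k" if "x \<in> RA" "x \<notin> A1 \<union> A2" for x
 proof -
  have "(x, k) \<in> U1" "(x, k) \<notin> F1" using that A_un by (auto simp: U1_def)
  then show ?thesis
  proof (rule facets_crossed[OF F1])
   fix s' t' assume "(s', t') \<in> F1" "x < s'" "s' < k" "k < t'"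
   then show ?thesis using F1U by fastforce
  next
   fix s' t' assume "(s', t') \<in> F1" "s' < x" "x < t'" "t' < k"
   then show ?thesis using G1 by blast
  qed
 qed
 have notB: "\<exists>s' t'. (s', t') \<in> G & k \<le> s' & s' < y & y < t' & t' < j"
  if "y \<in> BL \<union> BR" "y \<notin> B1 \<union> B2" for y proof -
  have "(y, j) \<in> U2" "(y, j) \<notin> F2" using that B_un by (auto simp: U2_def)
  then show ?thesis
  proof (rule facets_crossed[OF F2])
   fix s' t' assume "(s', t') \<in> F2" "y < s'" "s' < j" "j < t'"
   then show ?thesis using F2U by fastforce
  next
   fix s' t' assume q: "(s', t') \<in> F2" "s' < y" "y < t'" "t' < j"
   then have "k \<le> s'" using F2U by blast
   then show ?thesis using q G2 by blast
  qed
 qed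
 obtain p where p: "p \<in> A1" "p \<in> A2" using A_pivot by blast
 have pk: "p < k" using A_mem p by blast
 from u(1) show ?thesis
 proof (cases rule: U_cases)
  case 1
  then have "(s, t) \<in> U1" "(s, t) \<notin> F1" using u(2) G1 by (auto simp: U1_def)
  then show ?thesis
  proof (rule facets_crossed[OF F1])
   fix s' t' assume q: "(s', t') \<in> F1" "s < s'" "s' < t" "t < t'"
   show ?thesis
   proof (cases "t' < k")
    case True then show ?thesis using q G1 by blast
   next
    case False
    then have "t' = k" using F1U[OF q(1)] by auto
    then obtain t'' where "t'' \<ge> k" "(s', t'') \<in> G" using far A_un q(1) by blast
    then show ?thesis using q 1 by (meson less_le_trans)
   qed
  next
   fix s' t' assume "(s', t') \<in> F1" "s' < s" "s < t'" "t' < t"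
   then show ?thesis using G1 1 by (meson less_trans)
  qed
 next
  case 2
  then have "(s, t) \<in> U2" "(s, t) \<notin> F2" using u(2) G2 by (auto simp: U2_def)
  then show ?thesis
  proof (rule facets_crossed[OF F2])
   fix s' t' assume q: "(s', t') \<in> F2" "s < s'" "s' < t" "t < t'"
   show ?thesis
   proof (cases "t' < j")
    case True then show ?thesis using q G2 by blast
   next
    case False
    then have tj: "t' = j" using F2U[OF q(1)] by auto
    then have "s' \<in> B1 \<or> s' \<in> B2" using B_un q(1) by blast
    then show ?thesis
    proof
     assume "s' \<in> B1" then show ?thesis using GB q tj by blast
    next
     assume "s' \<in> B2"
     then obtain x where x: "(x, s') \<in> E" using E_right by blast
     then have "x < s" using E_sub A_mem 2 by (meson UnI2 less_le_trans)
     then show ?thesis using GE[OF x] q by blast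
    qed
   qed
  next
   fix s' t' assume "(s', t') \<in> F2" "s' < s" "s < t'" "t' < t"
   then show ?thesis using G2 2 by (meson less_trans)
  qed
 next
  case 3
  consider "s \<notin> A1 \<union> A2" | "t \<notin> B1 \<union> B2" | "s \<in> A1 - A2" "t \<in> B1 \<union> B2"
   | "s \<in> A2" "t \<in> B1 - B2" | "s \<in> A2" "t \<in> B2" by blast
  then show ?thesis
  proof cases
   case 1
   then show ?thesis using notA[OF 3(1)] 3 by (meson less_le_trans)
  next
   case 2
   then obtain s' t' where "(s', t') \<in> G" "k \<le> s'" "s' < t" "t < t'" using notB[of t] 3 by blast
   then show ?thesis using 3 by (meson less_le_trans)
  next
   case c: 3
   then have "s \<le> p" "s ~= p" using A_order p by auto
   then have "(p, j) \<in> G & s < p & p < t & t < j" using GA p 3 pk by auto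
   then show ?thesis by blast
  next
   case c: 4
   have real_b
   proof (rule ccontr)
    assume "~ real_b"
    then have "B2 = {y \<in> {s. (s, j) \<in> F2}. y \<in> BL}" using B unfolding splits_right_def by simp
    then show False using c 3 B_un by blast
   qed
   then obtain q where q: "q \<in> B1" "q \<in> B2" using B_pivot by blast
   have "q ~= t" using q c by blast
   moreover have "q \<le> t" using B_order q c by blast
   ultimately have "(q, j) \<in> G & s < q & q < t & t < j" using GB q 3 B_mem[of q] by auto
   then show ?thesis by blast
  next
   case c: 5
   then have "(s, t) \<notin> E" using u(2) GE by blast
   then obtain x' y' where xy: "(x', y') \<in> E" "s < x' & t < y' \<or> x' < s & y' < t" using E_max c by blast
   have "x' < k" "k \<le> y'" using E_sub[OF xy(1)] A_mem B_mem by blast+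
   then have "s < x' & x' < t & t < y' \<or> x' < s & s < y' & y' < t" using xy 3 by auto
   then show ?thesis using GE[OF xy(1)] by blast
  qed
 next
  case 4
  show ?thesis
  proof (cases "s \<in> A1 \<union> A2")
   case False
   then show ?thesis using notA[OF 4(1)] 4 lkj by (meson less_trans)
  next
   case True
   then have "s \<in> A2" "s ~= p" using GA u(2) 4 p by auto
   then have ps: "p < s" using A_order[OF p(1)] by fastforce
   obtain y where y: "(p, y) \<in> E" using E_left p by blast
   have "k \<le> y" "y < j" using E_sub[OF y] B_mem by blast+
   then have "p < s & s < y & y < t" using ps 4 by auto
   then show ?thesis using GE[OF y] by blast
  qed
 next
  case 5
  show ?thesis
  proof (cases "s \<in> B1 \<union> B2")
   case False
   then show ?thesis using notB[of s] 5 by blast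
  next
   case True
   then have s: "s \<in> B2" "s \<notin> B1" using GB u(2) 5 by auto
   have real_b
   proof (rule ccontr)
    assume "~ real_b"
    then have "B1 = {y \<in> {s. (s, j) \<in> F2}. y \<in> BR}" using B unfolding splits_right_def by simp
    then show False using s 5 True B_un by blast
   qed
   then obtain q where q: "q \<in> B1" "q \<in> B2" using B_pivot by blast
   have "s < q" using B_order[OF s(1) q(1)] s q by (metis le_neq_implies_less)
   moreover obtain x where x: "(x, q) \<in> E" using E_right q by blast
   moreover have "x < s" using E_sub[OF x] A_mem[of x] 5 by auto
   ultimately show ?thesis using GE[OF x] B_mem[of q] q 5 by blast
  qed
 qed
qed

lemma G_facet: "G \<in> facets U" using G_U G_noncrossing G_max unfolding facets_def by blast

lemma G_parts: "con1 G = F1" "con2 G = F2" "xs1 G = A1" "ys1 G = B1" "mid G = E"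
proof -
 have GA: "(x, j) \<in> G & x < k \<longleftrightarrow> x \<in> A1" for x
  using A_mem B_mem E_sub lkj F1U F2U unfolding reglue_def by fastforce
 have GB: "(x, j) \<in> G & k \<le> x \<longleftrightarrow> x \<in> B1" for x
  using A_mem B_mem E_sub lkj F1U F2U unfolding reglue_def by fastforce
 have GE: "(x, y) \<in> G & x < k & k \<le> y & y < j \<longleftrightarrow> (x, y) \<in> E" for x y
  using A_mem B_mem E_sub lkj F1U F2U unfolding reglue_def by fastforce
 have G1: "(x, y) \<in> G & y < k \<longleftrightarrow> (x, y) \<in> F1 & y < k" for x y
  using A_mem B_mem E_sub lkj F1U F2U unfolding reglue_def by fastforce
 have G2: "(x, y) \<in> G & k \<le> x & y < j \<longleftrightarrow> (x, y) \<in> F2 & y < j" for x y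
  using A_mem B_mem E_sub lkj F1U F2U unfolding reglue_def by fastforce
 show "xs1 G = A1" unfolding xs1_def[OF G_facet] using GA by auto
 show "ys1 G = B1" unfolding ys1_def[OF G_facet] using GB by auto
 show "mid G = E" unfolding mid_def[OF G_facet] using GE by auto
 have nbA: "(\<exists>t\<ge>k. (x, t) \<in> G) & x < k \<longleftrightarrow> (x, k) \<in> F1" for x proof -
  have "(\<exists>t\<ge>k. (x, t) \<in> G) & x < k \<longleftrightarrow> (x, j) \<in> G & x < k \<or> (\<exists>y. (x, y) \<in> G & x < k & k \<le> y & y < j)"
   using G_U U_bounds lkj by (metis le_neq_implies_less less_imp_le subsetD)
  also have "\<dots> \<longleftrightarrow> x \<in> A1 \<union> A2" unfolding GA GE using E_left E_sub by auto
  also have "\<dots> \<longleftrightarrow> (x, k) \<in> F1" using A_un by blast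
  finally show ?thesis .
 qed
 have nbB: "k \<le> y & ((y, j) \<in> G \<or> y < j & (\<exists>s<k. (s, y) \<in> G)) \<longleftrightarrow> (y, j) \<in> F2" for y
 proof -
  have "k \<le> y & ((y, j) \<in> G \<or> y < j & (\<exists>s<k. (s, y) \<in> G)) \<longleftrightarrow>
    (y, j) \<in> G & k \<le> y \<or> (\<exists>x. (x, y) \<in> G & x < k & k \<le> y & y < j)" by auto
  also have "\<dots> \<longleftrightarrow> y \<in> B1 \<union> B2" unfolding GB GE using E_right E_sub by auto
  also have "\<dots> \<longleftrightarrow> (y, j) \<in> F2" using B_un by blast
  finally show ?thesis .
 qed
 show "con1 G = F1"
 proof (rule set_eqI)
  fix p :: "nat \<times> nat"
  obtain s t where p: "p = (s, t)" by (cases p)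
  show "p \<in> con1 G \<longleftrightarrow> p \<in> F1" unfolding p con1_def using nbA[of s] G1[of s t] F1U[of s t] by auto
 qed
 show "con2 G = F2"
 proof (rule set_eqI)
  fix p :: "nat \<times> nat"
  obtain s t where p: "p = (s, t)" by (cases p)
  show "p \<in> con2 G \<longleftrightarrow> p \<in> F2" unfolding p con2_def using nbB[of s] G2[of s t] F2U[of s t] by auto
 qed
qed

end

text \<open>The glued set does not mention \<open>A2\<close> and \<open>B2\<close>, but they can be
  recovered: a half with its pivot determines the other half, and in the virtual case both are
  prescribed.\<close>

lemma glue_bij: "bij_betw (\<lambda>(F1, F2, (A1, A2), (B1, B2), E). reglue F1 F2 A1 B1 E)
  (SIGMA F1:facets U1. SIGMA F2:facets U2.
   SIGMA (A1, A2):{(A1, A2). splits_left {s. (s, k) \<in> F1} A1 A2}.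
   SIGMA (B1, B2):{(B1, B2). splits_right {s. (s, j) \<in> F2} B1 B2}. ladders A2 B2)
  (facets U)"
proof -
 let ?D = "SIGMA F1:facets U1. SIGMA F2:facets U2.
   SIGMA (A1, A2):{(A1, A2). splits_left {s. (s, k) \<in> F1} A1 A2}.
   SIGMA (B1, B2):{(B1, B2). splits_right {s. (s, j) \<in> F2} B1 B2}. ladders A2 B2"
 let ?f = "\<lambda>(F1, F2, (A1, A2), (B1, B2), E). reglue F1 F2 A1 B1 E"
 have other_left: "A2 = A2'" if h: "splits_left A A1 A2" "splits_left A A1 A2'" for A A1 A2 A2' :: "nat set" proof -
  obtain p p' where p: "p \<in> A" "A1 = {x \<in> A. x \<le> p}" "A2 = {x \<in> A. p \<le> x}"
   and p': "p' \<in> A" "A1 = {x \<in> A. x \<le> p'}" "A2' = {x \<in> A. p' \<le> x}"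
   using h unfolding splits_left_def by blast
  have "p \<in> A1" "p' \<in> A1" using p p' by blast+
  then have "p = p'" unfolding p(2) using p'(2) \<open>p \<in> A1\<close> by auto
  then show ?thesis using p p' by simp
 qed
 have other_right: "B2 = B2'" if h: "splits_right A B1 B2" "splits_right A B1 B2'" for A B1 B2 B2' :: "nat set"
 proof (cases real_b)
  case True
  obtain p p' where p: "p \<in> A" "B1 = {x \<in> A. p \<le> x}" "B2 = {x \<in> A. x \<le> p}"
   and p': "p' \<in> A" "B1 = {x \<in> A. p' \<le> x}" "B2' = {x \<in> A. x \<le> p'}"
   using h True unfolding splits_right_def by auto
  have "p \<in> B1" "p' \<in> B1" using p p' by blast+
  then have "p = p'" unfolding p(2) using p'(2) \<open>p \<in> B1\<close> by auto
  then show ?thesis using p p' by simp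
 next
  case False then show ?thesis using h unfolding splits_right_def by auto
 qed
 have "inj_on ?f ?D"
 proof (rule inj_onI)
  fix x y assume x: "x \<in> ?D" and y: "y \<in> ?D" and eq: "?f x = ?f y"
  obtain F1 F2 A1 A2 B1 B2 E where xe: "x = (F1, F2, (A1, A2), (B1, B2), E)" by (metis surj_pair)
  obtain F1' F2' A1' A2' B1' B2' E' where ye: "y = (F1', F2', (A1', A2'), (B1', B2'), E')" by (metis surj_pair)
  have hx: "F1 \<in> facets U1" "F2 \<in> facets U2" "splits_left {s. (s, k) \<in> F1} A1 A2"
   "splits_right {s. (s, j) \<in> F2} B1 B2" "E \<in> ladders A2 B2" using x unfolding xe by auto
  have hy: "F1' \<in> facets U1" "F2' \<in> facets U2" "splits_left {s. (s, k) \<in> F1'} A1' A2'"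
   "splits_right {s. (s, j) \<in> F2'} B1' B2'" "E' \<in> ladders A2' B2'" using y unfolding ye by auto
  have e: "reglue F1 F2 A1 B1 E = reglue F1' F2' A1' B1' E'" using eq unfolding xe ye by simp
  have "F1 = F1'" "F2 = F2'" "A1 = A1'" "B1 = B1'" "E = E'" using G_parts[OF hx] G_parts[OF hy] unfolding e by simp_all
  then show "x = y" unfolding xe ye using other_left[OF hx(3), of A2'] other_right[OF hx(4), of B2'] hy by simp
 qed
 moreover have "?f ` ?D = facets U"
 proof
  show "?f ` ?D \<subseteq> facets U"
  proof (rule image_subsetI)
   fix x assume x: "x \<in> ?D"
   obtain F1 F2 A1 A2 B1 B2 E where xe: "x = (F1, F2, (A1, A2), (B1, B2), E)" by (metis surj_pair)
   have hx: "F1 \<in> facets U1" "F2 \<in> facets U2" "splits_left {s. (s, k) \<in> F1} A1 A2"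
    "splits_right {s. (s, j) \<in> F2} B1 B2" "E \<in> ladders A2 B2" using x unfolding xe by auto
   show "?f x \<in> facets U" unfolding xe using G_facet[OF hx] by simp
  qed
  show "facets U \<subseteq> ?f ` ?D"
  proof
   fix F assume F: "F \<in> facets U"
   note un = unglue[OF F]
   show "F \<in> ?f ` ?D"
   proof (rule image_eqI)
    show "F = ?f (con1 F, con2 F, (xs1 F, xs2 F), (ys1 F, ys2 F), mid F)" using un(1) by simp
    show "(con1 F, con2 F, (xs1 F, xs2 F), (ys1 F, ys2 F), mid F) \<in> ?D" using un by auto
   qed
  qed
 qed
 ultimately show ?thesis by (simp add: bij_betw_def)
qed

end

section \<open>Equality of the two recursions\<close>

lemma bij_splits_left:
 fixes A :: "nat set"
 assumes fin: "finite A" shows "bij_betw (\<lambda>p. ({x \<in> A. x \<le> p}, {x \<in> A. p \<le> x})) A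
  {(A1, A2). \<exists>p\<in>A. A1 = {x \<in> A. x \<le> p} & A2 = {x \<in> A. p \<le> x}}"
proof -
 have "inj_on (\<lambda>p. ({x \<in> A. x \<le> p}, {x \<in> A. p \<le> x})) A"
 proof (rule inj_onI)
  fix p q assume a: "p \<in> A" "q \<in> A" "({x \<in> A. x \<le> p}, {x \<in> A. p \<le> x}) = ({x \<in> A. x \<le> q}, {x \<in> A. q \<le> x})"
  then have "p \<in> {x \<in> A. x \<le> q}" "p \<in> {x \<in> A. q \<le> x}" by auto
  then show "p = q" by simp
 qed
 then show ?thesis by (auto simp: bij_betw_def)
qed

text \<open>A pivot of rank \<open>i\<close> leaves \<open>i\<close> elements before it and
  \<open>card A - 1 - i\<close> after it. Subtracting one from each half removes the shared
  pivot.\<close>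

lemma sum_splits_left:
 fixes A :: "nat set" and h :: "nat => nat => nat"
 assumes fin: "finite A" and ne: "A ~= {}"
 shows "(\<Sum>(A1, A2)\<in>{(A1, A2). \<exists>p\<in>A. A1 = {x \<in> A. x \<le> p} & A2 = {x \<in> A. p \<le> x}}.
   h (card A1 - 1) (card A2 - 1)) = (\<Sum>i\<le>card A - 1. h i (card A - 1 - i))"
proof -
 let ?r = "\<lambda>p. card {y \<in> A. y < p}"
 have 1: "card {x \<in> A. x \<le> p} - 1 = ?r p" if "p \<in> A" for p proof -
  have "{x \<in> A. x \<le> p} = insert p {y \<in> A. y < p}" using that by auto
  then show ?thesis using fin by simp
 qed
 have 2: "card {x \<in> A. p \<le> x} - 1 = card A - 1 - ?r p" if "p \<in> A" for p proof -
  have "A = {y \<in> A. y < p} \<union> {x \<in> A. p \<le> x}" by auto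
  moreover have "{y \<in> A. y < p} \<inter> {x \<in> A. p \<le> x} = {}" by auto
  ultimately have "card A = ?r p + card {x \<in> A. p \<le> x}"
   using fin by (metis (no_types, lifting) card_Un_disjoint finite_Un)
  then show ?thesis by simp
 qed
 have "(\<Sum>(A1, A2)\<in>{(A1, A2). \<exists>p\<in>A. A1 = {x \<in> A. x \<le> p} & A2 = {x \<in> A. p \<le> x}}.
   h (card A1 - 1) (card A2 - 1)) =
  (\<Sum>p\<in>A. (\<lambda>(A1, A2). h (card A1 - 1) (card A2 - 1)) ({x \<in> A. x \<le> p}, {x \<in> A. p \<le> x}))"
  by (rule sum.reindex_bij_betw[OF bij_splits_left[OF fin], symmetric])
 also have "\<dots> = (\<Sum>p\<in>A. (\<lambda>i. h i (card A - 1 - i)) (?r p))" by (rule sum.cong) (use 1 2 in auto)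
 also have "\<dots> = (\<Sum>i\<in>{..<card A}. h i (card A - 1 - i))" by (rule sum.reindex_bij_betw[OF rank_bij(1)[OF fin]])
 also have "{..<card A} = {..card A - 1}" proof -
  have "card A > 0" using fin ne by (simp add: card_gt_0_iff)
  then show ?thesis by (cases "card A") auto
 qed
 finally show ?thesis .
qed

section \<open>Counting through the gluing\<close>

context glue begin

lemma finite_facets:
 assumes "finite V" shows "finite (facets V)" by (rule finite_subset[of _ "Pow V"]) (use assms in "auto simp: facets_def")

lemma finite_U: "finite U1" "finite U2" "finite U"
proof -
 have "PA \<subseteq> {..k} \<times> {..k}" "RA \<subseteq> {..k}" "PB \<subseteq> {..j} \<times> {..j}" "BL \<subseteq> {..j}" "BR \<subseteq> {..j}"
  using PA RA PB BL BR by fastforce+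
 then have "finite PA" "finite RA" "finite PB" "finite BL" "finite BR" by (auto intro: finite_subset)
 then show "finite U1" "finite U2" "finite U" by (auto simp: U1_def U2_def U_def)
qed

lemma nb1_nonempty:
 assumes F1: "F1 \<in> facets U1" shows "finite {s. (s, k) \<in> F1}" "{s. (s, k) \<in> F1} ~= {}"
proof -
 show "finite {s. (s, k) \<in> F1}" by (rule finite_subset[of _ "fst ` U1"]) (use facets_subset[OF F1] finite_U in "force+")
 have "(k - 1, k) \<in> F1"
 proof (rule facets_max[OF F1])
  show "(k - 1, k) \<in> U1" using RA0 by (simp add: U1_def)
 qed auto
 then show "{s. (s, k) \<in> F1} ~= {}" by blast
qed

lemma nb2_nonempty:
 assumes F2: "F2 \<in> facets U2" shows "finite {s. (s, j) \<in> F2}" "k \<in> {s. (s, j) \<in> F2}"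
proof -
 show "finite {s. (s, j) \<in> F2}" by (rule finite_subset[of _ "fst ` U2"]) (use facets_subset[OF F2] finite_U in "force+")
 have "(k, j) \<in> F2"
 proof (rule facets_max[OF F2])
  show "(k, j) \<in> U2" using BL0 by (simp add: U2_def)
 next
  fix s' t' assume "(s', t') \<in> F2" "j < t'"
  then show False using facets_subset[OF F2] PB unfolding U2_def by fastforce
 next
  fix s' t' assume "(s', t') \<in> F2" "s' < k"
  then show False using facets_subset[OF F2] PB BL BR unfolding U2_def by fastforce
 qed
 then show "k \<in> {s. (s, j) \<in> F2}" by blast
qed

text \<open>The right-hand side has the shape of \<open>sum_inner_nests_rec\<close>, with the number
  of neighbours of the outside, less one, in place of the number of available walks. The binomial
  coefficient counts the ladders between the halves \<open>A2\<close> and \<open>B2\<close>.\<close>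

lemma sum_facets_glue:
 fixes g :: "nat => nat => nat"
 shows "(\<Sum>F\<in>facets U. g (card {x. x < k & (x, j) \<in> F} - 1) (card {y. k \<le> y & (y, j) \<in> F} - 1)) =
  (\<Sum>F1\<in>facets U1. \<Sum>F2\<in>facets U2. if real_b then
    \<Sum>i\<le>card {s. (s, k) \<in> F1} - 1. \<Sum>m\<le>card {s. (s, j) \<in> F2} - 1.
     ((card {s. (s, k) \<in> F1} - 1 - i + (card {s. (s, j) \<in> F2} - 1 - m)) choose
      (card {s. (s, k) \<in> F1} - 1 - i)) * g i m
   else
    \<Sum>i\<le>card {s. (s, k) \<in> F1} - 1.
     ((card {s. (s, k) \<in> F1} - 1 - i + (card {s \<in> BL. (s, j) \<in> F2} - 1)) choose
      (card {s. (s, k) \<in> F1} - 1 - i)) * g i (card {s \<in> BR. (s, j) \<in> F2} - 1))"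
  (is "(\<Sum>F\<in>facets U. ?H F) = ?R")
proof -
 let ?L = "\<lambda>F1. {(A1, A2). splits_left {s. (s, k) \<in> F1} A1 A2}"
 let ?B = "\<lambda>F2. {(B1, B2). splits_right {s. (s, j) \<in> F2} B1 B2}"
 have finL: "finite (?L F1)" if "F1 \<in> facets U1" for F1 proof -
  have "?L F1 \<subseteq> Pow {s. (s, k) \<in> F1} \<times> Pow {s. (s, k) \<in> F1}" by (auto simp: splits_left_def)
  then show ?thesis using nb1_nonempty[OF that] by (meson finite_Pow_iff finite_SigmaI finite_subset)
 qed
 have finB: "finite (?B F2)" if "F2 \<in> facets U2" for F2 proof -
  have "?B F2 \<subseteq> Pow {s. (s, j) \<in> F2} \<times> Pow {s. (s, j) \<in> F2}"
   by (auto simp: splits_right_def split: if_splits)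
  then show ?thesis using nb2_nonempty[OF that] by (meson finite_Pow_iff finite_SigmaI finite_subset)
 qed
 have fin_sub: "finite A1 & finite A2 & A2 ~= {}" if "F1 \<in> facets U1" "(A1, A2) \<in> ?L F1" for F1 A1 A2
  using that nb1_nonempty[OF that(1)] by (auto simp: splits_left_def)
 have fin_sub2: "finite B1 & finite B2 & B2 ~= {}" if "F2 \<in> facets U2" "(B1, B2) \<in> ?B F2" for F2 B1 B2
  using that nb2_nonempty[OF that(1)] BL0 by (auto simp: splits_right_def split: if_splits)
 have finlad: "finite (ladders A2 B2)" if "F1 \<in> facets U1" "F2 \<in> facets U2" "splits_left {s. (s, k) \<in> F1} A1 A2"
   "splits_right {s. (s, j) \<in> F2} B1 B2" for F1 F2 A1 A2 B1 B2
  using fin_sub[OF that(1)] fin_sub2[OF that(2)] that(3,4) finite_ladders by blast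
 have "(\<Sum>F\<in>facets U. ?H F) =
  (\<Sum>x\<in>(SIGMA F1:facets U1. SIGMA F2:facets U2. SIGMA (A1, A2):?L F1.
    SIGMA (B1, B2):?B F2. ladders A2 B2).
   ?H ((\<lambda>(F1, F2, (A1, A2), (B1, B2), E). reglue F1 F2 A1 B1 E) x))"
  by (rule sum.reindex_bij_betw[OF glue_bij, symmetric])
 also have "\<dots> = (\<Sum>x\<in>(SIGMA F1:facets U1. SIGMA F2:facets U2. SIGMA (A1, A2):?L F1.
    SIGMA (B1, B2):?B F2. ladders A2 B2).
   (case x of (F1, F2, (A1, A2), (B1, B2), E) => g (card A1 - 1) (card B1 - 1)))"
 proof (rule sum.cong[OF refl])
  fix x assume x: "x \<in> (SIGMA F1:facets U1. SIGMA F2:facets U2. SIGMA (A1, A2):?L F1.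
    SIGMA (B1, B2):?B F2. ladders A2 B2)"
  obtain F1 F2 A1 A2 B1 B2 E where xe: "x = (F1, F2, (A1, A2), (B1, B2), E)" by (metis surj_pair)
  have hx: "F1 \<in> facets U1" "F2 \<in> facets U2" "splits_left {s. (s, k) \<in> F1} A1 A2"
   "splits_right {s. (s, j) \<in> F2} B1 B2" "E \<in> ladders A2 B2" using x unfolding xe by auto
  have "{x. x < k & (x, j) \<in> reglue F1 F2 A1 B1 E} = A1" "{y. k \<le> y & (y, j) \<in> reglue F1 F2 A1 B1 E} = B1"
   using G_parts[OF hx] unfolding xs1_def[OF G_facet[OF hx]] ys1_def[OF G_facet[OF hx]] by simp_all
  then show "?H ((\<lambda>(F1, F2, (A1, A2), (B1, B2), E). reglue F1 F2 A1 B1 E) x) =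
    (case x of (F1, F2, (A1, A2), (B1, B2), E) => g (card A1 - 1) (card B1 - 1))" unfolding xe by simp
 qed
 also have "\<dots> = (\<Sum>F1\<in>facets U1. \<Sum>F2\<in>facets U2. \<Sum>(A1, A2)\<in>?L F1. \<Sum>(B1, B2)\<in>?B F2.
   card (ladders A2 B2) * g (card A1 - 1) (card B1 - 1))" proof -
  have e4: "(\<Sum>(B1, B2)\<in>?B F2. card (ladders A2 B2) * g (card A1 - 1) (card B1 - 1)) =
    (\<Sum>(b, E)\<in>(SIGMA (B1, B2):?B F2. ladders A2 B2). g (card A1 - 1) (card (fst b) - 1))"
   if "F1 \<in> facets U1" "F2 \<in> facets U2" "(A1, A2) \<in> ?L F1" for F1 F2 A1 A2 proof -
   have "(\<Sum>(b, E)\<in>(SIGMA (B1, B2):?B F2. ladders A2 B2). g (card A1 - 1) (card (fst b) - 1)) =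
     (\<Sum>b\<in>?B F2. \<Sum>E\<in>(case b of (B1, B2) => ladders A2 B2). g (card A1 - 1) (card (fst b) - 1))"
    by (rule sum.Sigma[symmetric]) (use finB[OF that(2)] finlad[OF that(1,2)] that(3) in auto)
   then show ?thesis by (simp add: case_prod_unfold)
  qed
  have e3: "(\<Sum>(A1, A2)\<in>?L F1. \<Sum>(B1, B2)\<in>?B F2. card (ladders A2 B2) * g (card A1 - 1) (card B1 - 1)) =
    (\<Sum>(a, b, E)\<in>(SIGMA (A1, A2):?L F1. SIGMA (B1, B2):?B F2. ladders A2 B2).
     g (card (fst a) - 1) (card (fst b) - 1))" if "F1 \<in> facets U1" "F2 \<in> facets U2" for F1 F2 proof -
   have "(\<Sum>(A1, A2)\<in>?L F1. \<Sum>(B1, B2)\<in>?B F2. card (ladders A2 B2) * g (card A1 - 1) (card B1 - 1)) =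
     (\<Sum>a\<in>?L F1. \<Sum>(b, E)\<in>(case a of (A1, A2) => SIGMA (B1, B2):?B F2. ladders A2 B2).
      g (card (fst a) - 1) (card (fst b) - 1))" by (rule sum.cong[OF refl]) (use e4[OF that] in auto)
   also have "\<dots> = (\<Sum>(a, bE)\<in>(SIGMA a:?L F1. (case a of (A1, A2) => SIGMA (B1, B2):?B F2. ladders A2 B2)).
      (case bE of (b, E) => g (card (fst a) - 1) (card (fst b) - 1)))" by (rule sum.Sigma)
     (use finL[OF that(1)] finB[OF that(2)] finlad[OF that] in "auto intro!: finite_SigmaI")
   finally show ?thesis by (simp add: case_prod_unfold)
  qed
  have fin3: "finite (SIGMA (A1, A2):?L F1. SIGMA (B1, B2):?B F2. ladders A2 B2)"
   if "F1 \<in> facets U1" "F2 \<in> facets U2" for F1 F2 using finL[OF that(1)] finB[OF that(2)] finlad[OF that]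
   by (auto intro!: finite_SigmaI)
  have e2: "(\<Sum>F2\<in>facets U2. \<Sum>(A1, A2)\<in>?L F1. \<Sum>(B1, B2)\<in>?B F2. card (ladders A2 B2) * g (card A1 - 1) (card B1 - 1)) =
    (\<Sum>(F2, a, b, E)\<in>(SIGMA F2:facets U2. SIGMA (A1, A2):?L F1. SIGMA (B1, B2):?B F2. ladders A2 B2).
     g (card (fst a) - 1) (card (fst b) - 1))" if "F1 \<in> facets U1" for F1 proof -
   have "(\<Sum>F2\<in>facets U2. \<Sum>(A1, A2)\<in>?L F1. \<Sum>(B1, B2)\<in>?B F2. card (ladders A2 B2) * g (card A1 - 1) (card B1 - 1)) =
     (\<Sum>F2\<in>facets U2. \<Sum>(a, b, E)\<in>(SIGMA (A1, A2):?L F1. SIGMA (B1, B2):?B F2. ladders A2 B2).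
     g (card (fst a) - 1) (card (fst b) - 1))" by (rule sum.cong[OF refl]) (use e3[OF that] in auto)
   also have "\<dots> = (\<Sum>(F2, x)\<in>(SIGMA F2:facets U2. SIGMA (A1, A2):?L F1. SIGMA (B1, B2):?B F2. ladders A2 B2).
     (case x of (a, b, E) => g (card (fst a) - 1) (card (fst b) - 1)))"
    by (rule sum.Sigma) (use finite_facets finite_U fin3[OF that] in auto)
   finally show ?thesis .
  qed
  have "(\<Sum>F1\<in>facets U1. \<Sum>F2\<in>facets U2. \<Sum>(A1, A2)\<in>?L F1. \<Sum>(B1, B2)\<in>?B F2.
    card (ladders A2 B2) * g (card A1 - 1) (card B1 - 1)) =
    (\<Sum>F1\<in>facets U1. \<Sum>x\<in>(SIGMA F2:facets U2. SIGMA (A1, A2):?L F1. SIGMA (B1, B2):?B F2. ladders A2 B2).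
     (case x of (F2, a, b, E) => g (card (fst a) - 1) (card (fst b) - 1)))" by (rule sum.cong[OF refl]) (use e2 in auto)
  also have "\<dots> = (\<Sum>(F1, x)\<in>(SIGMA F1:facets U1. SIGMA F2:facets U2. SIGMA (A1, A2):?L F1.
    SIGMA (B1, B2):?B F2. ladders A2 B2).
     (case x of (F2, a, b, E) => g (card (fst a) - 1) (card (fst b) - 1)))"
   by (rule sum.Sigma) (use finite_facets finite_U fin3 in "auto intro!: finite_SigmaI")
  finally show ?thesis by (simp add: case_prod_unfold)
 qed
 also have "\<dots> = ?R"
 proof (intro sum.cong refl)
  fix F1 F2 assume F: "F1 \<in> facets U1" "F2 \<in> facets U2"
  let ?A = "{s. (s, k) \<in> F1}" and ?C = "{s. (s, j) \<in> F2}"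
  note nA = nb1_nonempty[OF F(1)] and nC = nb2_nonempty[OF F(2)]
  have lad: "card (ladders A2 B2) = ((card A2 - 1) + (card B2 - 1)) choose (card A2 - 1)"
   if "(A1, A2) \<in> ?L F1" "(B1, B2) \<in> ?B F2" for A1 A2 B1 B2
   using fin_sub[OF F(1) that(1)] fin_sub2[OF F(2) that(2)] by (intro card_ladders) auto
  have "(\<Sum>(A1, A2)\<in>?L F1. \<Sum>(B1, B2)\<in>?B F2. card (ladders A2 B2) * g (card A1 - 1) (card B1 - 1)) =
    (\<Sum>(A1, A2)\<in>?L F1. (\<lambda>i i'. \<Sum>(B1, B2)\<in>?B F2.
     ((i' + (card B2 - 1)) choose i') * g i (card B1 - 1)) (card A1 - 1) (card A2 - 1))"
  proof (rule sum.cong[OF refl])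
   fix a assume a: "a \<in> ?L F1"
   obtain A1 A2 where ae: "a = (A1, A2)" by (cases a)
   show "(case a of (A1, A2) => \<Sum>(B1, B2)\<in>?B F2. card (ladders A2 B2) * g (card A1 - 1) (card B1 - 1)) =
    (case a of (A1, A2) => (\<lambda>i i'. \<Sum>(B1, B2)\<in>?B F2.
     ((i' + (card B2 - 1)) choose i') * g i (card B1 - 1)) (card A1 - 1) (card A2 - 1))" unfolding ae prod.case
    by (rule sum.cong[OF refl]) (use lad[OF a[unfolded ae]] in auto)
  qed
  also have "\<dots> = (\<Sum>i\<le>card ?A - 1. \<Sum>(B1, B2)\<in>?B F2.
     ((card ?A - 1 - i + (card B2 - 1)) choose (card ?A - 1 - i)) * g i (card B1 - 1))"
   unfolding splits_left_def by (rule sum_splits_left[OF nA])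
  also have "\<dots> = (if real_b then
    \<Sum>i\<le>card ?A - 1. \<Sum>m\<le>card ?C - 1.
     ((card ?A - 1 - i + (card ?C - 1 - m)) choose (card ?A - 1 - i)) * g i m
   else
    \<Sum>i\<le>card ?A - 1.
     ((card ?A - 1 - i + (card {s \<in> BL. (s, j) \<in> F2} - 1)) choose
      (card ?A - 1 - i)) * g i (card {s \<in> BR. (s, j) \<in> F2} - 1))"
  proof (cases real_b)
   case True
   have "(\<Sum>(B1, B2)\<in>?B F2. ((x + (card B2 - 1)) choose x) * g i (card B1 - 1)) =
     (\<Sum>m\<le>card ?C - 1. ((x + (card ?C - 1 - m)) choose x) * g i m)" for i x proof -
    have "(\<Sum>(B1, B2)\<in>?B F2. ((x + (card B2 - 1)) choose x) * g i (card B1 - 1)) =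
     (\<Sum>(B2, B1)\<in>{(A1, A2). \<exists>p\<in>?C. A1 = {y \<in> ?C. y \<le> p} & A2 = {y \<in> ?C. p \<le> y}}.
       (\<lambda>m' m. ((x + m') choose x) * g i m) (card B2 - 1) (card B1 - 1))" proof -
     have "splits_right ?C B1 B2 \<longleftrightarrow> (\<exists>p\<in>?C. B2 = {y \<in> ?C. y \<le> p} & B1 = {y \<in> ?C. p \<le> y})" for B1 B2
      unfolding splits_right_def using True by simp
     then show ?thesis by (intro sum.reindex_bij_witness[where i = prod.swap and j = prod.swap]) auto
    qed
    also have "\<dots> = (\<Sum>m\<le>card ?C - 1. ((x + m) choose x) * g i (card ?C - 1 - m))"
     by (rule sum_splits_left) (use nC in auto)
    also have "\<dots> = (\<Sum>m\<le>card ?C - 1. ((x + (card ?C - 1 - m)) choose x) * g i m)" proof -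
     have "(\<Sum>m\<le>M. f m (M - m)) = (\<Sum>m\<le>M. f (M - m) m)" for M and f :: "nat => nat => nat"
      by (rule sum.reindex_bij_witness[where i = "\<lambda>m. M - m" and j = "\<lambda>m. M - m"]) auto
     then show ?thesis .
    qed
    finally show ?thesis .
   qed
   then show ?thesis using True by simp
  next
   case False
   have "?B F2 = {({s \<in> BR. (s, j) \<in> F2}, {s \<in> BL. (s, j) \<in> F2})}"
    unfolding splits_right_def using False by auto
   then show ?thesis using False by simp
  qed
  finally show "(\<Sum>(A1, A2)\<in>?L F1. \<Sum>(B1, B2)\<in>?B F2. card (ladders A2 B2) * g (card A1 - 1) (card B1 - 1)) =
   (if real_b then
    \<Sum>i\<le>card ?A - 1. \<Sum>m\<le>card ?C - 1.
     ((card ?A - 1 - i + (card ?C - 1 - m)) choose (card ?A - 1 - i)) * g i m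
   else
    \<Sum>i\<le>card ?A - 1.
     ((card ?A - 1 - i + (card {s \<in> BL. (s, j) \<in> F2} - 1)) choose
      (card ?A - 1 - i)) * g i (card {s \<in> BR. (s, j) \<in> F2} - 1))" .
 qed
 finally show ?thesis .
qed

end

section \<open>Chords read off a tree\<close>

primrec wf_tr :: "tr => bool" where
 "wf_tr Lf = True"
| "wf_tr (Nd r a b) = (real_top a & wf_tr a & wf_tr b)"

primrec leaves :: "tr => nat" where
 "leaves Lf = 1"
| "leaves (Nd r a b) = leaves a + leaves b"

text \<open>The ends from which a path can go up and leave the interval through an arc at its left
  or at its right end vertex, turning only between incident sides. A real top arc touches both
  vertices, so the two sets agree; below a virtual top the left child serves the left vertex and the
  right child the right one.\<close>

fun reach_left :: "tr => nat => nat set" and reach_right :: "tr => nat => nat set" where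
 "reach_left Lf l = {l}"
| "reach_left (Nd r a b) l = reach_left a l \<union> (if r then reach_right b (l + leaves a) else {})"
| "reach_right Lf l = {l}"
| "reach_right (Nd r a b) l = (if r then reach_left a l else {}) \<union> reach_right b (l + leaves a)"

text \<open>The chords that appear at a node turn around the vertex between its children, so they
  leave the right child at its left end. The left child is real and may be left through
  \<open>reach_left\<close> as well as \<open>reach_right\<close>.\<close>

primrec inner_chords :: "tr => nat => (nat \<times> nat) set" where
 "inner_chords Lf l = {}"
| "inner_chords (Nd r a b) l =
   reach_left a l \<times> reach_left b (l + leaves a) \<union> inner_chords a l \<union> inner_chords b (l + leaves a)"

definition chords :: "tr => nat => (nat \<times> nat) set" where
 "chords t l = inner_chords t l \<union> (reach_left t l \<union> reach_right t l) \<times> {l + leaves t}"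

lemma leaves_pos: "leaves t > 0" by (induction t) auto

lemma reach_union:
 "reach_left (Nd r a b) l \<union> reach_right (Nd r a b) l = reach_left a l \<union> reach_right b (l + leaves a)" by auto

lemma reach_real: "real_top t ==> reach_left t l = reach_right t l" by (cases t) auto

lemma reach_bounds: "s \<in> reach_left t l \<union> reach_right t l ==> l \<le> s & s < l + leaves t"
 by (induction t arbitrary: l) (fastforce split: if_splits)+

lemma reach_ends: "l \<in> reach_left t l" "wf_tr t ==> l + leaves t - 1 \<in> reach_right t l"
proof (induction t arbitrary: l)
 case (Nd r a b)
 case 2
 then show ?case using Nd(4)[of "l + leaves a"] leaves_pos[of b] by (simp add: add.assoc)
qed auto

lemma inner_chords_bounds: "(s, t) \<in> inner_chords T l ==> l \<le> s & s < t & t < l + leaves T"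
proof (induction T arbitrary: l)
 case (Nd r a b)
 have "s \<in> reach_left a l ==> l \<le> s & s < l + leaves a"
  "t \<in> reach_left b (l + leaves a) ==> l + leaves a \<le> t & t < l + leaves a + leaves b" using reach_bounds by blast+
 then show ?case using Nd.prems Nd.IH[of l] Nd.IH(2)[of "l + leaves a"] by fastforce
qed simp

lemma glue_tree:
 assumes "wf_tr (Nd r a b)"
 shows "glue l (l + leaves a) (l + leaves (Nd r a b)) (inner_chords a l) (inner_chords b (l + leaves a))
  (reach_left a l) (reach_left b (l + leaves a)) (reach_right b (l + leaves a)) (real_top b)"
proof
 let ?k = "l + leaves a"
 show "\<And>s t. (s, t) \<in> inner_chords a l ==> l \<le> s & s < t & t < ?k" using inner_chords_bounds by blast
 show "\<And>s t. (s, t) \<in> inner_chords b ?k ==> ?k \<le> s & s < t & t < l + leaves (Nd r a b)"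
  using inner_chords_bounds by (metis add.assoc leaves.simps(2))
 show "\<And>s. s \<in> reach_left a l ==> l \<le> s & s < ?k" using reach_bounds by blast
 show "l \<in> reach_left a l" by (rule reach_ends)
 show "?k - 1 \<in> reach_left a l" using reach_ends(2)[of a l] reach_real[of a l] assms by simp
 show "\<And>s. s \<in> reach_left b ?k ==> ?k \<le> s & s < l + leaves (Nd r a b)"
  using reach_bounds by (metis UnCI add.assoc leaves.simps(2))
 show "?k \<in> reach_left b ?k" by (rule reach_ends)
 show "\<And>s. s \<in> reach_right b ?k ==> ?k \<le> s & s < l + leaves (Nd r a b)"
  using reach_bounds by (metis UnCI add.assoc leaves.simps(2))
 show "real_top b ==> reach_left b ?k = reach_right b ?k" by (rule reach_real)
 show "s < t" if "~ real_top b" "s \<in> reach_left b ?k" "t \<in> reach_right b ?k" for s t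
 proof (cases b)
  case (Nd r' a' b')
  then have "s \<in> reach_left a' ?k" "t \<in> reach_right b' (?k + leaves a')" using that by auto
  then show ?thesis using reach_bounds by (meson UnCI less_le_trans)
 qed (use that in simp)
qed

text \<open>Both sides satisfy the same recursion, so induction on the tree suffices, provided
  \<open>g\<close> stays arbitrary: the inner sums produced by one step are used as weights for the
  children.\<close>

lemma count_walks_eq_facets:
 fixes g :: "nat => nat => nat"
 assumes "wf_tr (Nd r a b)"
 shows "(\<Sum>N\<in>inner_nests (Nd r a b). g (card (avail_left (Nd r a b) N)) (card (avail_right (Nd r a b) N))) =
  (\<Sum>F\<in>facets (chords (Nd r a b) l).
   g (card {x. x < l + leaves a & (x, l + leaves (Nd r a b)) \<in> F} - 1)
    (card {x. l + leaves a \<le> x & (x, l + leaves (Nd r a b)) \<in> F} - 1))" using assms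
proof (induction "Nd r a b" arbitrary: r a b l g rule: measure_induct_rule[where f = size])
 case (less r a b)
 let ?t = "Nd r a b"
 let ?k = "l + leaves a" and ?j = "l + leaves (Nd r a b)"
 interpret glue l ?k ?j "inner_chords a l" "inner_chords b ?k" "reach_left a l" "reach_left b ?k"
  "reach_right b ?k" "real_top b" by (rule glue_tree[OF less.prems])
 have wf: "real_top a" "wf_tr a" "wf_tr b" using less.prems by auto
 have U: "U = chords ?t l" unfolding U_def chords_def reach_union by (auto simp: add.assoc)
 have U1: "U1 = chords a l" unfolding U1_def chords_def reach_real[OF wf(1), symmetric] by simp
 have U2: "U2 = chords b ?k" unfolding U2_def chords_def by (simp add: add.assoc)
 \<comment> \<open>For a real child only the total counts. It comes from the two-parameter statement
   with weight \<open>h (1 + i + i')\<close>: on the serpent side the 1 is the word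
   \<open>End\<close>, on the chord side it corrects for two subtractions of one instead of a single
   one.\<close>
 have closed: "(\<Sum>N\<in>inner_nests c. h (card (avail c N))) =
   (\<Sum>F\<in>facets (chords c m). h (card {s. (s, m + leaves c) \<in> F} - 1))"
  if c: "wf_tr c" "size c < size ?t" "real_top c" for c m and h :: "nat => nat"
 proof (cases c)
  case Lf
  have "inner_nests c = {{}}" using Lf by (auto simp: inner_nests_def indep_def)
  moreover have "facets (chords c m) = {{(m, m + 1)}}" using Lf by (auto simp: facets_def chords_def noncrossing_def)
  moreover have "card {s. (s, m + leaves c) \<in> {(m, m + 1)}} - 1 = 0" using Lf by simp
  ultimately show ?thesis using Lf by (simp add: avail_def)
 next
  case (Nd r' a' b')
  let ?k' = "m + leaves a'" and ?j' = "m + leaves c"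
  have wf': "wf_tr (Nd r' a' b')" using c Nd by simp
  interpret c: glue m ?k' "m + leaves (Nd r' a' b')" "inner_chords a' m" "inner_chords b' ?k'" "reach_left a' m"
   "reach_left b' ?k'" "reach_right b' ?k'" "real_top b'" by (rule glue_tree[OF wf'])
  have cU: "c.U = chords (Nd r' a' b') m" unfolding c.U_def chords_def reach_union by (auto simp: add.assoc)
  have "(\<Sum>N\<in>inner_nests c. h (card (avail c N))) =
   (\<Sum>N\<in>inner_nests (Nd r' a' b').
    (\<lambda>i i'. h (1 + i + i')) (card (avail_left (Nd r' a' b') N)) (card (avail_right (Nd r' a' b') N)))"
   by (rule sum.cong) (use Nd card_avail in auto)
  also have "\<dots> = (\<Sum>F\<in>facets (chords (Nd r' a' b') m). (\<lambda>i i'. h (1 + i + i'))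
    (card {x. x < ?k' & (x, m + leaves (Nd r' a' b')) \<in> F} - 1)
    (card {x. ?k' \<le> x & (x, m + leaves (Nd r' a' b')) \<in> F} - 1))" by (rule less.hyps) (use c Nd wf' in auto)
  also have "\<dots> = (\<Sum>F\<in>facets (chords c m). h (card {s. (s, ?j') \<in> F} - 1))"
  proof (rule sum.cong)
   fix F assume F: "F \<in> facets (chords c m)"
   then have F': "F \<in> facets c.U" using cU Nd by simp
   let ?X = "{x. x < ?k' & (x, ?j') \<in> F}" and ?Y = "{x. ?k' \<le> x & (x, ?j') \<in> F}"
   have "{s. (s, ?j') \<in> F} = ?X \<union> ?Y" by auto
   moreover have fin: "finite ?X" "finite ?Y" proof -
    have "s \<le> ?j'" if "(s, ?j') \<in> F" for s using c.U_bounds[of s ?j'] subsetD[OF facets_subset[OF F'] that] by simp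
    then have "?X \<subseteq> {..?j'}" "?Y \<subseteq> {..?j'}" by auto
    then show "finite ?X" "finite ?Y" by (auto intro: finite_subset)
   qed
   ultimately have "card {s. (s, ?j') \<in> F} = card ?X + card ?Y"
    by (metis (no_types, lifting) card_Un_disjoint disjoint_iff mem_Collect_eq not_le)
   moreover have "m \<in> ?X" using c.left_edge[OF F'] c.lkj Nd by simp
   moreover have "?Y ~= {}" proof -
    have y: "c.ys1 F ~= {}" proof -
     have "(m + leaves c - 1, m + leaves c) \<in> F"
     proof (rule facets_max[OF F'])
      have "?k' + leaves b' - 1 \<in> reach_right b' ?k'" using reach_ends(2) wf' by simp
      then show "(m + leaves c - 1, m + leaves c) \<in> c.U" unfolding c.U_def Nd by (simp add: add.assoc)
     qed auto
     then show ?thesis unfolding c.ys1_def[OF F'] using Nd leaves_pos[of b'] by force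
    qed
    then show ?thesis unfolding c.ys1_def[OF F'] using Nd by simp
   qed
   ultimately have "card {s. (s, ?j') \<in> F} - 1 = 1 + (card ?X - 1) + (card ?Y - 1)"
    using fin by (cases "card ?X"; cases "card ?Y") auto
   then show "(\<lambda>i i'. h (1 + i + i')) (card {x. x < ?k' & (x, m + leaves (Nd r' a' b')) \<in> F} - 1)
    (card {x. ?k' \<le> x & (x, m + leaves (Nd r' a' b')) \<in> F} - 1) = h (card {s. (s, ?j') \<in> F} - 1)" using Nd by simp
  qed (use Nd in simp)
  finally show ?thesis .
 qed
 note rec = sum_inner_nests_rec[OF wf(1) refl, where r = r and b = b and g = g]
 have "(\<Sum>N\<in>inner_nests ?t. g (card (avail_left ?t N)) (card (avail_right ?t N))) =
  (\<Sum>F1\<in>facets U1. \<Sum>F2\<in>facets U2. if real_top b then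
    \<Sum>i\<le>card {s. (s, ?k) \<in> F1} - 1. \<Sum>m\<le>card {s. (s, ?j) \<in> F2} - 1.
     ((card {s. (s, ?k) \<in> F1} - 1 - i + (card {s. (s, ?j) \<in> F2} - 1 - m)) choose
      (card {s. (s, ?k) \<in> F1} - 1 - i)) * g i m
   else
    \<Sum>i\<le>card {s. (s, ?k) \<in> F1} - 1.
     ((card {s. (s, ?k) \<in> F1} - 1 - i + (card {s \<in> reach_left b ?k. (s, ?j) \<in> F2} - 1)) choose
      (card {s. (s, ?k) \<in> F1} - 1 - i)) * g i (card {s \<in> reach_right b ?k. (s, ?j) \<in> F2} - 1))"
 proof (cases "real_top b")
  case True
  define G where "G x y = (\<Sum>i\<le>x. \<Sum>m\<le>y. ((x - i + (y - m)) choose (x - i)) * g i m)" for x y :: nat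
  have "(\<Sum>N\<in>inner_nests ?t. g (card (avail_left ?t N)) (card (avail_right ?t N))) =
    (\<Sum>N\<in>inner_nests a. \<Sum>M\<in>inner_nests b. G (card (avail a N)) (card (avail b M)))"
   unfolding rec G_def using True by simp
  also have "\<dots> = (\<Sum>N\<in>inner_nests a. \<Sum>F2\<in>facets U2. G (card (avail a N)) (card {s. (s, ?j) \<in> F2} - 1))"
   unfolding U2 using closed[of b "G _" ?k] wf True by (simp add: add.assoc)
  also have "\<dots> = (\<Sum>F1\<in>facets U1. \<Sum>F2\<in>facets U2. G (card {s. (s, ?k) \<in> F1} - 1) (card {s. (s, ?j) \<in> F2} - 1))"
   unfolding U1 by (rule closed) (use wf in auto)
  finally show ?thesis unfolding G_def using True by simp
 next
  case False
  then obtain a' b' where b: "b = Nd False a' b'" by (cases b) auto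
  define G where "G x y z = (\<Sum>i\<le>x. ((x - i + y) choose (x - i)) * g i z)" for x y z :: nat
  have parts: "{s \<in> reach_left b ?k. (s, ?j) \<in> F2} = {x. x < ?k + leaves a' & (x, ?k + leaves b) \<in> F2}"
   "{s \<in> reach_right b ?k. (s, ?j) \<in> F2} = {x. ?k + leaves a' \<le> x & (x, ?k + leaves b) \<in> F2}"
   if "F2 \<in> facets U2" for F2 proof -
   have "s \<in> reach_left a' ?k & s < ?k + leaves a' \<or> s \<in> reach_right b' (?k + leaves a') & ?k + leaves a' \<le> s"
    if "(s, ?j) \<in> F2" for s proof -
    have "s \<in> reach_left b ?k \<union> reach_right b ?k"
     using that facets_subset[OF \<open>F2 \<in> facets U2\<close>] PB unfolding U2_def by fastforce
    then show ?thesis using reach_bounds[of s a' ?k] reach_bounds[of s b' "?k + leaves a'"] by (auto simp: b)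
   qed
   note mem = this
   have bl: "s < ?k + leaves a'" if "s \<in> reach_left a' ?k" for s using reach_bounds[of s a' ?k] that by simp
   have br: "?k + leaves a' \<le> s" if "s \<in> reach_right b' (?k + leaves a')" for s
    using reach_bounds[of s b' "?k + leaves a'"] that by simp
   have R: "reach_left b ?k = reach_left a' ?k" "reach_right b ?k = reach_right b' (?k + leaves a')" by (simp_all add: b)
   have J: "?k + leaves b = ?j" by simp
   show "{s \<in> reach_left b ?k. (s, ?j) \<in> F2} = {x. x < ?k + leaves a' & (x, ?k + leaves b) \<in> F2}"
    unfolding R J using mem bl br by (metis (lifting) leD)
   show "{s \<in> reach_right b ?k. (s, ?j) \<in> F2} = {x. ?k + leaves a' \<le> x & (x, ?k + leaves b) \<in> F2}"
    unfolding R J using mem bl br by (metis (lifting) leD)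
  qed
  have "(\<Sum>N\<in>inner_nests ?t. g (card (avail_left ?t N)) (card (avail_right ?t N))) =
    (\<Sum>N\<in>inner_nests a. \<Sum>M\<in>inner_nests b. G (card (avail a N)) (card (avail_left b M)) (card (avail_right b M)))"
   unfolding rec G_def using False by simp
  also have "\<dots> = (\<Sum>N\<in>inner_nests a. \<Sum>F2\<in>facets U2. G (card (avail a N))
    (card {x. x < ?k + leaves a' & (x, ?k + leaves b) \<in> F2} - 1)
    (card {x. ?k + leaves a' \<le> x & (x, ?k + leaves b) \<in> F2} - 1))"
   unfolding U2 unfolding b by (rule sum.cong[OF refl], rule less.hyps) (use wf b in auto)
  also have "\<dots> = (\<Sum>F1\<in>facets U1. \<Sum>F2\<in>facets U2. G (card {s. (s, ?k) \<in> F1} - 1)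
    (card {x. x < ?k + leaves a' & (x, ?k + leaves b) \<in> F2} - 1)
    (card {x. ?k + leaves a' \<le> x & (x, ?k + leaves b) \<in> F2} - 1))" unfolding U1 by (rule closed) (use wf in auto)
  finally show ?thesis unfolding G_def using False parts by simp
 qed
 also have "\<dots> = (\<Sum>F\<in>facets U. g (card {x. x < ?k & (x, ?j) \<in> F} - 1) (card {x. ?k \<le> x & (x, ?j) \<in> F} - 1))"
  by (rule sum_facets_glue[symmetric])
 finally show ?case unfolding U .
qed

theorem card_inner_nests_eq_facets:
 assumes "wf_tr (Nd r a b)" shows "card (inner_nests (Nd r a b)) = card (facets (chords (Nd r a b) l))"
 using count_walks_eq_facets[OF assms, of "\<lambda>_ _. 1" l] by simp

section \<open>Convex polygons in the plane\<close>

text \<open>The cross product of \<open>b - a\<close> and \<open>z - a\<close>, positive to the left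
  of the line from \<open>a\<close> to \<open>b\<close>. It is written as an inner product so that
  half-space facts apply directly.\<close>

definition turn :: "complex => complex => complex => real" where
 "turn a b z = (\<i> * (b - a)) \<bullet> z - (\<i> * (b - a)) \<bullet> a"

lemma turn_eq: "turn a b z = Re (b - a) * Im (z - a) - Im (b - a) * Re (z - a)"
 by (simp add: turn_def inner_complex_def algebra_simps)

lemma turn_ends [simp]: "turn a b a = 0" "turn a b b = 0" by (simp_all add: turn_eq)

lemma turn_affine: "turn a b ((1 - u) *\<^sub>R x + u *\<^sub>R y) = (1 - u) * turn a b x + u * turn a b y"
 by (simp add: turn_eq algebra_simps)

lemma turn_cycle: "turn a b c = turn b c a" "turn a b c = - turn a c b" "turn b a c = - turn a b c"
 by (simp_all add: turn_eq algebra_simps)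

lemma turn_halfspaces: "open {z. turn a b z > 0}" "open {z. turn a b z < 0}"
 "closed {z. turn a b z \<ge> 0}" "closed {z. turn a b z \<le> 0}" "convex {z. turn a b z > 0}" "convex {z. turn a b z < 0}"
 "convex {z. turn a b z \<ge> 0}" "convex {z. turn a b z \<le> 0}"
 using open_halfspace_gt[of "(\<i> * (b - a)) \<bullet> a" "\<i> * (b - a)"] open_halfspace_lt[of "\<i> * (b - a)" "(\<i> * (b - a)) \<bullet> a"]
  closed_halfspace_ge[of "(\<i> * (b - a)) \<bullet> a" "\<i> * (b - a)"] closed_halfspace_le[of "\<i> * (b - a)" "(\<i> * (b - a)) \<bullet> a"]
  convex_halfspace_gt[of "(\<i> * (b - a)) \<bullet> a" "\<i> * (b - a)"] convex_halfspace_lt[of "\<i> * (b - a)" "(\<i> * (b - a)) \<bullet> a"]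
  convex_halfspace_ge[of "(\<i> * (b - a)) \<bullet> a" "\<i> * (b - a)"] convex_halfspace_le[of "\<i> * (b - a)" "(\<i> * (b - a)) \<bullet> a"]
 by (simp_all add: turn_def)

lemma turn_hull_ge: "(\<And>x. x \<in> S ==> turn a b x \<ge> 0) ==> z \<in> convex hull S ==> turn a b z \<ge> 0"
 using hull_minimal[of S "{z. turn a b z \<ge> 0}" convex] turn_halfspaces(7)[of a b] by blast

lemma turn_hull_le: "(\<And>x. x \<in> S ==> turn a b x \<le> 0) ==> z \<in> convex hull S ==> turn a b z \<le> 0"
 using hull_minimal[of S "{z. turn a b z \<le> 0}" convex] turn_halfspaces(8)[of a b] by blast

text \<open>A hull meets a supporting hyperplane in a face, and a face of the hull of a finite set
  is the hull of some of the generators.\<close>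

lemma hull_face:
 fixes c :: "'a::euclidean_space"
 assumes "finite S" "\<And>x. x \<in> S ==> c \<bullet> x \<ge> d" "z \<in> convex hull S" "c \<bullet> z = d"
 shows "z \<in> convex hull {x \<in> S. c \<bullet> x = d}"
proof -
 let ?T = "(convex hull S) \<inter> {x. c \<bullet> x = d}"
 have ge: "c \<bullet> x \<ge> d" if "x \<in> convex hull S" for x
  using hull_minimal[of S "{x. c \<bullet> x \<ge> d}" convex] convex_halfspace_ge[of d c] assms(2) that by auto
 have "?T face_of convex hull S" by (rule face_of_Int_supporting_hyperplane_ge) (use ge in auto)
 then obtain S' where S': "S' \<subseteq> S" "?T = convex hull S'"
  using face_of_convex_hull_subset[of S ?T] finite_imp_compact[OF assms(1)] by blast
 have "S' \<subseteq> ?T" using S'(2) hull_subset[of S' convex] by simp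
 then have "S' \<subseteq> {x \<in> S. c \<bullet> x = d}" using S'(1) by auto
 then have "convex hull S' \<subseteq> convex hull {x \<in> S. c \<bullet> x = d}" by (rule hull_mono)
 then show ?thesis using assms(3,4) S'(2) by auto
qed

text \<open>The barycentric coordinates of \<open>z\<close> are quotients of values of
  \<open>turn\<close>, and the three hypotheses are their signs.\<close>

lemma triangle_mem:
 assumes D: "turn a b c > 0" and "turn a b z \<ge> 0" "turn a c z \<le> 0" "turn c b z \<le> 0"
 shows "z \<in> convex hull {a, c, b}"
proof -
 let ?D = "turn a b c"
 define u v w where "u = - turn c b z / ?D" and "v = turn a b z / ?D" and "w = - turn a c z / ?D"
 have nn: "u \<ge> 0" "v \<ge> 0" "w \<ge> 0" using assms by (auto simp: u_def v_def w_def divide_nonpos_pos)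
 have "turn a b z - turn a c z - turn c b z = ?D" by (simp add: turn_eq algebra_simps)
 then have s: "u + v + w = 1" using D by (simp add: u_def v_def w_def field_simps)
 have "?D *\<^sub>R z = (- turn c b z) *\<^sub>R a + turn a b z *\<^sub>R c + (- turn a c z) *\<^sub>R b"
  by (rule complex_eqI) (simp_all add: turn_eq algebra_simps)
 then have "z = (1 / ?D) *\<^sub>R ((- turn c b z) *\<^sub>R a + turn a b z *\<^sub>R c + (- turn a c z) *\<^sub>R b)"
  using D by (metis (no_types, lifting) divide_self_if order_less_irrefl scaleR_one scaleR_scaleR times_divide_eq_left mult.left_neutral)
 also have "\<dots> = u *\<^sub>R a + v *\<^sub>R c + w *\<^sub>R b"
  by (simp add: u_def v_def w_def scaleR_add_right scaleR_diff_right)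
 finally show ?thesis unfolding convex_hull_3 using nn s by blast
qed

lemma segments_cross:
 assumes 1: "turn a b c > 0" "turn a b d < 0" and 2: "turn c d a < 0" "turn c d b > 0"
 shows "open_segment a b \<inter> open_segment c d ~= {}"
proof -
 let ?N = "turn a b c - turn a b d"
 \<comment> \<open>\<open>u\<close> and \<open>v\<close> are the parameters of the intersection
   point on the two lines; by \<open>NE\<close> they have the same denominator.\<close>
 define u where "u = turn a b c / ?N"
 define v where "v = - turn c d a / ?N"
 have N: "?N > 0" using 1 by simp
 have NE: "?N = turn c d b - turn c d a" by (simp add: turn_eq algebra_simps)
 have u: "0 < u" "u < 1" using 1 N by (auto simp: u_def field_simps)
 have v: "0 < v" "v < 1" using 2 N NE by (auto simp: v_def field_simps)
 have Nu: "?N * (1 - u) = ?N - turn a b c" "?N * u = turn a b c"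
  and Nv: "?N * (1 - v) = ?N + turn c d a" "?N * v = - turn c d a"
  using N by (simp_all add: u_def v_def right_diff_distrib distrib_left)
 have "(1 - u) *\<^sub>R c + u *\<^sub>R d = (1 - v) *\<^sub>R a + v *\<^sub>R b" proof -
  have "?N *\<^sub>R ((1 - u) *\<^sub>R c + u *\<^sub>R d) = (?N - turn a b c) *\<^sub>R c + turn a b c *\<^sub>R d"
   by (simp only: scaleR_add_right scaleR_scaleR Nu)
  also have "\<dots> = (?N + turn c d a) *\<^sub>R a + (- turn c d a) *\<^sub>R b"
   by (rule complex_eqI) (simp_all add: turn_eq algebra_simps)
  also have "\<dots> = ?N *\<^sub>R ((1 - v) *\<^sub>R a + v *\<^sub>R b)" by (simp only: scaleR_add_right scaleR_scaleR Nv)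
  finally show ?thesis using N by (metis less_irrefl real_vector.scale_left_imp_eq)
 qed
 note eq = this
 have ne: "c ~= d" "a ~= b" using 1 2 by auto
 have "(1 - v) *\<^sub>R a + v *\<^sub>R b \<in> open_segment a b" unfolding in_segment(2) using v ne(2) by blast
 moreover have "(1 - u) *\<^sub>R c + u *\<^sub>R d \<in> open_segment c d" unfolding in_segment(2) using u ne(1) by blast
 ultimately show ?thesis using eq by auto
qed

lemma open_segment_turn_le:
 assumes "turn a b c \<le> 0" "turn a b d \<le> 0" "turn a b c < 0 \<or> turn a b d < 0" "z \<in> open_segment c d"
 shows "turn a b z < 0"
proof -
 obtain u where u: "0 < u" "u < 1" "z = (1 - u) *\<^sub>R c + u *\<^sub>R d" using assms(4) by (auto simp: in_segment)
 have "(1 - u) * turn a b c \<le> 0" "u * turn a b d \<le> 0" using assms u by (auto intro: mult_nonneg_nonpos)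
 moreover have "(1 - u) * turn a b c < 0 \<or> u * turn a b d < 0" using assms(3) u by (auto intro: mult_pos_neg)
 ultimately show ?thesis unfolding u(3) turn_affine by linarith
qed

lemma open_segment_turn_ge:
 assumes "turn a b c \<ge> 0" "turn a b d \<ge> 0" "turn a b c > 0 \<or> turn a b d > 0" "z \<in> open_segment c d"
 shows "turn a b z > 0" using open_segment_turn_le[of b a c d z] assms by (simp add: turn_cycle(3)[of b a])

lemma closed_segment_turn_le: "turn a b c \<le> 0 ==> turn a b d \<le> 0 ==> z \<in> closed_segment c d ==> turn a b z \<le> 0"
 using turn_hull_le[of "{c, d}"] by (auto simp: segment_convex_hull)

lemma closed_segment_turn_ge: "turn a b c \<ge> 0 ==> turn a b d \<ge> 0 ==> z \<in> closed_segment c d ==> turn a b z \<ge> 0"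
 using turn_hull_ge[of "{c, d}"] by (auto simp: segment_convex_hull)

lemma closed_segment_turn_zero: "z \<in> closed_segment a b ==> turn a b z = 0"
 using closed_segment_turn_le[of a b a b z] closed_segment_turn_ge[of a b a b z] by simp

locale clockwise_polygon =
 fixes P :: "nat => complex" and N :: nat
 assumes clockwise: "i < j ==> j < k ==> k < N ==> turn (P i) (P j) (P k) < 0"
begin

text \<open>For a clockwise polygon and a chord from \<open>i\<close> to \<open>j\<close> with
  \<open>i < j\<close> this is positive at the vertices strictly between \<open>i\<close> and
  \<open>j\<close> and negative at those outside.\<close>

definition L :: "nat \<times> nat => complex => real" where "L x z = turn (P (fst x)) (P (snd x)) z"

lemma L_vertex:
 assumes "i < j" "j < N" "m < N"
 shows "L (i, j) (P m) > 0 \<longleftrightarrow> i < m & m < j" "L (i, j) (P m) < 0 \<longleftrightarrow> m < i \<or> j < m"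
  "L (i, j) (P m) = 0 \<longleftrightarrow> m = i \<or> m = j"
proof -
 have "m = i \<or> m = j \<or> m < i \<or> (i < m & m < j) \<or> j < m" by auto
 moreover have "m < i ==> L (i, j) (P m) < 0"
  using clockwise[of m i j] assms turn_cycle(1)[of "P m" "P i" "P j"] by (simp add: L_def)
 moreover have "i < m ==> m < j ==> L (i, j) (P m) > 0"
  using clockwise[of i m j] assms turn_cycle(2)[of "P i" "P m" "P j"] by (simp add: L_def)
 moreover have "j < m ==> L (i, j) (P m) < 0" using clockwise[of i j m] assms by (simp add: L_def)
 moreover have "m = i \<or> m = j ==> L (i, j) (P m) = 0" by (auto simp: L_def)
 ultimately show "L (i, j) (P m) > 0 \<longleftrightarrow> i < m & m < j" "L (i, j) (P m) < 0 \<longleftrightarrow> m < i \<or> j < m"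
  "L (i, j) (P m) = 0 \<longleftrightarrow> m = i \<or> m = j" using assms(1) by (smt (verit) not_less_iff_gr_or_eq)+
qed

lemma P_inj: "i < N ==> j < N ==> 3 \<le> N ==> P i = P j ==> i = j"
proof (rule ccontr)
 assume a: "i < N" "j < N" "3 \<le> N" "P i = P j" "i ~= j"
 have *: False if ij: "i < j" "j < N" "P i = P j" for i j proof -
  obtain m where "m < N" "m ~= i" "m ~= j" proof -
   have "\<exists>m\<in>{0, 1, 2::nat}. m ~= i & m ~= j" by auto
   then obtain m where m: "m \<in> {0, 1, 2::nat}" "m ~= i" "m ~= j" by blast
   then have "m < N" using a(3) by auto
   then show thesis using that m by blast
  qed
  then have "L (i, j) (P m) ~= 0" using L_vertex(3)[of i j m] ij by auto
  then show False using ij(3) by (simp add: L_def turn_eq)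
 qed
 show False using *[of i j] *[of j i] a by (cases "i < j") auto
qed

text \<open>Fan triangulation from vertex \<open>i\<close>: the point lies on the inner side of the
  chord from \<open>i\<close> to the last but one vertex, where the induction hypothesis applies, or
  in the triangle cut off by that chord.\<close>

lemma hull_mem:
 assumes "i + 2 \<le> j" "j < N" "L (i, j) z \<ge> 0" "\<And>e. i \<le> e ==> e < j ==> L (e, Suc e) z \<le> 0"
 shows "z \<in> convex hull (P ` {i..j})" using assms
proof (induction j)
 case (Suc j)
 show ?case
 proof (cases "L (i, j) z \<ge> 0 & i + 2 \<le> j")
  case True
  then have "z \<in> convex hull (P ` {i..j})" using Suc by auto
  then show ?thesis by (rule subsetD[OF hull_mono, rotated]) auto
 next
  case False
  have "L (i, j) z \<le> 0"
  proof (cases "i + 2 \<le> j")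
   case True then show ?thesis using False by auto
  next
   case F2: False
   then have "j = Suc i" using Suc.prems(1) by auto
   then show ?thesis using Suc.prems(4)[of i] by auto
  qed
  moreover have "L (j, Suc j) z \<le> 0" using Suc.prems(1,4) by auto
  moreover have "L (i, Suc j) (P j) > 0" using L_vertex(1)[of i "Suc j" j] Suc.prems by auto
  ultimately have "z \<in> convex hull {P i, P j, P (Suc j)}"
   using triangle_mem[of "P i" "P (Suc j)" "P j" z] Suc.prems(3) by (simp add: L_def)
  then show ?thesis by (rule subsetD[OF hull_mono, rotated]) (use Suc.prems(1) in auto)
 qed
qed simp

definition "Q = convex hull (P ` {..<N})"

lemma Q_alt: "3 \<le> N ==> Q = convex hull (P ` {0..N - 1})"
 unfolding Q_def by (rule arg_cong[of _ _ "\<lambda>S. convex hull (P ` S)"]) auto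

lemma Q_root: "z \<in> Q ==> 2 \<le> N ==> L (0, N - 1) z \<ge> 0" unfolding Q_def L_def fst_conv snd_conv
proof (rule turn_hull_ge)
 fix x assume N: "2 \<le> N" and "x \<in> P ` {..<N}"
 then obtain m where "x = P m" "m < N" by auto
 moreover have "~ L (0, N - 1) (P m) < 0" using L_vertex(2)[of 0 "N - 1" m] N \<open>m < N\<close> by auto
 ultimately show "0 \<le> turn (P 0) (P (N - 1)) x" by (simp add: L_def)
qed

lemma Q_edge: "z \<in> Q ==> Suc e < N ==> L (e, Suc e) z \<le> 0" unfolding Q_def L_def fst_conv snd_conv
proof (rule turn_hull_le)
 fix x assume e: "Suc e < N" and "x \<in> P ` {..<N}"
 then obtain m where "x = P m" "m < N" by auto
 moreover have "~ L (e, Suc e) (P m) > 0" using L_vertex(1)[of e "Suc e" m] e \<open>m < N\<close> by auto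
 ultimately show "turn (P e) (P (Suc e)) x \<le> 0" by (simp add: L_def)
qed

lemma Q_iff: "3 \<le> N ==> z \<in> Q \<longleftrightarrow> L (0, N - 1) z \<ge> 0 & (\<forall>e. Suc e < N --> L (e, Suc e) z \<le> 0)"
 using Q_root[of z] Q_edge[of z] hull_mem[of 0 "N - 1" z] by (auto simp: Q_alt)

lemma P_in_Q: "m < N ==> P m \<in> Q" unfolding Q_def by (rule hull_inc) auto

lemma segment_in_Q: "i < N ==> j < N ==> closed_segment (P i) (P j) \<subseteq> Q"
 using P_in_Q by (simp add: Q_def closed_segment_subset)

text \<open>The line through both vertices supports the hull of the vertices from \<open>i\<close>
  to \<open>j\<close>, to which \<open>z\<close> belongs; for consecutive vertices it supports the
  whole polygon. The face on the supporting line is the segment.\<close>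

lemma line_in_Q:
 assumes "3 \<le> N" "i < j" "j < N" "z \<in> Q" "L (i, j) z = 0" shows "z \<in> closed_segment (P i) (P j)"
proof -
 have key: "z \<in> closed_segment (P i) (P j)"
  if S: "z \<in> convex hull (P ` S)" "S \<subseteq> {..<N}" and sg: "s = 1 \<or> s = - 1" "\<And>m. m \<in> S ==> s * L (i, j) (P m) \<ge> 0"
  for S and s :: real proof -
  let ?c = "s *\<^sub>R (\<i> * (P j - P i))" and ?d = "s * ((\<i> * (P j - P i)) \<bullet> P i)"
  have L: "?c \<bullet> x - ?d = s * L (i, j) x" for x by (simp add: L_def turn_def algebra_simps)
  have "finite S" using S(2) finite_subset by blast
  have "z \<in> convex hull {x \<in> P ` S. ?c \<bullet> x = ?d}"
  proof (rule hull_face)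
   show "finite (P ` S)" using \<open>finite S\<close> by simp
   show "?c \<bullet> x \<ge> ?d" if x: "x \<in> P ` S" for x proof -
    obtain m where "m \<in> S" "x = P m" using x by blast
    then have "0 \<le> s * L (i, j) x" using sg(2) by simp
    then have "0 \<le> ?c \<bullet> x - ?d" unfolding L .
    then show ?thesis by (simp only: diff_ge_0_iff_ge)
   qed
   show "?c \<bullet> z = ?d" using L[of z] assms(5) by simp
  qed (rule S(1))
  moreover have "{x \<in> P ` S. ?c \<bullet> x = ?d} \<subseteq> {P i, P j}"
  proof
   fix x assume x: "x \<in> {x \<in> P ` S. ?c \<bullet> x = ?d}"
   then obtain m where m: "x = P m" "m \<in> S" "?c \<bullet> P m = ?d" by blast
   have "s * L (i, j) (P m) = 0" unfolding L[symmetric] m(3) by simp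
   then have "L (i, j) (P m) = 0" using sg by auto
   then show "x \<in> {P i, P j}" using L_vertex(3)[of i j m] assms m S(2) by auto
  qed
  ultimately show ?thesis unfolding segment_convex_hull using hull_mono by blast
 qed
 show ?thesis
 proof (cases "i + 2 \<le> j")
  case True
  have "z \<in> convex hull (P ` {i..j})" by (rule hull_mem[OF True]) (use assms Q_edge in auto)
  then show ?thesis
  proof (rule key[where s = 1])
   fix m assume "m \<in> {i..j}"
   then show "0 \<le> 1 * L (i, j) (P m)" using L_vertex(2)[of i j m] assms by auto
  qed (use assms in auto)
 next
  case False
  then have j: "j = Suc i" using assms by auto
  have "z \<in> convex hull (P ` {..<N})" using assms(4) by (simp add: Q_def)
  then show ?thesis
  proof (rule key[where s = "- 1"])
   fix m assume "m \<in> {..<N}"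
   then show "0 \<le> - 1 * L (i, j) (P m)" using L_vertex(1)[of i j m] assms j by auto
  qed auto
 qed
qed

lemma Q_interior:
 assumes "3 \<le> N" "L (0, N - 1) z > 0" "\<And>e. Suc e < N ==> L (e, Suc e) z < 0" shows "z \<in> interior Q"
proof (rule interiorI)
 let ?O = "{z. L (0, N - 1) z > 0} \<inter> (\<Inter>e\<in>{e. Suc e < N}. {z. L (e, Suc e) z < 0})"
 have "finite {e. Suc e < N}" by (rule finite_subset[of _ "{..<N}"]) auto
 then show "open ?O" unfolding L_def by (intro open_Int open_INT ballI turn_halfspaces)
 show "z \<in> ?O" using assms by auto
 show "?O \<subseteq> Q" using Q_iff[OF assms(1)] by (auto intro: less_imp_le)
qed

text \<open>The midpoint of any other chord is strictly inside all edge lines. Conversely the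
  polygon lies on one side of an edge line, so no point of that line is interior.\<close>

lemma boundary_segment:
 assumes N: "3 \<le> N" and ij: "i < j" "j < N"
 shows "closed_segment (P i) (P j) \<subseteq> frontier Q \<longleftrightarrow> j = Suc i \<or> (i = 0 & j = N - 1)"
proof
 assume sub: "closed_segment (P i) (P j) \<subseteq> frontier Q"
 show "j = Suc i \<or> (i = 0 & j = N - 1)"
 proof (rule ccontr)
  assume c: "~ ?thesis"
  let ?z = "midpoint (P i) (P j)"
  have ne: "P i ~= P j" using P_inj[of i j] ij N by auto
  have mid: "?z \<in> open_segment (P i) (P j)" using ne by simp
  have "?z \<in> interior Q"
  proof (rule Q_interior[OF N])
   show "L (0, N - 1) ?z > 0" unfolding L_def
    by (rule open_segment_turn_ge[OF _ _ _ mid]; use L_vertex[of 0 "N - 1" i] L_vertex[of 0 "N - 1" j] c ij N in \<open>force simp: L_def\<close>)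
   fix e assume e: "Suc e < N"
   show "L (e, Suc e) ?z < 0" unfolding L_def
    by (rule open_segment_turn_le[OF _ _ _ mid]; use L_vertex[of e "Suc e" i] L_vertex[of e "Suc e" j] c ij N e in \<open>force simp: L_def\<close>)
  qed
  moreover have "?z \<in> frontier Q" using sub by auto
  ultimately show False by (simp add: frontier_def)
 qed
next
 assume a: "j = Suc i \<or> (i = 0 & j = N - 1)"
 have one_side: "z \<notin> interior Q" if z: "L (i, j) z = 0" for z
 proof
  assume zi: "z \<in> interior Q"
  let ?c = "\<i> * (P j - P i)"
  have c0: "?c ~= 0" using P_inj[of i j] ij N by auto
  obtain e where e: "e > 0" "ball z e \<subseteq> Q" using zi by (meson mem_interior)
  \<comment> \<open>A normal displacement of length \<open>e / 2\<close>: both shifted points stay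
    in the ball but lie on opposite sides of the line.\<close>
  define t where "t = e / (2 * norm ?c)"
  have t: "t > 0" using e c0 by (simp add: t_def)
  have b: "z + t *\<^sub>R ?c \<in> ball z e" "z - t *\<^sub>R ?c \<in> ball z e" using e c0 by (auto simp: t_def dist_norm)
  have "L (i, j) (z + t *\<^sub>R ?c) = t * (?c \<bullet> ?c)" "L (i, j) (z - t *\<^sub>R ?c) = - (t * (?c \<bullet> ?c))"
   using z by (simp_all add: L_def turn_def inner_add_right inner_diff_right)
  moreover have "t * (?c \<bullet> ?c) > 0" using t c0 by (metis inner_gt_zero_iff mult_pos_pos)
  ultimately have "L (i, j) (z + t *\<^sub>R ?c) > 0" "L (i, j) (z - t *\<^sub>R ?c) < 0" by auto
  moreover have "z + t *\<^sub>R ?c \<in> Q" "z - t *\<^sub>R ?c \<in> Q" using b e by auto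
  ultimately show False using a Q_root[of "z - t *\<^sub>R ?c"] Q_edge[of "z + t *\<^sub>R ?c" i] ij N by auto
 qed
 show "closed_segment (P i) (P j) \<subseteq> frontier Q"
 proof
  fix z assume z: "z \<in> closed_segment (P i) (P j)"
  then have "z \<in> closure Q" using segment_in_Q[of i j] ij closure_subset by fastforce
  moreover have "z \<notin> interior Q" using one_side closed_segment_turn_zero[OF z] by (simp add: L_def)
  ultimately show "z \<in> frontier Q" by (simp add: frontier_def)
 qed
qed

text \<open>Without interleaving, both ends of the second chord lie weakly on the same side of the
  first and not both on it, so the open segment stays strictly on that side.\<close>

lemma crossing_segments:
 assumes ij: "i < j" "j < N" and kl: "k < l" "l < N" and N: "3 \<le> N" and ne: "(i, j) ~= (k, l)"
 shows "open_segment (P i) (P j) \<inter> open_segment (P k) (P l) ~= {} \<longleftrightarrow> (i < k & k < j & j < l) \<or> (k < i & i < l & l < j)"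
proof
 have *: "open_segment (P i) (P j) \<inter> open_segment (P k) (P l) ~= {}" if "i < k" "k < j" "j < l" "l < N" for i j k l
  by (rule segments_cross; use L_vertex[of i j k] L_vertex[of i j l] L_vertex[of k l i] L_vertex[of k l j] that in \<open>simp add: L_def\<close>)
 assume "(i < k & k < j & j < l) \<or> (k < i & i < l & l < j)"
 then show "open_segment (P i) (P j) \<inter> open_segment (P k) (P l) ~= {}"
  using *[of i k j l] *[of k i l j] ij kl by (auto simp: Int_commute)
next
 assume I: "open_segment (P i) (P j) \<inter> open_segment (P k) (P l) ~= {}"
 then obtain z where z: "z \<in> open_segment (P i) (P j)" "z \<in> open_segment (P k) (P l)" by auto
 have L0: "L (i, j) z = 0" using closed_segment_turn_zero[of z "P i" "P j"] z(1) segment_open_subset_closed[of "P i" "P j"] by (auto simp: L_def open_segment_def)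
 show "(i < k & k < j & j < l) \<or> (k < i & i < l & l < j)"
 proof (rule ccontr)
  assume c: "~ ?thesis"
  let ?a = "L (i, j) (P k)" and ?b = "L (i, j) (P l)"
  note K = L_vertex[OF ij, of k] and M = L_vertex[OF ij, of l]
  have "(?a \<le> 0 & ?b \<le> 0 & (?a < 0 \<or> ?b < 0)) \<or> (?a \<ge> 0 & ?b \<ge> 0 & (?a > 0 \<or> ?b > 0))" proof -
   have "k < N" using kl by auto
   then have A: "?a > 0 \<longleftrightarrow> i < k & k < j" "?a < 0 \<longleftrightarrow> k < i \<or> j < k"
    and B: "?b > 0 \<longleftrightarrow> i < l & l < j" "?b < 0 \<longleftrightarrow> l < i \<or> j < l" using K M kl by auto
   have "(k \<le> i \<or> j \<le> k) & (l \<le> i \<or> j \<le> l) & (k < i \<or> j < k \<or> l < i \<or> j < l) \<or>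
     (i \<le> k & k \<le> j & i \<le> l & l \<le> j & (i < k & k < j \<or> i < l & l < j))" proof -
    have "i ~= k \<or> j ~= l" using ne by simp
    then show ?thesis using c ij(1) kl(1) by (cases i k rule: linorder_cases; cases j l rule: linorder_cases;
       cases k j rule: linorder_cases; cases i l rule: linorder_cases) simp_all
   qed
   then have "~ ?a > 0 & ~ ?b > 0 & (?a < 0 \<or> ?b < 0) \<or> ~ ?a < 0 & ~ ?b < 0 & (?a > 0 \<or> ?b > 0)"
    unfolding A B by auto
   then show ?thesis by (simp only: not_less)
  qed
  then show False
   using open_segment_turn_le[OF _ _ _ z(2), of "P i" "P j"] open_segment_turn_ge[OF _ _ _ z(2), of "P i" "P j"] L0
   by (auto simp: L_def)
 qed
qed

end

section \<open>Noncrossing arcs and the cells below them\<close>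

definition sub_arc :: "nat \<times> nat => nat \<times> nat => bool" where
 "sub_arc y x \<longleftrightarrow> fst x \<le> fst y & snd y \<le> snd x"

lemma sub_arc_trans: "sub_arc x y ==> sub_arc y z ==> sub_arc x z" by (auto simp: sub_arc_def)
lemma sub_arc_refl [simp]: "sub_arc x x" by (auto simp: sub_arc_def)
lemma sub_arc_antisym: "sub_arc x y ==> sub_arc y x ==> x = y" by (auto simp: sub_arc_def prod_eq_iff)

locale arc_family =
 fixes N :: nat and Bar :: "(nat \<times> nat) set"
 assumes N3: "3 \<le> N" and Bar: "x \<in> Bar ==> fst x < snd x & snd x < N"
  and Bar_nc: "x \<in> Bar ==> y \<in> Bar ==> ~ (fst x < fst y & fst y < snd x & snd x < snd y)"
  and Bar_edge: "Suc e < N ==> (e, Suc e) \<in> Bar" and Bar_root: "(0, N - 1) \<in> Bar"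
begin

text \<open>An arc spanning more than one edge stands for the cell immediately below it, so cells
  are indexed by arcs.\<close>

definition "nodes = {x \<in> Bar. Suc (fst x) < snd x}"

definition "side d x \<longleftrightarrow> d \<in> Bar & sub_arc d x &
 ~ (\<exists>y\<in>Bar. sub_arc d y & y ~= d & sub_arc y x & y ~= x)"

lemma finite_Bar: "finite Bar"
proof (rule finite_subset)
 show "Bar \<subseteq> {..N} \<times> {..N}"
 proof
  fix x assume "x \<in> Bar"
  then show "x \<in> {..N} \<times> {..N}" using Bar[of x] by (simp add: mem_Times_iff)
 qed
qed simp

lemma nested: "x \<in> Bar ==> y \<in> Bar ==> sub_arc x y \<or> sub_arc y x \<or> snd x \<le> fst y \<or> snd y \<le> fst x"
 using Bar_nc[of x y] Bar_nc[of y x] unfolding sub_arc_def by auto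

end

locale polygon_arcs = clockwise_polygon P N + arc_family N Bar for P N Bar
begin

definition "segm x = closed_segment (P (fst x)) (P (snd x))"

definition "region x = {z. L x z > 0 & (\<forall>y\<in>Bar. sub_arc y x --> y ~= x --> L y z < 0)}"

definition "closed_region x = {z. L x z \<ge> 0 & (\<forall>y\<in>Bar. sub_arc y x --> y ~= x --> L y z \<le> 0)}"

lemma L_vert:
 assumes "x \<in> Bar" "m < N"
 shows "L x (P m) > 0 \<longleftrightarrow> fst x < m & m < snd x" "L x (P m) < 0 \<longleftrightarrow> m < fst x \<or> snd x < m"
  "L x (P m) = 0 \<longleftrightarrow> m = fst x \<or> m = snd x"
 using L_vertex[of "fst x" "snd x" m] Bar[OF assms(1)] assms(2) by auto

lemma L_segm: "z \<in> segm x ==> L x z = 0" using closed_segment_turn_zero by (simp add: segm_def L_def)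

lemma on_segm: "x \<in> Bar ==> z \<in> Q ==> L x z = 0 ==> z \<in> segm x"
 using line_in_Q[of "fst x" "snd x" z] Bar[of x] N3 by (auto simp: segm_def)

lemma segm_Q: "x \<in> Bar ==> segm x \<subseteq> Q" using segment_in_Q[of "fst x" "snd x"] Bar[of x] by (auto simp: segm_def)

lemma open_region: "open (region x)"
proof -
 have "region x = {z. L x z > 0} \<inter> (\<Inter>y\<in>{y \<in> Bar. sub_arc y x & y ~= x}. {z. L y z < 0})"
  by (auto simp: region_def)
 then show ?thesis using finite_Bar by (auto simp: L_def turn_halfspaces intro!: open_Int open_INT)
qed

lemma convex_region: "convex (region x)"
proof -
 have "region x = {z. L x z > 0} \<inter> (\<Inter>y\<in>{y \<in> Bar. sub_arc y x & y ~= x}. {z. L y z < 0})"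
  by (auto simp: region_def)
 then show ?thesis by (auto simp: L_def turn_halfspaces intro!: convex_Int convex_INT)
qed

lemma closed_region_alt:
 "closed_region x = {z. L x z \<ge> 0} \<inter> (\<Inter>y\<in>{y \<in> Bar. sub_arc y x & y ~= x}. {z. L y z \<le> 0})"
 by (auto simp: closed_region_def)

lemma closed_closed_region: "closed (closed_region x)"
 unfolding closed_region_alt by (auto simp: L_def turn_halfspaces intro!: closed_Int closed_INT)

lemma convex_closed_region: "convex (closed_region x)"
 unfolding closed_region_alt by (auto simp: L_def turn_halfspaces intro!: convex_Int convex_INT)

lemma node: "x \<in> nodes ==> x \<in> Bar & Suc (fst x) < snd x & snd x < N" using Bar[of x] by (auto simp: nodes_def)

lemma region_hull:
 assumes x: "x \<in> nodes" and z: "z \<in> region x" shows "z \<in> convex hull (P ` {fst x..snd x})"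
proof (rule hull_mem)
 show "fst x + 2 \<le> snd x" "snd x < N" using node[OF x] by auto
 show "0 \<le> L (fst x, snd x) z" using z by (simp add: region_def)
 fix e assume e: "fst x \<le> e" "e < snd x"
 then have "(e, Suc e) \<in> Bar" using node[OF x] Bar_edge by auto
 moreover have "sub_arc (e, Suc e) x" "(e, Suc e) ~= x" using e node[OF x] by (auto simp: sub_arc_def)
 ultimately show "L (e, Suc e) z \<le> 0" using z unfolding region_def by fastforce
qed

lemma region_Q: "x \<in> nodes ==> region x \<subseteq> Q"
proof
 fix z assume x: "x \<in> nodes" "z \<in> region x"
 have "convex hull (P ` {fst x..snd x}) \<subseteq> Q" unfolding Q_def by (rule hull_mono) (use node[OF x(1)] in auto)
 then show "z \<in> Q" using region_hull[OF x] by blast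
qed

text \<open>For nested arcs the two regions lie on opposite sides of the smaller arc. For arcs side
  by side, one region lies in the hull of vertices that are all on the wrong side of the other
  arc.\<close>

lemma region_disjoint:
 assumes x: "x \<in> nodes" and y: "y \<in> nodes" and ne: "x ~= y" shows "region x \<inter> region y = {}"
proof (rule ccontr)
 assume "region x \<inter> region y ~= {}"
 then obtain z where z: "z \<in> region x" "z \<in> region y" by auto
 have xB: "x \<in> Bar" "y \<in> Bar" using x y by (auto simp: nodes_def)
 have pos: "L x z > 0" "L y z > 0" using z by (auto simp: region_def)
 have "~ sub_arc x y" "~ sub_arc y x" using z pos xB ne unfolding region_def by fastforce+
 then have d: "snd x \<le> fst y \<or> snd y \<le> fst x" using nested[OF xB] by auto
 have "L y z \<le> 0" unfolding L_def
 proof (rule turn_hull_le[OF _ region_hull[OF x z(1)]])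
  fix w assume "w \<in> P ` {fst x..snd x}"
  then obtain m where m: "w = P m" "fst x \<le> m" "m \<le> snd x" by auto
  then have "~ L y (P m) > 0" using L_vert(1)[OF xB(2), of m] d node[OF x] by auto
  then show "turn (P (fst y)) (P (snd y)) w \<le> 0" by (simp add: m L_def)
 qed
 then show False using pos by simp
qed

lemma region_nonempty: "x \<in> nodes ==> region x ~= {}"
proof -
 assume x: "x \<in> nodes"
 let ?i = "fst x" and ?j = "snd x"
 \<comment> \<open>The point will be the centroid of the triangle on the two ends of
   \<open>x\<close> and the farthest neighbour \<open>c\<close> of its left end before the right
   end. No arc strictly below \<open>x\<close> passes over \<open>c\<close>, so each of them has the
   three corners weakly on its outer side, not all on its line.\<close>
 define S where "S = {v. v < ?j & (?i, v) \<in> Bar}"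
 have fin: "finite S" unfolding S_def by (rule finite_subset[of _ "{..?j}"]) auto
 have "Suc ?i \<in> S" unfolding S_def using node[OF x] Bar_edge by auto
 then have cS: "Max S \<in> S" using fin Max_in by blast
 define c where "c = Max S"
 have c: "c < ?j" "(?i, c) \<in> Bar" using cS by (auto simp: S_def c_def)
 have ic: "?i < c" using Bar[OF c(2)] by simp
 have cmax: "v \<le> c" if "v < ?j" "(?i, v) \<in> Bar" for v
  unfolding c_def using fin that by (intro Max_ge) (auto simp: S_def)
 define w where "w = (1/3) *\<^sub>R (P ?i + P c + P ?j)"
 have Lw: "L y w = (L y (P ?i) + L y (P c) + L y (P ?j)) / 3" for y by (simp add: L_def turn_eq w_def field_simps)
 have lt: "?i < N" "c < N" "?j < N" using node[OF x] c by auto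
 have "L x w > 0" using L_vert[of x ?i] L_vert[of x c] L_vert[of x ?j] node[OF x] lt ic c(1) by (simp add: Lw)
 moreover have "L y w < 0" if y: "y \<in> Bar" "sub_arc y x" "y ~= x" for y proof -
  have "~ (fst y < c & c < snd y)"
  proof
   assume a: "fst y < c & c < snd y"
   have "fst y = ?i" using Bar_nc[OF c(2) y(1)] a y(2) by (auto simp: sub_arc_def)
   then have "snd y < ?j" using y by (auto simp: sub_arc_def prod_eq_iff)
   then show False using cmax[of "snd y"] y a \<open>fst y = ?i\<close> by (metis leD prod.collapse)
  qed
  then have "~ L y (P ?i) > 0" "~ L y (P c) > 0" "~ L y (P ?j) > 0"
   using L_vert(1)[OF y(1)] lt y(2) by (auto simp: sub_arc_def)
  moreover have "L y (P ?i) ~= 0 \<or> L y (P c) ~= 0 \<or> L y (P ?j) ~= 0" proof -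
   have "~ (?i \<in> {fst y, snd y} & c \<in> {fst y, snd y} & ?j \<in> {fst y, snd y})" using ic c(1) by auto
   then show ?thesis using L_vert(3)[OF y(1)] lt by auto
  qed
  ultimately show ?thesis unfolding Lw by (simp add: not_less) linarith
 qed
 ultimately have "w \<in> region x" by (simp add: region_def)
 then show ?thesis by blast
qed

text \<open>Starting from a point of the region, the open segment to any point of the weak
  intersection satisfies all inequalities strictly.\<close>

lemma closure_region:
 assumes x: "x \<in> nodes" shows "closure (region x) = closed_region x"
proof
 have "region x \<subseteq> closed_region x" by (auto simp: region_def closed_region_def intro: less_imp_le)
 then show "closure (region x) \<subseteq> closed_region x" using closed_closed_region by (simp add: closure_minimal)
 obtain z0 where z0: "z0 \<in> region x" using region_nonempty[OF x] by blast
 show "closed_region x \<subseteq> closure (region x)"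
 proof
  fix w assume w: "w \<in> closed_region x"
  show "w \<in> closure (region x)"
  proof (cases "w = z0")
   case True then show ?thesis using z0 closure_subset by blast
  next
   case False
   have "open_segment w z0 \<subseteq> region x"
   proof
    fix z assume z: "z \<in> open_segment w z0"
    have "L x z > 0" unfolding L_def
     by (rule open_segment_turn_ge[OF _ _ _ z]) (use w z0 in "auto simp: region_def closed_region_def L_def")
    moreover have "L y z < 0" if "y \<in> Bar" "sub_arc y x" "y ~= x" for y unfolding L_def
     by (rule open_segment_turn_le[OF _ _ _ z]) (use w z0 that in "auto simp: region_def closed_region_def L_def less_imp_le")
    ultimately show "z \<in> region x" by (simp add: region_def)
   qed
   then have "closure (open_segment w z0) \<subseteq> closure (region x)" by (rule closure_mono)
   then show ?thesis using False by (auto simp: closure_open_segment)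
  qed
 qed
qed

lemma vertex_closed_region:
 assumes x: "x \<in> nodes" and v: "v < N"
 shows "P v \<in> closed_region x \<longleftrightarrow> fst x \<le> v & v \<le> snd x &
  (\<forall>y\<in>Bar. sub_arc y x --> y ~= x --> ~ (fst y < v & v < snd y))"
proof -
 have xB: "x \<in> Bar" using node[OF x] by simp
 have "L x (P v) \<ge> 0 \<longleftrightarrow> fst x \<le> v & v \<le> snd x" using L_vert(2)[OF xB v] by auto
 moreover have "L y (P v) \<le> 0 \<longleftrightarrow> ~ (fst y < v & v < snd y)" if "y \<in> Bar" for y
  using L_vert(1)[OF that v] by auto
 ultimately show ?thesis unfolding closed_region_def by auto
qed

lemma segm_region: "d \<in> Bar ==> x \<in> nodes ==> segm d \<inter> region x = {}"
proof (rule ccontr)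
 assume d: "d \<in> Bar" and x: "x \<in> nodes" and "segm d \<inter> region x ~= {}"
 then obtain z where z: "z \<in> segm d" "z \<in> region x" by auto
 have xB: "x \<in> Bar" using node[OF x] by simp
 have pos: "L x z > 0" using z by (simp add: region_def)
 have "~ sub_arc d x" using z d L_segm[OF z(1)] pos unfolding region_def by fastforce
 then have out: "~ (fst x < fst d & fst d < snd x)" "~ (fst x < snd d & snd d < snd x)"
  using nested[OF d xB] Bar[OF d] by (auto simp: sub_arc_def)
 have dN: "fst d < N" "snd d < N" using Bar[OF d] by auto
 have "L x z \<le> 0" using closed_segment_turn_le[of "P (fst x)" "P (snd x)" "P (fst d)" "P (snd d)" z]
   L_vert(1)[OF xB dN(1)] L_vert(1)[OF xB dN(2)] out z(1) by (simp add: segm_def L_def not_less)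
 then show False using pos by simp
qed

text \<open>The segment avoids the open region, and the closed region is convex, so the question
  reduces to the two ends; an end fails exactly when some arc strictly below \<open>x\<close> passes
  over it.\<close>

lemma segm_frontier:
 assumes d: "d \<in> Bar" and x: "x \<in> nodes" shows "segm d \<subseteq> frontier (region x) \<longleftrightarrow> side d x"
proof -
 have xB: "x \<in> Bar" using node[OF x] by simp
 have dN: "fst d < N" "snd d < N" "fst d < snd d" using Bar[OF d] by auto
 have "segm d \<subseteq> frontier (region x) \<longleftrightarrow> segm d \<subseteq> closed_region x"
  using segm_region[OF d x] interior_open[OF open_region, of x] unfolding frontier_def closure_region[OF x] by auto
 also have "\<dots> \<longleftrightarrow> P (fst d) \<in> closed_region x & P (snd d) \<in> closed_region x"
  using convex_closed_region[of x] closed_segment_subset by (auto simp: segm_def)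
 also have "\<dots> \<longleftrightarrow> side d x"
 proof
  assume a: "P (fst d) \<in> closed_region x & P (snd d) \<in> closed_region x"
  then have s: "sub_arc d x" using vertex_closed_region[OF x] dN by (auto simp: sub_arc_def)
  have "False" if y: "y \<in> Bar" "sub_arc d y" "y ~= d" "sub_arc y x" "y ~= x" for y proof -
   have "fst y < fst d \<or> snd d < snd y" using y(2,3) by (auto simp: sub_arc_def prod_eq_iff)
   then have "(fst y < fst d & fst d < snd y) \<or> (fst y < snd d & snd d < snd y)" using y(2) dN by (auto simp: sub_arc_def)
   then show False using a vertex_closed_region[OF x dN(1)] vertex_closed_region[OF x dN(2)] y by blast
  qed
  then show "side d x" unfolding side_def using d s by blast
 next
  assume a: "side d x"
  have no: "~ (fst y < v & v < snd y)" if "y \<in> Bar" "sub_arc y x" "y ~= x" "v = fst d \<or> v = snd d" for y v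
  proof
   assume v: "fst y < v & v < snd y"
   have "sub_arc d y" using Bar_nc[OF d that(1)] Bar_nc[OF that(1) d] that(4) v dN by (auto simp: sub_arc_def)
   moreover have "y ~= d" using v that(4) by auto
   ultimately show False using a that unfolding side_def by blast
  qed
  show "P (fst d) \<in> closed_region x & P (snd d) \<in> closed_region x"
   using vertex_closed_region[OF x dN(1)] vertex_closed_region[OF x dN(2)] no a dN by (auto simp: side_def sub_arc_def)
 qed
 finally show ?thesis .
qed

definition "support = (\<Union>x\<in>Bar. segm x)"

lemma compl_Q: "- Q \<subseteq> - support" using segm_Q by (auto simp: support_def)

text \<open>The shortest arc that has \<open>z\<close> on its inner side; the root arc is one such
  arc, and minimality puts \<open>z\<close> outside all arcs below.\<close>

lemma covering:
 assumes z: "z \<in> Q" "z \<notin> support" shows "\<exists>x\<in>nodes. z \<in> region x"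
proof -
 have nz: "L x z ~= 0" if "x \<in> Bar" for x using on_segm[OF that z(1)] z(2) that by (auto simp: support_def)
 let ?S = "{x \<in> Bar. L x z > 0}"
 have "(0, N - 1) \<in> ?S" using Q_root[OF z(1)] N3 Bar_root nz[OF Bar_root] by auto
 then obtain x where x: "x \<in> ?S" "\<And>y. y \<in> ?S ==> snd x - fst x \<le> snd y - fst y"
  using ex_has_least_nat[of "\<lambda>x. x \<in> ?S" "(0, N - 1)" "\<lambda>x. snd x - fst x"] by blast
 have "Suc (fst x) < snd x"
 proof (rule ccontr)
  assume "~ ?thesis"
  then have "snd x = Suc (fst x)" using Bar[of x] x(1) by auto
  then have "x = (fst x, Suc (fst x))" by (simp add: prod_eq_iff)
  then have "L x z \<le> 0" using Q_edge[OF z(1), of "fst x"] Bar[of x] x(1) by auto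
  then show False using x(1) by auto
 qed
 moreover have "L y z < 0" if y: "y \<in> Bar" "sub_arc y x" "y ~= x" for y proof -
  have "snd y - fst y < snd x - fst x" using y(2,3) Bar[OF y(1)] by (auto simp: sub_arc_def prod_eq_iff)
  then have "~ L y z > 0" using x(2)[of y] y(1) by auto
  then show ?thesis using nz[OF y(1)] by auto
 qed
 ultimately show ?thesis using x(1) unfolding region_def nodes_def by (intro bexI[of _ x]) simp_all
qed

lemma region_component: "x \<in> nodes ==> region x \<in> components (- support)"
proof -
 assume x: "x \<in> nodes"
 have sub: "region x \<subseteq> - support" using segm_region[OF _ x] by (auto simp: support_def)
 have "D = region x" if D: "region x \<subseteq> D" "D \<subseteq> - support" "connected D" for D proof -
  \<comment> \<open>All other regions together with the outside of the polygon: an open set disjoint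
    from this region which covers the rest of the complement of the arcs.\<close>
  let ?V = "(\<Union>y\<in>nodes - {x}. region y) \<union> - Q"
  have "closed Q" unfolding Q_def by (intro compact_imp_closed compact_convex_hull finite_imp_compact) auto
  then have "open ?V" by (intro open_Un open_UN ballI open_region) (simp add: open_Compl)
  moreover have "D \<subseteq> region x \<union> ?V" using D(2) covering by blast
  moreover have "region x \<inter> ?V = {}" using region_disjoint[OF x] region_Q[OF x] by blast
  moreover have "region x \<inter> D ~= {}" using region_nonempty[OF x] D(1) by blast
  ultimately have "?V \<inter> D = {}" using connectedD[OF D(3) open_region[of x], of ?V] by blast
  then show ?thesis using \<open>D \<subseteq> region x \<union> ?V\<close> D(1) by blast
 qed
 then show ?thesis unfolding in_components_maximal using sub region_nonempty[OF x] convex_connected[OF convex_region] by blast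
qed

lemma bounded_Q: "bounded Q" unfolding Q_def by (intro compact_imp_bounded compact_convex_hull finite_imp_compact) auto

lemma bounded_components: "{C \<in> components (- support). bounded C} = region ` nodes"
proof
 show "region ` nodes \<subseteq> {C \<in> components (- support). bounded C}"
  using region_component bounded_subset[OF bounded_Q region_Q] by auto
 show "{C \<in> components (- support). bounded C} \<subseteq> region ` nodes"
 proof clarify
  fix C assume C: "C \<in> components (- support)" "bounded C"
  have Cs: "C \<subseteq> - support" "C ~= {}" using C(1) in_components_subset in_components_nonempty by blast+
  show "C \<in> region ` nodes"
  proof (cases "\<exists>x\<in>nodes. C \<inter> region x ~= {}")
   case True
   then obtain x where x: "x \<in> nodes" "C \<inter> region x ~= {}" by blast
   then have "C = region x" using components_nonoverlap[OF C(1) region_component[OF x(1)]] by blast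
   then show ?thesis using x by blast
  next
   case False
   then have "C \<subseteq> - Q" using covering Cs by blast
   moreover have "connected (- Q)" by (rule connected_complement_bounded_convex[OF bounded_Q]) (auto simp: Q_def)
   ultimately have "- Q = C" using C(1) compl_Q Cs unfolding in_components_maximal by blast
   then have "bounded (- Q)" using C(2) by simp
   then show ?thesis using cobounded_imp_unbounded bounded_Q by blast
  qed
 qed
qed

lemma inj_region: "inj_on region nodes" using region_disjoint region_nonempty by (auto simp: inj_on_def) blast+

lemma sub_arc_L:
 assumes d: "d \<in> Bar" and e: "e \<in> Bar"
 shows "sub_arc e d ==> z \<in> segm e ==> L d z \<ge> 0" "~ sub_arc e d ==> z \<in> segm e ==> L d z \<le> 0"
proof -
 have eN: "fst e < N" "snd e < N" "fst e < snd e" using Bar[OF e] by auto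
 show "sub_arc e d ==> z \<in> segm e ==> L d z \<ge> 0"
  using closed_segment_turn_ge[of "P (fst d)" "P (snd d)" "P (fst e)" "P (snd e)" z]
   L_vert(2)[OF d eN(1)] L_vert(2)[OF d eN(2)] eN(3) by (simp add: segm_def L_def sub_arc_def not_less[symmetric])
 assume ns: "~ sub_arc e d"
 have "~ (fst d < fst e & fst e < snd d)" "~ (fst d < snd e & snd e < snd d)"
  using nested[OF d e] ns eN by (auto simp: sub_arc_def)
 then have "L d (P (fst e)) \<le> 0" "L d (P (snd e)) \<le> 0"
  using L_vert(1)[OF d eN(1)] L_vert(1)[OF d eN(2)] by (simp_all only: not_less[symmetric] not_False_eq_True)
 then show "z \<in> segm e ==> L d z \<le> 0"
  using closed_segment_turn_le[of "P (fst d)" "P (snd d)" "P (fst e)" "P (snd e)" z] by (simp add: segm_def L_def)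
qed

lemma midpoint_L:
 assumes d: "d \<in> Bar" and e: "e \<in> Bar" and ne: "e ~= d"
 defines "m \<equiv> midpoint (P (fst e)) (P (snd e))" shows "m \<in> segm e" "L d m ~= 0"
proof -
 show m: "m \<in> segm e" by (simp add: segm_def m_def)
 have eN: "fst e < N" "snd e < N" "fst e < snd e" using Bar[OF e] by auto
 have Lm: "L d m = (L d (P (fst e)) + L d (P (snd e))) / 2" by (simp add: L_def turn_eq m_def midpoint_def field_simps)
 have ends: "P (fst e) \<in> segm e" "P (snd e) \<in> segm e" by (auto simp: segm_def)
 have nz: "L d (P (fst e)) ~= 0 \<or> L d (P (snd e)) ~= 0" using L_vert(3)[OF d] eN ne Bar[OF d] by (auto simp: prod_eq_iff)
 show "L d m ~= 0" using sub_arc_L(1)[OF d e _ ends(1)] sub_arc_L(1)[OF d e _ ends(2)]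
   sub_arc_L(2)[OF d e _ ends(1)] sub_arc_L(2)[OF d e _ ends(2)] nz unfolding Lm by (cases "sub_arc e d") auto
qed

text \<open>The line of \<open>d\<close> meets the polygon exactly in the segment of
  \<open>d\<close>. Points strictly on one side are joined by a straight segment; a connected set
  with points weakly on both sides meets the line.\<close>

lemma separated_iff:
 assumes d: "d \<in> Bar" and e: "e \<in> Bar" and f: "f \<in> Bar"
 shows "(\<forall>x\<in>segm e - segm d. \<forall>y\<in>segm f - segm d. ~ connected_component (Q - segm d) x y) \<longleftrightarrow>
  d = e \<or> d = f \<or> sub_arc e d ~= sub_arc f d"
proof
 assume a: "\<forall>x\<in>segm e - segm d. \<forall>y\<in>segm f - segm d. ~ connected_component (Q - segm d) x y"
 show "d = e \<or> d = f \<or> sub_arc e d ~= sub_arc f d"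
 proof (rule ccontr)
  assume c: "~ ?thesis"
  let ?x = "midpoint (P (fst e)) (P (snd e))" and ?y = "midpoint (P (fst f)) (P (snd f))"
  have x: "?x \<in> segm e" "L d ?x ~= 0" and y: "?y \<in> segm f" "L d ?y ~= 0"
   using midpoint_L[OF d e] midpoint_L[OF d f] c by auto
  then have xy: "?x \<in> segm e - segm d" "?y \<in> segm f - segm d" using L_segm[of _ d] by auto
  have same: "(L d ?x > 0 & L d ?y > 0) \<or> (L d ?x < 0 & L d ?y < 0)"
   using sub_arc_L[OF d e, of ?x] sub_arc_L[OF d f, of ?y] x y c by (cases "sub_arc e d") auto
  have "closed_segment ?x ?y \<subseteq> Q - segm d"
  proof
   fix z assume z: "z \<in> closed_segment ?x ?y"
   have "?x \<in> Q" "?y \<in> Q" using x y segm_Q e f by blast+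
   then have "z \<in> Q" using z closed_segment_subset[of ?x Q ?y] by (auto simp: Q_def)
   moreover have "L d z ~= 0" using same
   proof
    assume s: "L d ?x > 0 & L d ?y > 0"
    have "closed_segment ?x ?y \<subseteq> {z. turn (P (fst d)) (P (snd d)) z > 0}"
     by (rule closed_segment_subset) (use s turn_halfspaces in "auto simp: L_def")
    then show ?thesis using z by (auto simp: L_def)
   next
    assume s: "L d ?x < 0 & L d ?y < 0"
    have "closed_segment ?x ?y \<subseteq> {z. turn (P (fst d)) (P (snd d)) z < 0}"
     by (rule closed_segment_subset) (use s turn_halfspaces in "auto simp: L_def")
    then show ?thesis using z by (auto simp: L_def)
   qed
   ultimately show "z \<in> Q - segm d" using L_segm[of _ d] by auto
  qed
  then have "connected_component (Q - segm d) ?x ?y"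
   unfolding connected_component_def by (intro exI[of _ "closed_segment ?x ?y"]) auto
  then show False using a xy by blast
 qed
next
 assume a: "d = e \<or> d = f \<or> sub_arc e d ~= sub_arc f d"
 show "\<forall>x\<in>segm e - segm d. \<forall>y\<in>segm f - segm d. ~ connected_component (Q - segm d) x y"
 proof (intro ballI notI)
  fix x y assume x: "x \<in> segm e - segm d" and y: "y \<in> segm f - segm d" and "connected_component (Q - segm d) x y"
  then obtain T where T: "connected T" "T \<subseteq> Q - segm d" "x \<in> T" "y \<in> T"
   by (auto simp: connected_component_def)
  have ns: "sub_arc e d ~= sub_arc f d" using a x y by auto
  have sg: "L d x \<ge> 0 & L d y \<le> 0 \<or> L d x \<le> 0 & L d y \<ge> 0"
   using sub_arc_L[OF d e, of x] sub_arc_L[OF d f, of y] x y ns by (cases "sub_arc e d") auto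
  have "\<exists>z\<in>T. L d z = 0" using sg
  proof
   assume "L d x \<ge> 0 & L d y \<le> 0"
   then show ?thesis using connected_ivt_hyperplane[OF T(1) T(4) T(3)] by (force simp: L_def turn_def)
  next
   assume "L d x \<le> 0 & L d y \<ge> 0"
   then show ?thesis using connected_ivt_hyperplane[OF T(1) T(3) T(4)] by (force simp: L_def turn_def)
  qed
  then show False using T(2) on_segm[OF d] by blast
 qed
qed

end

section \<open>The tree of a dissection\<close>

primrec arcs :: "tr => nat => (nat \<times> nat) set" where
 "arcs Lf l = {(l, Suc l)}"
| "arcs (Nd r a b) l =
   (if r then {(l, l + (leaves a + leaves b))} else {}) \<union> arcs a l \<union> arcs b (l + leaves a)"

text \<open>The maximal real arcs at or below the node. For a virtual node these are the sides of
  the surrounding cell that lie in its interval.\<close>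

primrec tops :: "tr => nat => (nat \<times> nat) set" where
 "tops Lf l = {(l, Suc l)}"
| "tops (Nd r a b) l =
   (if r then {(l, l + (leaves a + leaves b))} else tops a l \<union> tops b (l + leaves a))"

lemma arcs_bounds: "x \<in> arcs t l ==> l \<le> fst x & fst x < snd x & snd x \<le> l + leaves t"
proof (induction t arbitrary: l)
 case (Nd r a b)
 then show ?case using leaves_pos[of a] leaves_pos[of b] by (fastforce split: if_splits)
qed auto

lemma tops_arcs: "tops t l \<subseteq> arcs t l" by (induction t arbitrary: l) fastforce+

lemma tops_real: "real_top t ==> tops t l = {(l, l + leaves t)}" by (cases t) auto

lemma tops_cover:
 "l \<le> s ==> s < l + leaves t ==> \<exists>\<tau>. {x \<in> tops t l. fst x \<le> s & s < snd x} = {\<tau>}"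
proof (induction t arbitrary: l)
 case Lf
 have "{x \<in> tops Lf l. fst x \<le> s & s < snd x} = {(l, Suc l)}" using Lf by auto
 then show ?case by blast
next
 case (Nd r a b)
 show ?case
 proof (cases r)
  case True
  then have "{x \<in> tops (Nd r a b) l. fst x \<le> s & s < snd x} = {(l, l + (leaves a + leaves b))}" using Nd.prems by auto
  then show ?thesis by blast
 next
  case False
  show ?thesis
  proof (cases "s < l + leaves a")
   case True
   then have "{x \<in> tops (Nd r a b) l. fst x \<le> s & s < snd x} = {x \<in> tops a l. fst x \<le> s & s < snd x}"
    using False tops_arcs[of b "l + leaves a"] arcs_bounds[of _ b "l + leaves a"] by fastforce
   then show ?thesis using Nd.IH(1)[of l] Nd.prems True by simp
  next
   case F: False
   then have "{x \<in> tops (Nd r a b) l. fst x \<le> s & s < snd x} =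
     {x \<in> tops b (l + leaves a). fst x \<le> s & s < snd x}"
    using False tops_arcs[of a l] arcs_bounds[of _ a l] by fastforce
   then show ?thesis using Nd.IH(2)[of "l + leaves a"] Nd.prems F by simp
  qed
 qed
qed

lemma under_top: "x \<in> arcs t l ==> \<exists>\<tau>\<in>tops t l. sub_arc x \<tau>"
proof (induction t arbitrary: l)
 case (Nd r a b)
 show ?case
 proof (cases r)
  case True
  then show ?thesis using arcs_bounds[OF Nd.prems] by (auto simp: sub_arc_def)
 next
  case False
  then show ?thesis using Nd by (simp split: if_splits) blast
 qed
qed auto

lemma top_maximal: "\<tau> \<in> tops t l ==> x \<in> arcs t l ==> sub_arc \<tau> x ==> x = \<tau>"
proof (induction t arbitrary: l)
 case (Nd r a b)
 let ?k = "l + leaves a"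
 show ?case
 proof (cases r)
  case True
  then have "\<tau> = (l, l + (leaves a + leaves b))" using Nd.prems by simp
  then show ?thesis using Nd.prems(3) arcs_bounds[OF Nd.prems(2)] by (auto simp: sub_arc_def prod_eq_iff)
 next
  case False
  then have t: "\<tau> \<in> tops a l \<or> \<tau> \<in> tops b ?k" and x: "x \<in> arcs a l \<or> x \<in> arcs b ?k"
   using Nd.prems by auto
  have "\<tau> \<in> tops a l ==> snd \<tau> \<le> ?k & fst \<tau> < snd \<tau>" "\<tau> \<in> tops b ?k ==> ?k \<le> fst \<tau> & fst \<tau> < snd \<tau>"
   using tops_arcs arcs_bounds by blast+
  moreover have "x \<in> arcs a l ==> snd x \<le> ?k" "x \<in> arcs b ?k ==> ?k \<le> fst x" using arcs_bounds by blast+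
  ultimately have "(\<tau> \<in> tops a l & x \<in> arcs a l) \<or> (\<tau> \<in> tops b ?k & x \<in> arcs b ?k)"
   using t x Nd.prems(3) unfolding sub_arc_def by (meson leD le_less_trans less_le_trans)
  then show ?thesis using Nd.IH Nd.prems(3) by blast
 qed
qed auto

text \<open>The cut is at the end \<open>k\<close> of the longest proper arc starting at
  \<open>i\<close>. No arc of \<open>B\<close> strictly inside passes over \<open>k\<close>, so all
  others lie in one of the two parts. The left part is an arc of \<open>B\<close>; the right part
  need not be one, and then it keeps \<open>j\<close> as its right end.\<close>

lemma ex_tree:
 fixes B :: "(nat \<times> nat) set"
 assumes lt: "\<And>x. x \<in> B ==> fst x < snd x"
  and nc: "\<And>x y. x \<in> B ==> y \<in> B ==> ~ (fst x < fst y & fst y < snd x & snd x < snd y)"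
  and edge: "\<And>e. i \<le> e ==> e < j ==> (e, Suc e) \<in> B" and ij: "i < j"
 shows "\<exists>t. wf_tr t & i + leaves t = j & arcs t i = {x \<in> B. sub_arc x (i, j)} & (real_top t \<longleftrightarrow> (i, j) \<in> B)"
 using edge ij
proof (induction "j - i" arbitrary: i j rule: less_induct)
 case less
 show ?case
 proof (cases "j = Suc i")
  case True
  have "{x \<in> B. sub_arc x (i, j)} = {(i, Suc i)}" using True less.prems(1)[of i] lt by (auto simp: sub_arc_def) fastforce+
  then show ?thesis using True less.prems(1)[of i] by (intro exI[of _ Lf]) auto
 next
  case False
  define S where "S = {v. v < j & (i, v) \<in> B}"
  have fin: "finite S" unfolding S_def by (rule finite_subset[of _ "{..j}"]) auto
  have "Suc i \<in> S" unfolding S_def using less.prems False by auto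
  then have "Max S \<in> S" using fin Max_in by blast
  define k where "k = Max S"
  have k: "k < j" "(i, k) \<in> B" using \<open>Max S \<in> S\<close> by (auto simp: S_def k_def)
  have ik: "i < k" using lt[OF k(2)] by simp
  have kmax: "v \<le> k" if "v < j" "(i, v) \<in> B" for v unfolding k_def using fin that by (intro Max_ge) (auto simp: S_def)
  have dec: "k - i < j - i" "j - k < j - i" using k ik by linarith+
  obtain a where a: "wf_tr a" "i + leaves a = k" "arcs a i = {x \<in> B. sub_arc x (i, k)}" "real_top a"
   using less.hyps[OF dec(1)] less.prems k ik by auto
  obtain b where b: "wf_tr b" "k + leaves b = j" "arcs b k = {x \<in> B. sub_arc x (k, j)}"
   using less.hyps[OF dec(2)] less.prems k ik by auto
  let ?t = "Nd ((i, j) \<in> B) a b"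
  have "x = (i, j) \<or> sub_arc x (i, k) \<or> sub_arc x (k, j)" if x: "x \<in> B" "sub_arc x (i, j)" for x
  proof (rule ccontr)
   assume c: "~ ?thesis"
   then have m: "fst x < k" "k < snd x" using x(2) by (auto simp: sub_arc_def)
   then have "fst x = i" using nc[OF k(2) x(1)] x(2) by (auto simp: sub_arc_def)
   moreover have "snd x < j" using c x(2) \<open>fst x = i\<close> by (auto simp: sub_arc_def prod_eq_iff)
   ultimately show False using kmax[of "snd x"] m x(1) by (metis leD prod.collapse)
  qed
  then have "{x \<in> B. sub_arc x (i, j)} = (if (i, j) \<in> B then {(i, j)} else {}) \<union> arcs a i \<union> arcs b k"
   unfolding a b using ik k(1) by (auto simp: sub_arc_def)
  moreover have "i + (leaves a + leaves b) = j" using a b by simp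
  ultimately have "arcs ?t i = {x \<in> B. sub_arc x (i, j)}" using a(2) by simp
  then show ?thesis using a b by (intro exI[of _ ?t]) auto
 qed
qed

definition share :: "nat \<times> nat => nat \<times> nat => bool" where
 "share d e \<longleftrightarrow> fst d = fst e \<or> fst d = snd e \<or> snd d = fst e \<or> snd d = snd e"

definition empty_or_incident :: "(nat \<times> nat) set => bool" where
 "empty_or_incident X \<longleftrightarrow> X = {} \<or> (\<exists>d e. X = {d, e} & d ~= e & share d e)"

lemma share_sym: "share d e ==> share e d" by (auto simp: share_def)

lemma empty_or_incident_pair: "d ~= e ==> empty_or_incident {d, e} \<longleftrightarrow> share d e"
 unfolding empty_or_incident_def by (metis doubleton_eq_iff empty_not_insert share_sym)

lemma empty_or_incident_empty [simp]: "empty_or_incident {}" by (simp add: empty_or_incident_def)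

section \<open>Accordions as sets of arcs crossed by a chord\<close>

context arc_family begin

definition "acc A \<longleftrightarrow> A \<subseteq> Bar & (\<forall>x\<in>nodes. empty_or_incident {d \<in> A. side d x})"

text \<open>An arc separates the solid vertices \<open>s\<close> and \<open>t\<close> iff exactly
  one of them lies under it. The index \<open>N - 1\<close> lies under no arc, not even the root,
  and so acts as the outside.\<close>

definition "crossed s t = {x \<in> Bar. (fst x \<le> s & s < snd x) ~= (fst x \<le> t & t < snd x)}"

definition "emb t l \<longleftrightarrow> wf_tr t & {x \<in> Bar. sub_arc x (l, l + leaves t)} = arcs t l"

definition "good_in A t l \<longleftrightarrow> (\<forall>x\<in>nodes \<inter> arcs t l. empty_or_incident {d \<in> A. side d x})"

lemma ex_tree_Bar: obtains a b where "emb (Nd True a b) 0" "leaves (Nd True a b) = N - 1"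
proof -
 obtain t where t: "wf_tr t" "0 + leaves t = N - 1" "arcs t 0 = {x \<in> Bar. sub_arc x (0, N - 1)}"
  "real_top t \<longleftrightarrow> (0, N - 1) \<in> Bar" using ex_tree[of Bar 0 "N - 1"] Bar Bar_nc Bar_edge N3 by auto
 obtain r a b where "t = Nd r a b" using t(2) N3 by (cases t) auto
 then have "t = Nd True a b" using t(4) Bar_root by simp
 then show thesis using that[of a b] t unfolding emb_def by simp
qed

lemma emb_sub:
 assumes "emb (Nd r a b) l" shows "emb a l" "emb b (l + leaves a)" "real_top a"
proof -
 let ?k = "l + leaves a" and ?j = "l + (leaves a + leaves b)"
 have e: "{x \<in> Bar. sub_arc x (l, ?j)} = arcs (Nd r a b) l" and wf: "wf_tr (Nd r a b)" using assms by (auto simp: emb_def)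
 have pos: "leaves a > 0" "leaves b > 0" by (rule leaves_pos)+
 have A: "x \<in> arcs a l ==> sub_arc x (l, ?k)" "x \<in> arcs b ?k ==> sub_arc x (?k, ?j) & fst x < snd x" for x
  using arcs_bounds[of x a l] arcs_bounds[of x b ?k] by (auto simp: sub_arc_def)
 have B: "x \<in> arcs a l ==> fst x < snd x" for x using arcs_bounds[of x a l] by auto
 show "real_top a" using wf by simp
 have sub: "{x \<in> Bar. sub_arc x J} = {x \<in> arcs (Nd r a b) l. sub_arc x J}" if "sub_arc J (l, ?j)" for J proof -
  have "{x \<in> Bar. sub_arc x J} = {x \<in> {x \<in> Bar. sub_arc x (l, ?j)}. sub_arc x J}"
   using that sub_arc_trans by blast
  then show ?thesis unfolding e .
 qed
 have ss: "arcs a l \<subseteq> arcs (Nd r a b) l" "arcs b ?k \<subseteq> arcs (Nd r a b) l" by auto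
 have "x \<in> arcs a l" if "x \<in> arcs (Nd r a b) l" "sub_arc x (l, ?k)" for x
  using that A(2)[of x] pos by (auto simp: sub_arc_def split: if_splits)
 then have "{x \<in> arcs (Nd r a b) l. sub_arc x (l, ?k)} = arcs a l" using A(1) ss(1) by blast
 then show "emb a l" using wf sub[of "(l, ?k)"] by (simp add: emb_def sub_arc_def)
 have "x \<in> arcs b ?k" if "x \<in> arcs (Nd r a b) l" "sub_arc x (?k, ?j)" for x
  using that A(1)[of x] B[of x] pos by (auto simp: sub_arc_def split: if_splits)
 then have "{x \<in> arcs (Nd r a b) l. sub_arc x (?k, ?j)} = arcs b ?k" using A(2) ss(2) by blast
 then show "emb b ?k" using wf sub[of "(?k, ?j)"] by (simp add: emb_def sub_arc_def add.assoc)
qed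

lemma emb_arcs: "emb t l ==> x \<in> arcs t l ==> x \<in> Bar" unfolding emb_def by blast

text \<open>The triangle of a real node is part of the cell below it, and virtual children only
  continue that cell; so its sides are the arc itself and the maximal real arcs of both
  children.\<close>

lemma side_top:
 assumes e: "emb (Nd True a b) l" shows "side d (l, l + (leaves a + leaves b)) \<longleftrightarrow>
  d \<in> {(l, l + (leaves a + leaves b))} \<union> tops a l \<union> tops b (l + leaves a)"
proof -
 let ?k = "l + leaves a" and ?j = "l + (leaves a + leaves b)" and ?x = "(l, l + (leaves a + leaves b))"
 have AA: "{x \<in> Bar. sub_arc x ?x} = arcs (Nd True a b) l" using e by (simp add: emb_def)
 have inner: "y \<in> arcs a l \<union> arcs b ?k \<longleftrightarrow> y \<in> Bar & sub_arc y ?x & y ~= ?x" for y proof -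
  have "?x \<notin> arcs a l" "?x \<notin> arcs b ?k"
   using arcs_bounds[of ?x a l] arcs_bounds[of ?x b ?k] leaves_pos[of a] leaves_pos[of b] by auto
  then show ?thesis using AA by auto
 qed
 have maxl: "y = d" if "d \<in> tops a l \<union> tops b ?k" "y \<in> arcs a l \<union> arcs b ?k" "sub_arc d y" for y
  using top_maximal[of d "Nd False a b" l y] that by simp
 show ?thesis
 proof
  assume s: "side d ?x"
  show "d \<in> {?x} \<union> tops a l \<union> tops b ?k"
  proof (cases "d = ?x")
   case False
   then have "d \<in> arcs (Nd False a b) l" using s inner[of d] by (simp add: side_def)
   then obtain \<tau> where \<tau>: "\<tau> \<in> tops (Nd False a b) l" "sub_arc d \<tau>" using under_top by blast
   then have "\<tau> \<in> arcs a l \<union> arcs b ?k" using tops_arcs[of "Nd False a b" l] by auto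
   then have "\<tau> = d" using s inner[of \<tau>] \<tau>(2) unfolding side_def by blast
   then show ?thesis using \<tau> by auto
  qed simp
 next
  assume d: "d \<in> {?x} \<union> tops a l \<union> tops b ?k"
  show "side d ?x"
  proof (cases "d = ?x")
   case True
   then show ?thesis using AA sub_arc_antisym by (auto simp: side_def)
  next
   case False
   then have dt: "d \<in> tops a l \<union> tops b ?k" using d by auto
   then have "d \<in> arcs a l \<union> arcs b ?k" using tops_arcs by blast
   then have "d \<in> Bar" "sub_arc d ?x" using inner by blast+
   moreover have "y = d" if "y \<in> Bar" "sub_arc d y" "sub_arc y ?x" "y ~= ?x" for y
    using maxl[OF dt] inner[of y] that by blast
   ultimately show ?thesis unfolding side_def by blast
  qed
 qed
qed

lemma node_top: "emb (Nd True a b) l ==> (l, l + (leaves a + leaves b)) \<in> nodes"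
 using emb_arcs[of "Nd True a b" l "(l, l + (leaves a + leaves b))"] leaves_pos[of a] leaves_pos[of b]
 by (auto simp: nodes_def)

lemma good_in_Nd:
 assumes e: "emb (Nd r a b) l" shows "good_in A (Nd r a b) l \<longleftrightarrow>
  (r --> empty_or_incident (A \<inter> ({(l, l + (leaves a + leaves b))} \<union> tops a l \<union> tops b (l + leaves a)))) &
  good_in A a l & good_in A b (l + leaves a)"
proof -
 let ?x = "(l, l + (leaves a + leaves b))"
 have "{d \<in> A. side d ?x} = A \<inter> ({?x} \<union> tops a l \<union> tops b (l + leaves a))" if r
  using side_top[of a b l] e that by auto
 moreover have "?x \<in> nodes" if r using node_top[of a b l] e that by auto
 ultimately show ?thesis unfolding good_in_def by auto
qed

lemma good_in_Lf: "good_in A Lf l" by (auto simp: good_in_def nodes_def)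

lemma good_in_disjoint:
 assumes e: "emb t l" and d: "A \<inter> arcs t l = {}" shows "good_in A t l" using assms
proof (induction t arbitrary: l)
 case (Nd r a b)
 have "A \<inter> arcs a l = {}" "A \<inter> arcs b (l + leaves a) = {}" using Nd.prems by auto
 moreover have "A \<inter> ({(l, l + (leaves a + leaves b))} \<union> tops a l \<union> tops b (l + leaves a)) = {}" if r
  using Nd.prems that tops_arcs by fastforce
 ultimately show ?case using Nd emb_sub[OF Nd.prems(1)] good_in_Nd[OF Nd.prems(1)] by auto
qed (simp add: good_in_Lf)

lemma crossed_outside:
 assumes "emb t l" "l \<le> s" "s < l + leaves t" "~ (l \<le> s' & s' < l + leaves t)"
 shows "crossed s s' \<inter> arcs t l = {x \<in> arcs t l. fst x \<le> s & s < snd x}"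
  "crossed s' s \<inter> arcs t l = {x \<in> arcs t l. fst x \<le> s & s < snd x}"
 using assms(4) emb_arcs[OF assms(1)] arcs_bounds[of _ t l] unfolding crossed_def by fastforce+

lemma no_arc_outside:
 assumes "emb t l" "~ (l \<le> s & s < l + leaves t)" "~ (l \<le> s' & s' < l + leaves t)"
 shows "crossed s s' \<inter> arcs t l = {}" using assms(2,3) arcs_bounds[of _ t l] unfolding crossed_def by fastforce

text \<open>A path from \<open>s\<close> upwards crosses all arcs over \<open>s\<close>. In the cell
  below a real node it meets the node's arc and one further side, and these must share a vertex. For
  a virtual top the cell is not yet closed; the position of the last side crossed records which
  vertex can still be shared with the next one.\<close>

lemma good_single:
 assumes e: "emb t l" and s: "l \<le> s" "s < l + leaves t"
  and A: "A \<inter> arcs t l = {x \<in> arcs t l. fst x \<le> s & s < snd x}"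
 shows "good_in A t l & (\<exists>\<tau>\<in>tops t l. fst \<tau> = l & s < snd \<tau>) \<longleftrightarrow> s \<in> reach_left t l"
  and "good_in A t l & (\<exists>\<tau>\<in>tops t l. snd \<tau> = l + leaves t & fst \<tau> \<le> s) \<longleftrightarrow> s \<in> reach_right t l"
 using assms
proof (induction t arbitrary: l)
 case Lf
 { case 1 then show ?case by (auto simp: good_in_Lf) }
 { case 2 then show ?case by (auto simp: good_in_Lf) }
next
 case (Nd r a b)
 have both: "(good_in A (Nd r a b) l & (\<exists>\<tau>\<in>tops (Nd r a b) l. fst \<tau> = l & s < snd \<tau>) \<longleftrightarrow> s \<in> reach_left (Nd r a b) l) &
  (good_in A (Nd r a b) l & (\<exists>\<tau>\<in>tops (Nd r a b) l. snd \<tau> = l + (leaves a + leaves b) & fst \<tau> \<le> s) \<longleftrightarrow> s \<in> reach_right (Nd r a b) l)"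
  if e: "emb (Nd r a b) l" and s: "l \<le> s" "s < l + leaves (Nd r a b)"
   and A: "A \<inter> arcs (Nd r a b) l = {x \<in> arcs (Nd r a b) l. fst x \<le> s & s < snd x}" for l proof -
  let ?k = "l + leaves a" and ?j = "l + (leaves a + leaves b)" and ?x = "(l, l + (leaves a + leaves b))"
  note sub = emb_sub[OF e]
  have Aa: "A \<inter> arcs a l = {x \<in> arcs a l. fst x \<le> s & s < snd x}" using A by auto
  have Ab: "A \<inter> arcs b ?k = {x \<in> arcs b ?k. fst x \<le> s & s < snd x}" using A by auto
  have ta: "tops a l = {(l, ?k)}" using tops_real[OF sub(3)] .
  have tb: "?k \<le> fst \<tau> & fst \<tau> < snd \<tau> & snd \<tau> \<le> ?j" if "\<tau> \<in> tops b ?k" for \<tau>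
   using that tops_arcs[of b ?k] arcs_bounds[of \<tau> b ?k] by auto
  have pos: "leaves a > 0" "leaves b > 0" by (rule leaves_pos)+
  have rr: "reach_right a l = reach_left a l" using reach_real[OF sub(3)] by simp
  show ?thesis
  proof (cases "s < ?k")
   case True
   have "A \<inter> arcs b ?k = {}" using Ab True arcs_bounds[of _ b ?k] by fastforce
   then have gb: "good_in A b ?k" using good_in_disjoint[OF sub(2)] by blast
   have ga: "good_in A a l \<longleftrightarrow> s \<in> reach_left a l"
    using Nd.IH(1)[OF sub(1) s(1) True Aa] ta True by auto
   have "A \<inter> ({?x} \<union> tops a l \<union> tops b ?k) = {?x, (l, ?k)}" if r proof -
    have "?x \<in> {x \<in> arcs (Nd r a b) l. fst x \<le> s & s < snd x}" using that s by simp
    then have "?x \<in> A" using A by blast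
    moreover have "(l, ?k) \<in> {x \<in> arcs a l. fst x \<le> s & s < snd x}" using tops_arcs[of a l] ta True s by auto
    then have "(l, ?k) \<in> A" using Aa by blast
    moreover have "A \<inter> tops b ?k = {}" using \<open>A \<inter> arcs b ?k = {}\<close> tops_arcs by blast
    ultimately show ?thesis using ta by auto
   qed
   moreover have "empty_or_incident {?x, (l, ?k)}" using pos by (subst empty_or_incident_pair) (auto simp: share_def)
   ultimately have g: "good_in A (Nd r a b) l \<longleftrightarrow> s \<in> reach_left a l"
    unfolding good_in_Nd[OF e] using ga gb by auto
   have nb: "s \<notin> reach_right b ?k" using reach_bounds[of s b ?k] True by auto
   show ?thesis
   proof (cases r)
    case True
    then show ?thesis using g nb s by auto
   next
    case False
    have "~ (\<exists>\<tau>\<in>tops a l \<union> tops b ?k. snd \<tau> = ?j & fst \<tau> \<le> s)"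
     using ta tb \<open>s < ?k\<close> pos by fastforce
    moreover have "\<exists>\<tau>\<in>tops a l \<union> tops b ?k. fst \<tau> = l & s < snd \<tau>" using ta \<open>s < ?k\<close> by auto
    ultimately show ?thesis using g nb False by auto
   qed
  next
   case F: False
   have "A \<inter> arcs a l = {}" using Aa F arcs_bounds[of _ a l] by fastforce
   then have ga: "good_in A a l" using good_in_disjoint[OF sub(1)] by blast
   obtain \<tau> where \<tau>: "{x \<in> tops b ?k. fst x \<le> s & s < snd x} = {\<tau>}"
    using tops_cover[of ?k s b] F s by auto
   have \<tau>t: "\<tau> \<in> tops b ?k" "fst \<tau> \<le> s" "s < snd \<tau>" using \<tau> by blast+
   then have \<tau>b: "?k \<le> fst \<tau> & fst \<tau> \<le> s & s < snd \<tau> & snd \<tau> \<le> ?j" using tb by blast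
   have Atb: "A \<inter> tops b ?k = {\<tau>}" using Ab tops_arcs[of b ?k] \<tau> by auto
   have right: "good_in A b ?k & snd \<tau> = ?j \<longleftrightarrow> s \<in> reach_right b ?k" proof -
    have "(\<exists>\<tau>\<in>tops b ?k. snd \<tau> = ?k + leaves b & fst \<tau> \<le> s) \<longleftrightarrow> snd \<tau> = ?j"
    proof
     assume "\<exists>\<tau>\<in>tops b ?k. snd \<tau> = ?k + leaves b & fst \<tau> \<le> s"
     then obtain \<tau>' where t': "\<tau>' \<in> tops b ?k" "snd \<tau>' = ?j" "fst \<tau>' \<le> s" by (auto simp: add.assoc)
     then have "\<tau>' \<in> {x \<in> tops b ?k. fst x \<le> s & s < snd x}" using s by simp
     then show "snd \<tau> = ?j" using \<tau> t' by simp
    next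
     assume "snd \<tau> = ?j"
     then show "\<exists>\<tau>\<in>tops b ?k. snd \<tau> = ?k + leaves b & fst \<tau> \<le> s" using \<tau>t \<tau>b by (auto simp: add.assoc)
    qed
    then show ?thesis using Nd.IH(4)[OF sub(2) _ _ Ab] F s by simp
   qed
   have na: "s \<notin> reach_left a l" using reach_bounds[of s a l] F by auto
   show ?thesis
   proof (cases r)
    case True
    have "A \<inter> ({?x} \<union> tops a l \<union> tops b ?k) = {?x, \<tau>}" proof -
     have "?x \<in> {x \<in> arcs (Nd r a b) l. fst x \<le> s & s < snd x}" using True s by simp
     then have "?x \<in> A" using A by blast
     moreover have "A \<inter> tops a l = {}" using \<open>A \<inter> arcs a l = {}\<close> tops_arcs by blast
     ultimately show ?thesis using Atb by auto
    qed
    moreover have "?x ~= \<tau>" using \<tau>b pos by auto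
    moreover have "share ?x \<tau> \<longleftrightarrow> snd \<tau> = ?j" using \<tau>b pos s by (auto simp: share_def)
    ultimately have "good_in A (Nd r a b) l \<longleftrightarrow> s \<in> reach_right b ?k"
     unfolding good_in_Nd[OF e] using ga right True empty_or_incident_pair[of ?x \<tau>] by auto
    then show ?thesis using True na s by auto
   next
    case False
    then have g: "good_in A (Nd r a b) l \<longleftrightarrow> good_in A b ?k" unfolding good_in_Nd[OF e] using ga by auto
    have "~ (\<exists>\<tau>\<in>tops a l \<union> tops b ?k. fst \<tau> = l & s < snd \<tau>)" using ta tb F pos by fastforce
    moreover have "(\<exists>\<tau>\<in>tops a l \<union> tops b ?k. snd \<tau> = ?j & fst \<tau> \<le> s) \<longleftrightarrow> snd \<tau> = ?j"
    proof
     assume "\<exists>\<tau>\<in>tops a l \<union> tops b ?k. snd \<tau> = ?j & fst \<tau> \<le> s"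
     then obtain \<tau>' where t': "\<tau>' \<in> tops b ?k" "snd \<tau>' = ?j" "fst \<tau>' \<le> s" using ta pos by auto
     then have "\<tau>' \<in> {x \<in> tops b ?k. fst x \<le> s & s < snd x}" using s by simp
     then show "snd \<tau> = ?j" using \<tau> t' by simp
    qed (use \<tau>t \<tau>b in auto)
    ultimately show ?thesis using g False na right by auto
   qed
  qed
 qed
 { case 1 show ?case by (rule conjunct1[OF both[OF 1]]) }
 { case 2 show ?case unfolding leaves.simps by (rule conjunct2[OF both[OF 2]]) }
qed

lemma good_closed:
 assumes e: "emb t l" "real_top t" and s: "l \<le> s" "s < l + leaves t"
  and A: "A \<inter> arcs t l = {x \<in> arcs t l. fst x \<le> s & s < snd x}"
 shows "good_in A t l \<longleftrightarrow> s \<in> reach_left t l"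
 using good_single(1)[OF e(1) s A] tops_real[OF e(2), of l] s by auto

text \<open>At the node where \<open>s\<close> and \<open>s'\<close> separate, the sides of the cell
  over them must be incident, which forces the vertex between the children. The second conjunct on
  the left takes care of a cell that is still open because the top is virtual.\<close>

lemma good_double:
 assumes "emb t l" "l \<le> s" "s < s'" "s' < l + leaves t"
 shows "good_in (crossed s s') t l & empty_or_incident (crossed s s' \<inter> tops t l) \<longleftrightarrow>
  (s, s') \<in> inner_chords t l" using assms
proof (induction t arbitrary: l)
 case Lf
 then show ?case by simp
next
 case (Nd r a b)
 let ?k = "l + leaves a" and ?j = "l + (leaves a + leaves b)" and ?x = "(l, l + (leaves a + leaves b))"
 let ?A = "crossed s s'"
 note e = Nd.prems(1) and sub = emb_sub[OF Nd.prems(1)]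
 have xA: "?x \<notin> ?A" using Nd.prems by (auto simp: crossed_def)
 have ta: "tops a l = {(l, ?k)}" using tops_real[OF sub(3)] .
 have tb: "?k \<le> fst \<tau> & fst \<tau> < snd \<tau> & snd \<tau> \<le> ?j" if "\<tau> \<in> tops b ?k" for \<tau>
  using that tops_arcs[of b ?k] arcs_bounds[of \<tau> b ?k] by auto
 have pos: "leaves a > 0" "leaves b > 0" by (rule leaves_pos)+
 have C: "good_in ?A (Nd r a b) l & empty_or_incident (?A \<inter> tops (Nd r a b) l) \<longleftrightarrow>
   empty_or_incident (?A \<inter> (tops a l \<union> tops b ?k)) & good_in ?A a l & good_in ?A b ?k"
 proof (cases r)
  case True
  have "?A \<inter> ({?x} \<union> tops a l \<union> tops b ?k) = ?A \<inter> (tops a l \<union> tops b ?k)" "?A \<inter> {?x} = {}"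
   using xA by auto
  then show ?thesis unfolding good_in_Nd[OF e] using True by simp
 next
  case False
  then show ?thesis unfolding good_in_Nd[OF e] by auto
 qed
 have inr: "(s, s') \<in> inner_chords a l ==> s' < ?k" "(s, s') \<in> inner_chords b ?k ==> ?k \<le> s"
  "s \<in> reach_left a l ==> s < ?k" "s' \<in> reach_left b ?k ==> ?k \<le> s'"
  using inner_chords_bounds[of s s' a l] inner_chords_bounds[of s s' b ?k]
   reach_bounds[of s a l] reach_bounds[of s' b ?k] by auto
 consider "s' < ?k" | "?k \<le> s" | "s < ?k" "?k \<le> s'" by linarith
 then show ?case
 proof cases
  case 1
  have "?A \<inter> arcs b ?k = {}" using no_arc_outside[OF sub(2)] 1 Nd.prems by auto
  then have "good_in ?A b ?k" "?A \<inter> tops b ?k = {}" using good_in_disjoint[OF sub(2)] tops_arcs by blast+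
  moreover have "?A \<inter> tops a l = {}" using ta 1 Nd.prems by (auto simp: crossed_def)
  ultimately show ?thesis unfolding C using Nd.IH(1)[OF sub(1)] Nd.prems 1 inr by (auto simp: Int_Un_distrib)
 next
  case 2
  have "?A \<inter> arcs a l = {}" using no_arc_outside[OF sub(1)] 2 Nd.prems by auto
  then have "good_in ?A a l" "?A \<inter> tops a l = {}" using good_in_disjoint[OF sub(1)] tops_arcs by blast+
  then show ?thesis unfolding C using Nd.IH(2)[OF sub(2)] Nd.prems 2 inr by (auto simp: Int_Un_distrib add.assoc)
 next
  case 3
  have Aa: "?A \<inter> arcs a l = {x \<in> arcs a l. fst x \<le> s & s < snd x}"
   using crossed_outside(1)[OF sub(1), of s s'] 3 Nd.prems by auto
  have Ab: "?A \<inter> arcs b ?k = {x \<in> arcs b ?k. fst x \<le> s' & s' < snd x}"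
   using crossed_outside(2)[OF sub(2), of s' s] 3 Nd.prems by auto
  obtain \<tau> where \<tau>: "{x \<in> tops b ?k. fst x \<le> s' & s' < snd x} = {\<tau>}"
   using tops_cover[of ?k s' b] 3 Nd.prems by auto
  have \<tau>t: "\<tau> \<in> tops b ?k" "fst \<tau> \<le> s'" "s' < snd \<tau>" using \<tau> by blast+
  then have \<tau>b: "?k \<le> fst \<tau> & fst \<tau> \<le> s' & s' < snd \<tau> & snd \<tau> \<le> ?j" using tb by blast
  have Atb: "?A \<inter> tops b ?k = {\<tau>}" using Ab tops_arcs[of b ?k] \<tau> by auto
  have Ata: "?A \<inter> tops a l = {(l, ?k)}" using Aa tops_arcs[of a l] ta 3 Nd.prems by auto
  have "empty_or_incident (?A \<inter> (tops a l \<union> tops b ?k)) \<longleftrightarrow> share (l, ?k) \<tau>" proof -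
   have "?A \<inter> (tops a l \<union> tops b ?k) = {(l, ?k), \<tau>}" using Atb Ata by blast
   moreover have "(l, ?k) ~= \<tau>" using \<tau>b pos by auto
   ultimately show ?thesis using empty_or_incident_pair by simp
  qed
  also have "\<dots> \<longleftrightarrow> fst \<tau> = ?k" using \<tau>b pos tb[OF \<tau>t(1)] by (auto simp: share_def)
  also have "\<dots> \<longleftrightarrow> (\<exists>\<tau>\<in>tops b ?k. fst \<tau> = ?k & s' < snd \<tau>)"
  proof
   assume "\<exists>\<tau>\<in>tops b ?k. fst \<tau> = ?k & s' < snd \<tau>"
   then obtain \<tau>' where t': "\<tau>' \<in> tops b ?k" "fst \<tau>' = ?k" "s' < snd \<tau>'" by auto
   then have "\<tau>' \<in> {x \<in> tops b ?k. fst x \<le> s' & s' < snd x}" using 3 by simp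
   then show "fst \<tau> = ?k" using \<tau> t' by simp
  qed (use \<tau>t \<tau>b in auto)
  finally have "empty_or_incident (?A \<inter> (tops a l \<union> tops b ?k)) & good_in ?A b ?k \<longleftrightarrow> s' \<in> reach_left b ?k"
   using good_single(1)[OF sub(2) _ _ Ab] 3 Nd.prems by auto
  moreover have "good_in ?A a l \<longleftrightarrow> s \<in> reach_left a l"
   using good_closed[OF sub(1,3) _ _ Aa] 3 Nd.prems by auto
  ultimately show ?thesis unfolding C using inr 3 by auto
 qed
qed

text \<open>A chord to \<open>N - 1\<close> crosses every arc over \<open>s\<close> including the
  root, which is the situation of one end; any other chord is the situation of two ends.\<close>

lemma acc_iff_chord:
 assumes e: "emb (Nd True a b) 0" and n: "leaves (Nd True a b) = N - 1" and st: "s < t" "t < N"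
 shows "acc (crossed s t) \<longleftrightarrow> (s, t) \<in> chords (Nd True a b) 0"
proof -
 let ?T = "Nd True a b"
 have all: "arcs ?T 0 = Bar" using e n Bar by (auto simp: emb_def sub_arc_def less_Suc_eq_le) fastforce+
 have acc: "acc (crossed s t) \<longleftrightarrow> good_in (crossed s t) ?T 0"
  unfolding acc_def good_in_def all by (auto simp: crossed_def nodes_def)
 have c: "(s, t) \<in> chords ?T 0 \<longleftrightarrow>
   (s, t) \<in> inner_chords ?T 0 \<or> s \<in> reach_left ?T 0 \<union> reach_right ?T 0 & t = leaves ?T"
  by (simp only: chords_def Un_iff mem_Sigma_iff singleton_iff add_0)
 show ?thesis
 proof (cases "t = N - 1")
  case True
  have "crossed s t \<inter> arcs ?T 0 = {x \<in> arcs ?T 0. fst x \<le> s & s < snd x}"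
   by (rule crossed_outside(1)[OF e]) (use True st n in auto)
  then have "acc (crossed s t) \<longleftrightarrow> s \<in> reach_left ?T 0"
   unfolding acc using good_closed[OF e, of s] st n True by simp
  moreover have "(s, t) \<notin> inner_chords ?T 0" using inner_chords_bounds[of s t ?T 0] n True by auto
  moreover have "reach_right ?T 0 = reach_left ?T 0" using reach_real[of ?T 0] by simp
  ultimately show ?thesis unfolding c using n True by (simp only: Un_absorb simp_thms)
 next
  case False
  have "crossed s t \<inter> tops ?T 0 = {}" using False st n by (auto simp: crossed_def)
  then have "acc (crossed s t) \<longleftrightarrow> (s, t) \<in> inner_chords ?T 0"
   unfolding acc using good_double[OF e, of s t] False st n by simp
  then show ?thesis unfolding c using False n by (simp only: simp_thms)
 qed
qed

end

section \<open>Walks of serpents\<close>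

text \<open>Virtual nodes contribute no arc, since passing through them does not leave the
  cell.\<close>

fun walk :: "tr => nat => word => (nat \<times> nat) set" where
 "walk Lf l w = {}"
| "walk (Nd r a b) l w = (if r then {(l, l + (leaves a + leaves b))} else {}) \<union>
   (case w of End => {} | Lft u => walk a l u | Rgt u => walk b (l + leaves a) u)"

fun strip :: "tr => nat => serp => (nat \<times> nat) set" where
 "strip Lf l s = {}"
| "strip (Nd r a b) l (Top w) = walk (Nd r a b) l w"
| "strip (Nd r a b) l (Hook u v) = walk a l u \<union> walk b (l + leaves a) v"
| "strip (Nd r a b) l (In s) = strip a l s"
| "strip (Nd r a b) l (Skip s) = strip b (l + leaves a) s"

lemma walk_arcs: "walk t l w \<subseteq> arcs t l"
proof (induction t arbitrary: l w)
 case (Nd r a b)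
 have "x \<in> walk a l u ==> x \<in> arcs a l" "x \<in> walk b (l + leaves a) u ==> x \<in> arcs b (l + leaves a)" for x u
  using Nd.IH by blast+
 then show ?case by (cases w) (auto split: if_splits)
qed simp

lemma strip_Top: "strip t l (Top w) = walk t l w" by (cases t) auto

lemma strip_arcs: "strip t l s \<subseteq> arcs t l"
proof (induction t arbitrary: l s)
 case (Nd r a b)
 have "walk a l u \<subseteq> arcs (Nd r a b) l" "walk b (l + leaves a) u \<subseteq> arcs (Nd r a b) l" for u
  using walk_arcs[of a l u] walk_arcs[of b "l + leaves a" u] by auto
 moreover have "strip a l s \<subseteq> arcs (Nd r a b) l" "strip b (l + leaves a) s \<subseteq> arcs (Nd r a b) l" for s
  using Nd.IH(1)[of l s] Nd.IH(2)[of "l + leaves a" s] by auto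
 moreover have "walk (Nd r a b) l u \<subseteq> arcs (Nd r a b) l" for u by (rule walk_arcs)
 ultimately show ?case by (cases s) (simp_all only: strip.simps Un_least)
qed simp

lemma walk_wide: "x \<in> walk t l w ==> Suc (fst x) < snd x"
proof (induction t arbitrary: l w)
 case (Nd r a b)
 then show ?case using leaves_pos[of a] leaves_pos[of b] by (cases w) (auto split: if_splits)
qed simp

lemma arcs_split: "x \<in> arcs a l ==> x \<notin> arcs b (l + leaves a)"
 "(l, l + (leaves a + leaves b)) \<notin> arcs a l" "(l, l + (leaves a + leaves b)) \<notin> arcs b (l + leaves a)"
proof -
 have p: "leaves a > 0" "leaves b > 0" by (rule leaves_pos)+
 show "x \<in> arcs a l ==> x \<notin> arcs b (l + leaves a)"
  using arcs_bounds[of x a l] arcs_bounds[of x b "l + leaves a"] by auto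
 show "(l, l + (leaves a + leaves b)) \<notin> arcs a l" "(l, l + (leaves a + leaves b)) \<notin> arcs b (l + leaves a)"
  using arcs_bounds[of "(l, l + (leaves a + leaves b))"] p by fastforce+
qed

lemma walk_top: "real_top t ==> w \<in> half_walks t ==> (l, l + leaves t) \<in> walk t l w" by (cases t) auto

lemma walk_right:
 "w \<in> half_walks t ==> real_top t \<or> (\<exists>v. w = Rgt v) ==> \<exists>d\<in>walk t l w. snd d = l + leaves t"
proof (induction t arbitrary: l w)
 case (Nd r a b)
 show ?case
 proof (cases r)
  case False
  then obtain v where v: "w = Rgt v" using Nd.prems by auto
  then have "v \<in> half_walks b" "real_top b \<or> (\<exists>u. v = Rgt u)" using Nd.prems(1) by auto
  then obtain d where "d \<in> walk b (l + leaves a) v" "snd d = l + leaves a + leaves b" using Nd.IH(2) by blast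
  then show ?thesis using v by (auto simp: add.assoc)
 qed auto
qed simp

lemma walk_left:
 assumes "wf_tr t" "w \<in> half_walks t" "real_top t \<or> (\<exists>v. w = Lft v)"
 shows "\<exists>d\<in>walk t l w. fst d = l"
proof (cases t)
 case (Nd r a b)
 then show ?thesis using assms walk_top[of a _ l] by (cases r) force+
qed (use assms in simp)

text \<open>Both walks pass through the same first real arc: the top arc itself, or below a virtual
  top the one reached by their common first letter. Otherwise they need not meet at all.\<close>

definition same_entry :: "tr => word => word => bool" where
 "same_entry t w v \<longleftrightarrow> real_top t \<or> (\<exists>w' v'. w = Lft w' & v = Lft v') \<or> (\<exists>w' v'. w = Rgt w' & v = Rgt v')"

text \<open>A dart is an arc with a direction, the flag telling whether it leads out of the interval spanned
  by the arc; left and right are those of a traveller along the dart.\<close>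

fun beyond :: "(nat \<times> nat) \<times> bool => nat \<times> nat => bool" where
 "beyond (x, up) d = (if up then ~ sub_arc d x else sub_arc d x & d ~= x)"

fun lv :: "(nat \<times> nat) \<times> bool => nat" where "lv (x, up) = (if up then snd x else fst x)"
fun rv :: "(nat \<times> nat) \<times> bool => nat" where "rv (x, up) = (if up then fst x else snd x)"

text \<open>The turn taken after the dart: 0 around its left vertex, 2 otherwise if the set goes on
  beyond the dart, and 1 if it stops. Larger values are further to the right.\<close>

definition code :: "(nat \<times> nat) set => (nat \<times> nat) \<times> bool => nat" where
 "code X e = (if \<exists>d\<in>X. beyond e d & (fst d = lv e \<or> snd d = lv e) then 0
   else if \<exists>d\<in>X. beyond e d then 2 else 1)"

lemma code_cong: "(\<And>d. beyond e d ==> d \<in> X \<longleftrightarrow> d \<in> Y) ==> code X e = code Y e"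
proof -
 assume a: "\<And>d. beyond e d ==> d \<in> X \<longleftrightarrow> d \<in> Y"
 have "(\<exists>d\<in>X. beyond e d & Q d) \<longleftrightarrow> (\<exists>d\<in>Y. beyond e d & Q d)" for Q using a by blast
 from this[of "\<lambda>d. fst d = lv e \<or> snd d = lv e"] this[of "\<lambda>d. True"] show ?thesis
  unfolding code_def by simp
qed

text \<open>The arc \<open>x\<close> is the lowest common arc: the common arcs all contain it and
  everything else lies strictly below it. \<open>P\<close> and \<open>P'\<close> are the comparisons
  of the two turns there.\<close>

definition diverge :: "(nat \<times> nat) set => (nat \<times> nat) set => nat \<times> nat => bool => bool => bool" where
 "diverge A B x P P' \<longleftrightarrow> x \<in> A & x \<in> B &
  (\<forall>d\<in>A. d \<in> B & sub_arc x d \<or> beyond (x, False) d) &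
  (\<forall>d\<in>B. d \<in> A & sub_arc x d \<or> beyond (x, False) d) &
  (\<forall>d\<in>A \<inter> B. ~ beyond (x, False) d) &
  (code A (x, False) \<le> code B (x, False) \<longleftrightarrow> P) &
  (code B (x, False) \<le> code A (x, False) \<longleftrightarrow> P')"

lemma divergeD:
 assumes "diverge A B x P P'"
 shows "x \<in> A" "x \<in> B" "\<forall>d\<in>A. d \<in> B & sub_arc x d \<or> beyond (x, False) d"
  "\<forall>d\<in>B. d \<in> A & sub_arc x d \<or> beyond (x, False) d" "\<forall>d\<in>A \<inter> B. ~ beyond (x, False) d"
  "code A (x, False) \<le> code B (x, False) \<longleftrightarrow> P" "code B (x, False) \<le> code A (x, False) \<longleftrightarrow> P'"
 using assms unfolding diverge_def by blast+

text \<open>The sets separate at the last real arc before the words differ; the letters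
  \<open>Lft\<close>, \<open>End\<close>, \<open>Rgt\<close> give the turns 0, 1, 2 there, so the
  turns compare like the words.\<close>

lemma walks_compare:
 assumes "wf_tr t" "w \<in> half_walks t" "v \<in> half_walks t" "same_entry t w v"
 shows "\<exists>x. diverge (walk t l w) (walk t l v) x (w \<le> v) (v \<le> w)" (is "\<exists>x. ?P t l w v x") using assms
proof (induction t arbitrary: l w v)
 case (Nd r a b)
 let ?k = "l + leaves a" and ?y = "(l, l + (leaves a + leaves b))"
 have pos: "leaves a > 0" "leaves b > 0" by (rule leaves_pos)+
 have wf: "wf_tr a" "wf_tr b" "real_top a" using Nd.prems(1) by auto
 have lift: "\<exists>x. ?P (Nd r a b) l w v x"
  if c: "?P c m w' v' x" "arcs c m \<subseteq> arcs a l \<or> arcs c m \<subseteq> arcs b ?k"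
   and W: "walk (Nd r a b) l w = (if r then {?y} else {}) \<union> walk c m w'"
    "walk (Nd r a b) l v = (if r then {?y} else {}) \<union> walk c m v'"
   and o: "w \<le> v \<longleftrightarrow> w' \<le> v'" "v \<le> w \<longleftrightarrow> v' \<le> w'" for c m w' v' x proof -
  have xa: "x \<in> arcs a l \<or> x \<in> arcs b ?k" using divergeD(1)[OF c(1)] c(2) walk_arcs by blast
  then have yx: "sub_arc x ?y" "~ beyond (x, False) ?y"
   using arcs_bounds[of x a l] arcs_bounds[of x b ?k] arcs_split pos by (auto simp: sub_arc_def)
  have cd: "code (walk (Nd r a b) l w) (x, False) = code (walk c m w') (x, False)"
   "code (walk (Nd r a b) l v) (x, False) = code (walk c m v') (x, False)"
   unfolding W by (rule code_cong; use yx(2) in \<open>auto simp del: beyond.simps\<close>)+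
  note c' = c(1)[unfolded diverge_def]
  show ?thesis unfolding diverge_def
  proof (intro exI conjI)
   show "x \<in> walk (Nd r a b) l w" "x \<in> walk (Nd r a b) l v" unfolding W using c' by blast+
   show "\<forall>d\<in>walk (Nd r a b) l w. d \<in> walk (Nd r a b) l v & sub_arc x d \<or> beyond (x, False) d"
    "\<forall>d\<in>walk (Nd r a b) l v. d \<in> walk (Nd r a b) l w & sub_arc x d \<or> beyond (x, False) d"
    "\<forall>d\<in>walk (Nd r a b) l w \<inter> walk (Nd r a b) l v. ~ beyond (x, False) d"
    unfolding W using c' yx by (auto simp del: beyond.simps split: if_splits)
  qed (use c' o cd in "simp_all")
 qed
 consider (L) w' v' where "w = Lft w'" "v = Lft v'" | (R) w' v' where "w = Rgt w'" "v = Rgt v'"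
  | (T) "r" "~ (\<exists>w' v'. w = Lft w' & v = Lft v')" "~ (\<exists>w' v'. w = Rgt w' & v = Rgt v')"
  using Nd.prems(4) by (auto simp: same_entry_def)
 then show ?case
 proof cases
  case L
  have "w' \<in> half_walks a" "v' \<in> half_walks a" "same_entry a w' v'"
   using L Nd.prems wf(3) by (auto simp: same_entry_def)
  then obtain x where "?P a l w' v' x" using Nd.IH(1)[OF wf(1), of w' v' l] by blast
  then show ?thesis by (rule lift) (use L in auto)
 next
  case R
  have "w' \<in> half_walks b" "v' \<in> half_walks b" "same_entry b w' v'" using R Nd.prems by (auto simp: same_entry_def)
  then obtain x where "?P b ?k w' v' x" using Nd.IH(2)[OF wf(2), of w' v' ?k] by blast
  then show ?thesis by (rule lift) (use R in auto)
 next
  case T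
  have sub: "sub_arc d ?y & d ~= ?y" if "d \<in> arcs a l \<or> d \<in> arcs b ?k" for d
   using that arcs_bounds[of d a l] arcs_bounds[of d b ?k] arcs_split by (auto simp: sub_arc_def)
  have mem: "?y \<in> walk (Nd r a b) l u" for u using T(1) by simp
  have bey: "d = ?y \<or> beyond (?y, False) d" if "d \<in> walk (Nd r a b) l u" for d u
   using that sub[of d] walk_arcs by (cases u) (auto split: if_splits)
  \<comment> \<open>The left child is real, so its top arc belongs to the walk and starts at the
    left vertex of the dart.\<close>
  have cL: "code (walk (Nd r a b) l (Lft u)) (?y, False) = 0" if "Lft u \<in> half_walks (Nd r a b)" for u proof -
   have "(l, ?k) \<in> walk a l u" using that wf(3) by (intro walk_top) auto
   then have "(l, ?k) \<in> walk (Nd r a b) l (Lft u)" by simp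
   moreover have "beyond (?y, False) (l, ?k)" using pos by (auto simp: sub_arc_def)
   ultimately have "\<exists>d\<in>walk (Nd r a b) l (Lft u). beyond (?y, False) d &
     (fst d = lv (?y, False) \<or> snd d = lv (?y, False))" by (intro bexI[of _ "(l, ?k)"]) (simp_all del: walk.simps)
   then show ?thesis unfolding code_def by simp
  qed
  have cE: "code (walk (Nd r a b) l End) (?y, False) = 1" by (auto simp: code_def)
  have cR: "code (walk (Nd r a b) l (Rgt u)) (?y, False) = 2" if "Rgt u \<in> half_walks (Nd r a b)" for u proof -
   have "u \<in> half_walks b" "real_top b \<or> (\<exists>v. u = Rgt v)" using that by auto
   then obtain d where d: "d \<in> walk b ?k u" using walk_right by blast
   then have "d \<in> walk (Nd r a b) l (Rgt u)" by simp
   moreover have "beyond (?y, False) d" using sub[of d] d walk_arcs by auto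
   ultimately have m: "\<exists>d\<in>walk (Nd r a b) l (Rgt u). beyond (?y, False) d" by blast
   have n: "~ (\<exists>d\<in>walk (Nd r a b) l (Rgt u). beyond (?y, False) d &
     (fst d = lv (?y, False) \<or> snd d = lv (?y, False)))"
   proof
    assume "\<exists>d\<in>walk (Nd r a b) l (Rgt u). beyond (?y, False) d &
     (fst d = lv (?y, False) \<or> snd d = lv (?y, False))"
    then obtain d where d: "d \<in> walk b ?k u" "fst d = l \<or> snd d = l" using T(1) by auto
    moreover have "d \<in> arcs b ?k" using d(1) walk_arcs by blast
    ultimately show False using arcs_bounds[of d b ?k] pos by auto
   qed
   show ?thesis unfolding code_def if_not_P[OF n] if_P[OF m] ..
  qed
  have ex: "?P (Nd r a b) l w v ?y"
   if "code (walk (Nd r a b) l w) (?y, False) \<le> code (walk (Nd r a b) l v) (?y, False) \<longleftrightarrow> w \<le> v"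
    "code (walk (Nd r a b) l v) (?y, False) \<le> code (walk (Nd r a b) l w) (?y, False) \<longleftrightarrow> v \<le> w"
  proof -
   have "d = ?y" if d: "d \<in> walk (Nd r a b) l w" "d \<in> walk (Nd r a b) l v" for d
   proof (rule ccontr)
    assume ny: "d ~= ?y"
    have aa: "u \<in> arcs a l" if "u \<in> walk a l z" for u z using that walk_arcs by blast
    have bb: "u \<in> arcs b ?k" if "u \<in> walk b ?k z" for u z using that walk_arcs by blast
    show False using d ny T(1) T(2,3) aa[of d] bb[of d] arcs_split(1)[of d a l b] by (cases w; cases v) auto
   qed
   then have c: "\<forall>d\<in>walk (Nd r a b) l w \<inter> walk (Nd r a b) l v. ~ beyond (?y, False) d"
    by (metis IntE beyond.simps)
   have b: "\<forall>d\<in>walk (Nd r a b) l z. d \<in> walk (Nd r a b) l z' & sub_arc ?y d \<or> beyond (?y, False) d" for z z'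
   proof
    fix d assume "d \<in> walk (Nd r a b) l z"
    then consider "d = ?y" | "beyond (?y, False) d" using bey by blast
    then show "d \<in> walk (Nd r a b) l z' & sub_arc ?y d \<or> beyond (?y, False) d"
     by cases (use mem in "simp_all del: walk.simps")
   qed
   show ?thesis unfolding diverge_def by (intro conjI; rule mem b c that)
  qed
  show ?thesis
   by (rule exI, rule ex; cases w; cases v) (use T cL cE cR Nd.prems in "auto simp del: walk.simps half_walks.simps")
 qed
qed simp

lemma walk_inj:
 assumes "wf_tr t" "w \<in> half_walks t" "v \<in> half_walks t" "same_entry t w v" "walk t l w = walk t l v" shows "w = v"
 using walks_compare[OF assms(1-4), of l] unfolding assms(5) diverge_def by (meson antisym order_refl)

lemma walk_nonempty:
 assumes "wf_tr t" "w \<in> half_walks t" "same_entry t w w" shows "walk t l w ~= {}"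
 using walks_compare[OF assms(1,2,2,3)] divergeD(1) by blast

lemma enter_left_same: "w \<in> enter_left t ==> v \<in> enter_left t ==> same_entry t w v"
 by (auto simp: enter_left_def same_entry_def)

section \<open>Serpents are determined by their arcs\<close>

definition serps :: "tr => serp set" where "serps t = inner_serps t \<union> {Top w |w. real_top t & w \<in> half_walks t}"

lemma inner_serps_Nd: "inner_serps (Nd r a b) =
  {Hook u v |u v. u \<in> half_walks a & v \<in> enter_left b} \<union> In ` serps a \<union> Skip ` serps b"
 by (simp add: serps_def)

lemma strip_inner_top: "s \<in> inner_serps t ==> (l, l + leaves t) \<notin> strip t l s"
proof (cases t)
 case (Nd r a b)
 assume "s \<in> inner_serps t"
 then have "\<nexists>w. s = Top w" using Top_not_inner by blast
 moreover have "walk a l u \<union> walk b (l + leaves a) v \<subseteq> arcs a l \<union> arcs b (l + leaves a)" for u v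
  using walk_arcs[of a l u] walk_arcs[of b "l + leaves a" v] by blast
 moreover have "strip a l u \<subseteq> arcs a l \<union> arcs b (l + leaves a)"
  "strip b (l + leaves a) u \<subseteq> arcs a l \<union> arcs b (l + leaves a)" for u
  using strip_arcs[of a l u] strip_arcs[of b "l + leaves a" u] by blast+
 ultimately have "strip t l s \<subseteq> arcs a l \<union> arcs b (l + leaves a)" unfolding Nd by (cases s) simp_all
 then show ?thesis using arcs_split(2,3)[of l a b] Nd by auto
qed simp

lemma strip_nonempty: "wf_tr t ==> s \<in> serps t ==> strip t l s ~= {}"
proof (induction t arbitrary: l s)
 case Lf
 then show ?case by (simp add: serps_def)
next
 case (Nd r a b)
 have wf: "wf_tr a" "wf_tr b" "real_top a" using Nd.prems(1) by auto
 consider (t) w where "s = Top w" "r" | (h) u v where "s = Hook u v" "u \<in> half_walks a"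
  | (i) s' where "s = In s'" "s' \<in> serps a" | (k) s' where "s = Skip s'" "s' \<in> serps b"
  using Nd.prems(2) unfolding serps_def[of "Nd r a b"] inner_serps_Nd by auto
 then show ?case
 proof cases
  case t
  then show ?thesis by simp
 next
  case h
  then show ?thesis using walk_top[OF wf(3), of u l] by auto
 next
  case i
  then show ?thesis using Nd.IH(1)[OF wf(1)] by simp
 next
  case k
  then show ?thesis using Nd.IH(2)[OF wf(2)] by simp
 qed
qed

text \<open>The top arc distinguishes \<open>Top\<close> from the other kinds. These are told apart
  by which of the two children contain arcs of the strip, and each part is decoded in its own
  subtree.\<close>

lemma strip_inj: "wf_tr t ==> s \<in> serps t ==> s' \<in> serps t ==> strip t l s = strip t l s' ==> s = s'"
proof (induction t arbitrary: l s s')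
 case Lf
 then show ?case by (simp add: serps_def)
next
 case (Nd r a b)
 let ?k = "l + leaves a"
 have wf: "wf_tr a" "wf_tr b" "real_top a" using Nd.prems(1) by auto
 have top: "(\<exists>w. s = Top w) \<longleftrightarrow> (l, l + leaves (Nd r a b)) \<in> strip (Nd r a b) l s" if "s \<in> serps (Nd r a b)" for s
  using that strip_inner_top[of s "Nd r a b" l] walk_top[of "Nd r a b" _ l] Top_not_inner
  unfolding serps_def by (auto simp: strip_Top simp del: walk.simps leaves.simps)
 define A where "A s = strip (Nd r a b) l s \<inter> arcs a l" for s
 define B where "B s = strip (Nd r a b) l s \<inter> arcs b ?k" for s
 have eq: "A s = A s'" "B s = B s'" unfolding A_def B_def by (simp_all only: Nd.prems(4))
 have disj: "X \<subseteq> arcs a l ==> X \<inter> arcs b ?k = {}" "X \<subseteq> arcs b ?k ==> X \<inter> arcs a l = {}" for X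
  using arcs_split(1)[of _ a l b] by blast+
 have parts: "A (Hook u v) = walk a l u" "B (Hook u v) = walk b ?k v"
  "A (In z) = strip a l z" "B (In z) = {}" "A (Skip z) = {}" "B (Skip z) = strip b ?k z" for u v z
  unfolding A_def B_def strip.simps
  using walk_arcs[of a l u] walk_arcs[of b ?k v] strip_arcs[of a l z] strip_arcs[of b ?k z] disj
  by (simp_all add: Int_Un_distrib2 Int_absorb2)
 have same: "same_entry a u u'" for u u' using wf(3) by (simp add: same_entry_def)
 have ne: "walk a l u ~= {}" if "u \<in> half_walks a" for u using walk_top[OF wf(3) that] by blast
 have neb: "walk b ?k u ~= {}" if "u \<in> enter_left b" for u
  using walk_nonempty[OF wf(2)] that enter_left_same[OF that that] by (simp add: enter_left_def)
 have nes: "z \<in> serps a ==> strip a l z ~= {}" "z \<in> serps b ==> strip b ?k z ~= {}" for z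
  using strip_nonempty wf by blast+
 show ?case
 proof (cases "\<exists>w. s = Top w")
  case True
  then obtain w v where "s = Top w" "s' = Top v" using top[OF Nd.prems(2)] top[OF Nd.prems(3)] Nd.prems(4) by blast
  then show ?thesis using Nd.prems Top_not_inner walk_inj[OF Nd.prems(1), of w v l]
   by (auto simp: serps_def same_entry_def strip_Top simp del: walk.simps half_walks.simps inner_serps.simps)
 next
  case False
  then have "~ (\<exists>w. s' = Top w)" using top[OF Nd.prems(2)] top[OF Nd.prems(3)] Nd.prems(4) by blast
  then have i: "s \<in> inner_serps (Nd r a b)" "s' \<in> inner_serps (Nd r a b)"
   using False Nd.prems(2,3) unfolding serps_def by blast+
  show ?thesis
  proof (cases s)
   case (Hook u v)
   then have uv: "u \<in> half_walks a" "v \<in> enter_left b" using i unfolding inner_serps_Nd by auto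
   have "A s' ~= {}" "B s' ~= {}" unfolding eq[symmetric] Hook parts using ne neb uv by auto
   then obtain u' v' where H': "s' = Hook u' v'" using i(2) parts \<open>~ (\<exists>w. s' = Top w)\<close> by (cases s') auto
   then have uv': "u' \<in> half_walks a" "v' \<in> enter_left b" using i unfolding inner_serps_Nd by auto
   have "walk a l u = walk a l u'" "walk b ?k v = walk b ?k v'" using eq unfolding Hook H' parts by auto
   then show ?thesis using walk_inj[OF wf(1) _ _ same] walk_inj[OF wf(2) _ _ enter_left_same] uv uv' Hook H'
    unfolding enter_left_def by blast
  next
   case (In z)
   then have z: "z \<in> serps a" using i unfolding inner_serps_Nd by auto
   have "B s' = {}" "A s' ~= {}" unfolding eq[symmetric] In parts using nes z by auto
   then obtain z' where z': "s' = In z'" "z' \<in> serps a" using i(2) neb unfolding inner_serps_Nd by (auto simp: parts)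
   then show ?thesis using eq(1) Nd.IH(1)[OF wf(1) z z'(2)] In by (simp add: parts)
  next
   case (Skip z)
   then have z: "z \<in> serps b" using i unfolding inner_serps_Nd by auto
   have "A s' = {}" "B s' ~= {}" unfolding eq[symmetric] Skip parts using nes z by auto
   then obtain z' where z': "s' = Skip z'" "z' \<in> serps b" using i(2) ne unfolding inner_serps_Nd by (auto simp: parts)
   then show ?thesis using eq(2) Nd.IH(2)[OF wf(2) z z'(2)] Skip by (simp add: parts)
  qed (use False in auto)
 qed
qed

section \<open>Paths and ends\<close>

context arc_family begin

text \<open>Arcs of single edges and the root arc are the boundary edges, so what remains
  corresponds to the internal diagonals.\<close>

definition "duals = nodes - {(0, N - 1)}"

definition "dpath xs ds \<longleftrightarrow> ds ~= [] & length xs = Suc (length ds) & distinct xs & set xs \<subseteq> nodes &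
 (\<forall>i<length ds. ds ! i \<in> duals & side (ds ! i) (xs ! i) & side (ds ! i) (xs ! Suc i))"

definition "is_path S \<longleftrightarrow> (\<exists>xs ds. dpath xs ds & set ds = S)"

definition "ends S = {(d, x). \<exists>xs ds. dpath xs ds & set ds = S &
 (d = hd ds & x = hd xs \<or> d = last ds & x = last xs)}"

lemma duals_Bar: "d \<in> duals ==> d \<in> Bar & d \<in> nodes & fst d < snd d & snd d < N"
 using Bar[of d] by (auto simp: duals_def nodes_def)

lemma side_refl: "d \<in> Bar ==> side d d" unfolding side_def using sub_arc_antisym sub_arc_refl by blast

lemma sub_root: "x \<in> Bar ==> sub_arc x (0, N - 1)" using Bar[of x] by (auto simp: sub_arc_def)

text \<open>An internal diagonal borders exactly two cells: the one below it, indexed by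
  \<open>d\<close> itself, and the one below the shortest arc \<open>q\<close> properly containing
  it.\<close>

lemma parent:
 assumes d: "d \<in> duals"
 obtains q where "q \<in> nodes" "q ~= d" "sub_arc d q" "\<And>x. x \<in> nodes ==> side d x \<longleftrightarrow> x = d \<or> x = q"
  "\<And>f. f \<in> Bar ==> sub_arc d f ==> f ~= d ==> sub_arc q f"
proof -
 let ?U = "\<lambda>y. y \<in> Bar & sub_arc d y & y ~= d"
 have dB: "d \<in> Bar" "fst d < snd d" "Suc (fst d) < snd d" "d ~= (0, N - 1)"
  using d duals_Bar[OF d] by (auto simp: duals_def nodes_def)
 have "?U (0, N - 1)" using dB Bar_root sub_root by auto
 then obtain q where q: "?U q" "\<And>y. ?U y ==> snd q - fst q \<le> snd y - fst y"
  using ex_has_least_nat[of ?U "(0, N - 1)" "\<lambda>y. snd y - fst y"] by blast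
 have min: "sub_arc q f" if f: "f \<in> Bar" "sub_arc d f" "f ~= d" for f proof -
  have c: "snd q - fst q \<le> snd f - fst f" using q f by blast
  from nested[OF conjunct1[OF q(1)] f(1)] show ?thesis using c f(2) q(1) dB(2) by (auto simp: sub_arc_def)
 qed
 show thesis
 proof (rule that)
  show "q \<in> nodes" using q(1) dB(3) by (auto simp: nodes_def sub_arc_def)
  show "q ~= d" "sub_arc d q" using q(1) by auto
  show "sub_arc q f" if "f \<in> Bar" "sub_arc d f" "f ~= d" for f by (rule min[OF that])
  show "side d x \<longleftrightarrow> x = d \<or> x = q" if x: "x \<in> nodes" for x
  proof
   assume s: "side d x"
   show "x = d \<or> x = q"
   proof (rule ccontr)
    assume "~ ?thesis"
    then have "sub_arc q x" "q ~= x" using min[of x] s x by (auto simp: side_def nodes_def)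
    then show False using s q(1) unfolding side_def by blast
   qed
  next
   have "side d q" unfolding side_def using dB(1) q(1) min sub_arc_antisym by blast
   then show "side d x" if "x = d \<or> x = q" using that side_refl[OF dB(1)] by blast
  qed
 qed
qed

text \<open>A diagonal and the cells next to it lie on the same side of every other arc. Hence
  walking in the dual tree changes sides of \<open>f\<close> only by crossing
  \<open>f\<close>.\<close>

lemma side_same:
 assumes d: "d \<in> duals" and x: "x \<in> nodes" "side d x" and f: "f \<in> Bar" "f ~= d"
 shows "sub_arc d f \<longleftrightarrow> sub_arc x f" using d
proof (rule parent)
 fix q assume q: "q \<in> nodes" "q ~= d" "sub_arc d q" "\<And>x. x \<in> nodes ==> side d x \<longleftrightarrow> x = d \<or> x = q"
  "\<And>f. f \<in> Bar ==> sub_arc d f ==> f ~= d ==> sub_arc q f"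
 have "x = d \<or> x = q" using q(4)[OF x(1)] x(2) by blast
 then show ?thesis using q(3) q(5)[OF f(1)] f(2) sub_arc_trans by blast
qed

lemma side_pair:
 assumes d: "d \<in> duals" and x: "x \<in> nodes" "side d x" and y: "y \<in> nodes" "side d y" and xy: "x ~= y"
 shows "sub_arc x d ~= sub_arc y d" "\<And>z. z \<in> nodes ==> side d z ==> z = x \<or> z = y"
proof -
 obtain q where q: "q \<in> nodes" "q ~= d" "sub_arc d q" "\<And>x. x \<in> nodes ==> side d x \<longleftrightarrow> x = d \<or> x = q"
  using parent[OF d] by metis
 have "x = d & y = q \<or> x = q & y = d" using q(4)[OF x(1)] q(4)[OF y(1)] x(2) y(2) xy by blast
 moreover have "~ sub_arc q d" using q(2,3) sub_arc_antisym by blast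
 ultimately show "sub_arc x d ~= sub_arc y d" by auto
 show "z = x \<or> z = y" if "z \<in> nodes" "side d z" for z
  using q(4)[OF that(1)] that(2) \<open>x = d & y = q \<or> x = q & y = d\<close> by blast
qed

lemma dpathD:
 assumes "dpath xs ds" "i < length ds"
 shows "ds ! i \<in> duals" "side (ds ! i) (xs ! i)" "side (ds ! i) (xs ! Suc i)" "xs ! i \<in> nodes" "xs ! Suc i \<in> nodes"
  "xs ! i ~= xs ! Suc i" using assms unfolding dpath_def by (auto simp: nth_eq_iff_index_eq)

lemma dpath_step:
 assumes p: "dpath xs ds" and i: "i < length ds"
 shows "f \<in> Bar ==> f ~= ds ! i ==> sub_arc (ds ! i) f \<longleftrightarrow> sub_arc (xs ! i) f"
  "f \<in> Bar ==> f ~= ds ! i ==> sub_arc (ds ! i) f \<longleftrightarrow> sub_arc (xs ! Suc i) f"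
  "sub_arc (xs ! i) (ds ! i) ~= sub_arc (xs ! Suc i) (ds ! i)"
  "x \<in> nodes ==> side (ds ! i) x ==> x = xs ! i \<or> x = xs ! Suc i"
proof -
 note d = dpathD[OF p i]
 show "f \<in> Bar ==> f ~= ds ! i ==> sub_arc (ds ! i) f \<longleftrightarrow> sub_arc (xs ! i) f"
  by (rule side_same[OF d(1,4,2)])
 show "f \<in> Bar ==> f ~= ds ! i ==> sub_arc (ds ! i) f \<longleftrightarrow> sub_arc (xs ! Suc i) f"
  by (rule side_same[OF d(1,5,3)])
 show "sub_arc (xs ! i) (ds ! i) ~= sub_arc (xs ! Suc i) (ds ! i)" by (rule side_pair(1)[OF d(1,4,2,5,3,6)])
 show "x \<in> nodes ==> side (ds ! i) x ==> x = xs ! i \<or> x = xs ! Suc i" by (rule side_pair(2)[OF d(1,4,2,5,3,6)])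
qed

lemma dpath_distinct: "dpath xs ds ==> distinct ds"
proof (rule ccontr)
 assume p: "dpath xs ds" and "~ distinct ds"
 then obtain i j where ij: "i < length ds" "j < length ds" "i < j" "ds ! i = ds ! j"
  by (metis distinct_conv_nth linorder_neqE_nat)
 have "xs ! i = xs ! j \<or> xs ! i = xs ! Suc j"
  using dpath_step(4)[OF p ij(2) dpathD(4)[OF p ij(1)]] dpathD(2)[OF p ij(1)] ij(4) by simp
 then show False using p ij(1-3) unfolding dpath_def by (auto simp: nth_eq_iff_index_eq)
qed

lemma dpath_const:
 assumes p: "dpath xs ds" and f: "f \<in> Bar"
 shows "i \<le> j ==> j \<le> length ds ==> (\<And>k. i \<le> k ==> k < j ==> ds ! k ~= f) ==>
  sub_arc (xs ! i) f \<longleftrightarrow> sub_arc (xs ! j) f"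
proof (induction j)
 case (Suc j)
 show ?case
 proof (cases "i = Suc j")
  case False
  then have l: "j < length ds" "i \<le> j" using Suc.prems by auto
  then have "f ~= ds ! j" using Suc.prems(3)[of j] by auto
  then have "sub_arc (xs ! j) f \<longleftrightarrow> sub_arc (xs ! Suc j) f" using dpath_step(1,2)[OF p l(1) f] by blast
  then show ?thesis using Suc.IH l Suc.prems by simp
 qed simp
qed simp

text \<open>Two edges of the path on different sides of \<open>f\<close> force the path to cross
  \<open>f\<close> in between.\<close>

lemma dpath_convex:
 assumes p: "dpath xs ds" and de: "d \<in> set ds" "e \<in> set ds" and f: "f \<in> Bar" "sub_arc d f ~= sub_arc e f"
 shows "f \<in> set ds"
proof (rule ccontr)
 assume nf: "f \<notin> set ds"
 have "sub_arc d f \<longleftrightarrow> sub_arc (xs ! 0) f" if d: "d \<in> set ds" for d proof -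
  obtain i where i: "i < length ds" "d = ds ! i" using d by (metis in_set_conv_nth)
  have "f ~= d" using nf d by blast
  then have "sub_arc d f \<longleftrightarrow> sub_arc (xs ! i) f" using dpath_step(1)[OF p i(1) f(1)] i(2) by simp
  moreover have "sub_arc (xs ! 0) f \<longleftrightarrow> sub_arc (xs ! i) f"
   by (rule dpath_const[OF p f(1)]) (use i nf in auto)
  ultimately show ?thesis by simp
 qed
 then show False using de f(2) by blast
qed

lemma dpath_between:
 assumes p: "dpath xs ds" and ikj: "i < k" "k < j" "j < length ds"
 shows "sub_arc (ds ! i) (ds ! k) ~= sub_arc (ds ! j) (ds ! k)"
proof -
 have i: "i < length ds" and k: "k < length ds" using ikj by linarith+
 have ne: "ds ! m ~= ds ! k" if "m ~= k" "m < length ds" for m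
  using dpath_distinct[OF p] that k by (simp add: nth_eq_iff_index_eq)
 have kB: "ds ! k \<in> Bar" using dpathD(1)[OF p k] duals_Bar by blast
 have "sub_arc (ds ! i) (ds ! k) \<longleftrightarrow> sub_arc (xs ! Suc i) (ds ! k)"
  using dpath_step(2)[OF p i kB] ne[of i] ikj i by auto
 also have "\<dots> \<longleftrightarrow> sub_arc (xs ! k) (ds ! k)" by (rule dpath_const[OF p kB]) (use ne ikj in auto)
 also have "\<dots> \<longleftrightarrow> ~ sub_arc (xs ! Suc k) (ds ! k)" using dpath_step(3)[OF p k] by blast
 also have "sub_arc (xs ! Suc k) (ds ! k) \<longleftrightarrow> sub_arc (xs ! j) (ds ! k)"
  by (rule dpath_const[OF p kB]) (use ne ikj in auto)
 also have "\<dots> \<longleftrightarrow> sub_arc (ds ! j) (ds ! k)" using dpath_step(1)[OF p ikj(3) kB] ne[of j] ikj by auto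
 finally show ?thesis by blast
qed

text \<open>The ends can be read off the set of edges alone: an edge with one of its two cells such
  that no other edge of the path borders this cell.\<close>

lemma dpath_ends:
 assumes p: "dpath xs ds"
 shows "{(d, x). d \<in> set ds & x \<in> nodes & side d x & (\<forall>e\<in>set ds. side e x --> e = d)} =
  {(hd ds, hd xs), (last ds, last xs)}" (is "?L = ?R")
proof
 let ?m = "length ds"
 have m: "?m > 0" "length xs = Suc ?m" using p by (auto simp: dpath_def)
 then have xne: "xs ~= []" by auto
 have lx: "last xs = xs ! ?m" "hd xs = xs ! 0" using m xne by (simp_all add: last_conv_nth hd_conv_nth)
 have ld: "last ds = ds ! (?m - 1)" "hd ds = ds ! 0" using m by (simp_all add: last_conv_nth hd_conv_nth)
 have dx: "distinct xs" using p by (simp add: dpath_def)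
 show "?L \<subseteq> ?R"
 proof
  fix z assume "z \<in> ?L"
  then obtain d x where z: "z = (d, x)" "d \<in> set ds" "x \<in> nodes" "side d x" "\<forall>e\<in>set ds. side e x --> e = d"
   by blast
  obtain i where i: "i < ?m" "d = ds ! i" using z(2) by (metis in_set_conv_nth)
  have ne: "ds ! j ~= d" if "j ~= i" "j < ?m" for j using dpath_distinct[OF p] that i by (simp add: nth_eq_iff_index_eq)
  have "x = xs ! i \<or> x = xs ! Suc i" using dpath_step(4)[OF p i(1) z(3)] z(4) i by simp
  then show "z \<in> ?R"
  proof
   assume x: "x = xs ! i"
   have "i = 0"
   proof (rule ccontr)
    assume "i ~= 0"
    then have j: "i - 1 < ?m" "Suc (i - 1) = i" using i by auto
    then have "side (ds ! (i - 1)) x" using dpathD(3)[OF p j(1)] x by simp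
    then show False using z(5) j ne[of "i - 1"] nth_mem[OF j(1)] by (metis n_not_Suc_n)
   qed
   then show ?thesis using z(1) i x lx ld by simp
  next
   assume x: "x = xs ! Suc i"
   have "Suc i = ?m"
   proof (rule ccontr)
    assume "Suc i ~= ?m"
    then have j: "Suc i < ?m" using i by auto
    then have "side (ds ! Suc i) x" using dpathD(2)[OF p j(1)] x by simp
    then show False using z(5) j ne[of "Suc i"] nth_mem[OF j(1)] by (metis n_not_Suc_n)
   qed
   then have "i = ?m - 1" by simp
   then have "d = last ds" "x = last xs" using i(2) x lx(1) ld(1) \<open>Suc i = ?m\<close> by simp_all
   then show ?thesis using z(1) by simp
  qed
 qed
 have idx: "j = 0" if j: "j < ?m" "side (ds ! j) (xs ! 0)" for j proof -
  have "xs ! 0 = xs ! j \<or> xs ! 0 = xs ! Suc j" using dpath_step(4)[OF p j(1) dpathD(4)[OF p m(1)]] j(2) by simp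
  then show ?thesis using dx m j(1) by (auto simp: nth_eq_iff_index_eq)
 qed
 have idx': "j = ?m - 1" if j: "j < ?m" "side (ds ! j) (xs ! ?m)" for j proof -
  have "xs ! ?m \<in> nodes" using p m by (auto simp: dpath_def)
  then have "xs ! ?m = xs ! j \<or> xs ! ?m = xs ! Suc j" using dpath_step(4)[OF p j(1)] j(2) by simp
  then show ?thesis using dx m j(1) by (auto simp: nth_eq_iff_index_eq)
 qed
 have "e = ds ! 0" if "e \<in> set ds" "side e (xs ! 0)" for e using idx that by (metis in_set_conv_nth)
 then have "(hd ds, hd xs) \<in> ?L" unfolding lx ld using dpathD(2,4)[OF p m(1)] m(1) by simp
 moreover have "e = ds ! (?m - 1)" if "e \<in> set ds" "side e (xs ! ?m)" for e using idx' that by (metis in_set_conv_nth)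
 then have "(last ds, last xs) \<in> ?L" unfolding lx ld using dpathD(3,5)[OF p, of "?m - 1"] m(1) by simp
 ultimately show "?R \<subseteq> ?L" by blast
qed

lemma ends_iff:
 assumes "is_path S"
 shows "(d, x) \<in> ends S \<longleftrightarrow> d \<in> S & x \<in> nodes & side d x & (\<forall>e\<in>S. side e x --> e = d)"
proof -
 have "(d, x) \<in> ends S \<longleftrightarrow> (\<exists>xs ds. dpath xs ds & set ds = S & (d, x) \<in> {(hd ds, hd xs), (last ds, last xs)})"
  by (auto simp: ends_def)
 also have "\<dots> \<longleftrightarrow> (\<exists>xs ds. dpath xs ds & set ds = S &
   (d \<in> S & x \<in> nodes & side d x & (\<forall>e\<in>S. side e x --> e = d)))"
 proof (intro ex_cong1 conj_cong refl)
  fix xs ds assume "dpath xs ds" "set ds = S"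
  then show "(d, x) \<in> {(hd ds, hd xs), (last ds, last xs)} \<longleftrightarrow>
    d \<in> S & x \<in> nodes & side d x & (\<forall>e\<in>S. side e x --> e = d)"
   using dpath_ends by (subst dpath_ends[symmetric]) auto
 qed
 finally show ?thesis using assms unfolding is_path_def by blast
qed

lemma ends_two:
 assumes "is_path S" "u \<in> ends S" "v \<in> ends S" "u ~= v" shows "ends S = {u, v}"
proof -
 obtain xs ds where p: "dpath xs ds" "set ds = S" using assms(1) by (auto simp: is_path_def)
 have "ends S = {(hd ds, hd xs), (last ds, last xs)}"
 proof (rule set_eqI)
  fix z show "z \<in> ends S \<longleftrightarrow> z \<in> {(hd ds, hd xs), (last ds, last xs)}"
   unfolding dpath_ends[OF p(1), symmetric] p(2) using ends_iff[OF assms(1)] by (cases z) simp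
 qed
 then show ?thesis using assms(2-4) by auto
qed

lemma path_duals: "is_path S ==> S \<subseteq> duals" using dpathD(1) by (fastforce simp: is_path_def in_set_conv_nth)

text \<open>By convexity of the second path, the positions of its edges in the first path form an
  interval, so the intersection is a contiguous piece.\<close>

lemma path_Int:
 assumes S: "is_path S" and S': "is_path S'" and ne: "S \<inter> S' ~= {}" shows "is_path (S \<inter> S')"
proof -
 obtain xs ds where p: "dpath xs ds" "set ds = S" using S by (auto simp: is_path_def)
 obtain xs' ds' where p': "dpath xs' ds'" "set ds' = S'" using S' by (auto simp: is_path_def)
 define J where "J = {i. i < length ds & ds ! i \<in> S'}"
 have fin: "finite J" unfolding J_def by simp
 obtain d where "d \<in> set ds" "d \<in> S'" using ne p(2) by blast
 then have Jne: "J ~= {}" unfolding J_def by (auto simp: in_set_conv_nth)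
 define i where "i = Min J"
 define j where "j = Max J"
 have ij: "i \<in> J" "j \<in> J" unfolding i_def j_def using fin Jne by simp_all
 have bd: "i \<le> k & k \<le> j" if "k \<in> J" for k unfolding i_def j_def using fin that by simp
 have Jeq: "J = {i..j}"
 proof (rule antisym)
  show "{i..j} \<subseteq> J"
  proof
   fix k assume k: "k \<in> {i..j}"
   show "k \<in> J"
   proof (cases "k = i \<or> k = j")
    case False
    then have kk: "i < k" "k < j" "j < length ds" using k ij by (auto simp: J_def)
    have "ds ! k \<in> S'" using dpath_convex[OF p'(1), of "ds ! i" "ds ! j" "ds ! k"] p'(2) ij dpath_between[OF p(1) kk]
      duals_Bar dpathD(1)[OF p(1), of k] kk by (auto simp: J_def)
    then show ?thesis using kk by (simp add: J_def)
   qed (use ij in auto)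
  qed
 qed (use bd in auto)
 have lj: "j < length ds" "i \<le> j" using ij bd by (auto simp: J_def)
 let ?es = "take (Suc j - i) (drop i ds)" and ?ys = "take (Suc (Suc j - i)) (drop i xs)"
 have lx: "length xs = Suc (length ds)" "distinct xs" "set xs \<subseteq> nodes" using p(1) by (auto simp: dpath_def)
 have len: "length ?es = Suc j - i" "length ?ys = Suc (Suc j - i)" using lj lx by auto
 have "set ?es = S \<inter> S'"
 proof (rule set_eqI)
  fix d
  have "d \<in> set ?es \<longleftrightarrow> (\<exists>m<Suc j - i. d = ds ! (i + m))"
   using len lj by (auto simp: in_set_conv_nth)
  also have "\<dots> \<longleftrightarrow> (\<exists>k\<in>{i..j}. d = ds ! k)"
  proof
   assume "\<exists>m<Suc j - i. d = ds ! (i + m)"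
   then obtain m where "m < Suc j - i" "d = ds ! (i + m)" by blast
   then show "\<exists>k\<in>{i..j}. d = ds ! k" by (intro bexI[of _ "i + m"]) auto
  next
   assume "\<exists>k\<in>{i..j}. d = ds ! k"
   then obtain k where "i \<le> k" "k \<le> j" "d = ds ! k" by auto
   then show "\<exists>m<Suc j - i. d = ds ! (i + m)" by (intro exI[of _ "k - i"]) auto
  qed
  also have "\<dots> \<longleftrightarrow> d \<in> S \<inter> S'" unfolding Jeq[symmetric] J_def using p(2) by (auto simp: in_set_conv_nth)
  finally show "d \<in> set ?es \<longleftrightarrow> d \<in> S \<inter> S'" .
 qed
 moreover have "dpath ?ys ?es" unfolding dpath_def
 proof (intro conjI allI impI)
  show "?es ~= []" using lj by auto
  show "length ?ys = Suc (length ?es)" using len by simp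
  show "distinct ?ys" using lx by simp
  show "set ?ys \<subseteq> nodes" using lx(3) by (meson order_trans set_drop_subset set_take_subset)
  fix m assume m: "m < length ?es"
  then have m': "i + m < length ds" "m < Suc j - i" using len lj by auto
  have n: "?es ! m = ds ! (i + m)" "?ys ! m = xs ! (i + m)" "?ys ! Suc m = xs ! Suc (i + m)" using m' lj lx by auto
  show "?es ! m \<in> duals" "side (?es ! m) (?ys ! m)" "side (?es ! m) (?ys ! Suc m)"
   unfolding n by (rule dpathD[OF p(1) m'(1)])+
 qed
 ultimately show ?thesis unfolding is_path_def by blast
qed

end

section \<open>Incompatibility at the ends of the intersection\<close>

definition hl :: "nat \<times> nat => nat set" where "hl d = {2 * fst d + 1, 2 * snd d + 1}"

definition V :: "nat \<times> nat => nat set" where "V d = {fst d, snd d}"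

lemma V_darts: "V x = {lv (x, up), rv (x, up)}" by (auto simp: V_def)

lemma share_V: "share d e \<longleftrightarrow> V d \<inter> V e ~= {}" by (auto simp: share_def V_def)

lemma hl_V: "2 * w + 1 \<in> hl d \<longleftrightarrow> w \<in> V d" by (auto simp: hl_def V_def)

section \<open>Local shape of a path at one of its arcs\<close>

context arc_family begin

lemma V_inj: "d \<in> Bar ==> e \<in> Bar ==> V d = V e ==> d = e"
 using Bar[of d] Bar[of e] by (auto simp: V_def doubleton_eq_iff prod_eq_iff)

lemma hl_inj: "inj_on hl Bar"
proof (rule inj_onI)
 fix d e assume "d \<in> Bar" "e \<in> Bar" "hl d = hl e"
 then show "d = e" using Bar[of d] Bar[of e] by (auto simp: hl_def doubleton_eq_iff prod_eq_iff)
qed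

text \<open>The local consequence of being a serpent: a cell is bordered by at most two arcs of the
  path, and if by two, these are incident.\<close>

definition "snake S \<longleftrightarrow> is_path S & (\<forall>x\<in>nodes. \<forall>d\<in>S. \<forall>e\<in>S. side d x --> side e x --> d ~= e -->
 share d e & (\<forall>f\<in>S. side f x --> f = d \<or> f = e))"

lemma path_convex: "is_path S ==> d \<in> S ==> e \<in> S ==> f \<in> Bar ==> sub_arc d f ~= sub_arc e f ==> f \<in> S"
 using dpath_convex unfolding is_path_def by blast

lemma side_apart:
 assumes "side d c" "side e c" "d ~= e" "d ~= c" "e ~= c" shows "snd d \<le> fst e \<or> snd e \<le> fst d"
 using nested[of d e] assms unfolding side_def by blast

text \<open>The sides of a cell are an arc and arcs side by side below it, so at most two of them
  meet at a vertex.\<close>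

lemma three_sides:
 assumes s: "side d c" "side e c" "side f c" and c: "c \<in> Bar" and ne: "d ~= e" "e ~= f" "d ~= f"
  and w: "w \<in> V d" "w \<in> V e" "w \<in> V f" shows False
proof -
 have b: "fst d < snd d & fst c \<le> fst d & snd d \<le> snd c" "fst e < snd e & fst c \<le> fst e & snd e \<le> snd c"
  "fst f < snd f & fst c \<le> fst f & snd f \<le> snd c"
  using s Bar[of d] Bar[of e] Bar[of f] unfolding side_def sub_arc_def by blast+
 have a: "x = c \<or> y = c \<or> snd x \<le> fst y \<or> snd y \<le> fst x" if "side x c" "side y c" "x ~= y" for x y
  using side_apart that by blast
 have "d = c \<or> e = c \<or> snd d \<le> fst e \<or> snd e \<le> fst d" "e = c \<or> f = c \<or> snd e \<le> fst f \<or> snd f \<le> fst e"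
  "d = c \<or> f = c \<or> snd d \<le> fst f \<or> snd f \<le> fst d" using a s ne by blast+
 moreover have "w = fst d \<or> w = snd d" "w = fst e \<or> w = snd e" "w = fst f \<or> w = snd f"
  using w by (auto simp: V_def)
 moreover have "~ (d = c & e = c)" "~ (e = c & f = c)" "~ (d = c & f = c)" using ne by blast+
 ultimately show False using b by (elim disjE) (simp_all, (linarith+)?)
qed

lemma child:
 assumes d: "d \<in> Bar" "sub_arc d c" "d ~= c" obtains n where "n \<in> Bar" "sub_arc d n" "n ~= c" "side n c"
proof -
 let ?U = "\<lambda>y. y \<in> Bar & sub_arc d y & sub_arc y c & y ~= c"
 have "snd y - fst y < N" if "?U y" for y using Bar[of y] that by auto
 moreover have "?U d" using d by simp
 ultimately obtain n where n: "?U n" "\<And>y. ?U y ==> snd y - fst y \<le> snd n - fst n"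
  using ex_has_greatest_nat[of ?U d "\<lambda>y. snd y - fst y" N] by blast
 have "y = n" if "y \<in> Bar" "sub_arc n y" "sub_arc y c" "y ~= c" for y proof -
  have "snd y - fst y \<le> snd n - fst n" using n that sub_arc_trans by blast
  then show ?thesis using that(2) Bar[of n] Bar[of y] n(1) that(1) by (auto simp: sub_arc_def prod_eq_iff)
 qed
 then have "side n c" unfolding side_def using n(1) by blast
 then show thesis using that n(1) by blast
qed

text \<open>The cell into which the dart leads: below \<open>x\<close> it is indexed by
  \<open>x\<close> itself, above it is the other cell of \<open>x\<close>.\<close>

fun dart_cell :: "(nat \<times> nat) \<times> bool => nat \<times> nat => bool" where
 "dart_cell (x, up) c \<longleftrightarrow> x \<in> duals & c \<in> nodes & side x c & (up \<longleftrightarrow> c ~= x)"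

lemma side_beyond:
 assumes "dart_cell (x, up) c" "side n c" "n ~= x" shows "beyond (x, up) n"
proof (cases up)
 case True
 then have c: "side x c" "c ~= x" "x \<in> Bar" using assms duals_Bar by auto
 have "~ sub_arc n x"
 proof
  assume a: "sub_arc n x"
  then have "x ~= c & sub_arc x c" using c by (auto simp: side_def)
  then show False using assms(2,3) a c(3) unfolding side_def by blast
 qed
 then show ?thesis using True by simp
next
 case False
 then show ?thesis using assms by (auto simp: side_def)
qed

lemma beyond_common:
 assumes "x \<in> Bar" "d \<in> Bar" "e \<in> Bar" "beyond (x, up) d" "~ beyond (x, up) e" "w \<in> V d" "w \<in> V e"
 shows "w \<in> V x"
proof -
 have lt: "fst x < snd x" "fst d < snd d" "fst e < snd e" using assms(1-3) Bar by blast+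
 have main: "w \<in> V x" if "u \<in> Bar" "v \<in> Bar" "sub_arc u x" "~ sub_arc v x" "w \<in> V u" "w \<in> V v" for u v
 proof -
  have "fst u < snd u" "fst v < snd v" using that(1,2) Bar by blast+
  moreover have "sub_arc x v \<or> snd x \<le> fst v \<or> snd v \<le> fst x" using nested[OF assms(1) that(2)] that(4) by blast
  moreover have "w = fst u \<or> w = snd u" "w = fst v \<or> w = snd v" using that by (auto simp: V_def)
  ultimately show ?thesis using that(3) lt unfolding sub_arc_def V_def by auto
 qed
 show ?thesis
 proof (cases up)
  case True
  then show ?thesis using main[of e d] assms by simp
 next
  case False
  then have "e = x \<or> ~ sub_arc e x" "sub_arc d x" using assms by auto
  then show ?thesis using main[of d e] assms by blast
 qed
qed

text \<open>If the path goes on anywhere beyond the dart, it does so through a side \<open>n\<close>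
  of the cell entered, since the path is convex. A vertex of \<open>x\<close> on a later arc is also
  a vertex of \<open>n\<close>, which lies in between.\<close>

lemma next_arc:
 assumes S: "is_path S" and x: "x \<in> S" and c: "dart_cell (x, up) c" and d: "d \<in> S" "beyond (x, up) d"
 obtains n where "n \<in> S" "n ~= x" "side n c" "\<And>w. w \<in> V x ==> w \<in> V d ==> w \<in> V n"
proof -
 have xB: "x \<in> Bar" "fst x < snd x" "side x c" "c \<in> nodes" "c \<in> Bar" "up \<longleftrightarrow> c ~= x"
  using c duals_Bar by (auto simp: nodes_def)
 have dB: "d \<in> Bar" "fst d < snd d" using path_duals[OF S] d duals_Bar by blast+
 show thesis
 proof (cases "sub_arc d c & d ~= c")
  case True
  then obtain n where n: "n \<in> Bar" "sub_arc d n" "n ~= c" "side n c" using child[OF dB(1)] by blast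
  have nc: "sub_arc n c" using n(4) by (simp add: side_def)
  have nx: "n ~= x"
  proof
   assume "n = x"
   then show False using d(2) n(2,3) xB(6) by auto
  qed
  have "~ sub_arc x n"
  proof
   assume a: "sub_arc x n"
   show False
   proof (cases up)
    case True
    then show False using xB(3) n(1,3) nx nc a unfolding side_def by blast
   next
    case False
    then show False using xB(6) a nc n(3) sub_arc_antisym by blast
   qed
  qed
  then have nS: "n \<in> S" using path_convex[OF S d(1) x n(1)] n(2) by blast
  have "w \<in> V n" if w: "w \<in> V x" "w \<in> V d" for w
  proof (cases up)
   case True
   then have "snd n \<le> fst x \<or> snd x \<le> fst n" using side_apart[OF n(4) xB(3) nx n(3)] xB(6) by auto
   then show ?thesis using w n(2) xB(2) dB(2) unfolding V_def sub_arc_def by auto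
  next
   case False
   then have "c = x" using xB(6) by simp
   then show ?thesis using w n(2) nc xB(2) dB(2) unfolding V_def sub_arc_def by auto
  qed
  then show thesis using that[OF nS nx n(4)] by blast
 next
  case False
  have up: up
  proof (rule ccontr)
   assume "~ up"
   then show False using d(2) False xB(6) by auto
  qed
  then have cx: "c ~= x" using xB(6) by simp
  have cS: "c \<in> S"
  proof (cases "d = c")
   case f: False
   then show ?thesis using path_convex[OF S d(1) x xB(5)] xB(3) False by (auto simp: side_def)
  qed (use d in simp)
  have "w \<in> V c" if w: "w \<in> V x" "w \<in> V d" for w
  proof (cases "d = c")
   case f: False
   then have b: "beyond (c, True) d" "~ beyond (c, True) x" using False xB(3) by (auto simp: side_def)
   show ?thesis by (rule beyond_common[OF xB(5) dB(1) xB(1) b w(2,1)])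
  qed (use w in simp)
  then show thesis using that[OF cS cx side_refl[OF xB(5)]] by blast
 qed
qed

text \<open>For a serpent the turn is decided by the next arc alone: it is incident to
  \<open>x\<close> in the cell entered, so it shares exactly one of the two vertices of
  \<open>x\<close>.\<close>

lemma code_next:
 assumes S: "snake S" and x: "x \<in> S" and c: "dart_cell (x, up) c"
 shows "code S (x, up) = 0 \<longleftrightarrow> (\<exists>n\<in>S. n ~= x & side n c & lv (x, up) \<in> V n)"
  "code S (x, up) = 2 \<longleftrightarrow> (\<exists>n\<in>S. n ~= x & side n c & rv (x, up) \<in> V n)"
  "code S (x, up) = 1 \<longleftrightarrow> (x, c) \<in> ends S" "code S (x, up) \<le> 2"
proof -
 have P: "is_path S" using S by (simp add: snake_def)
 let ?e = "(x, up)"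
 have cc: "c \<in> nodes" "side x c" "x \<in> Bar" using c duals_Bar by auto
 have SB: "n \<in> Bar" if "n \<in> S" for n using that path_duals[OF P] duals_Bar by blast
 have Vx: "V x = {lv ?e, rv ?e}" by (rule V_darts)
 have zero: "(\<exists>d\<in>S. beyond ?e d & (fst d = lv ?e \<or> snd d = lv ?e)) \<longleftrightarrow>
   (\<exists>n\<in>S. n ~= x & side n c & lv ?e \<in> V n)" (is "?Z \<longleftrightarrow> ?Z'")
 proof
  assume ?Z
  then obtain d where d: "d \<in> S" "beyond ?e d" "lv ?e \<in> V d" by (auto simp: V_def)
  have lx: "lv ?e \<in> V x" using Vx by blast
  obtain n where n: "n \<in> S" "n ~= x" "side n c" "\<And>w. w \<in> V x ==> w \<in> V d ==> w \<in> V n"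
   using next_arc[OF P x c d(1,2)] by metis
  then show ?Z' using n(4)[OF lx d(3)] by blast
 next
  assume ?Z'
  then obtain n where n: "n \<in> S" "n ~= x" "side n c" "lv ?e \<in> V n" by blast
  have "fst n = lv ?e \<or> snd n = lv ?e" using n(4) by (auto simp: V_def)
  then show ?Z using n(1) side_beyond[OF c n(3,2)] by blast
 qed
 have some: "(\<exists>d\<in>S. beyond ?e d) \<longleftrightarrow> (\<exists>n\<in>S. n ~= x & side n c)" (is "?W \<longleftrightarrow> ?W'")
 proof
  assume ?W
  then obtain d where d: "d \<in> S" "beyond ?e d" by blast
  show ?W' using next_arc[OF P x c d] by metis
 next
  assume ?W'
  then show ?W using side_beyond[OF c] by blast
 qed
 \<comment> \<open>The next arc is unique in the cell; meeting both vertices of \<open>x\<close> it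
   would have the same vertices as \<open>x\<close>, hence equal \<open>x\<close>.\<close>
 have excl: "~ (?Z' & (\<exists>n\<in>S. n ~= x & side n c & rv ?e \<in> V n))"
 proof
  assume "?Z' & (\<exists>n\<in>S. n ~= x & side n c & rv ?e \<in> V n)"
  then obtain n m where n: "n \<in> S" "n ~= x" "side n c" "lv ?e \<in> V n"
   and m: "m \<in> S" "m ~= x" "side m c" "rv ?e \<in> V m" by blast
  have "m = n" using S n(1-3) m(1-3) cc(1,2) x unfolding snake_def by metis
  then have "V x \<subseteq> V n" using n(4) m(4) Vx by simp
  moreover have "fst x < snd x" "fst n < snd n" using Bar[OF SB[OF x]] Bar[OF SB[OF n(1)]] by auto
  ultimately have "V x = V n" unfolding V_def by auto
  then show False using V_inj[OF SB[OF x] SB[OF n(1)]] n(2) by simp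
 qed
 have sh: "lv ?e \<in> V n \<or> rv ?e \<in> V n" if "n \<in> S" "n ~= x" "side n c" for n proof -
  have "share n x" using S that cc(1,2) x unfolding snake_def by blast
  then show ?thesis using Vx by (auto simp: share_V)
 qed
 have e: "(x, c) \<in> ends S \<longleftrightarrow> ~ ?W'" using ends_iff[OF P] x cc by blast
 have cd: "code S ?e = (if ?Z' then 0 else if ?W' then 2 else 1)" unfolding code_def zero some ..
 show "code S ?e = 0 \<longleftrightarrow> ?Z'" "code S ?e \<le> 2" unfolding cd by auto
 show "code S ?e = 2 \<longleftrightarrow> (\<exists>n\<in>S. n ~= x & side n c & rv ?e \<in> V n)" (is "_ \<longleftrightarrow> ?R")
 proof -
  have i: "(if A then 0 else if B then 2 else 1) = (2::nat) \<longleftrightarrow> R" if "B \<longleftrightarrow> A \<or> R" "~ (A & R)" for A B R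
   using that by auto
  have "?W' \<longleftrightarrow> ?Z' \<or> ?R" using sh by blast
  then show ?thesis unfolding cd by (rule i[OF _ excl])
 qed
 show "code S ?e = 1 \<longleftrightarrow> (x, c) \<in> ends S" proof -
  have "?Z' ==> ?W'" by blast
  then show ?thesis unfolding cd e by auto
 qed
qed

text \<open>Serpents that both turn around the same vertex use the same next arc, because only two
  sides of the cell meet there. This arc would be common, contrary to the dart being an end of the
  intersection.\<close>

lemma code_not_both:
 assumes S1: "snake S1" "x \<in> S1" and S2: "snake S2" "x \<in> S2" and c: "dart_cell (x, up) c"
  and I: "\<forall>d\<in>S1 \<inter> S2. ~ beyond (x, up) d" and eq: "code S1 (x, up) = code S2 (x, up)"
 shows "code S1 (x, up) = 1"
proof (rule ccontr)
 assume n1: "code S1 (x, up) ~= 1"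
 have cc: "c \<in> Bar" "side x c" using c by (auto simp: nodes_def)
 have "code S1 (x, up) = 0 \<or> code S1 (x, up) = 2" using code_next(4)[OF S1 c] n1 by linarith
 then obtain n m w where n: "n \<in> S1" "n ~= x" "side n c" "w \<in> V n" and m: "m \<in> S2" "m ~= x" "side m c" "w \<in> V m"
  and w: "w \<in> V x" using code_next(1,2)[OF S1 c] code_next(1,2)[OF S2 c] eq V_darts[of x up] by auto
 have "n = m" using three_sides[OF cc(2) n(3) m(3) cc(1)] n m w by blast
 then show False using I side_beyond[OF c n(3,2)] n(1) m(1) by blast
qed

lemma two_at_hl:
 assumes "S \<subseteq> Bar" "I \<subseteq> Bar" shows "two_at (hl ` I) (hl ` S) (2 * w + 1) \<longleftrightarrow>
  (\<exists>d\<in>S. \<exists>e\<in>S. d ~= e & w \<in> V d & w \<in> V e & ~ (d \<in> I & e \<in> I))"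
proof -
 have i: "hl d = hl e \<longleftrightarrow> d = e" if "d \<in> S" "e \<in> S" for d e
  using that assms hl_inj by (auto dest: inj_onD)
 have m: "hl d \<in> hl ` I \<longleftrightarrow> d \<in> I" if "d \<in> S" for d
  using that assms hl_inj by (auto dest: inj_onD)
 show ?thesis unfolding two_at_def bex_simps hl_V using i m by (metis (no_types, lifting))
qed

text \<open>Two diagonals at a vertex of the final edge \<open>xh\<close>, not both common, arise
  from a turn around that vertex at this end, or at the other end if the vertex belongs to both
  final edges.\<close>

lemma two_ends:
 assumes S: "is_path S" and I: "I \<subseteq> S" "xh \<in> I" "xt \<in> I"
  and c: "dart_cell (xh, bh) ch" "dart_cell (xt, bt) ct" and nI: "\<forall>d\<in>I. ~ beyond (xh, bh) d & ~ beyond (xt, bt) d"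
  and cov: "\<forall>d\<in>S. d \<in> I \<or> beyond (xh, bh) d \<or> beyond (xt, bt) d" and w: "w \<in> V xh"
 shows "(\<exists>d\<in>S. \<exists>e\<in>S. d ~= e & w \<in> V d & w \<in> V e & ~ (d \<in> I & e \<in> I)) \<longleftrightarrow>
  (\<exists>n\<in>S. n ~= xh & side n ch & w \<in> V n) \<or> w \<in> V xt & (\<exists>n\<in>S. n ~= xt & side n ct & w \<in> V n)"
  (is "?L \<longleftrightarrow> ?A \<or> w \<in> V xt & ?B")
proof
 have SB: "n \<in> Bar" if "n \<in> S" for n using that path_duals[OF S] duals_Bar by blast
 assume ?L
 then obtain d where d: "d \<in> S" "w \<in> V d" "d \<notin> I" by blast
 then consider "beyond (xh, bh) d" | "beyond (xt, bt) d" using cov by blast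
 then show "?A \<or> w \<in> V xt & ?B"
 proof cases
  case 1
  obtain n where "n \<in> S" "n ~= xh" "side n ch" "\<And>w. w \<in> V xh ==> w \<in> V d ==> w \<in> V n"
   using next_arc[OF S _ c(1) d(1) 1] I by (metis subsetD)
  then show ?thesis using w d(2) by blast
 next
  case 2
  have wt: "w \<in> V xt" using beyond_common[of xt d xh bt w] SB d 2 nI I w by blast
  obtain n where "n \<in> S" "n ~= xt" "side n ct" "\<And>w. w \<in> V xt ==> w \<in> V d ==> w \<in> V n"
   using next_arc[OF S _ c(2) d(1) 2] I by (metis subsetD)
  then show ?thesis using wt d(2) by blast
 qed
next
 assume r: "?A \<or> w \<in> V xt & ?B"
 then show ?L
 proof
  assume ?A
  then obtain n where n: "n \<in> S" "n ~= xh" "side n ch" "w \<in> V n" by blast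
  have "n \<notin> I" using side_beyond[OF c(1) n(3,2)] nI by blast
  then show ?L using n(1,2,4) w I by blast
 next
  assume "w \<in> V xt & ?B"
  then obtain n where n: "n \<in> S" "n ~= xt" "side n ct" "w \<in> V n" and wt: "w \<in> V xt" by blast
  have "n \<notin> I" using side_beyond[OF c(2) n(3,2)] nI by blast
  then show ?L using n(1,2,4) wt I by blast
 qed
qed

section \<open>From the four conditions to a comparison of turns\<close>

definition "fe S = hl ` fst ` ends S"

definition "arc_conflict S1 S2 uh vh ut vt \<longleftrightarrow>
 (let two = two_at (hl ` (S1 \<inter> S2)) in
   ends S1 \<inter> ends S2 ~= {}
  \<or> (two (hl ` S1) uh & two (hl ` S1) ut & two (hl ` S2) vh & two (hl ` S2) vt)
  \<or> ({uh, vh} \<in> fe S2 & (two (hl ` S1) uh & two (hl ` S1) ut \<or> two (hl ` S1) vh & two (hl ` S1) vt))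
  \<or> ({uh, vh} \<in> fe S1 & {ut, vt} \<in> fe S2 &
    (two (hl ` S1) ut & two (hl ` S2) vh \<or> two (hl ` S1) vt & two (hl ` S2) uh)))"

definition "incomp S1 S2 \<longleftrightarrow> S1 \<inter> S2 ~= {} & (\<exists>uh vh ut vt.
 fe (S1 \<inter> S2) = {{uh, vh}, {ut, vt}} & cyclic_chain N uh vh ut vt &
 (arc_conflict S1 S2 uh vh ut vt \<or> arc_conflict S2 S1 uh vh ut vt \<or>
  arc_conflict S1 S2 ut vt uh vh \<or> arc_conflict S2 S1 ut vt uh vh))"

lemma clockwise_dist_if:
 assumes "u < 2 * N" "v < 2 * N"
 shows "clockwise_dist N u v = (if u \<le> v then int v - int u else int v - int u + 2 * int N)"
proof (cases "u \<le> v")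
 case False
 have "(int v - int u) mod (2 * int N) = (int v - int u + 2 * int N) mod (2 * int N)" by simp
 also have "\<dots> = int v - int u + 2 * int N" by (rule mod_pos_pos_trivial) (use False assms in auto)
 finally show ?thesis using False by (simp add: clockwise_dist_def)
qed (use assms in "simp add: clockwise_dist_def")

text \<open>The cyclic order fixes the labelling of the two final edges up to exchanging them. This
  includes a single diagonal, whose two labellings are the exchanged ones.\<close>

lemma chain_facts:
 assumes b: "a < 2 * N" "b < 2 * N" "c < 2 * N" "d < 2 * N" and ch: "cyclic_chain N a b c d"
 shows "cyclic_chain N c d a b" "a ~= b" "c ~= d" "a ~= c" "b ~= d"
  "{{u, v}, {u', v'}} = {{a, b}, {c, d}} ==> cyclic_chain N u v u' v' ==>
   u = a & v = b & u' = c & v' = d \<or> u = c & v = d & u' = a & v' = b"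
proof -
 note D = clockwise_dist_if[OF b(1) b(1)] clockwise_dist_if[OF b(1) b(2)] clockwise_dist_if[OF b(1) b(3)] clockwise_dist_if[OF b(1) b(4)]
  clockwise_dist_if[OF b(2) b(1)] clockwise_dist_if[OF b(2) b(2)] clockwise_dist_if[OF b(2) b(3)] clockwise_dist_if[OF b(2) b(4)]
  clockwise_dist_if[OF b(3) b(1)] clockwise_dist_if[OF b(3) b(2)] clockwise_dist_if[OF b(3) b(3)] clockwise_dist_if[OF b(3) b(4)]
  clockwise_dist_if[OF b(4) b(1)] clockwise_dist_if[OF b(4) b(2)] clockwise_dist_if[OF b(4) b(3)] clockwise_dist_if[OF b(4) b(4)]
 show ab: "a ~= b" and cd: "c ~= d" and ac: "a ~= c" and bd: "b ~= d" and sym: "cyclic_chain N c d a b"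
  using ch b unfolding cyclic_chain_def D by (auto split: if_splits)
 have no: "~ cyclic_chain N a b d c" "~ cyclic_chain N c d b a" "~ cyclic_chain N b a c d" "~ cyclic_chain N d c a b"
  using ch b ab cd ac bd unfolding cyclic_chain_def D by (auto split: if_splits)
 have dbl: "b = c & a = d" if "cyclic_chain N b a d c \<or> cyclic_chain N d c b a"
  using that ch b ab cd ac bd unfolding cyclic_chain_def D by (auto split: if_splits)
 assume e: "{{u, v}, {u', v'}} = {{a, b}, {c, d}}" and ch': "cyclic_chain N u v u' v'"
 have dbl1: "b = c & a = d" if "cyclic_chain N b a d c" using dbl that by blast
 have dbl2: "b = c & a = d" if "cyclic_chain N d c b a" using dbl that by blast
 consider "{u, v} = {a, b}" "{u', v'} = {c, d}" | "{u, v} = {c, d}" "{u', v'} = {a, b}"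
  using e by (auto simp only: doubleton_eq_iff)
 then show "u = a & v = b & u' = c & v' = d \<or> u = c & v = d & u' = a & v' = b"
 proof cases
  case 1
  then consider "u = a" "v = b" "u' = c" "v' = d" | "u = b" "v = a" "u' = c" "v' = d"
   | "u = a" "v = b" "u' = d" "v' = c" | "u = b" "v = a" "u' = d" "v' = c" by (auto simp only: doubleton_eq_iff)
  then show ?thesis
  proof cases
   case 4
   then show ?thesis using dbl1 ch' by simp
  qed (use ch' no in simp_all)
 next
  case 2
  then consider "u = c" "v = d" "u' = a" "v' = b" | "u = d" "v = c" "u' = a" "v' = b"
   | "u = c" "v = d" "u' = b" "v' = a" | "u = d" "v = c" "u' = b" "v' = a" by (auto simp only: doubleton_eq_iff)
  then show ?thesis
  proof cases
   case 4
   then show ?thesis using dbl2 ch' by simp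
  qed (use ch' no in simp_all)
 qed
qed

text \<open>Propositional core. \<open>p\<close> and \<open>q\<close> are the turns of one serpent
  at the two ends, \<open>r\<close> and \<open>s\<close> those of the other, with index 0, 1, 2 for
  the value. \<open>E\<close> and \<open>F\<close> say that endpoints of the two final edges
  coincide. The four disjuncts are the conditions in the four orders allowed by exchanging serpents
  and ends.\<close>

lemma conflict_bool:
 fixes p0 p1 p2 q0 q1 q2 r0 r1 r2 s0 s1 s2 E F :: bool
 assumes "~ (p0 & p2)" "~ (q0 & q2)" "~ (r0 & r2)" "~ (s0 & s2)" "~ (p0 & r0)" "~ (p2 & r2)" "~ (q0 & s0)" "~ (q2 & s2)"
 defines "p1 \<equiv> ~ p0 & ~ p2" and "q1 \<equiv> ~ q0 & ~ q2" and "r1 \<equiv> ~ r0 & ~ r2" and "s1 \<equiv> ~ s0 & ~ s2"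
  and "X1 \<equiv> p1 \<or> E & F & q1" and "X2 \<equiv> r1 \<or> E & F & s1"
  and "Y1 \<equiv> q1 \<or> E & F & p1" and "Y2 \<equiv> s1 \<or> E & F & r1" and "C \<equiv> p1 & r1 \<or> q1 & s1"
  and "uh1 \<equiv> p0 \<or> E & q2" and "vh1 \<equiv> p2 \<or> F & q0"
  and "ut1 \<equiv> q0 \<or> F & p2" and "vt1 \<equiv> q2 \<or> E & p0"
  and "uh2 \<equiv> r0 \<or> E & s2" and "vh2 \<equiv> r2 \<or> F & s0"
  and "ut2 \<equiv> s0 \<or> F & r2" and "vt2 \<equiv> s2 \<or> E & r0"
 shows "(C \<or> (uh1 & ut1 & vh2 & vt2) \<or> (X2 & (uh1 & ut1 \<or> vh1 & vt1)) \<or> (X1 & Y2 & (ut1 & vh2 \<or> vt1 & uh2)))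
   \<or> (C \<or> (uh2 & ut2 & vh1 & vt1) \<or> (X1 & (uh2 & ut2 \<or> vh2 & vt2)) \<or> (X2 & Y1 & (ut2 & vh1 \<or> vt2 & uh1)))
   \<or> (C \<or> (ut1 & uh1 & vt2 & vh2) \<or> (Y2 & (ut1 & uh1 \<or> vt1 & vh1)) \<or> (Y1 & X2 & (uh1 & vt2 \<or> vh1 & ut2)))
   \<or> (C \<or> (ut2 & uh2 & vt1 & vh1) \<or> (Y1 & (ut2 & uh2 \<or> vt2 & vh2)) \<or> (Y2 & X1 & (uh2 & vt1 \<or> vh2 & ut1)))
  \<longleftrightarrow> (p0 \<or> r2 \<or> p1 & r1) & (q0 \<or> s2 \<or> q1 & s1) \<or> (r0 \<or> p2 \<or> p1 & r1) & (s0 \<or> q2 \<or> q1 & s1)"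
 using assms(1-8) unfolding assms(9-) by argo

lemma conflict_codes:
 fixes p q r s :: nat and E F :: bool
 assumes "p \<le> 2" "q \<le> 2" "r \<le> 2" "s \<le> 2" "p = r ==> p = 1" "q = s ==> q = 1"
 defines "X1 \<equiv> p = 1 \<or> E & F & q = 1" and "X2 \<equiv> r = 1 \<or> E & F & s = 1"
  and "Y1 \<equiv> q = 1 \<or> E & F & p = 1" and "Y2 \<equiv> s = 1 \<or> E & F & r = 1"
  and "C \<equiv> p = 1 & r = 1 \<or> q = 1 & s = 1"
  and "uh1 \<equiv> p = 0 \<or> E & q = 2" and "vh1 \<equiv> p = 2 \<or> F & q = 0"
  and "ut1 \<equiv> q = 0 \<or> F & p = 2" and "vt1 \<equiv> q = 2 \<or> E & p = 0"
  and "uh2 \<equiv> r = 0 \<or> E & s = 2" and "vh2 \<equiv> r = 2 \<or> F & s = 0"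
  and "ut2 \<equiv> s = 0 \<or> F & r = 2" and "vt2 \<equiv> s = 2 \<or> E & r = 0"
 shows "(C \<or> (uh1 & ut1 & vh2 & vt2) \<or> (X2 & (uh1 & ut1 \<or> vh1 & vt1)) \<or> (X1 & Y2 & (ut1 & vh2 \<or> vt1 & uh2)))
   \<or> (C \<or> (uh2 & ut2 & vh1 & vt1) \<or> (X1 & (uh2 & ut2 \<or> vh2 & vt2)) \<or> (X2 & Y1 & (ut2 & vh1 \<or> vt2 & uh1)))
   \<or> (C \<or> (ut1 & uh1 & vt2 & vh2) \<or> (Y2 & (ut1 & uh1 \<or> vt1 & vh1)) \<or> (Y1 & X2 & (uh1 & vt2 \<or> vh1 & ut2)))
   \<or> (C \<or> (ut2 & uh2 & vt1 & vh1) \<or> (Y1 & (ut2 & uh2 \<or> vt2 & vh2)) \<or> (Y2 & X1 & (uh2 & vt1 \<or> vh2 & ut1)))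
  \<longleftrightarrow> p \<le> r & q \<le> s \<or> r \<le> p & s \<le> q"
proof -
 have 1: "p \<le> r \<longleftrightarrow> p = 0 \<or> r = 2 \<or> p = 1 & r = 1" "r \<le> p \<longleftrightarrow> r = 0 \<or> p = 2 \<or> p = 1 & r = 1"
  "q \<le> s \<longleftrightarrow> q = 0 \<or> s = 2 \<or> q = 1 & s = 1" "s \<le> q \<longleftrightarrow> s = 0 \<or> q = 2 \<or> q = 1 & s = 1"
  using assms(1-4) by linarith+
 have 3: "~ (p = 0 & r = 0)" "~ (p = 2 & r = 2)" "~ (q = 0 & s = 0)" "~ (q = 2 & s = 2)" using assms(5,6) by auto
 have 4: "p = 1 \<longleftrightarrow> p ~= 0 & p ~= 2" "q = 1 \<longleftrightarrow> q ~= 0 & q ~= 2" "r = 1 \<longleftrightarrow> r ~= 0 & r ~= 2" "s = 1 \<longleftrightarrow> s ~= 0 & s ~= 2"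
  using assms(1-4) by linarith+
 show ?thesis unfolding assms(7-) 1 4 by (rule conflict_bool[OF _ _ _ _ 3]) linarith+
qed

text \<open>The four conditions, in all permitted exchanges of roles, say together that one serpent
  turns weakly to the left of the other at both ends of the intersection.\<close>

lemma incomp_codes:
 fixes xh xt ch ct :: "nat \<times> nat"
 assumes S: "snake S1" "snake S2" and x: "xh \<in> S1" "xh \<in> S2" "xt \<in> S1" "xt \<in> S2"
  and c: "dart_cell (xh, bh) ch" "dart_cell (xt, bt) ct" and ne: "(xh, ch) ~= (xt, ct)"
  and nI: "\<forall>d\<in>S1 \<inter> S2. ~ beyond (xh, bh) d & ~ beyond (xt, bt) d"
  and cov: "\<forall>d\<in>S1. d \<in> S2 \<or> beyond (xh, bh) d \<or> beyond (xt, bt) d"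
   "\<forall>d\<in>S2. d \<in> S1 \<or> beyond (xh, bh) d \<or> beyond (xt, bt) d"
  and chain: "cyclic_chain N (2 * lv (xh, bh) + 1) (2 * rv (xh, bh) + 1) (2 * lv (xt, bt) + 1) (2 * rv (xt, bt) + 1)"
 shows "incomp S1 S2 \<longleftrightarrow>
  code S1 (xh, bh) \<le> code S2 (xh, bh) & code S1 (xt, bt) \<le> code S2 (xt, bt) \<or>
  code S2 (xh, bh) \<le> code S1 (xh, bh) & code S2 (xt, bt) \<le> code S1 (xt, bt)"
proof -
 let ?I = "S1 \<inter> S2" and ?h = "(xh, bh)" and ?t = "(xt, bt)"
 let ?uh = "2 * lv ?h + 1" and ?vh = "2 * rv ?h + 1" and ?ut = "2 * lv ?t + 1" and ?vt = "2 * rv ?t + 1"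
 have P: "is_path S1" "is_path S2" using S by (auto simp: snake_def)
 have PI: "is_path ?I" using path_Int[OF P] x by blast
 have SB: "S1 \<subseteq> Bar" "S2 \<subseteq> Bar" "?I \<subseteq> Bar" using path_duals[OF P(1)] path_duals[OF P(2)] duals_Bar by blast+
 have xB: "xh \<in> Bar" "xt \<in> Bar" using SB x by blast+
 have cc: "ch \<in> nodes" "side xh ch" "ct \<in> nodes" "side xt ct" using c by auto
 have "(xh, ch) \<in> ends ?I" "(xt, ct) \<in> ends ?I"
  using ends_iff[OF PI] cc x nI side_beyond[OF c(1)] side_beyond[OF c(2)] by blast+
 then have eI: "ends ?I = {(xh, ch), (xt, ct)}" using ends_two[OF PI _ _ ne] by blast
 have hx: "hl xh = {?uh, ?vh}" "hl xt = {?ut, ?vt}" by (auto simp: hl_def)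
 have feI: "fe ?I = {{?uh, ?vh}, {?ut, ?vt}}" unfolding fe_def eI hx[symmetric] by simp
 have lt: "lv ?h < N" "rv ?h < N" "lv ?t < N" "rv ?t < N" using Bar[OF xB(1)] Bar[OF xB(2)] by auto
 have bd: "?uh < 2 * N" "?vh < 2 * N" "?ut < 2 * N" "?vt < 2 * N" using lt by auto
 note CF = chain_facts[OF bd chain]
 have df: "lv ?h ~= rv ?h" "lv ?t ~= rv ?t" "lv ?h ~= lv ?t" "rv ?h ~= rv ?t" using CF(2-5) by auto
 \<comment> \<open>A vertex common to both final edges is left for one dart and right for the other.
   Both coincidences together mean that the intersection is a single diagonal, so
   \<open>E & F\<close> replaces \<open>xh = xt\<close>.\<close>
 define E where "E \<longleftrightarrow> lv ?h = rv ?t"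
 define F where "F \<longleftrightarrow> rv ?h = lv ?t"
 have EF: "xh = xt \<longleftrightarrow> E & F"
 proof
  assume "xh = xt"
  then have "V xh = V xt" by simp
  then show "E & F" using df V_darts[of xh bh] V_darts[of xt bt] unfolding E_def F_def by (auto simp: doubleton_eq_iff)
 next
  assume "E & F"
  then have "V xh = V xt" using V_darts[of xh bh] V_darts[of xt bt] unfolding E_def F_def by auto
  then show "xh = xt" using V_inj xB by blast
 qed
 have two: "two_at (hl ` ?I) (hl ` S) ?uh \<longleftrightarrow> code S ?h = 0 \<or> E & code S ?t = 2"
   "two_at (hl ` ?I) (hl ` S) ?vh \<longleftrightarrow> code S ?h = 2 \<or> F & code S ?t = 0"
   "two_at (hl ` ?I) (hl ` S) ?ut \<longleftrightarrow> code S ?t = 0 \<or> F & code S ?h = 2"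
   "two_at (hl ` ?I) (hl ` S) ?vt \<longleftrightarrow> code S ?t = 2 \<or> E & code S ?h = 0" if "S = S1 \<or> S = S2" for S
 proof -
  have sn: "snake S" "is_path S" "S \<subseteq> Bar" "?I \<subseteq> S" "xh \<in> S" "xt \<in> S" using that S P SB x by auto
  have xI: "xh \<in> ?I" "xt \<in> ?I" using x by auto
  have cv: "\<forall>d\<in>S. d \<in> ?I \<or> beyond ?h d \<or> beyond ?t d" using that cov by blast
  then have cv': "\<forall>d\<in>S. d \<in> ?I \<or> beyond ?t d \<or> beyond ?h d" by blast
  have nI': "\<forall>d\<in>?I. ~ beyond ?t d & ~ beyond ?h d" using nI by blast
  note H = two_ends[OF sn(2,4) xI c nI cv] and T = two_ends[OF sn(2,4) xI(2,1) c(2,1) nI' cv']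
  note ch' = code_next(1,2)[OF sn(1,5) c(1)] and ct' = code_next(1,2)[OF sn(1,6) c(2)]
  have mem: "lv ?h \<in> V xh" "rv ?h \<in> V xh" "lv ?t \<in> V xt" "rv ?t \<in> V xt" by (auto simp: V_def)
  have Vt: "w \<in> V xt \<longleftrightarrow> w = lv ?t \<or> w = rv ?t" "w \<in> V xh \<longleftrightarrow> w = lv ?h \<or> w = rv ?h" for w
   using V_darts[of xt bt] V_darts[of xh bh] by auto
  show "two_at (hl ` ?I) (hl ` S) ?uh \<longleftrightarrow> code S ?h = 0 \<or> E & code S ?t = 2"
   unfolding two_at_hl[OF sn(3) SB(3)] H[OF mem(1)] ch' ct' E_def Vt using df by (cases "lv ?h = rv ?t") simp_all
  show "two_at (hl ` ?I) (hl ` S) ?vh \<longleftrightarrow> code S ?h = 2 \<or> F & code S ?t = 0"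
   unfolding two_at_hl[OF sn(3) SB(3)] H[OF mem(2)] ch' ct' F_def Vt using df by (cases "rv ?h = lv ?t") simp_all
  show "two_at (hl ` ?I) (hl ` S) ?ut \<longleftrightarrow> code S ?t = 0 \<or> F & code S ?h = 2"
   unfolding two_at_hl[OF sn(3) SB(3)] T[OF mem(3)] ch' ct' F_def Vt using df by (cases "rv ?h = lv ?t") simp_all
  show "two_at (hl ` ?I) (hl ` S) ?vt \<longleftrightarrow> code S ?t = 2 \<or> E & code S ?h = 0"
   unfolding two_at_hl[OF sn(3) SB(3)] T[OF mem(4)] ch' ct' E_def Vt using df by (cases "lv ?h = rv ?t") simp_all
 qed
 have endS: "(xh, z) \<in> ends S ==> z = ch \<or> xh = xt & z = ct" "(xt, z) \<in> ends S ==> z = ct \<or> xh = xt & z = ch"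
  if "S = S1 \<or> S = S2" for S z proof -
  have PS: "is_path S" "?I \<subseteq> S" using that P by auto
  have "(x, z) \<in> ends ?I" if "(x, z) \<in> ends S" "x \<in> ?I" for x proof -
   have "z \<in> nodes & side x z & (\<forall>e\<in>S. side e z --> e = x)" using ends_iff[OF PS(1), of x z] that(1) by blast
   then show ?thesis using ends_iff[OF PI, of x z] that(2) PS(2) by blast
  qed
  then have "(x, z) = (xh, ch) \<or> (x, z) = (xt, ct)" if "(x, z) \<in> ends S" "x \<in> ?I" for x
   using that unfolding eI by blast
  from this[of xh] this[of xt]
  show "(xh, z) \<in> ends S ==> z = ch \<or> xh = xt & z = ct" "(xt, z) \<in> ends S ==> z = ct \<or> xh = xt & z = ch"
   using x by auto
 qed
 have fe: "{?uh, ?vh} \<in> fe S \<longleftrightarrow> code S ?h = 1 \<or> E & F & code S ?t = 1"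
   "{?ut, ?vt} \<in> fe S \<longleftrightarrow> code S ?t = 1 \<or> E & F & code S ?h = 1" if s: "S = S1 \<or> S = S2" for S
 proof -
  have sn: "snake S" "is_path S" "S \<subseteq> Bar" "xh \<in> S" "xt \<in> S" using that S P SB x by auto
  have "hl x \<in> fe S \<longleftrightarrow> (\<exists>z. (x, z) \<in> ends S)" if "x \<in> Bar" for x
  proof
   assume "hl x \<in> fe S"
   then obtain y z where y: "hl x = hl y" "(y, z) \<in> ends S" unfolding fe_def by force
   then have "y \<in> Bar" using ends_iff[OF sn(2)] sn(3) by blast
   then show "\<exists>z. (x, z) \<in> ends S" using y that inj_onD[OF hl_inj y(1)] by blast
  qed (unfold fe_def, force)
  note in_fe = this[OF xB(1), unfolded hx] this[OF xB(2), unfolded hx]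
  have "(\<exists>z. (xh, z) \<in> ends S) \<longleftrightarrow> (xh, ch) \<in> ends S \<or> xh = xt & (xt, ct) \<in> ends S"
   using endS(1)[OF s] by metis
  moreover have "(\<exists>z. (xt, z) \<in> ends S) \<longleftrightarrow> (xt, ct) \<in> ends S \<or> xh = xt & (xh, ch) \<in> ends S"
   using endS(2)[OF s] by metis
  ultimately show "{?uh, ?vh} \<in> fe S \<longleftrightarrow> code S ?h = 1 \<or> E & F & code S ?t = 1"
   "{?ut, ?vt} \<in> fe S \<longleftrightarrow> code S ?t = 1 \<or> E & F & code S ?h = 1"
   unfolding hx code_next(3)[OF sn(1,4) c(1)] code_next(3)[OF sn(1,5) c(2)] in_fe by (simp_all only: EF conj_assoc)
 qed
 have common: "ends S1 \<inter> ends S2 ~= {} \<longleftrightarrow> code S1 ?h = 1 & code S2 ?h = 1 \<or> code S1 ?t = 1 & code S2 ?t = 1"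
 proof -
  have "(d, z) \<in> ends ?I" if "(d, z) \<in> ends S1" "(d, z) \<in> ends S2" for d z
   using ends_iff[OF PI, of d z] ends_iff[OF P(1), of d z] ends_iff[OF P(2), of d z] that by blast
  then have "ends S1 \<inter> ends S2 \<subseteq> ends ?I" by auto
  then show ?thesis unfolding eI
    code_next(3)[OF S(1) x(1) c(1)] code_next(3)[OF S(1) x(3) c(2)]
    code_next(3)[OF S(2) x(2) c(1)] code_next(3)[OF S(2) x(4) c(2)] by blast
 qed
 have le: "code S1 ?h \<le> 2" "code S1 ?t \<le> 2" "code S2 ?h \<le> 2" "code S2 ?t \<le> 2"
  using code_next(4)[OF S(1) x(1) c(1)] code_next(4)[OF S(1) x(3) c(2)]
    code_next(4)[OF S(2) x(2) c(1)] code_next(4)[OF S(2) x(4) c(2)] by auto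
 have nb: "code S1 ?h = code S2 ?h ==> code S1 ?h = 1" "code S1 ?t = code S2 ?t ==> code S1 ?t = 1"
  using code_not_both[OF S(1) x(1) S(2) x(2) c(1)] code_not_both[OF S(1) x(3) S(2) x(4) c(2)] nI by blast+
 define Q where "Q u v u' v' \<longleftrightarrow> arc_conflict S1 S2 u v u' v' \<or> arc_conflict S2 S1 u v u' v' \<or>
   arc_conflict S1 S2 u' v' u v \<or> arc_conflict S2 S1 u' v' u v" for u v u' v'
 have "incomp S1 S2 \<longleftrightarrow> (\<exists>u v u' v'. {{?uh, ?vh}, {?ut, ?vt}} = {{u, v}, {u', v'}} & cyclic_chain N u v u' v' & Q u v u' v')"
  unfolding incomp_def feI Q_def using x by blast
 also have "\<dots> \<longleftrightarrow> Q ?uh ?vh ?ut ?vt"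
 proof
  assume "\<exists>u v u' v'. {{?uh, ?vh}, {?ut, ?vt}} = {{u, v}, {u', v'}} & cyclic_chain N u v u' v' & Q u v u' v'"
  then obtain u v u' v' where q: "{{u, v}, {u', v'}} = {{?uh, ?vh}, {?ut, ?vt}}" "cyclic_chain N u v u' v'" "Q u v u' v'"
   by metis
  then have "Q ?uh ?vh ?ut ?vt \<or> Q ?ut ?vt ?uh ?vh" using CF(6)[OF q(1,2)] by blast
  then show "Q ?uh ?vh ?ut ?vt" unfolding Q_def by blast
 next
  assume "Q ?uh ?vh ?ut ?vt"
  then show "\<exists>u v u' v'. {{?uh, ?vh}, {?ut, ?vt}} = {{u, v}, {u', v'}} & cyclic_chain N u v u' v' & Q u v u' v'"
   using chain by blast
 qed
 also have "\<dots> \<longleftrightarrow> code S1 ?h \<le> code S2 ?h & code S1 ?t \<le> code S2 ?t \<or>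
   code S2 ?h \<le> code S1 ?h & code S2 ?t \<le> code S1 ?t"
  unfolding Q_def arc_conflict_def Let_def Int_commute[of S2 S1] Int_commute[of "ends S2" "ends S1"]
   two[OF disjI1[OF refl]] two[OF disjI2[OF refl]] fe[OF disjI1[OF refl]] fe[OF disjI2[OF refl]] common
  by (rule conflict_codes[OF le nb])
 finally show ?thesis .
qed

end

section \<open>Comparing serpents subtree by subtree\<close>

context arc_family begin

lemma chain_nested:
 assumes "c \<le> a" "a < b" "b \<le> d" "d < N" shows "cyclic_chain N (2 * a + 1) (2 * b + 1) (2 * d + 1) (2 * c + 1)"
 using assms clockwise_dist_if[of "2 * a + 1" "2 * b + 1"] clockwise_dist_if[of "2 * a + 1" "2 * c + 1"]
  clockwise_dist_if[of "2 * a + 1" "2 * d + 1"] unfolding cyclic_chain_def by (auto split: if_splits)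

lemma chain_disjoint:
 assumes "a < b" "b \<le> c" "c < d" "d < N" shows "cyclic_chain N (2 * a + 1) (2 * b + 1) (2 * c + 1) (2 * d + 1)"
 using assms clockwise_dist_if[of "2 * a + 1" "2 * b + 1"] clockwise_dist_if[of "2 * a + 1" "2 * c + 1"]
  clockwise_dist_if[of "2 * a + 1" "2 * d + 1"] unfolding cyclic_chain_def by (auto split: if_splits)

lemma incomp_sym: "incomp S1 S2 \<longleftrightarrow> incomp S2 S1" unfolding incomp_def Int_commute[of S2 S1] by blast

lemma incomp_disjoint: "S1 \<inter> S2 = {} ==> ~ incomp S1 S2" by (simp add: incomp_def)

lemma snake_duals: "snake S ==> S \<subseteq> duals" by (simp add: snake_def path_duals)

lemma emb_inside: "emb t l ==> d \<in> Bar ==> sub_arc d (l, l + leaves t) \<longleftrightarrow> d \<in> arcs t l"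
 unfolding emb_def by blast

lemma dart_down: "x \<in> duals ==> dart_cell (x, False) x" using duals_Bar side_refl by simp

lemma dart_up: "x \<in> duals ==> \<exists>c. dart_cell (x, True) c & c ~= x" by (rule parent) auto

lemma code_local:
 assumes "emb t l" "S \<subseteq> Bar" "S \<inter> arcs t l = W" "x \<in> arcs t l"
 shows "code S (x, False) = code W (x, False)"
proof (rule code_cong)
 fix d assume b: "beyond (x, False) d"
 have "sub_arc x (l, l + leaves t)" using arcs_bounds[OF assms(4)] by (simp add: sub_arc_def)
 moreover have "sub_arc d x" using b by simp
 ultimately have "d \<in> Bar ==> d \<in> arcs t l" using emb_inside[OF assms(1), of d] sub_arc_trans by blast
 then show "d \<in> S \<longleftrightarrow> d \<in> W" using assms(2,3) by blast
qed

text \<open>The common arcs form one descending path: its lower end is the arc where the two walks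
  separate, compared by the words, and its upper end is the top arc, compared by the upward
  turns.\<close>

lemma incomp_nested:
 assumes S: "snake S1" "snake S2" and e: "emb t l" and r: "real_top t"
  and w: "w \<in> half_walks t" "v \<in> half_walks t" "S1 \<inter> arcs t l = walk t l w" "S2 \<inter> arcs t l = walk t l v"
  and I: "S1 \<inter> S2 \<subseteq> arcs t l" shows "incomp S1 S2 \<longleftrightarrow>
  w \<le> v & code S1 ((l, l + leaves t), True) \<le> code S2 ((l, l + leaves t), True) \<or>
  v \<le> w & code S2 ((l, l + leaves t), True) \<le> code S1 ((l, l + leaves t), True)"
proof -
 let ?y = "(l, l + leaves t)"
 have wf: "wf_tr t" using e by (simp add: emb_def)
 have SB: "S1 \<subseteq> Bar" "S2 \<subseteq> Bar" using snake_duals S duals_Bar by blast+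
 have se: "same_entry t w v" using r by (simp add: same_entry_def)
 obtain x where "diverge (walk t l w) (walk t l v) x (w \<le> v) (v \<le> w)"
  using walks_compare[OF wf w(1,2) se, of l] by blast
 note x = divergeD[OF this]
 have xS: "x \<in> S1" "x \<in> S2" "x \<in> arcs t l" using x(1,2) w(3,4) by blast+
 have yS: "?y \<in> S1" "?y \<in> S2" using walk_top[OF r w(1), of l] walk_top[OF r w(2), of l] w(3,4) by blast+
 have du: "x \<in> duals" "?y \<in> duals" using snake_duals[OF S(1)] xS yS by blast+
 obtain c where c: "dart_cell (?y, True) c" "c ~= ?y" using dart_up[OF du(2)] by blast
 have bey: "beyond (?y, True) d" if "d \<in> Bar" "d \<notin> arcs t l" for d using that emb_inside[OF e] by simp
 have nby: "~ beyond (?y, True) d" if "d \<in> arcs t l" for d using arcs_bounds[OF that] by (simp add: sub_arc_def)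
 have nI: "\<forall>d\<in>S1 \<inter> S2. ~ beyond (x, False) d & ~ beyond (?y, True) d" using I x(5) nby w(3,4) by blast
 have cov: "\<forall>d\<in>S1. d \<in> S2 \<or> beyond (x, False) d \<or> beyond (?y, True) d"
  "\<forall>d\<in>S2. d \<in> S1 \<or> beyond (x, False) d \<or> beyond (?y, True) d" using bey SB x(3,4) w(3,4) by blast+
 have ne: "(x, x) ~= (?y, c)" using c(2) by blast
 have chain: "cyclic_chain N (2 * lv (x, False) + 1) (2 * rv (x, False) + 1) (2 * lv (?y, True) + 1) (2 * rv (?y, True) + 1)"
  using chain_nested[of l "fst x" "snd x" "l + leaves t"] arcs_bounds[OF xS(3)] duals_Bar[OF du(2)] by simp
 note cl = code_local[OF e SB(1) w(3) xS(3)] code_local[OF e SB(2) w(4) xS(3)]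
 show ?thesis unfolding incomp_codes[OF S xS(1,2) yS dart_down[OF du(1)] c(1) ne nI cov chain] cl x(6,7) ..
qed

text \<open>For two hooks at the same node both ends of the intersection point downwards, one in
  each child, so both comparisons are comparisons of words.\<close>

lemma incomp_fork:
 assumes S: "snake S1" "snake S2" and e: "emb a l" "emb b k" "k = l + leaves a" and r: "real_top a"
  and w: "u \<in> half_walks a" "u' \<in> half_walks a" "S1 \<inter> arcs a l = walk a l u" "S2 \<inter> arcs a l = walk a l u'"
  and v: "v \<in> enter_left b" "v' \<in> enter_left b" "S1 \<inter> arcs b k = walk b k v" "S2 \<inter> arcs b k = walk b k v'"
  and I: "S1 \<union> S2 \<subseteq> arcs a l \<union> arcs b k"
 shows "incomp S1 S2 \<longleftrightarrow> u \<le> u' & v \<le> v' \<or> u' \<le> u & v' \<le> v"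
proof -
 have wf: "wf_tr a" "wf_tr b" using e by (auto simp: emb_def)
 have SB: "S1 \<subseteq> Bar" "S2 \<subseteq> Bar" using snake_duals S duals_Bar by blast+
 have se: "same_entry a u u'" "same_entry b v v'" "v \<in> half_walks b" "v' \<in> half_walks b"
  using r enter_left_same[OF v(1,2)] v(1,2) by (auto simp: same_entry_def enter_left_def)
 obtain x where "diverge (walk a l u) (walk a l u') x (u \<le> u') (u' \<le> u)"
  using walks_compare[OF wf(1) w(1,2) se(1), of l] by blast
 note x = divergeD[OF this]
 obtain y where "diverge (walk b k v) (walk b k v') y (v \<le> v') (v' \<le> v)"
  using walks_compare[OF wf(2) se(3,4,2), of k] by blast
 note y = divergeD[OF this]
 have xS: "x \<in> S1" "x \<in> S2" "x \<in> arcs a l" using x(1,2) w(3,4) by blast+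
 have yS: "y \<in> S1" "y \<in> S2" "y \<in> arcs b k" using y(1,2) v(3,4) by blast+
 have du: "x \<in> duals" "y \<in> duals" using snake_duals[OF S(1)] xS yS by blast+
 have bx: "l \<le> fst x & fst x < snd x & snd x \<le> k" using arcs_bounds[OF xS(3)] e(3) by simp
 have byy: "k \<le> fst y & fst y < snd y" using arcs_bounds[OF yS(3)] by simp
 have nx: "~ beyond (x, False) d" if "d \<in> arcs b k" for d using arcs_bounds[OF that] bx by (auto simp: sub_arc_def)
 have ny: "~ beyond (y, False) d" if "d \<in> arcs a l" for d using arcs_bounds[OF that] byy e(3) by (auto simp: sub_arc_def)
 have nI: "\<forall>d\<in>S1 \<inter> S2. ~ beyond (x, False) d & ~ beyond (y, False) d"
 proof
  fix d assume d: "d \<in> S1 \<inter> S2"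
  then consider "d \<in> arcs a l" | "d \<in> arcs b k" using I by blast
  then show "~ beyond (x, False) d & ~ beyond (y, False) d"
  proof cases
   case 1
   then show ?thesis using d x(5) w(3,4) ny by blast
  next
   case 2
   then show ?thesis using d y(5) v(3,4) nx by blast
  qed
 qed
 have covS1: "d \<in> S2 \<or> beyond (x, False) d \<or> beyond (y, False) d" if d: "d \<in> S1" for d proof -
  consider "d \<in> S1 \<inter> arcs a l" | "d \<in> S1 \<inter> arcs b k" using d I by blast
  then show ?thesis
  proof cases
   case 1
   then have "d \<in> walk a l u" using w(3,4) by blast
   then have "d \<in> walk a l u' \<or> beyond (x, False) d" using x(3) by blast
   then show ?thesis using w(3,4) by blast
  next
   case 2
   then have "d \<in> walk b k v" using v(3,4) by blast
   then have "d \<in> walk b k v' \<or> beyond (y, False) d" using y(3) by blast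
   then show ?thesis using v(3,4) by blast
  qed
 qed
 have covS2: "d \<in> S1 \<or> beyond (x, False) d \<or> beyond (y, False) d" if d: "d \<in> S2" for d proof -
  consider "d \<in> S2 \<inter> arcs a l" | "d \<in> S2 \<inter> arcs b k" using d I by blast
  then show ?thesis
  proof cases
   case 1
   then have "d \<in> walk a l u'" using w(3,4) by blast
   then have "d \<in> walk a l u \<or> beyond (x, False) d" using x(4) by blast
   then show ?thesis using w(3,4) by blast
  next
   case 2
   then have "d \<in> walk b k v'" using v(3,4) by blast
   then have "d \<in> walk b k v \<or> beyond (y, False) d" using y(4) by blast
   then show ?thesis using v(3,4) by blast
  qed
 qed
 have cov: "\<forall>d\<in>S1. d \<in> S2 \<or> beyond (x, False) d \<or> beyond (y, False) d"
  "\<forall>d\<in>S2. d \<in> S1 \<or> beyond (x, False) d \<or> beyond (y, False) d" using covS1 covS2 by blast+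
 have ne: "(x, x) ~= (y, y)" using bx byy by auto
 have chain: "cyclic_chain N (2 * lv (x, False) + 1) (2 * rv (x, False) + 1) (2 * lv (y, False) + 1) (2 * rv (y, False) + 1)"
  using chain_disjoint[of "fst x" "snd x" "fst y" "snd y"] bx byy duals_Bar[OF du(2)] by simp
 note cl = code_local[OF e(1) SB(1) w(3) xS(3)] code_local[OF e(1) SB(2) w(4) xS(3)]
  code_local[OF e(2) SB(1) v(3) yS(3)] code_local[OF e(2) SB(2) v(4) yS(3)]
 show ?thesis unfolding incomp_codes[OF S xS(1,2) yS(1,2) dart_down[OF du(1)] dart_down[OF du(2)] ne nI cov chain] cl
   x(6,7) y(6,7) ..
qed

lemma code_touch:
 assumes S: "snake S" "x \<in> S" and d: "d \<in> S" "beyond (x, True) d"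
 shows "snd x \<in> V d ==> code S (x, True) = 0" "fst x \<in> V d ==> code S (x, True) = 2"
proof -
 obtain c where c: "dart_cell (x, True) c" using dart_up snake_duals[OF S(1)] S(2) by blast
 have P: "is_path S" using S by (simp add: snake_def)
 obtain n where n: "n \<in> S" "n ~= x" "side n c" "\<And>w. w \<in> V x ==> w \<in> V d ==> w \<in> V n"
  using next_arc[OF P S(2) c d] by metis
 show "snd x \<in> V d ==> code S (x, True) = 0" using n code_next(1)[OF S c] by (auto simp: V_def)
 show "fst x \<in> V d ==> code S (x, True) = 2" using n code_next(2)[OF S c] by (auto simp: V_def)
qed

lemma code_stop:
 assumes "S \<subseteq> arcs t l" shows "code S ((l, l + leaves t), True) = 1"
proof -
 have "~ beyond ((l, l + leaves t), True) d" if "d \<in> S" for d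
  using arcs_bounds[of d t l] assms that by (auto simp: sub_arc_def)
 then show ?thesis unfolding code_def by (auto simp del: beyond.simps)
qed

text \<open>How a serpent meeting the tree in \<open>w\<close> leaves it upwards. Below a virtual
  top the serpent stays in the surrounding cell, so its next arc must touch the end of the interval
  towards which \<open>w\<close> starts.\<close>

definition "exits t l w S \<longleftrightarrow> real_top t \<or> (\<exists>w'. w = Lft w') & (\<exists>d\<in>S - arcs t l. l \<in> V d) \<or>
 (\<exists>w'. w = Rgt w') & (\<exists>d\<in>S - arcs t l. l + leaves t \<in> V d)"

lemma exit_left:
 assumes e: "emb (Nd r a b) l" and S: "S \<inter> arcs (Nd r a b) l = walk (Nd r a b) l (Lft w)"
  and x: "exits (Nd r a b) l (Lft w) S" shows "\<exists>d\<in>S - arcs a l. l \<in> V d"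
proof (cases r)
 case True
 then have "(l, l + (leaves a + leaves b)) \<in> walk (Nd r a b) l (Lft w)" by simp
 then have "(l, l + (leaves a + leaves b)) \<in> S" using S by blast
 then show ?thesis using arcs_split(2)[of l a b] by (force simp: V_def)
next
 case False
 then show ?thesis using x by (auto simp: exits_def)
qed

lemma exit_right:
 assumes e: "emb (Nd r a b) l" and S: "S \<inter> arcs (Nd r a b) l = walk (Nd r a b) l (Rgt w)"
  and x: "exits (Nd r a b) l (Rgt w) S" shows "\<exists>d\<in>S - arcs b (l + leaves a). l + leaves a + leaves b \<in> V d"
proof (cases r)
 case True
 then have "(l, l + (leaves a + leaves b)) \<in> walk (Nd r a b) l (Rgt w)" by simp
 then have "(l, l + (leaves a + leaves b)) \<in> S" using S by blast
 then show ?thesis using arcs_split(3)[of l a b] by (force simp: V_def add.assoc)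
next
 case False
 then show ?thesis using x by (auto simp: exits_def add.assoc)
qed

lemma code_exit:
 assumes S: "snake S" and e: "emb t l" "real_top t" and w: "w \<in> half_walks t" "S \<inter> arcs t l = walk t l w"
 shows "\<exists>d\<in>S - arcs t l. l \<in> V d ==> code S ((l, l + leaves t), True) = 2"
  "\<exists>d\<in>S - arcs t l. l + leaves t \<in> V d ==> code S ((l, l + leaves t), True) = 0"
proof -
 let ?y = "(l, l + leaves t)"
 have y: "?y \<in> S" using walk_top[OF e(2) w(1)] w(2) by blast
 have b: "beyond (?y, True) d" if "d \<in> S - arcs t l" for d proof -
  have "d \<in> Bar" using that snake_duals[OF S] duals_Bar by blast
  then show ?thesis using that emb_inside[OF e(1), of d] by simp
 qed
 show "\<exists>d\<in>S - arcs t l. l \<in> V d ==> code S (?y, True) = 2" using code_touch(2)[OF S y] b by fastforce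
 show "\<exists>d\<in>S - arcs t l. l + leaves t \<in> V d ==> code S (?y, True) = 0"
  using code_touch(1)[OF S y] b by fastforce
qed

lemma strip_hook_parts: "strip (Nd r a b) l (Hook u v) \<inter> arcs a l = walk a l u"
 "strip (Nd r a b) l (Hook u v) \<inter> arcs b (l + leaves a) = walk b (l + leaves a) v"
 using walk_arcs[of a l u] walk_arcs[of b "l + leaves a" v] arcs_split(1)[of _ a l b] by auto

text \<open>Each half of a hook is the continuation of the other half, and the arcs through which
  they meet share the vertex between the children.\<close>

lemma hook_exits:
 assumes e: "emb (Nd r a b) l" and u: "u \<in> half_walks a" "v \<in> enter_left b" and S: "S = strip (Nd r a b) l (Hook u v)"
 shows "\<exists>d\<in>S - arcs a l. l + leaves a \<in> V d" "\<exists>d\<in>S - arcs b (l + leaves a). l + leaves a \<in> V d"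
proof -
 let ?k = "l + leaves a"
 have wf: "wf_tr b" "real_top a" using e by (auto simp: emb_def)
 obtain d where d: "d \<in> walk b ?k v" "fst d = ?k" using walk_left[OF wf(1), of v ?k] u(2) by (auto simp: enter_left_def)
 then have "d \<notin> arcs a l" using walk_arcs arcs_split(1) by blast
 then show "\<exists>d\<in>S - arcs a l. ?k \<in> V d" using d S by (intro bexI[of _ d]) (auto simp: V_def)
 have "(l, ?k) \<in> walk a l u" by (rule walk_top[OF wf(2) u(1)])
 moreover have "(l, ?k) \<notin> arcs b ?k" using calculation walk_arcs arcs_split(1) by blast
 ultimately show "\<exists>d\<in>S - arcs b ?k. ?k \<in> V d" using S by (force simp: V_def)
qed

text \<open>Induction along the descent of both. Whatever the turn at the top of the node, the
  serpent coming from above reaches the left child around its left end and the right child around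
  its right end, so the turns there are 2 and 0.\<close>

lemma hits_iff:
 assumes "emb t l" "snake S" "w \<in> half_walks t" "S \<inter> arcs t l = walk t l w" "exits t l w S"
  "s \<in> serps t" "snake (strip t l s)"
 shows "incomp S (strip t l s) \<longleftrightarrow> hits (code S ((l, l + leaves t), True)) w s" using assms
proof (induction t arbitrary: l w s)
 case Lf
 then show ?case by simp
next
 case (Nd r a b)
 let ?k = "l + leaves a" and ?y = "(l, l + (leaves a + leaves b))" and ?t = "Nd r a b"
 note e = Nd.prems(1) and S = Nd.prems(2) and w = Nd.prems(3,4) and x = Nd.prems(5) and S' = Nd.prems(7)
 note sub = emb_sub[OF e]
 have wf: "wf_tr a" "wf_tr b" using sub by (auto simp: emb_def)
 have ss: "arcs a l \<subseteq> arcs ?t l" "arcs b ?k \<subseteq> arcs ?t l" by auto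
 have disj: "arcs a l \<inter> arcs b ?k = {}" using arcs_split(1) by blast
 have yn: "?y \<notin> arcs a l" "?y \<notin> arcs b ?k" by (rule arcs_split)+
 have meet: "S \<inter> A = walk ?t l w \<inter> A" if "A \<subseteq> arcs ?t l" for A using w(2) that by blast
 have SE: "S \<inter> (arcs a l \<union> arcs b ?k) = {}" if "w = End" proof -
  have "S \<inter> (arcs a l \<union> arcs b ?k) = walk ?t l w \<inter> (arcs a l \<union> arcs b ?k)" by (rule meet) (use ss in blast)
  then show ?thesis using that yn by auto
 qed
 have SL: "S \<inter> arcs a l = walk a l z & S \<inter> arcs b ?k = {} & z \<in> half_walks a & (\<exists>d\<in>S - arcs a l. l \<in> V d) &
   code S ((l, ?k), True) = 2" if z: "w = Lft z" for z proof -
  have 2: "z \<in> half_walks a" using w(1) z by auto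
  have W: "walk ?t l w = (if r then {?y} else {}) \<union> walk a l z" using z by simp
  have 3: "S \<inter> arcs a l = walk a l z" unfolding meet[OF ss(1)] W using yn(1) walk_arcs[of a l z] by auto
  have "S \<inter> arcs b ?k = {}" unfolding meet[OF ss(2)] W using yn(2) walk_arcs[of a l z] disj by auto
  moreover have "\<exists>d\<in>S - arcs a l. l \<in> V d" using exit_left[OF e] w(2) x z by blast
  moreover from this have "code S ((l, ?k), True) = 2" by (rule code_exit(1)[OF S sub(1,3) 2 3])
  ultimately show ?thesis using 2 3 by blast
 qed
 have SR: "S \<inter> arcs b ?k = walk b ?k z & S \<inter> arcs a l = {} & z \<in> enter_right b &
   (\<exists>d\<in>S - arcs b ?k. ?k + leaves b \<in> V d) & (real_top b --> code S ((?k, ?k + leaves b), True) = 0)"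
  if z: "w = Rgt z" for z proof -
  have 2: "z \<in> enter_right b" using w(1) z by (auto simp: enter_right_def)
  then have zh: "z \<in> half_walks b" by (simp add: enter_right_def)
  have W: "walk ?t l w = (if r then {?y} else {}) \<union> walk b ?k z" using z by simp
  have 3: "S \<inter> arcs b ?k = walk b ?k z" unfolding meet[OF ss(2)] W using yn(2) walk_arcs[of b ?k z] by auto
  have "S \<inter> arcs a l = {}" unfolding meet[OF ss(1)] W using yn(1) walk_arcs[of b ?k z] disj by auto
  moreover have ex: "\<exists>d\<in>S - arcs b ?k. ?k + leaves b \<in> V d" using exit_right[OF e] w(2) x z by blast
  moreover have "real_top b --> code S ((?k, ?k + leaves b), True) = 0" using code_exit(2)[OF S sub(2) _ zh 3] ex by blast
  ultimately show ?thesis using 2 3 by blast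
 qed
 consider (t) v where "s = Top v" "r" "v \<in> half_walks ?t" | (h) u v where "s = Hook u v" "u \<in> half_walks a" "v \<in> enter_left b"
  | (i) z where "s = In z" "z \<in> serps a" | (k) z where "s = Skip z" "z \<in> serps b"
  using Nd.prems(6) unfolding serps_def[of ?t] inner_serps_Nd by auto
 then show ?case
 proof cases
  case t
  have 1: "strip ?t l s = walk ?t l v" using t by simp
  then have 2: "strip ?t l s \<inter> arcs ?t l = walk ?t l v" "strip ?t l s \<subseteq> arcs ?t l" using walk_arcs by blast+
  have "incomp S (strip ?t l s) \<longleftrightarrow>
    w \<le> v & code S ((l, l + leaves ?t), True) \<le> code (strip ?t l s) ((l, l + leaves ?t), True) \<or>
    v \<le> w & code (strip ?t l s) ((l, l + leaves ?t), True) \<le> code S ((l, l + leaves ?t), True)"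
   by (rule incomp_nested[OF S S' e _ w(1) t(3) w(2) 2(1)]) (use t 2 in auto)
  then have "incomp S (strip ?t l s) \<longleftrightarrow>
    w \<le> v & code S ((l, l + leaves ?t), True) \<le> 1 \<or> v \<le> w & 1 \<le> code S ((l, l + leaves ?t), True)"
   unfolding code_stop[OF 2(2)] .
  then show ?thesis unfolding t(1) hits.simps(1) .
 next
  case i
  have st: "strip ?t l s = strip a l z" "strip a l z \<subseteq> arcs a l" using i strip_arcs by auto
  show ?thesis
  proof (cases w)
   case End
   then have "S \<inter> strip ?t l s = {}" using SE st by blast
   then show ?thesis using incomp_disjoint End i by simp
  next
   case (Rgt v)
   then have "S \<inter> strip ?t l s = {}" using SR st by blast
   then show ?thesis using incomp_disjoint Rgt i by simp
  next
   case (Lft v)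
   note L = SL[OF Lft]
   have "incomp S (strip a l z) \<longleftrightarrow> hits (code S ((l, ?k), True)) v z"
    using Nd.IH(1)[OF sub(1) S _ _ _ i(2)] L S' st sub(3) by (simp add: exits_def)
   then show ?thesis using L Lft i st by simp
  qed
 next
  case k
  have st: "strip ?t l s = strip b ?k z" "strip b ?k z \<subseteq> arcs b ?k" using k strip_arcs by auto
  show ?thesis
  proof (cases w)
   case End
   then have "S \<inter> strip ?t l s = {}" using SE st by blast
   then show ?thesis using incomp_disjoint End k by simp
  next
   case (Lft v)
   then have "S \<inter> strip ?t l s = {}" using SL st by blast
   then show ?thesis using incomp_disjoint Lft k by simp
  next
   case (Rgt v)
   note R = SR[OF Rgt]
   have "exits b ?k v S" using R by (auto simp: exits_def enter_right_def)
   then have "incomp S (strip b ?k z) \<longleftrightarrow> hits (code S ((?k, ?k + leaves b), True)) v z"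
    using Nd.IH(2)[OF sub(2) S _ _ _ k(2)] R S' st by (simp add: enter_right_def)
   also have "\<dots> \<longleftrightarrow> hits 0 v z"
   proof (cases "real_top b")
    case False
    then have "z \<in> inner_serps b" using k(2) by (simp add: serps_def)
    then show ?thesis by (rule hits_inner)
   qed (use R in simp)
   finally show ?thesis using Rgt k st by simp
  qed
 next
  case h
  let ?S' = "strip ?t l s"
  have st: "?S' = walk a l u \<union> walk b ?k v" "?S' \<inter> arcs a l = walk a l u" "?S' \<inter> arcs b ?k = walk b ?k v"
   "?S' \<subseteq> arcs a l \<union> arcs b ?k"
   using h strip_hook_parts[of r a b l u v] walk_arcs[of a l u] walk_arcs[of b ?k v] by auto
  have v: "v \<in> half_walks b" using h(3) by (simp add: enter_left_def)
  note ex = hook_exits[OF e h(2,3)]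
  show ?thesis
  proof (cases w)
   case End
   then have "S \<inter> ?S' = {}" using SE st(4) by blast
   then show ?thesis using incomp_disjoint End h by simp
  next
   case (Lft z)
   note L = SL[OF Lft]
   have "code ?S' ((l, ?k), True) = 0" by (rule code_exit(2)[OF S' sub(1,3) h(2) st(2)]) (use ex(1) h(1) in blast)
   moreover have "incomp S ?S' \<longleftrightarrow> z \<le> u & code S ((l, ?k), True) \<le> code ?S' ((l, ?k), True) \<or>
     u \<le> z & code ?S' ((l, ?k), True) \<le> code S ((l, ?k), True)"
    by (rule incomp_nested[OF S S' sub(1,3) _ h(2) _ st(2)]) (use L st(4) in blast)+
   ultimately show ?thesis using L Lft h(1) by simp
  next
   case (Rgt z)
   note R = SR[OF Rgt]
   have z: "z \<in> half_walks b" using R by (simp add: enter_right_def)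
   show ?thesis
   proof (cases "real_top b")
    case True
    have "code ?S' ((?k, ?k + leaves b), True) = 2"
     by (rule code_exit(1)[OF S' sub(2) True v st(3)]) (use ex(2) h(1) in blast)
    moreover have "incomp S ?S' \<longleftrightarrow>
      z \<le> v & code S ((?k, ?k + leaves b), True) \<le> code ?S' ((?k, ?k + leaves b), True) \<or>
      v \<le> z & code ?S' ((?k, ?k + leaves b), True) \<le> code S ((?k, ?k + leaves b), True)"
     by (rule incomp_nested[OF S S' sub(2) True z v _ st(3)]) (use R st(4) in blast)+
    ultimately show ?thesis using R Rgt h(1) True by simp
   next
    case False
    then obtain z' v' where zv: "z = Rgt z'" "v = Lft v'" using R h(3) by (auto simp: enter_left_def enter_right_def)
    obtain a' b' where b: "b = Nd False a' b'" using False by (cases b) auto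
    have "walk b ?k z \<inter> walk b ?k v = {}"
     using walk_arcs[of a' ?k v'] walk_arcs[of b' "?k + leaves a'" z'] arcs_split(1)[of _ a' ?k b'] b zv by auto
    then have "S \<inter> ?S' = {}" using R st by blast
    then show ?thesis using incomp_disjoint Rgt h zv by simp
   qed
  qed
 qed
qed

lemma top_iff:
 assumes e: "emb t l" and S: "snake (strip t l (Top w))" and t: "real_top t" "w \<in> half_walks t"
  and s: "s \<in> serps t" "snake (strip t l s)"
 shows "incomp (strip t l (Top w)) (strip t l s) \<longleftrightarrow> hits 1 w s"
proof -
 let ?S = "strip t l (Top w)"
 have 1: "?S \<subseteq> arcs t l" "?S \<inter> arcs t l = walk t l w" using walk_arcs strip_Top by blast+
 have "exits t l w ?S" using t by (simp add: exits_def)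
 then show ?thesis using hits_iff[OF e S t(2) 1(2) _ s] code_stop[OF 1(1)] by simp
qed

text \<open>The serpent reaching higher in the tree enters the subtree of the other one from above,
  where \<open>hits_iff\<close> decides. Two hooks at the same node fork on both sides, and serpents
  in different children are disjoint.\<close>

theorem conf_iff:
 assumes "emb t l" "s \<in> serps t" "s' \<in> serps t" "snake (strip t l s)" "snake (strip t l s')"
 shows "incomp (strip t l s) (strip t l s') \<longleftrightarrow> conf s s'" using assms
proof (induction t arbitrary: l s s')
 case Lf
 then show ?case by (simp add: serps_def)
next
 case (Nd r a b)
 let ?k = "l + leaves a" and ?t = "Nd r a b"
 note e = Nd.prems(1)
 note sub = emb_sub[OF e]
 have disj: "arcs a l \<inter> arcs b ?k = {}" using arcs_split(1) by blast
 have kinds: "(\<exists>v. s = Top v & r & v \<in> half_walks ?t) \<or> (\<exists>u v. s = Hook u v & u \<in> half_walks a & v \<in> enter_left b) \<or>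
   (\<exists>z. s = In z & z \<in> serps a) \<or> (\<exists>z. s = Skip z & z \<in> serps b)" if "s \<in> serps ?t" for s
  using that unfolding serps_def[of ?t] inner_serps_Nd by auto
 have top: "incomp (strip ?t l s) (strip ?t l s') \<longleftrightarrow> conf s s'"
  if "s = Top w" "s \<in> serps ?t" "s' \<in> serps ?t" "snake (strip ?t l s)" "snake (strip ?t l s')" for s s' w proof -
  have w: "real_top ?t" "w \<in> half_walks ?t" using kinds[OF that(2)] that(1) by auto
  have "incomp (strip ?t l s) (strip ?t l s') \<longleftrightarrow> hits 1 w s'"
   using top_iff[OF e _ w that(3,5)] that by blast
  then show ?thesis using that(1) linear[of w] by (cases s') auto
 qed
 have hook: "incomp (strip ?t l s) (strip ?t l s') \<longleftrightarrow> conf s s'"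
  if s: "s = Hook u v" "s \<in> serps ?t" and s': "s' \<in> serps ?t" "\<nexists>w. s' = Top w"
   and sn: "snake (strip ?t l s)" "snake (strip ?t l s')" for s s' u v proof -
  let ?S = "strip ?t l s"
  have uv: "u \<in> half_walks a" "v \<in> enter_left b" "v \<in> half_walks b"
   using kinds[OF s(2)] s(1) by (auto simp: enter_left_def)
  have st: "?S \<inter> arcs a l = walk a l u" "?S \<inter> arcs b ?k = walk b ?k v" "?S \<subseteq> arcs a l \<union> arcs b ?k"
   using s(1) strip_hook_parts[of r a b l u v] walk_arcs[of a l u] walk_arcs[of b ?k v] by auto
  note ex = hook_exits[OF e uv(1,2), of ?S, unfolded s(1), OF refl, folded s(1)]
  consider (h) u' v' where "s' = Hook u' v'" "u' \<in> half_walks a" "v' \<in> enter_left b"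
   | (i) z where "s' = In z" "z \<in> serps a" | (k) z where "s' = Skip z" "z \<in> serps b"
   using kinds[OF s'(1)] s'(2) by blast
  then show ?thesis
  proof cases
   case h
   have st': "strip ?t l s' \<inter> arcs a l = walk a l u'" "strip ?t l s' \<inter> arcs b ?k = walk b ?k v'"
    "strip ?t l s' \<subseteq> arcs a l \<union> arcs b ?k"
    using h(1) strip_hook_parts[of r a b l u' v'] walk_arcs[of a l u'] walk_arcs[of b ?k v'] by auto
   have "incomp ?S (strip ?t l s') \<longleftrightarrow> u \<le> u' & v \<le> v' \<or> u' \<le> u & v' \<le> v"
    by (rule incomp_fork[OF sn sub(1,2) refl sub(3) uv(1) h(2) st(1) st'(1) uv(2) h(3) st(2) st'(2)])
     (use st(3) st'(3) in blast)
   then show ?thesis using s(1) h(1) by simp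
  next
   case i
   have "code ?S ((l, ?k), True) = 0" by (rule code_exit(2)[OF sn(1) sub(1,3) uv(1) st(1) ex(1)])
   moreover have "incomp ?S (strip a l z) \<longleftrightarrow> hits (code ?S ((l, l + leaves a), True)) u z"
    by (rule hits_iff[OF sub(1) sn(1) uv(1) st(1) _ i(2)]) (use sub(3) sn(2) i in "auto simp: exits_def")
   ultimately show ?thesis using s(1) i(1) by simp
  next
   case k
   have "exits b ?k v ?S" using uv(2) ex(2) by (auto simp: exits_def enter_left_def)
   then have "incomp ?S (strip b ?k z) \<longleftrightarrow> hits (code ?S ((?k, ?k + leaves b), True)) v z"
    using hits_iff[OF sub(2) sn(1) uv(3) st(2) _ k(2)] sn(2) k(1) by simp
   also have "\<dots> \<longleftrightarrow> hits 2 v z"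
   proof (cases "real_top b")
    case True
    then show ?thesis using code_exit(1)[OF sn(1) sub(2) True uv(3) st(2) ex(2)] by simp
   next
    case False
    then have "z \<in> inner_serps b" using k(2) by (simp add: serps_def)
    then show ?thesis by (rule hits_inner)
   qed
   finally show ?thesis using s(1) k(1) by simp
  qed
 qed
 note P = Nd.prems(2-)
 consider (t) w where "s = Top w" | (t') w where "s' = Top w"
  | (h) u v where "s = Hook u v" "\<nexists>w. s' = Top w" | (h') u v where "s' = Hook u v" "\<nexists>w. s = Top w"
  | (aa) z z' where "s = In z" "s' = In z'" "z \<in> serps a" "z' \<in> serps a"
  | (bb) z z' where "s = Skip z" "s' = Skip z'" "z \<in> serps b" "z' \<in> serps b"
  | (ab) z z' where "s = In z" "s' = Skip z'" | (ba) z z' where "s = Skip z" "s' = In z'"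
  using kinds[OF P(1)] kinds[OF P(2)] by (cases s; cases s') auto
 then show ?case
 proof cases
  case t
  then show ?thesis using top P by blast
 next
  case t'
  then show ?thesis using top[OF t' P(2,1,4,3)] incomp_sym conf_sym by blast
 next
  case h
  then show ?thesis using hook P by blast
 next
  case h'
  then show ?thesis using hook[OF h'(1) P(2,1) h'(2) P(4,3)] incomp_sym conf_sym by blast
 next
  case aa
  then show ?thesis using Nd.IH(1)[OF sub(1) aa(3,4)] P by simp
 next
  case bb
  then show ?thesis using Nd.IH(2)[OF sub(2) bb(3,4)] P by simp
 next
  case ab
  have "strip a l z \<inter> strip b ?k z' = {}" using strip_arcs[of a l z] strip_arcs[of b ?k z'] disj by blast
  then show ?thesis using incomp_disjoint ab by simp
 next
  case ba
  have "strip b ?k z \<inter> strip a l z' = {}" using strip_arcs[of a l z'] strip_arcs[of b ?k z] disj by blast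
  then show ?thesis using incomp_disjoint ba by simp
 qed
qed

end

section \<open>Serpents as paths of arcs\<close>

lemma same_entry_self: "same_entry t w w \<longleftrightarrow> real_top t \<or> (\<exists>v. w = Lft v) \<or> (\<exists>v. w = Rgt v)"
 by (auto simp: same_entry_def)

text \<open>One solid end lies under all arcs of a half walk, and it can leave the tree on the side
  where the walk enters. This yields the chord that crosses the whole walk, which shows that the
  walk belongs to an accordion.\<close>

lemma reach_walk:
 assumes "wf_tr t" "w \<in> half_walks t"
 shows "real_top t \<or> (\<exists>v. w = Lft v) ==> \<exists>p\<in>reach_left t l. \<forall>d\<in>walk t l w. fst d \<le> p & p < snd d"
  "real_top t \<or> (\<exists>v. w = Rgt v) ==> \<exists>p\<in>reach_right t l. \<forall>d\<in>walk t l w. fst d \<le> p & p < snd d"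
 using assms
proof (induction t arbitrary: l w)
 case Lf
 { case 1 then show ?case by simp }
 { case 2 then show ?case by simp }
next
 case (Nd r a b)
 let ?t = "Nd r a b"
 have both: "(real_top ?t \<or> (\<exists>v. w = Lft v) --> (\<exists>p\<in>reach_left ?t l. \<forall>d\<in>walk ?t l w. fst d \<le> p & p < snd d)) &
   (real_top ?t \<or> (\<exists>v. w = Rgt v) --> (\<exists>p\<in>reach_right ?t l. \<forall>d\<in>walk ?t l w. fst d \<le> p & p < snd d))"
  if P: "wf_tr ?t" "w \<in> half_walks ?t" for l w proof -
  let ?k = "l + leaves a"
  have wf: "wf_tr a" "wf_tr b" "real_top a" using P by auto
  have pos: "leaves a > 0" "leaves b > 0" by (rule leaves_pos)+
  show ?thesis
  proof (cases w)
   case End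
   have "l \<in> reach_left a l" by (rule reach_ends)
   then show ?thesis using End pos by (cases r) auto
  next
   case (Lft u)
   then obtain p where p: "p \<in> reach_left a l" "\<forall>d\<in>walk a l u. fst d \<le> p & p < snd d"
    using Nd.IH(1)[of u l] wf P by auto
   have "l \<le> p & p < ?k" using p(1) reach_bounds[of p a l] by blast
   then have "\<forall>d\<in>walk ?t l w. fst d \<le> p & p < snd d" using p(2) Lft by auto
   then show ?thesis using p(1) Lft by auto
  next
   case (Rgt u)
   then obtain p where p: "p \<in> reach_right b ?k" "\<forall>d\<in>walk b ?k u. fst d \<le> p & p < snd d"
    using Nd.IH(4)[of u ?k] wf P by auto
   have "?k \<le> p & p < ?k + leaves b" using p(1) reach_bounds[of p b ?k] by blast
   then have "\<forall>d\<in>walk ?t l w. fst d \<le> p & p < snd d" using p(2) Rgt by auto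
   then show ?thesis using p(1) Rgt by auto
  qed
 qed
 { case 1 show ?case by (rule mp[OF conjunct1[OF both[OF 1(2,3)]] 1(1)]) }
 { case 2 show ?case by (rule mp[OF conjunct2[OF both[OF 2(2,3)]] 2(1)]) }
qed

context arc_family begin

definition "subacc X \<longleftrightarrow> (\<exists>A. acc A & (\<exists>d1\<in>A \<inter> duals. \<exists>d2\<in>A \<inter> duals.
 X = {d \<in> A \<inter> duals. d1 = d \<or> d2 = d \<or> sub_arc d1 d ~= sub_arc d2 d}))"

definition "arc_serpent X \<longleftrightarrow> is_path X & subacc X"

text \<open>The surrounding accordion has at most two arcs at a cell and they are incident; a subset
  inherits this wherever it has two.\<close>

lemma serpent_snake:
 assumes "arc_serpent X" shows "snake X"
proof -
 have P: "is_path X" using assms by (simp add: arc_serpent_def)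
 obtain A where A: "acc A" "X \<subseteq> A" using assms unfolding arc_serpent_def subacc_def by blast
 have "share d e & (\<forall>f\<in>X. side f x --> f = d \<or> f = e)"
  if x: "x \<in> nodes" and d: "d \<in> X" "side d x" and e: "e \<in> X" "side e x" "d ~= e" for x d e proof -
  let ?B = "{d \<in> A. side d x}"
  have m: "d \<in> ?B" "e \<in> ?B" using d e A(2) by auto
  have "empty_or_incident ?B" using A(1) x by (simp add: acc_def)
  then obtain d' e' where B: "?B = {d', e'}" "share d' e'" using m unfolding empty_or_incident_def by blast
  then have de: "d = d' & e = e' \<or> d = e' & e = d'" using m[unfolded B(1)] e(3) by auto
  have "f = d \<or> f = e" if "f \<in> X" "side f x" for f proof -
   have "f \<in> ?B" using that A(2) by blast
   then show ?thesis unfolding B(1) using de by blast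
  qed
  then show ?thesis using de B(2) share_sym by blast
 qed
 then show ?thesis unfolding snake_def using P by blast
qed

lemma snake_path: "snake X ==> is_path X" by (simp add: snake_def)

lemma snake_pair: "snake X ==> x \<in> nodes ==> d \<in> X ==> e \<in> X ==> side d x ==> side e x ==> d ~= e ==>
  share d e & (\<forall>f\<in>X. side f x --> f = d \<or> f = e)" unfolding snake_def by blast

lemma tops_apart:
 assumes "\<tau> \<in> tops t l" "\<tau>' \<in> tops t l" "sub_arc \<tau> \<tau>'" shows "\<tau> = \<tau>'"
 using top_maximal[OF assms(1) _ assms(3)] assms(2) tops_arcs by blast

text \<open>Convexity puts every arc of the path in the two children below the only top it uses.
  That top touches an end of the interval, which decides between the left and the right
  child.\<close>

lemma snake_split:
 assumes X: "snake X" and e: "emb (Nd r a b) l"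
  and IH: "\<forall>n\<in>tops a l \<inter> X. (\<forall>\<tau>\<in>tops a l \<inter> X. \<tau> = n) --> (\<exists>w\<in>half_walks a. X \<inter> arcs a l = walk a l w)"
   "\<forall>n\<in>tops b (l + leaves a) \<inter> X. (\<forall>\<tau>\<in>tops b (l + leaves a) \<inter> X. \<tau> = n) -->
    snd n = l + leaves a + leaves b --> (\<exists>w\<in>enter_right b. X \<inter> arcs b (l + leaves a) = walk b (l + leaves a) w)"
  and n: "n \<in> tops a l \<union> tops b (l + leaves a)" "n \<in> X"
   "\<forall>\<tau>\<in>(tops a l \<union> tops b (l + leaves a)) \<inter> X. \<tau> = n"
  and s: "fst n = l \<or> snd n = l + (leaves a + leaves b)"
 shows "(\<exists>w. Lft w \<in> half_walks (Nd r a b) & X \<inter> (arcs a l \<union> arcs b (l + leaves a)) = walk a l w & fst n = l) \<or>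
  (\<exists>w. Rgt w \<in> half_walks (Nd r a b) & X \<inter> (arcs a l \<union> arcs b (l + leaves a)) = walk b (l + leaves a) w &
   snd n = l + (leaves a + leaves b))"
proof -
 let ?k = "l + leaves a"
 note sub = emb_sub[OF e]
 have pos: "leaves a > 0" "leaves b > 0" by (rule leaves_pos)+
 have ta: "tops a l = {(l, ?k)}" by (rule tops_real[OF sub(3)])
 have tb: "?k \<le> fst \<tau>" if "\<tau> \<in> tops b ?k" for \<tau>
  using that tops_arcs[of b ?k] arcs_bounds[of \<tau> b ?k] by blast
 have e': "x \<in> Bar" if "x \<in> tops a l \<union> tops b ?k" for x
  using that emb_arcs[OF sub(1)] emb_arcs[OF sub(2)] tops_arcs by blast
 have under: "\<exists>\<tau>\<in>tops a l \<union> tops b ?k. \<tau> \<in> X & sub_arc d \<tau>" if d: "d \<in> X" "d \<in> arcs a l \<union> arcs b ?k" for d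
 proof -
  have t': "n \<in> tops (Nd False a b) l" "d \<in> arcs (Nd False a b) l" using n(1) d(2) by auto
  obtain \<tau> where \<tau>: "\<tau> \<in> tops (Nd False a b) l" "sub_arc d \<tau>" using under_top[OF t'(2)] by blast
  have "\<tau> \<in> X"
  proof (cases "\<tau> = n")
   case True
   then show ?thesis using n(2) by simp
  next
   case False
   then have "~ sub_arc n \<tau>" using tops_apart[OF t'(1) \<tau>(1)] by blast
   moreover have "\<tau> \<in> Bar" by (rule e') (use \<tau>(1) in simp)
   ultimately show ?thesis using path_convex[OF snake_path[OF X] d(1) n(2)] \<tau>(2) by blast
  qed
  then show ?thesis using \<tau> by auto
 qed
 have within: "sub_arc d n" if d: "d \<in> X" "d \<in> arcs a l \<union> arcs b ?k" for d proof -
  obtain \<tau> where \<tau>: "\<tau> \<in> tops a l \<union> tops b ?k" "\<tau> \<in> X" "sub_arc d \<tau>" using under[OF d] by blast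
  then have "\<tau> = n" using n(3) by (metis IntI)
  then show ?thesis using \<tau>(3) by simp
 qed
 show ?thesis
 proof (cases "n \<in> tops a l")
  case True
  then have na: "n = (l, ?k)" using ta by simp
  obtain w where w: "w \<in> half_walks a" "X \<inter> arcs a l = walk a l w" using IH(1) True n(2,3) by blast
  have "d \<notin> arcs b ?k" if "d \<in> X" for d
  proof
   assume d: "d \<in> arcs b ?k"
   then have "sub_arc d n" using within that by blast
   then show False using arcs_bounds[OF d] na by (auto simp: sub_arc_def)
  qed
  then have "X \<inter> (arcs a l \<union> arcs b ?k) = walk a l w" using w(2) by blast
  then show ?thesis using w(1) na by auto
 next
  case False
  then have nb: "n \<in> tops b ?k" using n(1) by blast
  then have sn: "snd n = ?k + leaves b" using tb[OF nb] s pos by auto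
  obtain w where w: "w \<in> enter_right b" "X \<inter> arcs b ?k = walk b ?k w" using IH(2) nb n(2,3) sn by blast
  have "d \<notin> arcs a l" if "d \<in> X" for d
  proof
   assume d: "d \<in> arcs a l"
   then have "sub_arc d n" using within that by blast
   then show False using arcs_bounds[OF d] tb[OF nb] by (auto simp: sub_arc_def)
  qed
  then have "X \<inter> (arcs a l \<union> arcs b ?k) = walk b ?k w" using w(2) by blast
  moreover have "Rgt w \<in> half_walks (Nd r a b)" using w(1) by (auto simp: enter_right_def)
  moreover have "snd n = l + (leaves a + leaves b)" using sn by simp
  ultimately show ?thesis by blast
 qed
qed

text \<open>The word is read off by descending: in the cell below a real arc of the path at most one
  further side is used, and it is incident to that arc, hence it is the first or the last
  side.\<close>

lemma snake_walk:
 assumes X: "snake X"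
 shows "emb t l ==> n \<in> tops t l ==> n \<in> X ==> (\<forall>\<tau>\<in>tops t l \<inter> X. \<tau> = n) ==>
  real_top t \<or> fst n = l \<or> snd n = l + leaves t ==>
  \<exists>w\<in>half_walks t. X \<inter> arcs t l = walk t l w &
   (real_top t \<or> fst n = l & (\<exists>v. w = Lft v) \<or> snd n = l + leaves t & (\<exists>v. w = Rgt v))"
proof (induction t arbitrary: l n)
 case Lf
 then have "n \<in> nodes" using snake_duals[OF X] duals_Bar by blast
 then show ?case using Lf(2) by (auto simp: nodes_def)
next
 case (Nd r a b)
 let ?k = "l + leaves a" and ?y = "(l, l + (leaves a + leaves b))" and ?t = "Nd r a b"
 note e = Nd.prems(1) and sub = emb_sub[OF Nd.prems(1)]
 have pos: "leaves a > 0" "leaves b > 0" by (rule leaves_pos)+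
 have IHa: "\<exists>w\<in>half_walks a. X \<inter> arcs a l = walk a l w"
  if "n \<in> tops a l" "n \<in> X" "\<forall>\<tau>\<in>tops a l \<inter> X. \<tau> = n" for n
  using Nd.IH(1)[OF sub(1) that] sub(3) by blast
 have IHb: "\<exists>w\<in>enter_right b. X \<inter> arcs b ?k = walk b ?k w"
  if n: "n \<in> tops b ?k" "n \<in> X" "\<forall>\<tau>\<in>tops b ?k \<inter> X. \<tau> = n" "snd n = ?k + leaves b" for n
 proof -
  obtain w where w: "w \<in> half_walks b" "X \<inter> arcs b ?k = walk b ?k w"
   "real_top b \<or> fst n = ?k & (\<exists>v. w = Lft v) \<or> snd n = ?k + leaves b & (\<exists>v. w = Rgt v)"
   using Nd.IH(2)[OF sub(2) n(1-3)] n(4) by blast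
  have "real_top b" if "fst n = ?k"
  proof (rule ccontr)
   assume "~ real_top b"
   then obtain a' b' where b: "b = Nd False a' b'" by (cases b) auto
   have "n = (?k, ?k + (leaves a' + leaves b'))" using that n(4) b by (simp add: prod_eq_iff)
   moreover have "n \<in> arcs a' ?k \<union> arcs b' (?k + leaves a')" using n(1) b tops_arcs[of b ?k] by auto
   ultimately show False using arcs_split(2,3)[of ?k a' b'] by auto
  qed
  then have "w \<in> enter_right b" using w(1,3) by (auto simp: enter_right_def)
  then show ?thesis using w(2) by blast
 qed
 have IHab: "\<forall>n\<in>tops a l \<inter> X. (\<forall>\<tau>\<in>tops a l \<inter> X. \<tau> = n) --> (\<exists>w\<in>half_walks a. X \<inter> arcs a l = walk a l w)"
  "\<forall>n\<in>tops b ?k \<inter> X. (\<forall>\<tau>\<in>tops b ?k \<inter> X. \<tau> = n) -->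
   snd n = ?k + leaves b --> (\<exists>w\<in>enter_right b. X \<inter> arcs b ?k = walk b ?k w)"
  by (intro ballI impI, elim IntE, erule (2) IHa) (intro ballI impI, elim IntE, erule (3) IHb)
 note split = snake_split[OF X e IHab]
 show ?case
 proof (cases r)
  case False
  have "n \<in> tops a l \<union> tops b ?k" "\<forall>\<tau>\<in>(tops a l \<union> tops b ?k) \<inter> X. \<tau> = n"
   "fst n = l \<or> snd n = l + (leaves a + leaves b)" using Nd.prems(2,4,5) False by auto
  from split[OF this(1) Nd.prems(3) this(2,3)]
  consider (L) w where "Lft w \<in> half_walks ?t" "X \<inter> (arcs a l \<union> arcs b ?k) = walk a l w" "fst n = l"
   | (R) w where "Rgt w \<in> half_walks ?t" "X \<inter> (arcs a l \<union> arcs b ?k) = walk b ?k w" "snd n = l + (leaves a + leaves b)"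
   by blast
  then show ?thesis
  proof cases
   case L
   then show ?thesis using False by (intro bexI[of _ "Lft w"]) auto
  next
   case R
   then show ?thesis using False by (intro bexI[of _ "Rgt w"]) auto
  qed
 next
  case True
  then have ny: "n = ?y" using Nd.prems(2) by simp
  have yX: "?y \<in> X" using Nd.prems(3) ny by simp
  then have yn: "?y \<in> nodes" "?y \<in> Bar" using snake_duals[OF X] duals_Bar by blast+
  have arcs: "X \<inter> arcs ?t l = {?y} \<union> X \<inter> (arcs a l \<union> arcs b ?k)" using True yX by auto
  show ?thesis
  proof (cases "X \<inter> (arcs a l \<union> arcs b ?k) = {}")
   case c: True
   then show ?thesis using arcs True by (intro bexI[of _ End]) auto
  next
   case False
   then obtain d where d: "d \<in> X" "d \<in> arcs a l \<union> arcs b ?k" by blast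
   then have d': "d \<in> arcs (Nd False a b) l" by simp
   obtain \<tau> where \<tau>: "\<tau> \<in> tops (Nd False a b) l" "sub_arc d \<tau>" using under_top[OF d'] by blast
   have sides: "side \<sigma> ?y & \<sigma> ~= ?y" if "\<sigma> \<in> tops (Nd False a b) l" for \<sigma> proof -
    have "side \<sigma> ?y" using that side_top[of a b l] e True by auto
    moreover have "\<sigma> \<in> arcs a l \<union> arcs b ?k" using that tops_arcs by auto
    ultimately show ?thesis using arcs_split(2,3)[of l a b] by auto
   qed
   have "~ sub_arc ?y \<tau>" using sides[OF \<tau>(1)] sub_arc_antisym unfolding side_def by blast
   then have \<tau>X: "\<tau> \<in> X"
    using path_convex[OF snake_path[OF X] d(1) yX] \<tau>(2) sides[OF \<tau>(1)] by (auto simp: side_def)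
   have pr: "share ?y \<tau> & (\<forall>f\<in>X. side f ?y --> f = ?y \<or> f = \<tau>)"
    by (rule snake_pair[OF X yn(1) yX \<tau>X side_refl[OF yn(2)]]) (use sides[OF \<tau>(1)] in auto)
   have t1: "\<tau> \<in> tops a l \<union> tops b ?k" using \<tau>(1) by simp
   have t2: "\<forall>\<sigma>\<in>(tops a l \<union> tops b ?k) \<inter> X. \<sigma> = \<tau>" using pr sides by auto
   have "\<tau> \<in> arcs (Nd False a b) l" using \<tau>(1) tops_arcs by blast
   then have "l \<le> fst \<tau> & fst \<tau> < snd \<tau> & snd \<tau> \<le> l + (leaves a + leaves b)" using arcs_bounds[of \<tau> "Nd False a b" l] by simp
   then have t3: "fst \<tau> = l \<or> snd \<tau> = l + (leaves a + leaves b)" using pr unfolding share_def by auto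
   from split[OF t1 \<tau>X t2 t3]
   consider (L) w where "Lft w \<in> half_walks ?t" "X \<inter> (arcs a l \<union> arcs b ?k) = walk a l w"
    | (R) w where "Rgt w \<in> half_walks ?t" "X \<inter> (arcs a l \<union> arcs b ?k) = walk b ?k w" by blast
   then show ?thesis
   proof cases
    case L
    then show ?thesis using True arcs by (intro bexI[of _ "Lft w"]) auto
   next
    case R
    then show ?thesis using True arcs by (intro bexI[of _ "Rgt w"]) auto
   qed
  qed
 qed
qed

text \<open>A serpent inside one child is classified there. One meeting both children contains, by
  convexity, a top arc of each; as sides of the cell \<open>c\<close> these are incident, so they
  meet at the vertex between the children and the serpent is a hook.\<close>

lemma snake_strip:
 assumes X: "snake X" "X ~= {}"
 shows "emb t l ==> t = Nd r a b ==> X \<subseteq> arcs a l \<union> arcs b (l + leaves a) ==> c \<in> nodes ==>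
  (\<forall>\<tau>\<in>tops a l \<union> tops b (l + leaves a). side \<tau> c) ==>
  \<exists>s\<in>inner_serps (Nd r a b). X = strip (Nd r a b) l s"
proof (induction t arbitrary: r a b l c)
 case (Nd r' a' b')
 let ?k = "l + leaves a" and ?t = "Nd r a b"
 have eq: "r' = r" "a' = a" "b' = b" using Nd.prems(2) by auto
 note e = Nd.prems(1)[unfolded eq] and XX = Nd.prems(3) and c = Nd.prems(4,5) and hyps = Nd.IH[unfolded eq]
 note sub = emb_sub[OF e]
 have pos: "leaves a > 0" "leaves b > 0" by (rule leaves_pos)+
 have ta: "tops a l = {(l, ?k)}" by (rule tops_real[OF sub(3)])
 have disj: "arcs a l \<inter> arcs b ?k = {}" using arcs_split(1) by blast
 \<comment> \<open>A child with a real top arc starts a new cell. Either the path uses this arc and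
   is a half walk below it, or it is inner with the new cell in the role of
   \<open>c\<close>.\<close>
 have real: "\<exists>s\<in>serps t. X = strip t m s" if t: "emb t m" "real_top t" "X \<subseteq> arcs t m"
   and IH: "\<And>a' b'. t = Nd True a' b' ==> X \<subseteq> arcs a' m \<union> arcs b' (m + leaves a') ==>
    (m, m + leaves t) \<in> nodes ==> \<forall>\<tau>\<in>tops a' m \<union> tops b' (m + leaves a'). side \<tau> (m, m + leaves t) ==>
    \<exists>s\<in>inner_serps t. X = strip t m s" for t m
 proof (cases "(m, m + leaves t) \<in> X")
  case True
  have Xm: "X \<inter> arcs t m = X" using t(3) by blast
  have "(m, m + leaves t) \<in> tops t m" "\<forall>\<sigma>\<in>tops t m \<inter> X. \<sigma> = (m, m + leaves t)"
   using tops_real[OF t(2)] by auto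
  from snake_walk[OF X(1) t(1) this(1) True this(2)] t(2)
  obtain w where "w \<in> half_walks t" "X \<inter> arcs t m = walk t m w" by blast
  then have "w \<in> half_walks t" "X = walk t m w" using Xm by auto
  then show ?thesis using t(2) by (intro bexI[of _ "Top w"]) (auto simp: strip_Top serps_def)
 next
  case False
  show ?thesis
  proof (cases t)
   case Lf
   then show ?thesis using t(3) False X(2) by auto
  next
   case N: (Nd r' a' b')
   then have t': "t = Nd True a' b'" using t(2) by simp
   have "X \<subseteq> arcs a' m \<union> arcs b' (m + leaves a')" using t(3) False t' by auto
   moreover have "(m, m + leaves t) \<in> nodes" using node_top[of a' b' m] t(1) t' by simp
   moreover have "\<forall>\<tau>\<in>tops a' m \<union> tops b' (m + leaves a'). side \<tau> (m, m + leaves t)"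
    using side_top[of a' b' m] t(1) t' by auto
   ultimately show ?thesis using IH[OF t'] by (auto simp: serps_def)
  qed
 qed
 consider (a) "X \<subseteq> arcs a l" | (b) "X \<subseteq> arcs b ?k"
  | (ab) d d' where "d \<in> X" "d \<in> arcs a l" "d' \<in> X" "d' \<in> arcs b ?k" using XX by blast
 then show ?case
 proof cases
  case a
  have "\<exists>s\<in>serps a. X = strip a l s"
  proof (rule real[OF sub(1,3) a])
   fix a' b' assume h: "a = Nd True a' b'" "X \<subseteq> arcs a' l \<union> arcs b' (l + leaves a')"
    "(l, l + leaves a) \<in> nodes" "\<forall>\<tau>\<in>tops a' l \<union> tops b' (l + leaves a'). side \<tau> (l, l + leaves a)"
   show "\<exists>s\<in>inner_serps a. X = strip a l s" using hyps(1)[OF sub(1) h] h(1) by simp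
  qed
  then obtain s where "s \<in> serps a" "X = strip a l s" by blast
  then show ?thesis unfolding inner_serps_Nd by (intro bexI[of _ "In s"]) simp_all
 next
  case b
  have "\<exists>s\<in>serps b. X = strip b ?k s"
  proof (cases "real_top b")
   case True
   show ?thesis
   proof (rule real[OF sub(2) True b])
    fix a' b' assume h: "b = Nd True a' b'" "X \<subseteq> arcs a' ?k \<union> arcs b' (?k + leaves a')"
     "(?k, ?k + leaves b) \<in> nodes" "\<forall>\<tau>\<in>tops a' ?k \<union> tops b' (?k + leaves a'). side \<tau> (?k, ?k + leaves b)"
    show "\<exists>s\<in>inner_serps b. X = strip b ?k s" using hyps(2)[OF sub(2) h] h(1) by simp
   qed
  next
   case False
   then obtain a' b' where h: "b = Nd False a' b'" by (cases b) auto
   have "X \<subseteq> arcs a' ?k \<union> arcs b' (?k + leaves a')" using b h by simp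
   moreover have "\<forall>\<tau>\<in>tops a' ?k \<union> tops b' (?k + leaves a'). side \<tau> c" using c(2) h by simp
   ultimately show ?thesis using hyps(2)[OF sub(2) h _ c(1)] h by (auto simp: serps_def)
  qed
  then obtain s where "s \<in> serps b" "X = strip b ?k s" by blast
  then show ?thesis unfolding inner_serps_Nd by (intro bexI[of _ "Skip s"]) simp_all
 next
  case ab
  have P: "is_path X" by (rule snake_path[OF X(1)])
  have nd: "~ sub_arc d' (l, ?k)" using arcs_bounds[OF ab(4)] by (auto simp: sub_arc_def)
  have "sub_arc d (l, ?k)" using arcs_bounds[OF ab(2)] by (auto simp: sub_arc_def)
  moreover have "(l, ?k) \<in> Bar" using emb_arcs[OF sub(1)] tops_arcs ta by blast
  ultimately have t1: "(l, ?k) \<in> X" using path_convex[OF P ab(1,3)] nd by blast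
  obtain \<tau> where \<tau>: "\<tau> \<in> tops b ?k" "sub_arc d' \<tau>" using under_top[OF ab(4)] by blast
  have \<tau>b: "\<tau> \<in> arcs b ?k" using \<tau>(1) tops_arcs by blast
  have bd: "?k \<le> fst \<tau> & fst \<tau> < snd \<tau>" using arcs_bounds[OF \<tau>b] by blast
  have "~ sub_arc d \<tau>" using arcs_bounds[OF ab(2)] bd by (auto simp: sub_arc_def)
  then have t2: "\<tau> \<in> X" using path_convex[OF P ab(1,3)] \<tau>(2) emb_arcs[OF sub(2) \<tau>b] by blast
  have sd: "side (l, ?k) c" "side \<tau> c" using c(2) ta \<tau>(1) by auto
  have ne: "(l, ?k) ~= \<tau>" using bd pos by auto
  have pr: "share (l, ?k) \<tau> & (\<forall>f\<in>X. side f c --> f = (l, ?k) \<or> f = \<tau>)"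
   by (rule snake_pair[OF X(1) c(1) t1 t2 sd ne])
  then have f: "fst \<tau> = ?k" using bd pos unfolding share_def by auto
  have una: "\<forall>\<sigma>\<in>tops a l \<inter> X. \<sigma> = (l, ?k)" using ta by simp
  obtain u where u: "u \<in> half_walks a" "X \<inter> arcs a l = walk a l u"
   using snake_walk[OF X(1) sub(1) _ t1 una] ta sub(3) by auto
  have unb: "\<forall>\<sigma>\<in>tops b ?k \<inter> X. \<sigma> = \<tau>"
  proof
   fix \<sigma> assume s: "\<sigma> \<in> tops b ?k \<inter> X"
   then have "\<sigma> = (l, ?k) \<or> \<sigma> = \<tau>" using pr c(2) by blast
   moreover have "\<sigma> \<in> arcs b ?k" using s tops_arcs by blast
   then have "\<sigma> ~= (l, ?k)" using arcs_bounds[of \<sigma> b ?k] pos by auto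
   ultimately show "\<sigma> = \<tau>" by blast
  qed
  obtain v where v: "v \<in> half_walks b" "X \<inter> arcs b ?k = walk b ?k v"
   "real_top b \<or> fst \<tau> = ?k & (\<exists>v'. v = Lft v') \<or> snd \<tau> = ?k + leaves b & (\<exists>v'. v = Rgt v')"
   using snake_walk[OF X(1) sub(2) \<tau>(1) t2 unb] f by blast
  have "real_top b" if "snd \<tau> = ?k + leaves b"
  proof (rule ccontr)
   assume "~ real_top b"
   then obtain a' b' where b: "b = Nd False a' b'" by (cases b) auto
   have "\<tau> = (?k, ?k + (leaves a' + leaves b'))" using that f b by (simp add: prod_eq_iff)
   moreover have "\<tau> \<in> arcs a' ?k \<union> arcs b' (?k + leaves a')" using \<tau>b b by auto
   ultimately show False using arcs_split(2,3)[of ?k a' b'] by auto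
  qed
  then have vl: "v \<in> enter_left b" using v(1,3) by (auto simp: enter_left_def)
  have "X = walk a l u \<union> walk b ?k v" using XX u(2) v(2) by blast
  then show ?thesis unfolding inner_serps_Nd using u(1) vl by (intro bexI[of _ "Hook u v"]) auto
 qed
qed simp

section \<open>From words back to dual paths\<close>

definition "trail xs ds \<longleftrightarrow> length xs = Suc (length ds) & distinct xs & set xs \<subseteq> nodes &
 (\<forall>i<length ds. ds ! i \<in> duals & side (ds ! i) (xs ! i) & side (ds ! i) (xs ! Suc i))"

lemma trail_Cons:
 assumes "trail xs ds" "x \<in> nodes" "x \<notin> set xs" "d \<in> duals" "side d x" "side d (hd xs)"
 shows "trail (x # xs) (d # ds)"
proof -
 have h: "hd xs = xs ! 0" using assms(1) by (cases xs) (auto simp: trail_def)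
 show ?thesis unfolding trail_def
 proof (intro conjI allI impI)
  fix i assume "i < length (d # ds)"
  then show "(d # ds) ! i \<in> duals" "side ((d # ds) ! i) ((x # xs) ! i)" "side ((d # ds) ! i) ((x # xs) ! Suc i)"
   using assms h by (cases i; auto simp: trail_def)+
 qed (use assms in "auto simp: trail_def")
qed

lemma trail_rev:
 assumes "trail xs ds" shows "trail (rev xs) (rev ds)" unfolding trail_def
proof (intro conjI allI impI)
 have l: "length xs = Suc (length ds)" using assms by (simp add: trail_def)
 fix i assume "i < length (rev ds)"
 then have i: "i < length ds" "length ds - Suc i < length ds" by auto
 have r: "rev ds ! i = ds ! (length ds - Suc i)" "rev xs ! i = xs ! Suc (length ds - Suc i)"
  "rev xs ! Suc i = xs ! (length ds - Suc i)" using i l by (simp_all add: rev_nth Suc_diff_Suc)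
 show "rev ds ! i \<in> duals" "side (rev ds ! i) (rev xs ! i)" "side (rev ds ! i) (rev xs ! Suc i)"
  unfolding r using assms i(2) by (auto simp: trail_def)
qed (use assms in "auto simp: trail_def")

lemma trail_descend:
 assumes "trail xs ds" "set es \<subseteq> duals" "distinct es" "set es \<inter> set xs = {}"
  "successively (\<lambda>x y. side y x) es" "es ~= [] ==> side (hd es) (hd xs)" shows "trail (rev es @ xs) (rev es @ ds)"
 using assms
proof (induction es arbitrary: xs ds)
 case (Cons e es)
 have e: "e \<in> duals" "e \<in> nodes" "side e e" using Cons.prems(2) duals_Bar side_refl by auto
 have "trail (e # xs) (e # ds)" by (rule trail_Cons[OF Cons.prems(1) e(2) _ e(1,3)]) (use Cons.prems(4,6) in auto)
 then have "trail (rev es @ e # xs) (rev es @ e # ds)" by (rule Cons.IH) (use Cons.prems in "auto simp: successively_Cons")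
 then show ?case by simp
qed simp

text \<open>Two descending chains of arcs starting at sides of the same cell \<open>c\<close> are
  joined there: one is reversed, so that it leads up to \<open>c\<close>, and the other is
  appended.\<close>

lemma fork_path:
 assumes c: "c \<in> nodes" "c \<notin> set es \<union> set fs" and s: "set es \<union> set fs \<subseteq> duals" "distinct es" "distinct fs"
  "set es \<inter> set fs = {}" "successively (\<lambda>x y. side y x) es" "successively (\<lambda>x y. side y x) fs"
  and h: "es ~= [] ==> side (hd es) c" "fs ~= [] ==> side (hd fs) c" and ne: "es ~= [] \<or> fs ~= []"
 shows "is_path (set es \<union> set fs)"
proof -
 have "trail [c] []" using c by (simp add: trail_def)
 then have "trail (rev es @ [c]) (rev es @ [])" by (rule trail_descend) (use c s h in auto)
 then have "trail (c # es) es" using trail_rev by fastforce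
 then have "trail (rev fs @ c # es) (rev fs @ es)" by (rule trail_descend) (use c s h in auto)
 then have "dpath (rev fs @ c # es) (rev fs @ es)" using ne by (auto simp: trail_def dpath_def)
 then show ?thesis unfolding is_path_def by (metis Un_commute set_append set_rev)
qed

lemma walk_list:
 assumes "emb t l" "w \<in> half_walks t" "same_entry t w w"
 shows "\<exists>ds. ds ~= [] & set ds = walk t l w & hd ds \<in> tops t l & distinct ds & successively (\<lambda>x y. side y x) ds"
 using assms
proof (induction t arbitrary: l w)
 case (Nd r a b)
 let ?k = "l + leaves a" and ?y = "(l, l + (leaves a + leaves b))"
 note sub = emb_sub[OF Nd.prems(1)]
 have y: "?y \<notin> arcs a l" "?y \<notin> arcs b ?k" by (rule arcs_split)+
 have step: ?case
  if W: "walk (Nd r a b) l w = (if r then {?y} else {}) \<union> walk c m u" "walk c m u \<subseteq> arcs a l \<union> arcs b ?k"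
   "tops c m \<subseteq> tops a l \<union> tops b ?k"
   and ds: "ds ~= []" "set ds = walk c m u" "hd ds \<in> tops c m" "distinct ds" "successively (\<lambda>x y. side y x) ds"
  for c m u ds
 proof (cases r)
  case True
  have "side (hd ds) ?y" using side_top[of a b l] Nd.prems(1) True ds(3) W(3) by auto
  then have "successively (\<lambda>x y. side y x) (?y # ds)" using ds(5,1) by (cases ds) auto
  moreover have "?y \<notin> set ds" using ds(2) W(2) y by blast
  ultimately show ?thesis using W(1) ds True by (intro exI[of _ "?y # ds"]) auto
 next
  case False
  then show ?thesis using W ds by (intro exI[of _ ds]) auto
 qed
 show ?case
 proof (cases w)
  case End
  then have r using Nd.prems(3) by (auto simp: same_entry_self)
  then show ?thesis using End by (intro exI[of _ "[?y]"]) auto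
 next
  case (Lft u)
  then have "u \<in> half_walks a" "same_entry a u u" using Nd.prems(2) sub(3) by (auto simp: same_entry_self)
  then obtain ds where "ds ~= []" "set ds = walk a l u" "hd ds \<in> tops a l" "distinct ds" "successively (\<lambda>x y. side y x) ds"
   using Nd.IH(1)[OF sub(1)] by blast
  moreover have "walk a l u \<subseteq> arcs a l \<union> arcs b ?k" using walk_arcs by blast
  ultimately show ?thesis using step[of a l u ds] Lft by simp
 next
  case (Rgt u)
  then have "u \<in> half_walks b" "same_entry b u u" using Nd.prems(2) by (auto simp: same_entry_self)
  then obtain ds where "ds ~= []" "set ds = walk b ?k u" "hd ds \<in> tops b ?k" "distinct ds" "successively (\<lambda>x y. side y x) ds"
   using Nd.IH(2)[OF sub(2)] by blast
  moreover have "walk b ?k u \<subseteq> arcs a l \<union> arcs b ?k" using walk_arcs by blast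
  ultimately show ?thesis using step[of b ?k u ds] Rgt by simp
 qed
qed simp

lemma walk_bottom:
 assumes "wf_tr t" "w \<in> half_walks t" "same_entry t w w"
 obtains x where "x \<in> walk t l w" "\<forall>d\<in>walk t l w. sub_arc x d"
 using walks_compare[OF assms(1,2,2,3), of l] unfolding diverge_def by blast

text \<open>All arcs are crossed by the chord, and every one of them separates two extreme arcs of
  the set. Together with convexity this makes the set a subaccordion of the accordion of that
  chord.\<close>

definition "confined X p q \<longleftrightarrow> X \<subseteq> crossed p q &
 (\<exists>d1\<in>X. \<exists>d2\<in>X. \<forall>d\<in>X. d1 = d \<or> d2 = d \<or> sub_arc d1 d ~= sub_arc d2 d)"

text \<open>The cell \<open>c\<close> has the tops of both children among its sides; it lies above
  them and is passed on unchanged through virtual right children. A hook passes through it from one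
  child to the other, and a serpent starting at a top arc ends in it.\<close>

lemma strip_path: "emb t l ==> t = Nd r a b ==> c \<in> nodes ==> c \<notin> arcs a l \<union> arcs b (l + leaves a) ==>
  \<forall>\<tau>\<in>tops a l \<union> tops b (l + leaves a). side \<tau> c ==> arcs a l \<union> arcs b (l + leaves a) \<subseteq> Bar - {(0, N - 1)} ==>
  s \<in> inner_serps t ==>
  is_path (strip t l s) & (\<exists>(p, q)\<in>inner_chords t l. confined (strip t l s) p q)"
proof (induction t arbitrary: r a b l c s)
 case (Nd r' a' b')
 let ?k = "l + leaves a" and ?t = "Nd r a b"
 have eq: "r' = r" "a' = a" "b' = b" using Nd.prems(2) by auto
 note e = Nd.prems(1)[unfolded eq] and c = Nd.prems(3-5) and B = Nd.prems(6) and hyps = Nd.IH[unfolded eq]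
 note s = Nd.prems(7)[unfolded eq inner_serps_Nd]
 note sub = emb_sub[OF e]
 have wf: "wf_tr a" "wf_tr b" using sub by (auto simp: emb_def)
 have pos: "leaves a > 0" "leaves b > 0" by (rule leaves_pos)+
 have du: "x \<in> duals" if "x \<in> walk a l w \<or> x \<in> walk b ?k w" for x w proof -
  have "x \<in> Bar - {(0, N - 1)}" using that walk_arcs B by blast
  moreover have "Suc (fst x) < snd x" using that walk_wide by blast
  ultimately show ?thesis by (simp add: duals_def nodes_def)
 qed
 have ch: "inner_chords ?t l = reach_left a l \<times> reach_left b ?k \<union> inner_chords a l \<union> inner_chords b ?k" by simp
 have cr: "d \<in> crossed p q" if "d \<in> Bar" "fst d \<le> p & p < snd d" "~ (fst d \<le> q & q < snd d)" for d p q
  using that by (auto simp: crossed_def)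
 have cr': "d \<in> crossed p q" if "d \<in> Bar" "fst d \<le> q & q < snd d" "~ (fst d \<le> p & p < snd d)" for d p q
  using that by (auto simp: crossed_def)
 have top: "is_path (walk z m w) & (\<exists>(p, q)\<in>inner_chords ?t l. confined (walk z m w) p q)"
  if z: "emb z m" "real_top z" "w \<in> half_walks z" "arcs z m \<subseteq> arcs a l \<union> arcs b ?k" "tops z m \<subseteq> tops a l \<union> tops b ?k"
   and pq: "\<And>d. d \<in> walk z m w ==> d \<in> crossed p q" "(p, q) \<in> inner_chords ?t l" "walk z m w \<subseteq> duals" for z m w p q
 proof -
  have wfz: "wf_tr z" using z(1) by (simp add: emb_def)
  have se: "same_entry z w w" using z(2) by (simp add: same_entry_def)
  obtain ds where ds: "ds ~= []" "set ds = walk z m w" "hd ds \<in> tops z m" "distinct ds" "successively (\<lambda>x y. side y x) ds"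
   using walk_list[OF z(1,3) se] by blast
  have "side (hd ds) c" using ds(3) c(3) z(5) by blast
  moreover have "c \<notin> set ds" using ds(2) c(2) z(4) walk_arcs by blast
  ultimately have P: "is_path (walk z m w)" using fork_path[of c ds "[]"] c(1) ds pq(3) by auto
  obtain x where x: "x \<in> walk z m w" "\<forall>d\<in>walk z m w. sub_arc x d" using walk_bottom[OF wfz z(3) se] by blast
  have y: "(m, m + leaves z) \<in> walk z m w" by (rule walk_top[OF z(2,3)])
  have "x = d \<or> (m, m + leaves z) = d \<or> sub_arc x d ~= sub_arc (m, m + leaves z) d" if "d \<in> walk z m w" for d
  proof -
   have "d \<in> arcs z m" using that walk_arcs by blast
   then have "sub_arc d (m, m + leaves z)" using arcs_bounds[of d z m] by (auto simp: sub_arc_def)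
   then show ?thesis using x(2) that sub_arc_antisym by blast
  qed
  then have "confined (walk z m w) p q" unfolding confined_def using x(1) y pq(1) by blast
  then show ?thesis using P pq(2) by blast
 qed
 consider (h) u v where "s = Hook u v" "u \<in> half_walks a" "v \<in> enter_left b"
  | (at) w where "s = In (Top w)" "w \<in> half_walks a" | (ai) z where "s = In z" "z \<in> inner_serps a"
  | (bt) w where "s = Skip (Top w)" "real_top b" "w \<in> half_walks b" | (bi) z where "s = Skip z" "z \<in> inner_serps b"
  using s by (auto simp: serps_def)
 then show ?case
 proof cases
  case h
  have v: "v \<in> half_walks b" "real_top b \<or> (\<exists>v'. v = Lft v')" using h(3) by (auto simp: enter_left_def)
  have se: "same_entry a u u" "same_entry b v v" using sub(3) enter_left_same[OF h(3,3)] by (auto simp: same_entry_def)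
  obtain es where es: "es ~= []" "set es = walk a l u" "hd es \<in> tops a l" "distinct es" "successively (\<lambda>x y. side y x) es"
   using walk_list[OF sub(1) h(2) se(1)] by blast
  obtain fs where fs: "fs ~= []" "set fs = walk b ?k v" "hd fs \<in> tops b ?k" "distinct fs" "successively (\<lambda>x y. side y x) fs"
   using walk_list[OF sub(2) v(1) se(2)] by blast
  have disj: "walk a l u \<inter> walk b ?k v = {}" using walk_arcs arcs_split(1) by blast
  have dus: "walk a l u \<union> walk b ?k v \<subseteq> duals" using du by blast
  have "is_path (set es \<union> set fs)" by (rule fork_path[OF c(1) _ _ es(4) fs(4) _ es(5) fs(5)])
    (use es fs c(2,3) dus disj walk_arcs[of a l u] walk_arcs[of b ?k v] in auto)
  then have P: "is_path (strip ?t l s)" using es(2) fs(2) h(1) by simp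
  obtain x where x: "x \<in> walk a l u" "\<forall>d\<in>walk a l u. sub_arc x d" using walk_bottom[OF wf(1) h(2) se(1)] by blast
  obtain y where y: "y \<in> walk b ?k v" "\<forall>d\<in>walk b ?k v. sub_arc y d" using walk_bottom[OF wf(2) v(1) se(2)] by blast
  obtain p where p: "p \<in> reach_left a l" "\<forall>d\<in>walk a l u. fst d \<le> p & p < snd d"
   using reach_walk(1)[OF wf(1) h(2)] sub(3) by blast
  obtain q where q: "q \<in> reach_left b ?k" "\<forall>d\<in>walk b ?k v. fst d \<le> q & q < snd d"
   using reach_walk(1)[OF wf(2) v(1,2)] by blast
  have ba: "l \<le> fst d & fst d < snd d & snd d \<le> ?k" if "d \<in> walk a l u" for d
   using that arcs_bounds[of d a l] walk_arcs by blast
  have bb: "?k \<le> fst d & fst d < snd d" if "d \<in> walk b ?k v" for d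
   using that arcs_bounds[of d b ?k] walk_arcs by blast
  have pb: "p < ?k" "?k \<le> q" using p(1) q(1) reach_bounds[of p a l] reach_bounds[of q b ?k] by auto
  have st: "strip ?t l s = walk a l u \<union> walk b ?k v" using h(1) by simp
  have BB: "d \<in> Bar" if "d \<in> strip ?t l s" for d using that st du duals_Bar by blast
  have "d \<in> crossed p q & (sub_arc x d ~= sub_arc y d)" if d: "d \<in> strip ?t l s" for d proof -
   consider "d \<in> walk a l u" | "d \<in> walk b ?k v" using d st by blast
   then show ?thesis
   proof cases
    case 1
    have "d \<in> crossed p q" by (rule cr[OF BB[OF d]]) (use p(2) 1 ba[OF 1] pb in auto)
    moreover have "~ sub_arc y d" using bb[OF y(1)] ba[OF 1] by (auto simp: sub_arc_def)
    ultimately show ?thesis using x(2) 1 by blast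
   next
    case 2
    have "d \<in> crossed p q" by (rule cr'[OF BB[OF d]]) (use q(2) 2 bb[OF 2] pb in auto)
    moreover have "~ sub_arc x d" using ba[OF x(1)] bb[OF 2] by (auto simp: sub_arc_def)
    ultimately show ?thesis using y(2) 2 by blast
   qed
  qed
  then have "confined (strip ?t l s) p q" unfolding confined_def using x(1) y(1) st by blast
  moreover have "(p, q) \<in> inner_chords ?t l" unfolding ch using p(1) q(1) by blast
  ultimately show ?thesis unfolding eq using P by blast
 next
  case at
  obtain p where p: "p \<in> reach_left a l" "\<forall>d\<in>walk a l w. fst d \<le> p & p < snd d"
   using reach_walk(1)[OF wf(1) at(2)] sub(3) by blast
  \<comment> \<open>\<open>?k\<close> is the first end in the right child: it lies under no arc of
    the left child and can always leave to the left.\<close>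
  have "d \<in> crossed p ?k" if d: "d \<in> walk a l w" for d
  proof (rule cr)
   show "d \<in> Bar" using du d duals_Bar by blast
   have "d \<in> arcs a l" using d walk_arcs by blast
   then show "~ (fst d \<le> ?k & ?k < snd d)" using arcs_bounds[of d a l] by auto
  qed (use p d in blast)
  moreover have "(p, ?k) \<in> inner_chords ?t l" unfolding ch using p(1) reach_ends(1) by blast
  moreover have "walk a l w \<subseteq> duals" using du by blast
  ultimately have "is_path (walk a l w) & (\<exists>(p, q)\<in>inner_chords ?t l. confined (walk a l w) p q)"
   using top[OF sub(1,3) at(2)] by blast
  then show ?thesis unfolding eq at(1) by (simp add: strip_Top)
 next
  case bt
  obtain q where q: "q \<in> reach_left b ?k" "\<forall>d\<in>walk b ?k w. fst d \<le> q & q < snd d"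
   using reach_walk(1)[OF wf(2) bt(3)] bt(2) by blast
  \<comment> \<open>\<open>?k - 1\<close>, the last end in the left child, plays the corresponding
    role.\<close>
  have "d \<in> crossed (?k - 1) q" if d: "d \<in> walk b ?k w" for d
  proof (rule cr')
   show "d \<in> Bar" using du d duals_Bar by blast
   have "d \<in> arcs b ?k" using d walk_arcs by blast
   then show "~ (fst d \<le> ?k - 1 & ?k - 1 < snd d)" using arcs_bounds[of d b ?k] pos by auto
  qed (use q d in blast)
  moreover have "?k - 1 \<in> reach_left a l" using reach_ends(2)[OF wf(1)] reach_real[OF sub(3)] by blast
  then have "(?k - 1, q) \<in> inner_chords ?t l" unfolding ch using q(1) by blast
  moreover have "walk b ?k w \<subseteq> duals" using du by blast
  ultimately have "is_path (walk b ?k w) & (\<exists>(p, q)\<in>inner_chords ?t l. confined (walk b ?k w) p q)"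
   using top[OF sub(2) bt(2,3)] by blast
  then show ?thesis unfolding eq bt(1) by (simp add: strip_Top)
 next
  case ai
  obtain a1 a2 where a: "a = Nd True a1 a2" using ai(2) sub(3) by (cases a) auto
  have sub_a: "arcs a1 l \<union> arcs a2 (l + leaves a1) \<subseteq> arcs a l" unfolding a by auto
  have "is_path (strip a l z) & (\<exists>(p, q)\<in>inner_chords a l. confined (strip a l z) p q)"
  proof (rule hyps(1)[OF sub(1) a])
   show "(l, l + (leaves a1 + leaves a2)) \<in> nodes" using node_top[of a1 a2 l] sub(1) a by simp
   show "(l, l + (leaves a1 + leaves a2)) \<notin> arcs a1 l \<union> arcs a2 (l + leaves a1)" using arcs_split(2,3) by blast
   show "\<forall>\<tau>\<in>tops a1 l \<union> tops a2 (l + leaves a1). side \<tau> (l, l + (leaves a1 + leaves a2))"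
    using side_top[of a1 a2 l] sub(1) a by auto
   show "arcs a1 l \<union> arcs a2 (l + leaves a1) \<subseteq> Bar - {(0, N - 1)}" using B sub_a by blast
  qed (rule ai(2))
  then show ?thesis unfolding eq ai(1) ch strip.simps by blast
 next
  case bi
  obtain r1 b1 b2 where b: "b = Nd r1 b1 b2" using bi(2) by (cases b) auto
  have sub_b: "arcs b1 ?k \<union> arcs b2 (?k + leaves b1) \<subseteq> arcs b ?k" unfolding b by auto
  have "is_path (strip b ?k z) & (\<exists>(p, q)\<in>inner_chords b ?k. confined (strip b ?k z) p q)"
  proof (cases r1)
   case True
   show ?thesis
   proof (rule hyps(2)[OF sub(2) b])
    show "(?k, ?k + (leaves b1 + leaves b2)) \<in> nodes" using node_top[of b1 b2 ?k] sub(2) b True by simp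
    show "(?k, ?k + (leaves b1 + leaves b2)) \<notin> arcs b1 ?k \<union> arcs b2 (?k + leaves b1)" using arcs_split(2,3) by blast
    show "\<forall>\<tau>\<in>tops b1 ?k \<union> tops b2 (?k + leaves b1). side \<tau> (?k, ?k + (leaves b1 + leaves b2))"
     using side_top[of b1 b2 ?k] sub(2) b True by auto
    show "arcs b1 ?k \<union> arcs b2 (?k + leaves b1) \<subseteq> Bar - {(0, N - 1)}" using B sub_b by blast
   qed (rule bi(2))
  next
   case False
   show ?thesis
   proof (rule hyps(2)[OF sub(2) b c(1)])
    show "c \<notin> arcs b1 ?k \<union> arcs b2 (?k + leaves b1)" using c(2) sub_b by blast
    show "\<forall>\<tau>\<in>tops b1 ?k \<union> tops b2 (?k + leaves b1). side \<tau> c" using c(3) b False by simp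
    show "arcs b1 ?k \<union> arcs b2 (?k + leaves b1) \<subseteq> Bar - {(0, N - 1)}" using B sub_b by blast
   qed (rule bi(2))
  qed
  then show ?thesis unfolding eq bi(1) ch strip.simps by blast
 qed
qed simp

lemma arc_serpents:
 assumes e: "emb (Nd True a b) 0" and n: "leaves (Nd True a b) = N - 1"
 shows "Collect arc_serpent = strip (Nd True a b) 0 ` inner_serps (Nd True a b)"
proof (intro set_eqI iffI)
 let ?T = "Nd True a b"
 have root: "(0, leaves a + leaves b) = (0, N - 1)" using n by simp
 have all: "arcs ?T 0 = Bar" using e n Bar by (auto simp: emb_def sub_arc_def less_Suc_eq_le) fastforce+
 have inn: "arcs a 0 \<union> arcs b (0 + leaves a) = Bar - {(0, N - 1)}" using all arcs_split(2,3)[of 0 a b] root by auto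
 have c: "(0, N - 1) \<in> nodes" using Bar_root N3 by (auto simp: nodes_def)
 have sd: "\<forall>\<tau>\<in>tops a 0 \<union> tops b (0 + leaves a). side \<tau> (0, N - 1)"
  using side_top[OF e] root by auto
 fix X
 { assume "X \<in> Collect arc_serpent"
  then have X: "arc_serpent X" by simp
  have ne: "X ~= {}" using X unfolding arc_serpent_def is_path_def dpath_def by auto
  have "X \<subseteq> duals" using snake_duals serpent_snake[OF X] by blast
  then have "X \<subseteq> arcs a 0 \<union> arcs b (0 + leaves a)" unfolding inn by (auto simp: duals_def nodes_def)
  then show "X \<in> strip ?T 0 ` inner_serps ?T" using snake_strip[OF serpent_snake[OF X] ne e refl _ c sd] by blast }
 { assume "X \<in> strip ?T 0 ` inner_serps ?T"
  then obtain s where s: "s \<in> inner_serps ?T" "X = strip ?T 0 s" by blast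
  have nc: "(0, N - 1) \<notin> arcs a 0 \<union> arcs b (0 + leaves a)" unfolding inn by blast
  have "arcs a 0 \<union> arcs b (0 + leaves a) \<subseteq> Bar - {(0, N - 1)}" unfolding inn ..
  from strip_path[OF e refl c nc sd this s(1)] obtain p q
   where P: "is_path X" and pq: "(p, q) \<in> inner_chords ?T 0" "confined X p q" unfolding s(2) by blast
  have lt: "p < q" "q < N" using inner_chords_bounds[OF pq(1)] n by auto
  have "(p, q) \<in> chords ?T 0" using pq(1) unfolding chords_def by blast
  then have A: "acc (crossed p q)" using acc_iff_chord[OF e n lt] by blast
  obtain d1 d2 where d: "d1 \<in> X" "d2 \<in> X" "\<forall>d\<in>X. d1 = d \<or> d2 = d \<or> sub_arc d1 d ~= sub_arc d2 d"
   and cr: "X \<subseteq> crossed p q" using pq(2) unfolding confined_def by blast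
  have du: "X \<subseteq> duals" by (rule path_duals[OF P])
  have "X = {d \<in> crossed p q \<inter> duals. d1 = d \<or> d2 = d \<or> sub_arc d1 d ~= sub_arc d2 d}" (is "_ = ?R")
  proof
   show "X \<subseteq> ?R" using d(3) cr du by blast
   show "?R \<subseteq> X"
   proof
    fix f assume f: "f \<in> ?R"
    then have "f \<in> Bar" using duals_Bar by blast
    then show "f \<in> X" using f d(1,2) path_convex[OF P d(1,2)] by blast
   qed
  qed
  then have "subacc X" unfolding subacc_def using A d(1,2) cr du by blast
  then show "X \<in> Collect arc_serpent" using P by (simp add: arc_serpent_def) }
qed

theorem card_arc_nests:
 assumes e: "emb (Nd True a b) 0" and n: "leaves (Nd True a b) = N - 1"
 defines "\<N> \<equiv> {M. (\<forall>S\<in>M. arc_serpent S) & pairwise (\<lambda>S S'. ~ incomp S S') M}"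
 shows "finite \<N>" "card \<N> = card (inner_nests (Nd True a b))"
proof -
 let ?T = "Nd True a b" and ?f = "strip (Nd True a b) 0"
 have wf: "wf_tr ?T" using e by (simp add: emb_def)
 have ser: "inner_serps ?T \<subseteq> serps ?T" by (auto simp: serps_def)
 have inj: "inj_on ?f (inner_serps ?T)" using strip_inj[OF wf] ser by (intro inj_onI) blast
 have sn: "arc_serpent (?f s)" if "s \<in> inner_serps ?T" for s using arc_serpents[OF e n] that by blast
 have cf: "incomp (?f s) (?f s') \<longleftrightarrow> conf s s'" if "s \<in> inner_serps ?T" "s' \<in> inner_serps ?T" for s s'
  using conf_iff[OF e] that ser sn serpent_snake by blast
 have pw: "pairwise (\<lambda>S S'. ~ incomp S S') (?f ` M) \<longleftrightarrow> indep M" if M: "M \<subseteq> inner_serps ?T" for M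
 proof -
  have "(s ~= s' --> ?f s ~= ?f s' --> ~ incomp (?f s) (?f s')) \<longleftrightarrow> (s ~= s' --> ~ conf s s')"
   if "s \<in> M" "s' \<in> M" for s s' proof -
   have m: "s \<in> inner_serps ?T" "s' \<in> inner_serps ?T" using that M by auto
   then have "?f s = ?f s' ==> s = s'" by (metis inj_onD[OF inj])
   then show ?thesis using cf[OF m] by blast
  qed
  then show ?thesis unfolding pairwise_image unfolding pairwise_def indep_def by (intro ball_cong refl)
 qed
 have img: "\<N> = (\<lambda>M. ?f ` M) ` inner_nests ?T"
 proof (intro set_eqI iffI)
  fix M assume "M \<in> \<N>"
  then have M: "M \<subseteq> ?f ` inner_serps ?T" "pairwise (\<lambda>S S'. ~ incomp S S') M"
   using arc_serpents[OF e n] unfolding \<N>_def by blast+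
  then obtain M' where "M' \<subseteq> inner_serps ?T" "M = ?f ` M'" by (meson subset_imageE)
  then show "M \<in> (\<lambda>M. ?f ` M) ` inner_nests ?T" using pw M(2) unfolding inner_nests_def by blast
 next
  fix M assume "M \<in> (\<lambda>M. ?f ` M) ` inner_nests ?T"
  then obtain M' where "M' \<subseteq> inner_serps ?T" "indep M'" "M = ?f ` M'" unfolding inner_nests_def by blast
  then show "M \<in> \<N>" unfolding \<N>_def using pw sn by blast
 qed
 have "inj_on (\<lambda>M. ?f ` M) (inner_nests ?T)"
  by (rule inj_on_subset[OF inj_on_image_Pow[OF inj]]) (auto simp: inner_nests_def)
 then show "card \<N> = card (inner_nests ?T)" unfolding img by (rule card_image)
 show "finite \<N>" unfolding img using finite_inner_nests by blast
qed

end

section \<open>Transfer to labelled polygons\<close>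

lemma hollow_alt: "hollow n = (\<lambda>i. 2 * i + 1) ` {..<n}"
proof (intro set_eqI iffI)
 fix x assume "x \<in> hollow n"
 then have "x = 2 * (x div 2) + 1" "x div 2 < n" by (auto simp: hollow_def elim!: oddE)
 then show "x \<in> (\<lambda>i. 2 * i + 1) ` {..<n}" by blast
qed (auto simp: hollow_def)

lemma solid_alt: "solid n = (\<lambda>i. 2 * i + 2) ` {..<n}"
proof (intro set_eqI iffI)
 fix x assume "x \<in> solid n"
 then have "x = 2 * (x div 2 - 1) + 2" "x div 2 - 1 < n" by (auto simp: solid_def elim!: evenE)
 then show "x \<in> (\<lambda>i. 2 * i + 2) ` {..<n}" by blast
qed (auto simp: solid_def)

text \<open>Twice the signed area of an inscribed triangle as a product of sines of half the
  differences of the angles; the factors are positive for clockwise points within one turn.\<close>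

lemma turn_cis: "turn (cis (- a)) (cis (- b)) (cis (- c)) = - 4 * sin ((b - a) / 2) * sin ((c - b) / 2) * sin ((c - a) / 2)"
proof -
 define x where "x = (b - a) / 2"
 define y where "y = (c - b) / 2"
 have bc: "b = a + 2 * x" "c = a + 2 * x + 2 * y" "(c - a) / 2 = x + y" by (simp_all add: x_def y_def field_simps)
 have "turn (cis (- a)) (cis (- b)) (cis (- c)) = - (sin (b - a) + sin (c - b) - sin (c - a))"
  by (simp add: turn_eq sin_diff algebra_simps)
 also have "\<dots> = - (sin (2 * x) + sin (2 * y) - sin (2 * x + 2 * y))" by (simp add: bc)
 also have "\<dots> = - (sin (2 * x) * (1 - cos (2 * y)) + sin (2 * y) * (1 - cos (2 * x)))"
  by (simp add: sin_add algebra_simps)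
 also have "\<dots> = - (2 * sin x * cos x * (2 * (sin y)\<^sup>2) + 2 * sin y * cos y * (2 * (sin x)\<^sup>2))"
  by (simp only: sin_double cos_double_sin) simp
 also have "\<dots> = - 4 * sin x * sin y * sin (x + y)" by (simp add: sin_add power2_eq_square algebra_simps)
 finally show ?thesis unfolding x_def[symmetric] y_def[symmetric] bc(3) .
qed

lemma clockwise_turn:
 assumes c: "clockwise_on_circle n p" and i: "1 \<le> i" "i < j" "j < k" "k \<le> 2 * n" shows "turn (p i) (p j) (p k) < 0"
proof -
 obtain \<theta> where t: "strict_mono_on {1..2*n} \<theta>" "\<theta> (2*n) < \<theta> 1 + 2 * pi" "\<forall>i\<in>{1..2*n}. p i = cis (- \<theta> i)"
  using c by (auto simp: clockwise_on_circle_def)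
 have m: "\<theta> i < \<theta> j" "\<theta> j < \<theta> k" using strict_mono_onD[OF t(1)] i by auto
 have "\<theta> 1 \<le> \<theta> i" "\<theta> k \<le> \<theta> (2*n)"
  using strict_mono_onD[OF t(1), of 1 i] strict_mono_onD[OF t(1), of k "2*n"] i by (cases "i = 1"; cases "k = 2*n"; force)+
 then have "\<theta> k - \<theta> i < 2 * pi" using t(2) by linarith
 then have "sin ((\<theta> j - \<theta> i) / 2) > 0" "sin ((\<theta> k - \<theta> j) / 2) > 0" "sin ((\<theta> k - \<theta> i) / 2) > 0"
  using m by (auto intro!: sin_gt_zero)
 then have "0 < sin ((\<theta> j - \<theta> i) / 2) * sin ((\<theta> k - \<theta> j) / 2) * sin ((\<theta> k - \<theta> i) / 2)" by simp
 moreover have "p i = cis (- \<theta> i)" "p j = cis (- \<theta> j)" "p k = cis (- \<theta> k)" using t(3) i by auto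
 ultimately show ?thesis by (simp add: turn_cis mult_ac)
qed

section \<open>Polygons on every second label\<close>

definition edges :: "nat => (nat \<times> nat) set" where
 "edges n = {(i, j). i < j & j < n & (j = Suc i \<or> i = 0 & j = n - 1)}"

definition pairs :: "nat => (nat \<times> nat) set" where "pairs n = {(i, j). i < j & j < n}"

definition interleaved :: "nat \<times> nat => nat \<times> nat => bool" where
 "interleaved x y \<longleftrightarrow> fst x < fst y & fst y < snd x & snd x < snd y \<or> fst y < fst x & fst x < snd y & snd y < snd x"

lemma noncrossing_iff: "noncrossing F \<longleftrightarrow> (\<forall>x\<in>F. \<forall>y\<in>F. ~ interleaved x y)"
proof -
 have "noncrossing F \<longleftrightarrow> (\<forall>x\<in>F. \<forall>y\<in>F. ~ (fst x < fst y & fst y < snd x & snd x < snd y))"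
  by (simp add: noncrossing_def Ball_def split_paired_All imp_conjL)
 then show ?thesis unfolding interleaved_def by blast
qed

text \<open>The polygon on the labels \<open>c, c + 2, c + 4, \<dots>\<close>, hollow for \<open>c = 1\<close> and solid for \<open>c = 2\<close>.\<close>

locale labelled_polygon = clockwise_polygon "\<lambda>i. p (2 * i + c)" n for p :: "nat => complex" and c n +
 assumes n3: "3 \<le> n"
begin

definition "vs = (\<lambda>i. 2 * i + c) ` {..<n}"

definition "lb x = {2 * fst x + c, 2 * snd x + c}" for x :: "nat \<times> nat"

lemma lb_inj: "inj_on lb (pairs n)" by (rule inj_onI) (auto simp: lb_def pairs_def doubleton_eq_iff)

lemma polygon_vs: "polygon p vs = Q" by (simp add: polygon_def Q_def vs_def image_image)

lemma diagonals_vs: "diagonals vs = lb ` pairs n"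
proof (intro set_eqI iffI)
 fix d assume "d \<in> diagonals vs"
 then obtain i j where ij: "i < n" "j < n" "i ~= j" "d = {2 * i + c, 2 * j + c}" unfolding diagonals_def vs_def by auto
 show "d \<in> lb ` pairs n"
 proof (cases "i < j")
  case True
  then show ?thesis using ij by (intro image_eqI[of _ _ "(i, j)"]) (auto simp: lb_def pairs_def)
 next
  case False
  then show ?thesis using ij by (intro image_eqI[of _ _ "(j, i)"]) (auto simp: lb_def pairs_def)
 qed
next
 fix d assume "d \<in> lb ` pairs n"
 then show "d \<in> diagonals vs" unfolding diagonals_def vs_def lb_def pairs_def by force
qed

lemma seg_lb: "seg p (lb x) = closed_segment (p (2 * fst x + c)) (p (2 * snd x + c))"
 by (simp add: seg_def lb_def segment_convex_hull)

lemma boundary_vs: "boundary_edges p vs = lb ` edges n"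
proof -
 have "seg p (lb x) \<subseteq> frontier Q \<longleftrightarrow> x \<in> edges n" if "x \<in> pairs n" for x
  using boundary_segment[OF n3, of "fst x" "snd x"] that by (cases x) (auto simp: seg_lb pairs_def edges_def)
 moreover have "edges n \<subseteq> pairs n" by (auto simp: edges_def pairs_def)
 ultimately show ?thesis unfolding boundary_edges_def diagonals_vs polygon_vs by blast
qed

lemma internal_vs: "internal_diagonals p vs = lb ` (pairs n - edges n)"
proof -
 have "edges n \<subseteq> pairs n" by (auto simp: edges_def pairs_def)
 then show ?thesis unfolding internal_diagonals_def diagonals_vs boundary_vs
  using inj_on_image_set_diff[OF lb_inj, of "pairs n" "edges n"] by simp
qed

lemma crossing_vs:
 assumes "x \<in> pairs n" "y \<in> pairs n" shows "crossing p (lb x) (lb y) \<longleftrightarrow> interleaved x y"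
proof (cases "x = y")
 case True
 then show ?thesis by (auto simp: crossing_def interleaved_def)
next
 case False
 have xy: "fst x < snd x" "snd x < n" "fst y < snd y" "snd y < n" using assms by (auto simp: pairs_def)
 have "p (2 * fst x + c) ~= p (2 * snd x + c)" "p (2 * fst y + c) ~= p (2 * snd y + c)"
  using P_inj[of "fst x" "snd x"] P_inj[of "fst y" "snd y"] xy n3 by auto
 moreover have "lb x ~= lb y" using False inj_onD[OF lb_inj] assms by blast
 ultimately show ?thesis using crossing_segments[OF xy n3] False
  by (auto simp: crossing_def seg_lb rel_interior_closed_segment interleaved_def prod_eq_iff)
qed

end

declare One_nat_def [simp del]

section \<open>The dissected polygon as an arc family\<close>

locale dissected_polygon =
 fixes n :: nat and p :: "nat => complex" and D :: "nat set set"
 assumes n3: "3 \<le> n" and circle: "clockwise_on_circle n p" and dissection: "dissection p (hollow n) D"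
begin

sublocale hol: labelled_polygon p 1 n by unfold_locales (use clockwise_turn[OF circle] n3 in auto)

sublocale sol: labelled_polygon p 2 n by unfold_locales (use clockwise_turn[OF circle] n3 in auto)

lemma vs: "hollow n = hol.vs" "solid n = sol.vs" by (simp_all only: hollow_alt solid_alt hol.vs_def sol.vs_def)

lemma hol_lb: "hol.lb = hl" by (rule ext) (simp only: hol.lb_def hl_def)

definition "Bar = {x \<in> pairs n. hl x \<in> D \<or> x \<in> edges n}"

lemma D_internal: "D \<subseteq> hl ` (pairs n - edges n)"
 using dissection hol.internal_vs unfolding dissection_def vs hol_lb by simp

sublocale polygon_arcs "\<lambda>i. p (2 * i + 1)" n Bar
proof unfold_locales
 show "3 \<le> n" by (rule n3)
 show "fst x < snd x & snd x < n" if "x \<in> Bar" for x using that by (auto simp: Bar_def pairs_def)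
 show "(e, Suc e) \<in> Bar" if "Suc e < n" for e using that by (auto simp: Bar_def pairs_def edges_def)
 show "(0, n - 1) \<in> Bar" using n3 by (auto simp: Bar_def pairs_def edges_def)
 show "~ (fst x < fst y & fst y < snd x & snd x < snd y)" if "x \<in> Bar" "y \<in> Bar" for x y
 proof
  assume a: "fst x < fst y & fst y < snd x & snd x < snd y"
  have xy: "x \<in> pairs n" "y \<in> pairs n" using that by (auto simp: Bar_def)
  have "x \<notin> edges n" "y \<notin> edges n" using a xy by (auto simp: edges_def pairs_def)
  then have "hl x \<in> D" "hl y \<in> D" using that by (auto simp: Bar_def)
  moreover have "hl x ~= hl y" using a xy inj_onD[OF hol.lb_inj] unfolding hol_lb by blast
  ultimately have "~ crossing p (hl x) (hl y)" using dissection unfolding dissection_def pairwise_def by blast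
  then show False using hol.crossing_vs[OF xy] a unfolding hol_lb by (simp add: interleaved_def)
 qed
qed

lemma duals_D: "hl ` duals = D"
proof
 show "hl ` duals \<subseteq> D"
 proof
  fix d assume "d \<in> hl ` duals"
  then obtain x where x: "x \<in> Bar" "Suc (fst x) < snd x" "x ~= (0, n - 1)" "d = hl x" by (auto simp: duals_def nodes_def)
  then have "x \<notin> edges n" by (auto simp: edges_def)
  then show "d \<in> D" using x(1,4) unfolding Bar_def by blast
 qed
 show "D \<subseteq> hl ` duals"
 proof
  fix d assume d: "d \<in> D"
  then obtain x where x: "x \<in> pairs n" "x \<notin> edges n" "d = hl x" using D_internal by blast
  have "x \<in> Bar" using x d unfolding Bar_def by blast
  moreover have "Suc (fst x) < snd x" "x ~= (0, n - 1)" using x(1,2) by (auto simp: edges_def pairs_def)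
  ultimately have "x \<in> duals" by (simp add: duals_def nodes_def)
  then show "d \<in> hl ` duals" using x by blast
 qed
qed

lemma closed_Bar: "closed_dissection p (hollow n) D = hl ` Bar"
proof -
 have "closed_dissection p (hollow n) D = D \<union> hl ` edges n"
  unfolding closed_dissection_def vs hol.boundary_vs hol_lb ..
 moreover have "Bar = {x \<in> pairs n. hl x \<in> D} \<union> edges n" by (auto simp: Bar_def edges_def pairs_def)
 moreover have "hl ` {x \<in> pairs n. hl x \<in> D} = D" using D_internal by blast
 ultimately show ?thesis by (simp add: image_Un)
qed

lemma seg_hl: "seg p (hl x) = segm x" using hol.seg_lb[of x] unfolding hol_lb segm_def .

lemma cells_nodes: "cells p (hollow n) D = region ` nodes"
 unfolding cells_def closed_Bar bounded_components[symmetric] support_def image_image seg_hl ..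

lemma is_side_iff: "d \<in> Bar ==> x \<in> nodes ==> is_side p (hl d) (region x) \<longleftrightarrow> side d x"
 unfolding is_side_def seg_hl by (rule segm_frontier)

lemma hl_meet: "hl d \<inter> hl e ~= {} \<longleftrightarrow> share d e" by (auto simp: hl_def share_def)

lemma hl_incident:
 assumes "X \<subseteq> Bar"
 shows "hl ` X = {} \<or> (\<exists>d e. hl ` X = {d, e} & d ~= e & d \<inter> e ~= {}) \<longleftrightarrow> empty_or_incident X"
proof -
 have inj: "inj_on hl X" using hl_inj assms inj_on_subset by blast
 have "(\<exists>d e. hl ` X = {d, e} & d ~= e & d \<inter> e ~= {}) \<longleftrightarrow> (\<exists>d e. X = {d, e} & d ~= e & share d e)"
 proof
  assume "\<exists>d e. hl ` X = {d, e} & d ~= e & d \<inter> e ~= {}"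
  then obtain d e where de: "hl ` X = {d, e}" "d ~= e" "d \<inter> e ~= {}" by blast
  have "d \<in> hl ` X" "e \<in> hl ` X" unfolding de(1) by auto
  then obtain d' e' where d': "d' \<in> X" "e' \<in> X" "d = hl d'" "e = hl e'" by blast
  have "x = d' \<or> x = e'" if "x \<in> X" for x proof -
   have "hl x \<in> {d, e}" using that unfolding de(1)[symmetric] by blast
   then show ?thesis using inj_onD[OF inj] that d' by blast
  qed
  then have "X = {d', e'}" using d' by blast
  then show "\<exists>d e. X = {d, e} & d ~= e & share d e" using de(2,3) d' hl_meet by blast
 next
  assume "\<exists>d e. X = {d, e} & d ~= e & share d e"
  then obtain d e where de: "X = {d, e}" "d ~= e" "share d e" by blast
  then have "hl d ~= hl e" using inj_onD[OF inj] by blast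
  then show "\<exists>d e. hl ` X = {d, e} & d ~= e & d \<inter> e ~= {}"
   using de hl_meet by (intro exI[of _ "hl d"] exI[of _ "hl e"]) simp
 qed
 then show ?thesis by (simp add: empty_or_incident_def)
qed

lemma accordion_iff:
 assumes A: "A \<subseteq> Bar" shows "accordion p (hollow n) D (hl ` A) \<longleftrightarrow> acc A"
proof -
 have e: "{d \<in> hl ` A. is_side p d (region x)} = hl ` {d \<in> A. side d x}" if "x \<in> nodes" for x
  using is_side_iff[OF _ that] A by blast
 have c: "({d \<in> hl ` A. is_side p d (region x)} = {} \<or>
   (\<exists>d e. {d \<in> hl ` A. is_side p d (region x)} = {d, e} & d ~= e & d \<inter> e ~= {})) \<longleftrightarrow>
   empty_or_incident {d \<in> A. side d x}" if "x \<in> nodes" for x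
  unfolding e[OF that] by (rule hl_incident) (use A in blast)
 have "hl ` A \<subseteq> hl ` Bar" using A by blast
 moreover have all: "(\<forall>C\<in>region ` nodes. {d \<in> hl ` A. is_side p d C} = {} \<or>
   (\<exists>d e. {d \<in> hl ` A. is_side p d C} = {d, e} & d ~= e & d \<inter> e ~= {})) \<longleftrightarrow>
   (\<forall>x\<in>nodes. empty_or_incident {d \<in> A. side d x})" by (simp only: ball_simps c cong: ball_cong)
 ultimately show ?thesis unfolding accordion_def closed_Bar cells_nodes acc_def all using A by simp
qed

text \<open>The geometric separation of \<open>separated_iff\<close>; in terms of arcs,
  \<open>d\<close> is one of the two diagonals or contains exactly one of them.\<close>

lemma lies_between_iff: "d \<in> Bar ==> e \<in> Bar ==> f \<in> Bar ==>
  lies_between p (hollow n) (hl e) (hl f) (hl d) \<longleftrightarrow> e = d \<or> f = d \<or> sub_arc e d ~= sub_arc f d"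
 unfolding lies_between_def seg_hl vs hol.polygon_vs using separated_iff[of d e f] by auto

lemma subaccordion_iff: "subaccordion p (hollow n) D S \<longleftrightarrow> (\<exists>X. S = hl ` X & subacc X)"
proof -
 have duB: "duals \<subseteq> Bar" using duals_Bar by blast
 have AD: "hl ` A \<inter> D = hl ` (A \<inter> duals)" if "A \<subseteq> Bar" for A
  using inj_on_image_Int[OF hl_inj that duB] by (simp add: duals_D)
 have B: "{d \<in> hl ` (A \<inter> duals). lies_between p (hollow n) (hl e) (hl f) d} =
   hl ` {d \<in> A \<inter> duals. e = d \<or> f = d \<or> sub_arc e d ~= sub_arc f d}"
  if "e \<in> A \<inter> duals" "f \<in> A \<inter> duals" for A e f proof -
  have "lies_between p (hollow n) (hl e) (hl f) (hl d) \<longleftrightarrow> e = d \<or> f = d \<or> sub_arc e d ~= sub_arc f d"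
   if "d \<in> A \<inter> duals" for d
   by (rule lies_between_iff) (use that \<open>e \<in> A \<inter> duals\<close> \<open>f \<in> A \<inter> duals\<close> duB in blast)+
  then have "{d \<in> A \<inter> duals. lies_between p (hollow n) (hl e) (hl f) (hl d)} =
    {d \<in> A \<inter> duals. e = d \<or> f = d \<or> sub_arc e d ~= sub_arc f d}" by (intro Collect_cong) blast
  moreover have "{d \<in> hl ` (A \<inter> duals). lies_between p (hollow n) (hl e) (hl f) d} =
    hl ` {d \<in> A \<inter> duals. lies_between p (hollow n) (hl e) (hl f) (hl d)}" by blast
  ultimately show ?thesis by simp
 qed
 have "subaccordion p (hollow n) D S \<longleftrightarrow> (\<exists>A\<subseteq>Bar. accordion p (hollow n) D (hl ` A) &
   (\<exists>d1\<in>hl ` A \<inter> D. \<exists>d2\<in>hl ` A \<inter> D. S = {d \<in> hl ` A \<inter> D. lies_between p (hollow n) d1 d2 d}))"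
   (is "_ \<longleftrightarrow> (\<exists>A\<subseteq>Bar. ?P (hl ` A))") proof -
  have "(\<exists>A'. ?P A') \<longleftrightarrow> (\<exists>A\<subseteq>Bar. ?P (hl ` A))"
  proof
   assume "\<exists>A'. ?P A'"
   then obtain A' where A': "?P A'" by (rule exE)
   then have "A' \<subseteq> hl ` Bar" by (simp add: accordion_def closed_Bar)
   then obtain A where A: "A \<subseteq> Bar" "A' = hl ` A" by (meson subset_imageE)
   then have "?P (hl ` A)" using A' by (simp only:)
   then have "A \<subseteq> Bar & ?P (hl ` A)" by (rule conjI[OF A(1)])
   then show "\<exists>A\<subseteq>Bar. ?P (hl ` A)" by (rule exI)
  next
   assume "\<exists>A\<subseteq>Bar. ?P (hl ` A)"
   then obtain A where "A \<subseteq> Bar & ?P (hl ` A)" by (rule exE)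
   then have "?P (hl ` A)" by (rule conjunct2)
   then show "\<exists>A'. ?P A'" by (rule exI)
  qed
  then show ?thesis unfolding subaccordion_def .
 qed
 also have "\<dots> \<longleftrightarrow> (\<exists>A\<subseteq>Bar. acc A & (\<exists>e\<in>A \<inter> duals. \<exists>f\<in>A \<inter> duals.
   S = hl ` {d \<in> A \<inter> duals. e = d \<or> f = d \<or> sub_arc e d ~= sub_arc f d}))"
 proof (intro ex_cong1 conj_cong refl)
  fix A assume A: "A \<subseteq> Bar"
  show "accordion p (hollow n) D (hl ` A) \<longleftrightarrow> acc A" by (rule accordion_iff[OF A])
  show "(\<exists>d1\<in>hl ` A \<inter> D. \<exists>d2\<in>hl ` A \<inter> D. S = {d \<in> hl ` A \<inter> D. lies_between p (hollow n) d1 d2 d}) \<longleftrightarrow>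
    (\<exists>e\<in>A \<inter> duals. \<exists>f\<in>A \<inter> duals.
     S = hl ` {d \<in> A \<inter> duals. e = d \<or> f = d \<or> sub_arc e d ~= sub_arc f d})"
   unfolding AD[OF A] bex_simps(7) by (intro bex_cong refl) (simp only: B)
 qed
 also have "\<dots> \<longleftrightarrow> (\<exists>X. S = hl ` X & subacc X)" unfolding subacc_def acc_def by blast
 finally show ?thesis .
qed

lemma dual_path_iff:
 "dual_path p (hollow n) D cs ds \<longleftrightarrow> (\<exists>xs es. cs = map region xs & ds = map hl es & dpath xs es)"
proof
 assume d: "dual_path p (hollow n) D cs ds"
 then have cd: "set cs \<subseteq> region ` nodes" "set ds \<subseteq> hl ` duals" "length cs = Suc (length ds)"
  unfolding dual_path_def cells_nodes duals_D by (auto simp: in_set_conv_nth)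
 then have "cs \<in> map region ` lists nodes" "ds \<in> map hl ` lists duals" by (auto simp: lists_image[symmetric])
 then obtain xs es where x: "xs \<in> lists nodes" "cs = map region xs" "es \<in> lists duals" "ds = map hl es" by blast
 have "dpath xs es" unfolding dpath_def
 proof (intro conjI allI impI)
  show "es ~= []" "length xs = Suc (length es)" "distinct xs" "set xs \<subseteq> nodes"
   using d x unfolding dual_path_def by (auto simp: distinct_map)
  fix i assume i: "i < length es"
  have m: "es ! i \<in> duals" "xs ! i \<in> nodes" "xs ! Suc i \<in> nodes" using x i cd(3) by (auto simp: in_lists_conv_set)
  then show "es ! i \<in> duals" by simp
  have "is_side p (hl (es ! i)) (region (xs ! i)) & is_side p (hl (es ! i)) (region (xs ! Suc i))"
   using d i cd(3) unfolding dual_path_def x by auto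
  then show "side (es ! i) (xs ! i)" "side (es ! i) (xs ! Suc i)" using is_side_iff m duals_Bar by blast+
 qed
 then show "\<exists>xs es. cs = map region xs & ds = map hl es & dpath xs es" using x by blast
next
 assume "\<exists>xs es. cs = map region xs & ds = map hl es & dpath xs es"
 then obtain xs es where x: "cs = map region xs" "ds = map hl es" "dpath xs es" by blast
 have l: "length xs = Suc (length es)" "es ~= []" "distinct xs" "set xs \<subseteq> nodes" using x(3) by (auto simp: dpath_def)
 show "dual_path p (hollow n) D cs ds" unfolding dual_path_def x(1,2) cells_nodes
 proof (intro conjI allI impI)
  show "distinct (map region xs)" using l inj_on_subset[OF inj_region] by (auto simp: distinct_map)
  fix i assume "i < length (map hl es)"
  then have i: "i < length es" by simp
  note d = dpathD[OF x(3) i]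
  show "map hl es ! i \<in> D" using d(1) i duals_D by auto
  show "is_side p (map hl es ! i) (map region xs ! i)" "is_side p (map hl es ! i) (map region xs ! Suc i)"
   using d i l(1) is_side_iff duals_Bar by auto
 qed (use l in auto)
qed

lemma serpent_iff: "serpent p (hollow n) D S \<longleftrightarrow> (\<exists>X. S = hl ` X & arc_serpent X)"
proof
 assume "serpent p (hollow n) D S"
 then obtain xs es X where x: "dpath xs es" "S = hl ` set es" "S = hl ` X" "subacc X"
  unfolding serpent_def dual_path_iff subaccordion_iff by auto
 have "set es \<subseteq> duals" using x(1) path_duals unfolding is_path_def by blast
 moreover have "X \<subseteq> duals" using x(4) unfolding subacc_def by blast
 ultimately have "set es = X" using inj_on_image_eq_iff[OF hl_inj, of "set es" X] x(2,3) duals_Bar by blast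
 then show "\<exists>X. S = hl ` X & arc_serpent X" using x unfolding arc_serpent_def is_path_def by blast
next
 assume "\<exists>X. S = hl ` X & arc_serpent X"
 then obtain X xs es where x: "S = hl ` X" "dpath xs es" "set es = X" "subacc X"
  unfolding arc_serpent_def is_path_def by blast
 have "dual_path p (hollow n) D (map region xs) (map hl es)" using dual_path_iff x(2) by blast
 moreover have "S = set (map hl es)" using x by simp
 ultimately show "serpent p (hollow n) D S" unfolding serpent_def subaccordion_iff using x(1,4) by blast
qed

lemma path_ends_iff:
 assumes X: "X \<subseteq> Bar" shows "path_ends p (hollow n) D (hl ` X) = map_prod hl region ` ends X"
proof -
 have eq: "set es = X" if "dpath xs es" "hl ` set es = hl ` X" for xs es proof -
  have "set es \<subseteq> duals" using that(1) path_duals unfolding is_path_def by blast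
  then show ?thesis using inj_on_image_eq_iff[OF hl_inj, of "set es" X] that(2) duals_Bar X by blast
 qed
 show ?thesis
 proof (intro set_eqI iffI)
  fix z assume "z \<in> path_ends p (hollow n) D (hl ` X)"
  then obtain xs es where x: "dpath xs es" "hl ` set es = hl ` X"
   "z = (hd (map hl es), hd (map region xs)) \<or> z = (last (map hl es), last (map region xs))"
   unfolding path_ends_def dual_path_iff by auto
  have ne: "es ~= []" "xs ~= []" using x(1) by (auto simp: dpath_def)
  have "z = map_prod hl region (hd es, hd xs) \<or> z = map_prod hl region (last es, last xs)"
   using x(3) ne by (simp add: hd_map last_map)
  moreover have "(hd es, hd xs) \<in> ends X" "(last es, last xs) \<in> ends X"
   unfolding ends_def using x(1) eq[OF x(1,2)] by blast+
  ultimately show "z \<in> map_prod hl region ` ends X" by blast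
 next
  fix z assume "z \<in> map_prod hl region ` ends X"
  then obtain xs es where x: "dpath xs es" "set es = X"
   "z = map_prod hl region (hd es, hd xs) \<or> z = map_prod hl region (last es, last xs)" unfolding ends_def by auto
  have ne: "es ~= []" "xs ~= []" using x(1) by (auto simp: dpath_def)
  have "z = (hd (map hl es), hd (map region xs)) \<or> z = (last (map hl es), last (map region xs))"
   using x(3) ne by (simp add: hd_map last_map)
  moreover have "dual_path p (hollow n) D (map region xs) (map hl es)" using dual_path_iff x(1) by blast
  moreover have "set (map hl es) = hl ` X" using x(2) by simp
  ultimately show "z \<in> path_ends p (hollow n) D (hl ` X)" unfolding path_ends_def by blast
 qed
qed

lemma final_edges_iff: "X \<subseteq> Bar ==> final_edges p (hollow n) D (hl ` X) = fe X"
 unfolding final_edges_def fe_def by (simp add: path_ends_iff image_image)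

lemma incompatible_iff:
 assumes X: "X \<subseteq> Bar" "Y \<subseteq> Bar"
 shows "incompatible n p D (hl ` X) (hl ` Y) \<longleftrightarrow> incomp X Y"
proof -
 have I: "hl ` A \<inter> hl ` B = hl ` (A \<inter> B)" if "A \<subseteq> Bar" "B \<subseteq> Bar" for A B
  using inj_on_image_Int[OF hl_inj that] by simp
 have "ends A \<subseteq> Bar \<times> nodes" if "A \<subseteq> Bar" for A
 proof
  fix z assume "z \<in> ends A"
  then obtain xs es where x: "dpath xs es" "set es = A" "z = (hd es, hd xs) \<or> z = (last es, last xs)"
   unfolding ends_def by auto
  have "es ~= []" "xs ~= []" "set xs \<subseteq> nodes" using x(1) by (auto simp: dpath_def)
  then show "z \<in> Bar \<times> nodes" using x(2,3) that hd_in_set last_in_set by blast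
 qed
 moreover have "inj_on (map_prod hl region) (Bar \<times> nodes)" by (rule map_prod_inj_on[OF hl_inj inj_region])
 ultimately have E: "path_ends p (hollow n) D (hl ` A) \<inter> path_ends p (hollow n) D (hl ` B) ~= {} \<longleftrightarrow> ends A \<inter> ends B ~= {}"
  if "A \<subseteq> Bar" "B \<subseteq> Bar" for A B unfolding path_ends_iff[OF that(1)] path_ends_iff[OF that(2)]
  using inj_on_image_Int[of "map_prod hl region" "Bar \<times> nodes" "ends A" "ends B"] that by (metis image_is_empty)
 have C: "serpent_conflict p (hollow n) D (hl ` A) (hl ` B) u v u' v' \<longleftrightarrow> arc_conflict A B u v u' v'"
  if "A \<subseteq> Bar" "B \<subseteq> Bar" for A B u v u' v'
  unfolding serpent_conflict_def arc_conflict_def I[OF that] E[OF that] final_edges_iff[OF that(1)]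
   final_edges_iff[OF that(2)] ..
 have XY: "X \<inter> Y \<subseteq> Bar" using X by blast
 show ?thesis unfolding incompatible_def incomp_def I[OF X] final_edges_iff[OF XY] C[OF X] C[OF X(2,1)] by simp
qed

lemma serpent_nests: "{M. serpent_nest n p D M} =
  (\<lambda>M. (`) hl ` M) ` {M. (\<forall>S\<in>M. arc_serpent S) & pairwise (\<lambda>S S'. ~ incomp S S') M}" (is "?L = ?f ` ?R")
proof -
 have B: "X \<subseteq> Bar" if "arc_serpent X" for X using that path_duals duals_Bar unfolding arc_serpent_def by blast
 have inc: "incompatible n p D (hl ` X) (hl ` Y) \<longleftrightarrow> incomp X Y" if "arc_serpent X" "arc_serpent Y" for X Y
  by (rule incompatible_iff[OF B[OF that(1)] B[OF that(2)]])
 have eq: "hl ` X = hl ` Y \<longleftrightarrow> X = Y" if "arc_serpent X" "arc_serpent Y" for X Y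
  using inj_on_image_eq_iff[OF hl_inj B[OF that(1)] B[OF that(2)]] .
 have pw: "pairwise (\<lambda>S S'. ~ incompatible n p D S S') (?f M) \<longleftrightarrow> pairwise (\<lambda>S S'. ~ incomp S S') M"
  if M: "\<forall>S\<in>M. arc_serpent S" for M
  unfolding pairwise_image unfolding pairwise_def using M by (intro ball_cong refl) (simp add: inc eq)
 show ?thesis
 proof (intro set_eqI iffI)
  fix M assume "M \<in> ?L"
  then have M: "M \<subseteq> (`) hl ` Collect arc_serpent" "pairwise (\<lambda>S S'. ~ incompatible n p D S S') M"
   unfolding serpent_nest_def serpent_iff by blast+
  then obtain M' where M': "M' \<subseteq> Collect arc_serpent" "M = ?f M'" by (meson subset_imageE)
  then show "M \<in> ?f ` ?R" using pw[of M'] M(2) by blast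
 next
  fix M assume "M \<in> ?f ` ?R"
  then obtain M' where M': "\<forall>S\<in>M'. arc_serpent S" "pairwise (\<lambda>S S'. ~ incomp S S') M'" "M = ?f M'" by blast
  then have "\<forall>S\<in>M. serpent p (hollow n) D S" unfolding serpent_iff by blast
  then show "M \<in> ?L" using pw[OF M'(1)] M'(2,3) unfolding serpent_nest_def by simp
 qed
qed

lemma card_serpent_nests:
 assumes "emb (Nd True a b) 0" "leaves (Nd True a b) = n - 1"
 shows "finite {M. serpent_nest n p D M}" "card {M. serpent_nest n p D M} = card (inner_nests (Nd True a b))"
proof -
 let ?R = "{M. (\<forall>S\<in>M. arc_serpent S) & pairwise (\<lambda>S S'. ~ incomp S S') M}"
 have "inj_on (\<lambda>M. (`) hl ` M) ?R"
 proof (rule inj_on_subset[OF inj_on_image_Pow[OF inj_on_image_Pow[OF hl_inj]]])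
  show "?R \<subseteq> Pow (Pow Bar)" using path_duals duals_Bar unfolding arc_serpent_def by blast
 qed
 then show "card {M. serpent_nest n p D M} = card (inner_nests (Nd True a b))"
  unfolding serpent_nests using card_arc_nests(2)[OF assms] by (simp add: card_image)
 show "finite {M. serpent_nest n p D M}" unfolding serpent_nests using card_arc_nests(1)[OF assms] by blast
qed

text \<open>Solid and hollow vertices alternate, so crossing is decided by positions among all
  \<open>2 * n\<close> points, where solid \<open>i\<close> comes right after hollow
  \<open>i\<close>.\<close>

lemma solid_crossing:
 assumes x: "x \<in> pairs n" and y: "y \<in> Bar"
 shows "crossing p (sol.lb x) (hl y) \<longleftrightarrow> y \<in> crossed (fst x) (snd x)"
proof -
 \<comment> \<open>Position \<open>m\<close> is label \<open>m + 1\<close>: hollow \<open>i\<close>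
   sits at \<open>2 * i\<close>, solid \<open>i\<close> at \<open>2 * i + 1\<close>.\<close>
 interpret full: clockwise_polygon "\<lambda>i. p (i + 1)" "2 * n" by unfold_locales (use clockwise_turn[OF circle] in auto)
 have b: "fst x < snd x" "snd x < n" "fst y < snd y" "snd y < n" using x Bar[OF y] by (auto simp: pairs_def)
 have e: "seg p (sol.lb x) = closed_segment (p (2 * fst x + 1 + 1)) (p (2 * snd x + 1 + 1))"
  "seg p (hl y) = closed_segment (p (2 * fst y + 1)) (p (2 * snd y + 1))"
  by (simp_all add: sol.seg_lb seg_hl segm_def add.assoc)
 have "sol.lb x ~= hl y" proof -
  have "2 * fst x + 2 ~= 2 * fst y + 1" "2 * fst x + 2 ~= 2 * snd y + 1" by presburger+
  then show ?thesis by (auto simp: sol.lb_def hl_def doubleton_eq_iff)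
 qed
 moreover have "p (2 * fst x + 1 + 1) ~= p (2 * snd x + 1 + 1)" "p (2 * fst y + 1) ~= p (2 * snd y + 1)"
  using full.P_inj[of "2 * fst x + 1" "2 * snd x + 1"] full.P_inj[of "2 * fst y" "2 * snd y"] b n3 by auto
 ultimately have "crossing p (sol.lb x) (hl y) \<longleftrightarrow>
   open_segment (p (2 * fst x + 1 + 1)) (p (2 * snd x + 1 + 1)) \<inter> open_segment (p (2 * fst y + 1)) (p (2 * snd y + 1)) ~= {}"
  unfolding crossing_def e rel_interior_closed_segment by simp
 also have "\<dots> \<longleftrightarrow> (2 * fst x + 1 < 2 * fst y & 2 * fst y < 2 * snd x + 1 & 2 * snd x + 1 < 2 * snd y) \<or>
   (2 * fst y < 2 * fst x + 1 & 2 * fst x + 1 < 2 * snd y & 2 * snd y < 2 * snd x + 1)"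
 proof (rule full.crossing_segments)
  have "2 * fst x + 1 ~= 2 * fst y" by presburger
  then show "(2 * fst x + 1, 2 * snd x + 1) ~= (2 * fst y, 2 * snd y)" by simp
 qed (use b n3 in auto)
 also have "\<dots> \<longleftrightarrow> y \<in> crossed (fst x) (snd x)" proof -
  have "2 * u + 1 < 2 * v \<longleftrightarrow> u < v" "2 * v < 2 * u + 1 \<longleftrightarrow> v \<le> u" for u v :: nat by presburger+
  then show ?thesis using y b unfolding crossed_def by auto
 qed
 finally show ?thesis .
qed

section \<open>Accordion dissections as facets\<close>

definition "U = {x \<in> pairs n. acc (crossed (fst x) (snd x))}"

lemma accordion_diagonal_iff: "accordion_diagonal n p D \<delta> \<longleftrightarrow> \<delta> \<in> sol.lb ` U"
proof -
 have "accordion p (hollow n) D {d \<in> closed_dissection p (hollow n) D. crossing p (sol.lb x) d} \<longleftrightarrow>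
   acc (crossed (fst x) (snd x))" if x: "x \<in> pairs n" for x proof -
  have sub: "crossed (fst x) (snd x) \<subseteq> Bar" by (auto simp: crossed_def)
  have "{d \<in> hl ` Bar. crossing p (sol.lb x) d} = hl ` {d \<in> Bar. crossing p (sol.lb x) (hl d)}" by blast
  also have "{d \<in> Bar. crossing p (sol.lb x) (hl d)} = crossed (fst x) (snd x)" using solid_crossing[OF x] sub by blast
  finally show ?thesis unfolding closed_Bar using accordion_iff[OF sub] by simp
 qed
 then show ?thesis unfolding accordion_diagonal_def vs sol.diagonals_vs U_def by blast
qed

lemma edge_crosses_nothing: "x \<in> edges n ==> y \<in> pairs n ==> ~ interleaved x y & ~ interleaved y x"
 by (auto simp: edges_def pairs_def interleaved_def)

lemma accordion_dissection_iff:
 "accordion_dissection n p D E \<longleftrightarrow> (\<exists>F \<subseteq> U - edges n. E = sol.lb ` F & noncrossing F)"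
proof -
 have nc: "pairwise (\<lambda>d e. ~ crossing p d e) (sol.lb ` F) \<longleftrightarrow> noncrossing F" if F: "F \<subseteq> U - edges n" for F
 proof -
  have P: "F \<subseteq> pairs n" using F by (auto simp: U_def)
  have "(x ~= y --> sol.lb x ~= sol.lb y --> ~ crossing p (sol.lb x) (sol.lb y)) \<longleftrightarrow> ~ interleaved x y"
   if "x \<in> F" "y \<in> F" for x y proof -
   have xy: "x \<in> pairs n" "y \<in> pairs n" using that P by auto
   have "sol.lb x = sol.lb y ==> x = y" by (rule inj_onD[OF sol.lb_inj _ xy])
   moreover have "~ interleaved x x" by (simp add: interleaved_def)
   ultimately show ?thesis using sol.crossing_vs[OF xy] by blast
  qed
  then have "pairwise (\<lambda>d e. ~ crossing p d e) (sol.lb ` F) \<longleftrightarrow> (\<forall>x\<in>F. \<forall>y\<in>F. ~ interleaved x y)"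
   unfolding pairwise_image unfolding pairwise_def by (intro ball_cong refl)
  also have "\<dots> \<longleftrightarrow> noncrossing F" by (rule noncrossing_iff[symmetric])
  finally show ?thesis .
 qed
 have UE: "sol.lb ` U \<inter> sol.lb ` (pairs n - edges n) = sol.lb ` (U - edges n)" proof -
  have "sol.lb ` U \<inter> sol.lb ` (pairs n - edges n) = sol.lb ` (U \<inter> (pairs n - edges n))"
   by (rule inj_on_image_Int[OF sol.lb_inj, symmetric]) (auto simp: U_def)
  moreover have "U \<inter> (pairs n - edges n) = U - edges n" by (auto simp: U_def)
  ultimately show ?thesis by simp
 qed
 have "accordion_dissection n p D E \<longleftrightarrow> E \<subseteq> sol.lb ` (U - edges n) & pairwise (\<lambda>d e. ~ crossing p d e) E"
  unfolding accordion_dissection_def dissection_def accordion_diagonal_iff vs sol.internal_vs UE[symmetric] by blast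
 also have "\<dots> \<longleftrightarrow> (\<exists>F \<subseteq> U - edges n. E = sol.lb ` F & noncrossing F)"
  unfolding subset_image_iff using nc by blast
 finally show ?thesis .
qed

text \<open>Boundary edges cross nothing, so a facet contains all those that are accordion
  diagonals; removing them leaves a maximal dissection, and adding them back gives the
  facet.\<close>

lemma maximal_facets: "{E. maximal_accordion_dissection n p D E} = (\<lambda>G. sol.lb ` (G - edges n)) ` facets U"
proof (intro set_eqI iffI)
 have UP: "U \<subseteq> pairs n" by (auto simp: U_def)
 have inj: "sol.lb ` A = sol.lb ` B \<longleftrightarrow> A = B" if "A \<subseteq> U" "B \<subseteq> U" for A B
  using inj_on_image_eq_iff[OF sol.lb_inj, of A B] that UP by blast
 have fac: "G \<in> facets U \<longleftrightarrow> G \<subseteq> U & noncrossing G & (\<forall>x\<in>U - G. \<exists>y\<in>G. interleaved x y)" for G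
  by (simp add: facets_def interleaved_def Ball_def Bex_def split_paired_All split_paired_Ex imp_conjL)
 note ncI = noncrossing_iff
 have sym: "interleaved x y \<longleftrightarrow> interleaved y x" for x y by (auto simp: interleaved_def)
 have irr: "~ interleaved x x" for x by (simp add: interleaved_def)
 fix E
 { assume "E \<in> (\<lambda>G. sol.lb ` (G - edges n)) ` facets U"
  then obtain G where G: "G \<in> facets U" "E = sol.lb ` (G - edges n)" by blast
  have GU: "G \<subseteq> U" "noncrossing G" "\<And>x. x \<in> U ==> x \<notin> G ==> \<exists>y\<in>G. interleaved x y"
   using iffD1[OF fac G(1)] by blast+
  have nc: "noncrossing (G - edges n)" using GU(2) unfolding ncI by blast
  have ss: "G - edges n \<subseteq> U - edges n" using GU(1) by blast
  have E: "accordion_dissection n p D E"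
   unfolding accordion_dissection_iff by (intro exI[of _ "G - edges n"] conjI ss G(2) nc)
  have "E' = E" if E': "accordion_dissection n p D E'" "E \<subseteq> E'" for E' proof -
   obtain F where F: "F \<subseteq> U - edges n" "E' = sol.lb ` F" "noncrossing F"
    using E'(1) unfolding accordion_dissection_iff by blast
   have sub: "G - edges n \<subseteq> F"
   proof
    fix x assume x: "x \<in> G - edges n"
    then obtain y where y: "y \<in> F" "sol.lb x = sol.lb y" using E'(2) unfolding G(2) F(2) by blast
    have "x = y" by (rule inj_onD[OF sol.lb_inj y(2)]) (use x y(1) F(1) GU(1) UP in blast)+
    then show "x \<in> F" using y(1) by simp
   qed
   have "x \<in> G" if x: "x \<in> F" for x
   proof (rule ccontr)
    assume "x \<notin> G"
    then obtain y where y: "y \<in> G" "interleaved x y" using GU(3) x F(1) by blast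
    have "x \<in> pairs n" using x F(1) UP by blast
    then have "y \<notin> edges n" using edge_crosses_nothing y(2) by blast
    then show False using y sub x F(3) unfolding ncI by blast
   qed
   then have "F = G - edges n" using sub F(1) by blast
   then show ?thesis using F(2) G(2) by simp
  qed
  with E show "E \<in> {E. maximal_accordion_dissection n p D E}" unfolding maximal_accordion_dissection_def by simp }
 { assume "E \<in> {E. maximal_accordion_dissection n p D E}"
  then have E: "accordion_dissection n p D E" "\<And>E'. accordion_dissection n p D E' ==> E \<subseteq> E' ==> E' = E"
   unfolding maximal_accordion_dissection_def by blast+
  obtain F where F: "F \<subseteq> U - edges n" "E = sol.lb ` F" "noncrossing F"
   using E(1) unfolding accordion_dissection_iff by blast
  let ?G = "F \<union> U \<inter> edges n"
  have eq: "?G - edges n = F" using F(1) by blast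
  have "?G \<in> facets U" unfolding fac
  proof (intro conjI ballI)
   show "?G \<subseteq> U" using F(1) by blast
   show "noncrossing ?G" unfolding ncI
   proof (intro ballI)
    fix x y assume xy: "x \<in> ?G" "y \<in> ?G"
    have "x \<in> pairs n" "y \<in> pairs n" using xy F(1) UP by blast+
    then show "~ interleaved x y" using xy F(3) edge_crosses_nothing unfolding ncI by blast
   qed
   fix x assume x: "x \<in> U - ?G"
   show "\<exists>y\<in>?G. interleaved x y"
   proof (rule ccontr)
    assume no: "~ ?thesis"
    have "noncrossing (insert x F)" unfolding ncI
    proof (intro ballI)
     fix u v assume "u \<in> insert x F" "v \<in> insert x F"
     then show "~ interleaved u v" using no F(3) sym irr unfolding ncI by blast
    qed
    moreover have "insert x F \<subseteq> U - edges n" using x F(1) by blast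
    ultimately have ad: "accordion_dissection n p D (sol.lb ` insert x F)"
     unfolding accordion_dissection_iff by (intro exI[of _ "insert x F"] conjI refl)
    have "sol.lb ` insert x F = E" by (rule E(2)[OF ad]) (use F(2) in auto)
    then have ie: "sol.lb ` insert x F = sol.lb ` F" using F(2) by (rule trans)
    have sub: "insert x F \<subseteq> U" "F \<subseteq> U" using x F(1) by blast+
    have "insert x F = F" by (rule iffD1[OF inj[OF sub] ie])
    then show False using x by blast
   qed
  qed
  then show "E \<in> (\<lambda>G. sol.lb ` (G - edges n)) ` facets U" using F(2) eq by (intro image_eqI[of _ _ ?G]) simp_all }
qed

lemma card_maximal:
 "finite {E. maximal_accordion_dissection n p D E}" "card {E. maximal_accordion_dissection n p D E} = card (facets U)"
proof -
 have UP: "U \<subseteq> pairs n" by (auto simp: U_def)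
 have "pairs n \<subseteq> {..<n} \<times> {..<n}" by (auto simp: pairs_def)
 then have "finite U" using UP by (meson finite_SigmaI finite_lessThan finite_subset)
 then have "finite (Pow U)" by simp
 then have fin: "finite (facets U)" by (rule rev_finite_subset) (auto simp: facets_def)
 then show "finite {E. maximal_accordion_dissection n p D E}" unfolding maximal_facets by blast
 have "inj_on (\<lambda>G. sol.lb ` (G - edges n)) (facets U)"
 proof (rule inj_onI)
  fix G H assume GH: "G \<in> facets U" "H \<in> facets U" "sol.lb ` (G - edges n) = sol.lb ` (H - edges n)"
  have ed: "x \<in> K" if K: "K \<in> facets U" "x \<in> U" "x \<in> edges n" for K x proof -
   have KP: "K \<subseteq> pairs n" using facets_subset[OF K(1)] UP by blast
   have "(fst x, snd x) \<in> K"
   proof (rule facets_max[OF K(1)])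
    fix s' t' assume st: "(s', t') \<in> K"
    have i: "~ interleaved x (s', t')" using edge_crosses_nothing[OF K(3)] st KP by blast
    show "fst x < s' ==> s' < snd x ==> snd x < t' ==> False" using i by (simp add: interleaved_def)
    show "s' < fst x ==> fst x < t' ==> t' < snd x ==> False" using i by (simp add: interleaved_def)
   qed (use K(2) in simp)
   then show ?thesis by simp
  qed
  have sub: "G \<subseteq> U" "H \<subseteq> U" using facets_subset GH by blast+
  then have "G - edges n = H - edges n"
   using inj_on_image_eq_iff[OF sol.lb_inj, of "G - edges n" "H - edges n"] GH(3) UP by blast
  moreover have "G \<inter> edges n = H \<inter> edges n" using ed GH(1,2) sub by blast
  ultimately show "G = H" by blast
 qed
 then show "card {E. maximal_accordion_dissection n p D E} = card (facets U)" unfolding maximal_facets by (rule card_image)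
qed

text \<open>Both families are finite and are counted on the same tree of arcs, once by nests of
  words and once by facets of chords.\<close>

theorem nests_dissections: "\<exists>f. bij_betw f {M. serpent_nest n p D M} {E. maximal_accordion_dissection n p D E}"
proof -
 obtain a b where e: "emb (Nd True a b) 0" "leaves (Nd True a b) = n - 1" by (rule ex_tree_Bar)
 let ?T = "Nd True a b"
 have "(s, t) \<in> chords ?T 0 ==> s < t & t < n" for s t
  using inner_chords_bounds[of s t ?T 0] reach_bounds[of s ?T 0] e(2) n3 unfolding chords_def by auto
 then have "U = chords ?T 0" using acc_iff_chord[OF e] unfolding U_def pairs_def by fastforce
 moreover have "wf_tr ?T" using e(1) by (simp add: emb_def)
 ultimately have "card {M. serpent_nest n p D M} = card {E. maximal_accordion_dissection n p D E}"
  using card_serpent_nests(2)[OF e] card_maximal(2) card_inner_nests_eq_facets by simp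
 then show ?thesis using finite_same_card_bij card_serpent_nests(1)[OF e] card_maximal(1) by blast
qed

end

text \<open>With two vertices the polygon is a segment, which has empty interior in the plane and so
  equals its frontier.\<close>

lemma small_polygon:
 fixes p :: "nat => complex" and V :: "nat set"
 assumes "card V \<le> 2" "finite V" shows "internal_diagonals p V = {}"
proof -
 have "d \<in> boundary_edges p V" if d: "d \<in> diagonals V" for d proof -
  obtain u v where uv: "u \<in> V" "v \<in> V" "u ~= v" "d = {u, v}" using d by (auto simp: diagonals_def)
  then have "card {u, v} = 2" "{u, v} \<subseteq> V" by auto
  then have V: "V = {u, v}" using card_seteq[OF assms(2)] assms(1) by metis
  have "seg p d = closed_segment (p u) (p v)" by (simp add: seg_def uv segment_convex_hull)
  moreover have "polygon p V = closed_segment (p u) (p v)" by (simp add: polygon_def V segment_convex_hull)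
  moreover have "interior (closed_segment (p u) (p v)) = {}" by (simp add: interior_closed_segment_ge2)
  then have "frontier (closed_segment (p u) (p v)) = closed_segment (p u) (p v)" by (simp add: frontier_def closure_closed)
  ultimately show ?thesis using d by (simp add: boundary_edges_def)
 qed
 then show ?thesis by (auto simp: internal_diagonals_def)
qed

text \<open>There are no internal diagonals at all, so each side consists of the empty set
  alone.\<close>

lemma small_case:
 assumes n: "n \<le> 2" and D: "dissection p (hollow n) D"
 shows "\<exists>f. bij_betw f {M. serpent_nest n p D M} {E. maximal_accordion_dissection n p D E}"
proof -
 have c: "card (hollow n) \<le> 2" "card (solid n) \<le> 2" "finite (hollow n)" "finite (solid n)"
  using card_image_le[of "{..<n}" "\<lambda>i. 2 * i + 1"] card_image_le[of "{..<n}" "\<lambda>i. 2 * i + 2"] n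
  unfolding hollow_alt solid_alt by auto
 have "D = {}" using D small_polygon[OF c(1,3), of p] by (auto simp: dissection_def)
 then have "~ serpent p (hollow n) D S" for S unfolding serpent_def subaccordion_def by blast
 then have N: "{M. serpent_nest n p D M} = {{}}" by (auto simp: serpent_nest_def)
 have "accordion_dissection n p D E \<longleftrightarrow> E = {}" for E
  unfolding accordion_dissection_def dissection_def small_polygon[OF c(2,4), of p] by auto
 then have M: "{E. maximal_accordion_dissection n p D E} = {{}}" by (auto simp: maximal_accordion_dissection_def)
 show ?thesis unfolding N M by (intro exI[of _ "\<lambda>_. {}"]) (simp add: bij_betw_def)
qed

theorem theorem3p1:
  fixes n :: nat and p :: "nat \<Rightarrow> complex" and D :: "nat set set"
  assumes "n \<ge> 1"
    and "clockwise_on_circle n p"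
    and "dissection p (hollow n) D"
  shows "\<exists>f. bij_betw f {N. serpent_nest n p D N} {E. maximal_accordion_dissection n p D E}"
proof (cases "3 \<le> n")
  case True
  then interpret dissected_polygon n p D by unfold_locales (use assms in auto)
  show ?thesis by (rule nests_dissections)
qed (use small_case assms(3) in auto)

end
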